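(* In the special Lagrangian case described in the context, suppose $T$ is a $\Lambda$-weighted gradient cycle on $B$ with support $\Gamma\subset B$. Then $\Gamma$ is a locally finite embedded graph; in particular, on any compact subset of $B$, it contains only finitely many vertices, and each edge is a gradient flowline.
   Context: **Special Lagrangian case.** $B\subset\mathbb{R}^n$ is a contractible open domain with coordinates $x_1,\dots,x_n$; $u$ is a smooth convex function on $B$ whose Hessian $g_{ij}=\partial^2u/\partial x_i\partial x_j$ gives a Riemannian (Hessian) metric $g=g_{ij}dx_idx_j$. $T^n=\mathbb{R}^n/\mathbb{Z}^n$ has periodic coordinates $y_i$, and $\pi:X=T^n\times B\to B$ is the projection. $\Lambda=H_{n-1}(T^n,\mathbb{Z})$. For $\delta\in\Lambda$, $|\delta|_p$ is the minimal mass of integral currents in the class $\delta$ on $\pi^{-1}(p)=T^n$ with metric $g_{ij}(p)dy_idy_j$. With $\delta_i:=(-1)^{n-i}\int_\delta dy_1\wedge\dots\wedge\widehat{dy_i}\wedge\dots\wedge dy_n$ (regarding $\delta$ as an element of $T_p^*B$), $|\delta|_p=\sqrt{\det(g)g^{ij}\delta_i\delta_j}$. For $\delta\neq0$ let $v_p(\delta)=\dfrac{g^{ij}(p)\delta_j\,\partial/\partial x_i}{\sqrt{g^{ij}(p)\delta_i\delta_j}}\in T_pB$. A **gradient flowline** is a trajectory of $\frac{dx_i}{dt}=\sum_jg^{ij}(x)\delta_j$ for a fixed nonzero $\delta\in\Lambda$, i.e. a $g$-gradient flowline of the linear function $x\mapsto\langle\delta,x\rangle$. **Currents on $B$.** A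 $\Lambda$-valued $1$-rectifiable current $T$ in $B$ is $T(\beta)=\int_\Gamma\langle\beta(x),\xi(x)\rangle\delta(x)\,d\mathcal{H}^1(x)$ for compactly supported $1$-forms $\beta$, where $\Gamma=\mathrm{spt}(T)\subset B$ is $1$-rectifiable, $\xi(x)$ is a $g$-unit vector spanning the approximate tangent space $T_x\Gamma$ for $\mathcal{H}^1$-a.e. $x$, and $\delta:\Gamma\to\Lambda$ is locally integrable (the pair $(\delta,\xi)$ may be replaced by $(-\delta,-\xi)$). It is closed if $\partial T(f)=T(df)=0$ for all $f\in C^\infty_{cpt}(B)$. $T$ is a $\Lambda$-weighted gradient cycle if $\partial T=0$ and $\xi(p)=v_p(\delta(p))$ for $\mathcal{H}^1$-a.e. $p\in\Gamma$. *)

theory Defs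
  imports "HOL-Analysis.Analysis"
begin

section \<open>Hessian domains\<close>

definition partial_deriv :: "'n::finite \<Rightarrow> (real^'n \<Rightarrow> real) \<Rightarrow> real^'n \<Rightarrow> real" where
  "partial_deriv i f x = frechet_derivative f (at x) (axis i 1)"

primrec Ck_on :: "nat \<Rightarrow> (real^'n::finite) set \<Rightarrow> (real^'n \<Rightarrow> real) \<Rightarrow> bool" where
  "Ck_on 0 S f \<longleftrightarrow> continuous_on S f"
| "Ck_on (Suc k) S f \<longleftrightarrow> f differentiable_on S \<and> (\<forall>i. Ck_on k S (partial_deriv i f))"

text \<open>Used for open \<^term>\<open>S\<close> only.\<close>

definition smooth_on :: "(real^'n::finite) set \<Rightarrow> (real^'n \<Rightarrow> real) \<Rightarrow> bool" where
  "smooth_on S f \<longleftrightarrow> (\<forall>k. Ck_on k S f)"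

definition gradient_form :: "(real^'n::finite \<Rightarrow> real) \<Rightarrow> real^'n \<Rightarrow> real^'n" where
  "gradient_form f x = (\<chi> i. partial_deriv i f x)"

definition hessian :: "(real^'n::finite \<Rightarrow> real) \<Rightarrow> real^'n \<Rightarrow> real^'n^'n" where
  "hessian u x = (\<chi> i j. partial_deriv i (partial_deriv j u) x)"

text \<open>The domain need not be convex, so convexity of the potential is required on the convex
  subsets of the domain.\<close>

definition hessian_domain :: "(real^'n::finite) set \<Rightarrow> (real^'n \<Rightarrow> real) \<Rightarrow> bool" where
  "hessian_domain B u \<longleftrightarrow>
     open B \<and> B \<noteq> {} \<and> contractible B \<and> smooth_on B u \<and>
     (\<forall>C. convex C \<and> C \<subseteq> B \<longrightarrow> convex_on C u) \<and>
     (\<forall>x\<in>B. \<forall>w. w \<noteq> 0 \<longrightarrow> w \<bullet> (hessian u x *v w) > 0)"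

definition g_norm :: "(real^'n::finite \<Rightarrow> real) \<Rightarrow> real^'n \<Rightarrow> real^'n \<Rightarrow> real" where
  "g_norm u x w = sqrt (w \<bullet> (hessian u x *v w))"

text \<open>Lengths and distances are extended reals because \<^const>\<open>valid_path\<close> admits paths whose
  derivative is unbounded near finitely many parameters, hence paths of infinite length.\<close>

definition g_length :: "(real^'n::finite \<Rightarrow> real) \<Rightarrow> (real \<Rightarrow> real^'n) \<Rightarrow> ennreal" where
  "g_length u \<gamma> =
     (\<integral>\<^sup>+ t\<in>{0..1}. ennreal (g_norm u (\<gamma> t) (vector_derivative \<gamma> (at t))) \<partial>lborel)"

definition g_dist ::
  "(real^'n::finite) set \<Rightarrow> (real^'n \<Rightarrow> real) \<Rightarrow> real^'n \<Rightarrow> real^'n \<Rightarrow> ennreal" where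
  "g_dist B u x y =
     (INF \<gamma>\<in>{\<gamma>. valid_path \<gamma> \<and> path_image \<gamma> \<subseteq> B \<and> pathstart \<gamma> = x \<and> pathfinish \<gamma> = y}. g_length u \<gamma>)"


section \<open>One-dimensional Hausdorff measure\<close>

definition ediam :: "('a \<Rightarrow> 'a \<Rightarrow> ennreal) \<Rightarrow> 'a set \<Rightarrow> ennreal" where
  "ediam d A = (SUP x\<in>A. SUP y\<in>A. d x y)"

definition hausdorff1_pre :: "'a set \<Rightarrow> ('a \<Rightarrow> 'a \<Rightarrow> ennreal) \<Rightarrow> real \<Rightarrow> 'a set \<Rightarrow> ennreal" where
  "hausdorff1_pre S d \<epsilon> E =
     (INF A\<in>{A :: nat \<Rightarrow> 'a set. (\<forall>i. A i \<subseteq> S \<and> ediam d (A i) \<le> ennreal \<epsilon>) \<and> E \<subseteq> (\<Union>i. A i)}.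
        \<Sum>i. ediam d (A i))"

definition hausdorff1_outer :: "'a set \<Rightarrow> ('a \<Rightarrow> 'a \<Rightarrow> ennreal) \<Rightarrow> 'a set \<Rightarrow> ennreal" where
  "hausdorff1_outer S d E = (SUP \<epsilon>\<in>{0<..}. hausdorff1_pre S d \<epsilon> E)"

text \<open>The measurable sets are all sets satisfying the Caratheodory criterion.\<close>

definition hausdorff1 :: "'a set \<Rightarrow> ('a \<Rightarrow> 'a \<Rightarrow> ennreal) \<Rightarrow> 'a measure" where
  "hausdorff1 S d =
     measure_of S (lambda_system S (Pow S) (hausdorff1_outer S d)) (hausdorff1_outer S d)"

lemma hausdorff1_pre_subadditive:
  assumes "\<epsilon> > 0"
  shows "hausdorff1_pre S d \<epsilon> (\<Union>i. E i) \<le> (\<Sum>i. hausdorff1_pre S d \<epsilon> (E (i::nat)))"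
proof (rule ennreal_le_epsilon)
  fix e :: real
  assume e: "0 < e" and fin: "(\<Sum>i. hausdorff1_pre S d \<epsilon> (E i)) < top"
  define C where "C E = {A :: nat \<Rightarrow> 'a set.
    (\<forall>i. A i \<subseteq> S \<and> ediam d (A i) \<le> ennreal \<epsilon>) \<and> E \<subseteq> (\<Union>i. A i)}" for E
  have pre: "hausdorff1_pre S d \<epsilon> F = (INF A\<in>C F. \<Sum>i. ediam d (A i))" for F
    by (simp add: hausdorff1_pre_def C_def)
  have "\<exists>A\<in>C (E n). (\<Sum>i. ediam d (A i)) \<le> hausdorff1_pre S d \<epsilon> (E n) + ennreal (e * (1/2)^Suc n)" for n
  proof -
    have "hausdorff1_pre S d \<epsilon> (E n) < top"
      using fin by (metis ennreal_suminf_lessD)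
    moreover have "ennreal (e * (1/2)^Suc n) > 0"
      using e by (simp add: ennreal_zero_less_mult_iff)
    ultimately have "hausdorff1_pre S d \<epsilon> (E n) < hausdorff1_pre S d \<epsilon> (E n) + ennreal (e * (1/2)^Suc n)"
      by (metis add.right_neutral ennreal_add_left_cancel_less infinity_ennreal_def less_irrefl)
    then show ?thesis
      unfolding pre by (subst (asm) INF_less_iff) (auto intro: less_imp_le)
  qed
  then obtain A where A: "\<And>n. A n \<in> C (E n)"
      "\<And>n. (\<Sum>i. ediam d (A n i)) \<le> hausdorff1_pre S d \<epsilon> (E n) + ennreal (e * (1/2)^Suc n)"
    by metis
  define D where "D k = (case prod_decode k of (n, i) \<Rightarrow> A n i)" for k
  have AD: "A n i = D (prod_encode (n, i))" for n i
    by (simp add: D_def)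
  have "D \<in> C (\<Union>i. E i)"
  proof -
    have "D k \<subseteq> S \<and> ediam d (D k) \<le> ennreal \<epsilon>" for k
      using A(1) by (auto simp: C_def D_def split: prod.splits)
    moreover have "x \<in> (\<Union>k. D k)" if "x \<in> E n" for x n
      using A(1)[of n] that AD by (fastforce simp: C_def)
    ultimately show ?thesis
      by (fastforce simp: C_def)
  qed
  then have "hausdorff1_pre S d \<epsilon> (\<Union>i. E i) \<le> (\<Sum>k. ediam d (D k))"
    unfolding pre by (rule INF_lower)
  also have "\<dots> = (\<Sum>n. \<Sum>i. ediam d (A n i))"
    using suminf_ennreal_2dimen[where f="\<lambda>p. ediam d (A (fst p) (snd p))"
        and g="\<lambda>n. \<Sum>i. ediam d (A n i)"]
    by (simp add: D_def o_def case_prod_unfold)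
  also have "\<dots> \<le> (\<Sum>n. hausdorff1_pre S d \<epsilon> (E n) + ennreal (e * (1/2)^Suc n))"
    by (intro suminf_le A(2)) auto
  also have "\<dots> = (\<Sum>n. hausdorff1_pre S d \<epsilon> (E n)) + (\<Sum>n. ennreal (e * (1/2)^Suc n))"
    by (simp add: suminf_add)
  also have "(\<Sum>n. ennreal (e * (1/2)^Suc n)) = ennreal e"
    using sums_mult[OF power_half_series, of e] e by (intro suminf_ennreal_eq) auto
  finally show "hausdorff1_pre S d \<epsilon> (\<Union>i. E i) \<le> (\<Sum>i. hausdorff1_pre S d \<epsilon> (E i)) + ennreal e" .
qed

lemma hausdorff1_outer_measure_space:
  "outer_measure_space (Pow S) (hausdorff1_outer S d)"
proof -
  have "hausdorff1_pre S d \<epsilon> {} = 0" for \<epsilon>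
    unfolding hausdorff1_pre_def
    by (rule antisym[OF INF_lower2[of "\<lambda>_. {}"]]) (auto simp: ediam_def bot_ennreal)
  then have 1: "positive (Pow S) (hausdorff1_outer S d)"
    by (auto simp: positive_def hausdorff1_outer_def)
  have 2: "increasing (Pow S) (hausdorff1_outer S d)"
    unfolding increasing_def hausdorff1_outer_def hausdorff1_pre_def
    by (intro ballI impI SUP_mono' INF_superset_mono) auto
  have "hausdorff1_outer S d (\<Union>i. E i) \<le> (\<Sum>i. hausdorff1_outer S d (E (i::nat)))" for E
    unfolding hausdorff1_outer_def[of S d "\<Union>i. E i"]
  proof (rule SUP_least)
    fix \<epsilon> :: real assume "\<epsilon> \<in> {0<..}"
    then have "hausdorff1_pre S d \<epsilon> (\<Union>i. E i) \<le> (\<Sum>i. hausdorff1_pre S d \<epsilon> (E i))"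
      by (simp add: hausdorff1_pre_subadditive)
    also have "\<dots> \<le> (\<Sum>i. hausdorff1_outer S d (E i))"
      using \<open>\<epsilon> \<in> _\<close> by (intro suminf_le) (auto simp: hausdorff1_outer_def intro: SUP_upper)
    finally show "hausdorff1_pre S d \<epsilon> (\<Union>i. E i) \<le> (\<Sum>i. hausdorff1_outer S d (E i))" .
  qed
  then have 3: "countably_subadditive (Pow S) (hausdorff1_outer S d)"
    by (auto simp: countably_subadditive_def)
  from 1 2 3 show ?thesis
    by (simp add: outer_measure_space_def)
qed

lemma hausdorff1_measure_space:
  "measure_space S (lambda_system S (Pow S) (hausdorff1_outer S d)) (hausdorff1_outer S d)"
  using sigma_algebra.caratheodory_lemma[OF sigma_algebra_Pow hausdorff1_outer_measure_space] .

lemma sets_hausdorff1: "sets (hausdorff1 S d) = lambda_system S (Pow S) (hausdorff1_outer S d)"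
  using hausdorff1_measure_space[of S d] unfolding hausdorff1_def measure_space_def
  by (metis sigma_algebra.sets_measure_of_eq)

lemma emeasure_hausdorff1:
  "E \<in> sets (hausdorff1 S d) \<Longrightarrow> emeasure (hausdorff1 S d) E = hausdorff1_outer S d E"
  using hausdorff1_measure_space[of S d] unfolding sets_hausdorff1
  by (intro emeasure_measure_of[OF hausdorff1_def]) 
    (auto simp: measure_space_def sets_hausdorff1 lambda_system_def)

abbreviation g_hausdorff1 :: "(real^'n::finite) set \<Rightarrow> (real^'n \<Rightarrow> real) \<Rightarrow> (real^'n) measure" where
  "g_hausdorff1 B u \<equiv> hausdorff1 B (g_dist B u)"


section \<open>Lattice-weighted rectifiable currents\<close>

text \<open>
  A class $\delta \in \Lambda = H_{n-1}(T^n,\mathbb{Z})$ is given by its integral coordinates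
  $\delta_i = (-1)^{n-i}\int_\delta dy_1\wedge\dots\wedge\widehat{dy_i}\wedge\dots\wedge dy_n$;
  the map $\delta \mapsto (\delta_i)$ is an isomorphism from $\Lambda$ onto $\mathbb{Z}^n$.
  Regarded as an element of $T^*_pB$, the class is the covector $\sum_i \delta_i\,dx_i$.
\<close>

type_synonym 'n lattice = "int^'n"

definition covector :: "'n::finite lattice \<Rightarrow> real^'n" where
  "covector \<delta> = (\<chi> i. real_of_int (\<delta> $ i))"

definition flow_field :: "(real^'n::finite \<Rightarrow> real) \<Rightarrow> 'n lattice \<Rightarrow> real^'n \<Rightarrow> real^'n" where
  "flow_field u \<delta> x = matrix_inv (hessian u x) *v covector \<delta>"

definition unit_flow_field :: "(real^'n::finite \<Rightarrow> real) \<Rightarrow> 'n lattice \<Rightarrow> real^'n \<Rightarrow> real^'n" where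
  "unit_flow_field u \<delta> x = flow_field u \<delta> x /\<^sub>R sqrt (covector \<delta> \<bullet> flow_field u \<delta> x)"

text \<open>One-forms are given by their components with respect to $dx_1,\dots,dx_n$, and forms on the
  domain with compact support are extended by zero.\<close>

definition test_function :: "(real^'n::finite) set \<Rightarrow> (real^'n \<Rightarrow> real) \<Rightarrow> bool" where
  "test_function U f \<longleftrightarrow>
     smooth_on UNIV f \<and> compact (closure {x. f x \<noteq> 0}) \<and> closure {x. f x \<noteq> 0} \<subseteq> U"

definition test_form :: "(real^'n::finite) set \<Rightarrow> (real^'n \<Rightarrow> real^'n) \<Rightarrow> bool" where
  "test_form U \<beta> \<longleftrightarrow> (\<forall>i. test_function U (\<lambda>x. \<beta> x $ i))"

text \<open>Currents take values in $\Lambda\otimes\mathbb{R}$.\<close>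

type_synonym 'n lattice_current = "(real^'n \<Rightarrow> real^'n) \<Rightarrow> real^'n"

definition current_support :: "(real^'n::finite) set \<Rightarrow> 'n lattice_current \<Rightarrow> (real^'n) set" where
  "current_support B T =
     {x\<in>B. \<forall>U. open U \<and> x \<in> U \<and> U \<subseteq> B \<longrightarrow> (\<exists>\<beta>. test_form U \<beta> \<and> T \<beta> \<noteq> 0)}"

definition closed_current :: "(real^'n::finite) set \<Rightarrow> 'n lattice_current \<Rightarrow> bool" where
  "closed_current B T \<longleftrightarrow> (\<forall>f. test_function B f \<longrightarrow> T (gradient_form f) = 0)"

definition rectifiable1 ::
  "(real^'n::finite) set \<Rightarrow> (real^'n \<Rightarrow> real) \<Rightarrow> (real^'n) set \<Rightarrow> bool" where
  "rectifiable1 B u \<Gamma> \<longleftrightarrow>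
     \<Gamma> \<in> sets (g_hausdorff1 B u) \<and>
     (\<exists>f :: nat \<Rightarrow> real \<Rightarrow> real^'n.
        (\<forall>i. \<exists>L. L-lipschitz_on UNIV (f i)) \<and>
        \<Gamma> - (\<Union>i. range (f i)) \<in> null_sets (g_hausdorff1 B u))"

text \<open>
  The line $\mathbb{R}v$ is the approximate tangent space of $\Gamma$ at $x$ when the rescalings
  of the $g$-Hausdorff measure on $\Gamma$ converge vaguely to the $g(x)$-length measure on
  $\mathbb{R}v$.  For a $g(x)$-unit vector $v$ the latter is the image of Lebesgue measure under
  $t \mapsto tv$.
\<close>

definition spans_approx_tangent ::
  "(real^'n::finite) set \<Rightarrow> (real^'n \<Rightarrow> real) \<Rightarrow> (real^'n) set \<Rightarrow> real^'n \<Rightarrow> real^'n \<Rightarrow> bool" where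
  "spans_approx_tangent B u \<Gamma> x v \<longleftrightarrow>
     g_norm u x v = 1 \<and>
     (\<forall>\<phi> :: real^'n \<Rightarrow> real. continuous_on UNIV \<phi> \<and> compact (closure {y. \<phi> y \<noteq> 0}) \<longrightarrow>
        ((\<lambda>r. (LINT y:\<Gamma>|g_hausdorff1 B u. \<phi> ((y - x) /\<^sub>R r)) / r)
          \<longlongrightarrow> (LINT t|lborel. \<phi> (t *\<^sub>R v))) (at_right 0))"

definition rectifiable_current ::
  "(real^'n::finite) set \<Rightarrow> (real^'n \<Rightarrow> real) \<Rightarrow> 'n lattice_current \<Rightarrow>
     (real^'n \<Rightarrow> 'n lattice) \<Rightarrow> (real^'n \<Rightarrow> real^'n) \<Rightarrow> bool" where
  "rectifiable_current B u T \<delta> \<xi> \<longleftrightarrow>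
     (let \<Gamma> = current_support B T; H = g_hausdorff1 B u in
        rectifiable1 B u \<Gamma> \<and>
        set_borel_measurable H \<Gamma> \<xi> \<and>
        (AE x in H. x \<in> \<Gamma> \<longrightarrow> spans_approx_tangent B u \<Gamma> x (\<xi> x)) \<and>
        (\<forall>K. compact K \<and> K \<subseteq> B \<longrightarrow> set_integrable H (\<Gamma> \<inter> K) (\<lambda>x. covector (\<delta> x))) \<and>
        (\<forall>\<beta>. test_form B \<beta> \<longrightarrow> T \<beta> = (LINT x:\<Gamma>|H. (\<beta> x \<bullet> \<xi> x) *\<^sub>R covector (\<delta> x))))"

definition weighted_gradient_cycle ::
  "(real^'n::finite) set \<Rightarrow> (real^'n \<Rightarrow> real) \<Rightarrow> 'n lattice_current \<Rightarrow> bool" where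
  "weighted_gradient_cycle B u T \<longleftrightarrow>
     closed_current B T \<and>
     (\<exists>\<delta> \<xi>. rectifiable_current B u T \<delta> \<xi> \<and>
        (AE x in g_hausdorff1 B u. x \<in> current_support B T \<longrightarrow>
           \<delta> x \<noteq> 0 \<and> \<xi> x = unit_flow_field u (\<delta> x) x))"


section \<open>Graphs and flowlines\<close>

text \<open>At an end of an edge the parametrisation converges to a vertex or leaves every compact
  subset of the domain.\<close>

definition edge_end :: "'a::topological_space set \<Rightarrow> 'a set \<Rightarrow> (real \<Rightarrow> 'a) \<Rightarrow> real filter \<Rightarrow> bool" where
  "edge_end B V \<gamma> F \<longleftrightarrow>
     (\<exists>v\<in>V. (\<gamma> \<longlongrightarrow> v) F) \<or> (\<forall>K. compact K \<and> K \<subseteq> B \<longrightarrow> (\<forall>\<^sub>F t in F. \<gamma> t \<notin> K))"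

definition embedded_edge :: "'a::topological_space set \<Rightarrow> 'a set \<Rightarrow> 'a set \<Rightarrow> bool" where
  "embedded_edge B V e \<longleftrightarrow>
     (\<exists>\<gamma> \<gamma>'. homeomorphism {0<..<1::real} e \<gamma> \<gamma>' \<and>
        edge_end B V \<gamma> (at_right 0) \<and> edge_end B V \<gamma> (at_left 1))"

definition locally_finite_embedded_graph ::
  "'a::topological_space set \<Rightarrow> 'a set \<Rightarrow> 'a set \<Rightarrow> 'a set set \<Rightarrow> bool" where
  "locally_finite_embedded_graph B \<Gamma> V E \<longleftrightarrow>
     \<Gamma> \<subseteq> B \<and> \<Gamma> = V \<union> \<Union>E \<and> V \<inter> \<Union>E = {} \<and> pairwise disjnt E \<and>
     (\<forall>e\<in>E. embedded_edge B V e) \<and>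
     (\<forall>K. compact K \<and> K \<subseteq> B \<longrightarrow> finite (V \<inter> K) \<and> finite {e\<in>E. e \<inter> K \<noteq> {}})"

definition gradient_flowline ::
  "(real^'n::finite) set \<Rightarrow> (real^'n \<Rightarrow> real) \<Rightarrow> (real^'n) set \<Rightarrow> bool" where
  "gradient_flowline B u e \<longleftrightarrow>
     (\<exists>\<delta> I x. \<delta> \<noteq> 0 \<and> open I \<and> is_interval I \<and> I \<noteq> {} \<and> e = x ` I \<and>
        (\<forall>t\<in>I. x t \<in> B \<and> (x has_vector_derivative flow_field u \<delta> (x t)) (at t)))"

end

theory Submission
  imports Defs "HOL-Analysis.Analysis"
begin

text \<open>In the dual coordinates \<open>y = \<nabla>u(x)\<close> gradient flowlines become straight lines in lattice directions, and closedness of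
  the current says that the measure with density \<open>|d|\<^sup>2\<close> (\<open>d\<close> the lattice weight, which is also the tangent direction) is a
  stationary one-dimensional varifold. The monotonicity formula bounds \<open>|d|\<close> locally, so only finitely many directions
  occur, and gives a lower density bound at every point of the support; finiteness of the radial term forces the
  support near a point into finitely many thin sectors around lattice directions \<open>e\<close>. Inside a sector, fields
  \<open>f(t) z\<close>, with \<open>t\<close> the coordinate along \<open>e\<close> and \<open>z\<close> the transversal one, between slices that avoid the
  small set of weights not parallel to \<open>e\<close>, show that all weights are parallel to \<open>e\<close>; then constancy of the
  transversal second moment along \<open>e\<close> and its decay at the vertex confine the support to one ray. The support is thus
  locally a finite star of segments. A locally finite cover by such stars yields the graph, with the centres
  and end points of the stars as vertices.\<close>

section \<open>Monotonicity formula for stationary one-dimensional measures\<close>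

text \<open>Stationarity rests on a coincidence: the weight of the current is a vector, and the
  gradient condition makes the tangent in dual coordinates a positive multiple of that same vector.
  Testing component i of the closed current with component i of a field X pulled back by the
  gradient map, and summing over i, yields the integral of \<open>X' d \<bullet> d\<close>, the
  first variation. The pulled back field is only C^1 while currents are tested with smooth forms,
  hence the mollification. The weights are a priori merely locally integrable. Their bound comes
  from the covers that the definition of Hausdorff measure supplies, without a differentiation
  theorem for measures. Tangent cones are never taken: finitely many directions remain, and every
  deviation from them costs a definite amount of monotonicity. In a sector, averaging over a slab of
  heights could still meet transversal weights; their mass is so small that a set of heights of
  positive length misses them, and through those heights the transversal flux is exactly
  zero.\<close>

text \<open>With \<open>s\<close> the squared radius, \<open>kA\<close> is the solution of \<open>kA + 2 s kA' = kphi\<close> that is regular at 0; hence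
  the radial part of the test field with profile \<open>kA\<close> is the mollified mass.\<close>

definition kA :: "real \<Rightarrow> real" where
  "kA s = (if s \<le> 1 then 1 - 2 * s / 3 + s\<^sup>2 / 5 else 8 / (15 * sqrt s))"

text \<open>Minus the derivative of \<open>kA\<close>. Beyond 1 the equation for \<open>kA\<close>
  is homogeneous, with solutions proportional to \<open>1 / sqrt s\<close>; the factor 8/15 = 1 -
  2/3 + 1/5 matches the polynomial at 1, and 4/15 = 2/3 - 2/5 shows that the derivatives match
  too.\<close>

definition kB :: "real \<Rightarrow> real" where
  "kB s = (if s \<le> 1 then 2 / 3 - 2 * s / 5 else 4 / (15 * (s * sqrt s)))"

definition kphi :: "real \<Rightarrow> real" where
  "kphi s = (if s \<le> 1 then (1 - s)\<^sup>2 else 0)"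

section \<open>Calculus of the radial kernels\<close>

lemma kA_deriv: "(kA has_real_derivative - kB s) (at s)"
proof -
  have 1: "((\<lambda>s. 1 - 2 * s / 3 + s\<^sup>2 / 5) has_real_derivative (2 * s / 5 - 2 / 3)) (at s within T)" for s :: real and T
    by (auto intro!: derivative_eq_intros simp: field_simps)
  have 2: "((\<lambda>s. 8 / (15 * sqrt s)) has_real_derivative - (4 / (15 * (s * sqrt s)))) (at s within T)" if "s > 0" for s :: real and T
    using that by (auto intro!: derivative_eq_intros simp: field_simps power2_eq_square)
  have "((\<lambda>x. if x \<in> {..1} then 1 - 2 * x / 3 + x\<^sup>2 / 5 else 8 / (15 * sqrt x)) has_vector_derivative
         (if s \<in> {..1} then 2 * s / 5 - 2 / 3 else - (4 / (15 * (s * sqrt s))))) (at s within UNIV)"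
    by (rule has_vector_derivative_If_within_closures[where T="{1..}" and S="{..1}"])
      (auto simp flip: has_real_derivative_iff_has_vector_derivative intro!: 1 2[simplified] split: if_splits)
  moreover have "kA = (\<lambda>x. if x \<in> {..1} then 1 - 2 * x / 3 + x\<^sup>2 / 5 else 8 / (15 * sqrt x))"
    by (auto simp: kA_def)
  moreover have "(if s \<in> {..1} then 2 * s / 5 - 2 / 3 else - (4 / (15 * (s * sqrt s)))) = - kB s"
    by (auto simp: kB_def)
  ultimately show ?thesis
    by (simp add: has_real_derivative_iff_has_vector_derivative)
qed

lemma kB_cont: "continuous_on UNIV kB"
proof -
  have "continuous_on ({..1} \<union> {1..}) (\<lambda>s::real. if s \<le> 1 then 2 / 3 - 2 * s / 5 else 4 / (15 * (s * sqrt s)))"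
    by (intro continuous_on_If continuous_intros) auto
  moreover have "{..1} \<union> {1..} = (UNIV::real set)" by auto
  ultimately show ?thesis unfolding kB_def[abs_def] by simp
qed

lemma kA_cont: "continuous_on UNIV kA"
  using kA_deriv by (meson DERIV_continuous_on UNIV_I has_field_derivative_at_within)

lemma kphi_eq: "0 \<le> s \<Longrightarrow> kA s - 2 * s * kB s = kphi s"
  by (auto simp: kA_def kB_def kphi_def power2_eq_square field_simps)

lemma kphi_bounds: "0 \<le> s \<Longrightarrow> 0 \<le> kphi s \<and> kphi s \<le> 1"
  by (auto simp: kphi_def intro: power_le_one)

lemma kphi_measurable[measurable]: "kphi \<in> borel_measurable borel"
  unfolding kphi_def[abs_def] by measurable

lemma kB_measurable[measurable]: "kB \<in> borel_measurable borel"
  by (rule borel_measurable_continuous_onI[OF kB_cont])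

lemma kA_measurable[measurable]: "kA \<in> borel_measurable borel"
  by (rule borel_measurable_continuous_onI[OF kA_cont])

lemma kB_bounds: "0 \<le> s \<Longrightarrow> 0 \<le> kB s \<and> kB s \<le> 2 / 3"
proof -
  assume "0 \<le> s"
  have "4 / (15 * (s * sqrt s)) \<le> 4 / 15" if "1 < s"
  proof -
    have "1 \<le> s * sqrt s" using that mult_mono[of 1 s 1 "sqrt s"] by simp
    then show ?thesis by (simp add: divide_le_eq)
  qed
  moreover have "0 \<le> 4 / (15 * (s * sqrt s))" using \<open>0 \<le> s\<close> by simp
  ultimately have "\<not> s \<le> 1 \<Longrightarrow> 0 \<le> 4 / (15 * (s * sqrt s)) \<and> 4 / (15 * (s * sqrt s)) \<le> 2 / 3" by linarith
  then show ?thesis using \<open>0 \<le> s\<close> unfolding kB_def by (cases "s \<le> 1") auto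
qed

text \<open>At a fixed distance c all dependence on the scale r goes into q = min 1 (c/r). The
  polynomial 2/3 q^3 - 2/5 q^5 takes at q = 1 the value 4/15 of the tail, so monotonicity in r and
  the size of the gap are both read off one polynomial.\<close>

lemma kB_cube: 
  assumes "0 < c" "0 < r"
  shows "kB (c\<^sup>2 / r\<^sup>2) / r ^ 3 = (2 / 3 * (min 1 (c / r)) ^ 3 - 2 / 5 * (min 1 (c / r)) ^ 5) / c ^ 3"
proof (cases "c \<le> r")
  case True
  then have "c\<^sup>2 / r\<^sup>2 \<le> 1" "min 1 (c / r) = c / r"
    using assms by (auto simp: divide_le_eq power_mono)
  show ?thesis unfolding \<open>min 1 (c / r) = c / r\<close> using assms \<open>c\<^sup>2 / r\<^sup>2 \<le> 1\<close>
    by (simp add: kB_def field_simps eval_nat_numeral)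
next
  case False
  then have *: "\<not> c\<^sup>2 / r\<^sup>2 \<le> 1" "min 1 (c / r) = 1"
    using assms by (auto simp: divide_le_eq power2_le_iff_abs_le)
  have "sqrt (c\<^sup>2 / r\<^sup>2) = c / r" using assms by (simp add: real_sqrt_divide)
  then show ?thesis using assms * 
    by (simp add: kB_def field_simps eval_nat_numeral)
qed

lemma kP_mono: "0 \<le> a \<Longrightarrow> a \<le> b \<Longrightarrow> b \<le> 1 \<Longrightarrow> 2/3 * a ^ 3 - 2/5 * a ^ 5 \<le> 2/3 * b ^ 3 - 2/5 * (b::real) ^ 5"
proof (rule DERIV_nonneg_imp_nondecreasing[of a b "\<lambda>x. 2/3 * x ^ 3 - 2/5 * x ^ 5"])
  fix x assume *: "a \<le> x" "x \<le> b" and "0 \<le> a" "a \<le> b" "b \<le> 1"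
  then have "x ^ 4 \<le> x ^ 2" by (intro power_decreasing) auto
  then show "\<exists>y. ((\<lambda>x. 2/3 * x ^ 3 - 2/5 * x ^ 5) has_real_derivative y) (at x) \<and> 0 \<le> y"
    by (intro exI[of _ "2 * x ^ 2 - 2 * x ^ 4"]) (auto intro!: derivative_eq_intros simp: field_simps)
qed

lemma kB_mono:
  assumes "0 \<le> s" "0 < r" "r \<le> r'"
  shows "kB (s / r'\<^sup>2) / r' ^ 3 \<le> kB (s / r\<^sup>2) / r ^ 3"
proof (cases "s = 0")
  \<comment> \<open>At the centre \<open>kB_cube\<close> does not apply, since it divides by c^3;
    there \<open>kB\<close> has the value 2/3 at every scale.\<close>
  case True
  have "r ^ 3 \<le> r' ^ 3" using assms by (intro power_mono) auto
  then show ?thesis using True assms by (simp add: kB_def frac_le)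
next
  case False
  define c where "c = sqrt s"
  have c: "s = c\<^sup>2" "0 < c" using False assms by (auto simp: c_def)
  have "c / r' \<le> c / r" using assms c by (intro divide_left_mono) auto
  then have "2/3 * (min 1 (c/r')) ^ 3 - 2/5 * (min 1 (c/r')) ^ 5 \<le> 2/3 * (min 1 (c/r)) ^ 3 - 2/5 * (min 1 (c/r)) ^ 5"
    using assms c by (intro kP_mono) auto
  then show ?thesis
    using assms c unfolding c(1) by (subst (1 2) kB_cube) (auto intro!: divide_right_mono)
qed

text \<open>The two values of min 1 (c/r) are 1 at the small scale and at most 1/2 at the large one,
  where the polynomial of \<open>kB_cube\<close> is 4/15 and at most 17/240; the difference is at
  least 47/240 > 1/6. This quantifies how strict the monotonicity is on an annulus.\<close>

lemma kB_gap:
  assumes "0 < r" "r \<le> c" "2 * c \<le> r'"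
  shows "1 / (6 * c ^ 3) \<le> kB (c\<^sup>2 / r\<^sup>2) / r ^ 3 - kB (c\<^sup>2 / r'\<^sup>2) / r' ^ 3"
proof -
  have c: "0 < c" "0 < r'" using assms by auto
  have m: "min 1 (c / r) = 1" using assms by auto
  have "c / r' \<le> 1/2" using assms c by (simp add: field_simps)
  then have "2/3 * (min 1 (c/r')) ^ 3 - 2/5 * (min 1 (c/r')) ^ 5 \<le> 2/3 * (1/2) ^ 3 - 2/5 * (1/2) ^ 5"
    using c by (intro kP_mono) auto
  also have "\<dots> = (2/24 - 2/160::real)" by (simp add: eval_nat_numeral)
  finally have "2/3 * (min 1 (c/r')) ^ 3 - 2/5 * (min 1 (c/r')) ^ 5 \<le> 2/24 - (2/160::real)" .
  then have "1/6 \<le> (4/15) - (2/3 * (min 1 (c/r')) ^ 3 - 2/5 * (min 1 (c/r')) ^ 5)" by simp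
  then have "1/6 / c^3 \<le> ((4/15) - (2/3 * (min 1 (c/r')) ^ 3 - 2/5 * (min 1 (c/r')) ^ 5)) / c^3"
    using c by (intro divide_right_mono) auto
  then show ?thesis
    using assms c by (subst (1 2) kB_cube) (auto simp: m diff_divide_distrib)
qed

text \<open>A cycle seen in one chart: \<open>Y\<close> is the position in dual coordinates and
  \<open>d\<close> the weight, which is also the tangent direction. M is scaled so that
  \<open>norm d\<close> times M is Euclidean length on the image; length with multiplicity
  \<open>norm d\<close> then has the squared norm as density. \<open>cover\<close> is what is kept
  of Hausdorff measure; its centres lie in the covered set, so that a property of the points of that
  set holds at the centres. \<open>mass_pos\<close> says that every point of the space belongs to
  the support.\<close>

locale lattice_stationary = finite_measure M
  for M :: "'a measure" +
  fixes Y d :: "'a \<Rightarrow> 'b::euclidean_space" and W \<Lambda> :: "'b set" and C0 :: real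
  assumes Y[measurable]: "Y \<in> borel_measurable M"
    and d[measurable]: "d \<in> borel_measurable M"
    and W: "open W"
    and YW: "\<And>x. x \<in> space M \<Longrightarrow> Y x \<in> W"
    and dsq: "integrable M (\<lambda>x. (norm (d x))\<^sup>2)"
    and d_AE: "AE x in M. d x \<in> \<Lambda> \<and> 1 \<le> norm (d x)"
    and \<Lambda>_finite: "\<And>r. finite (\<Lambda> \<inter> cball 0 r)"
    and C0: "0 < C0"
    and cover: "\<And>A \<eta>. A \<in> sets M \<Longrightarrow> A \<noteq> {} \<Longrightarrow> 0 < \<eta> \<Longrightarrow>
      \<exists>a \<rho>. (\<forall>i::nat. a i \<in> Y ` A \<and> 0 < \<rho> i \<and> \<rho> i < \<eta>) \<and> Y ` A \<subseteq> (\<Union>i. ball (a i) (\<rho> i)) \<and>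
        summable \<rho> \<and> suminf \<rho> \<le> C0 * (LINT x|M. indicator A x * norm (d x)) + \<eta>"
    and stat: "\<And>X X' K. (\<And>y. (X has_derivative X' y) (at y)) \<Longrightarrow> (\<And>h. continuous_on UNIV (\<lambda>y. X' y h)) \<Longrightarrow>
      compact K \<Longrightarrow> K \<subseteq> W \<Longrightarrow> (\<And>y. y \<notin> K \<Longrightarrow> X y = 0) \<Longrightarrow>
      (LINT x|M. X' (Y x) (d x) \<bullet> d x) = 0"
    and image_closed: "closedin (top_of_set W) (Y ` space M)"
    and mass_pos: "\<And>x r. x \<in> space M \<Longrightarrow> 0 < r \<Longrightarrow> 0 < measure M {x'\<in>space M. dist (Y x') (Y x) < r}"
begin

text \<open>The mollified density ratio at scale r, with \<open>kphi\<close> in place of the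
  indicator of the ball.\<close>

definition I :: "real \<Rightarrow> 'b \<Rightarrow> real" where
  "I r p = (LINT x|M. kphi ((norm (Y x - p))\<^sup>2 / r\<^sup>2) * (norm (d x))\<^sup>2) / r"

text \<open>By Lagrange's identity the squared area of the parallelogram spanned by the radius
  vector and \<open>d\<close>; it vanishes exactly when the two are linearly dependent.\<close>

definition S :: "'b \<Rightarrow> 'a \<Rightarrow> real" where
  "S p x = (norm (Y x - p))\<^sup>2 * (norm (d x))\<^sup>2 - ((Y x - p) \<bullet> d x)\<^sup>2"

lemma S_nonneg: "0 \<le> S p x"
proof -
  have "((Y x - p) \<bullet> d x)\<^sup>2 \<le> (norm (Y x - p) * norm (d x))\<^sup>2"
    by (rule abs_le_square_iff[THEN iffD1]) (simp add: Cauchy_Schwarz_ineq2)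
  then show ?thesis by (simp add: S_def power_mult_distrib)
qed

lemma integrable_bounded_dsq:
  assumes [measurable]: "f \<in> borel_measurable M" and "\<And>x. x \<in> space M \<Longrightarrow> \<bar>f x\<bar> \<le> C * (norm (d x))\<^sup>2"
  shows "integrable M (f :: 'a \<Rightarrow> real)"
proof (rule Bochner_Integration.integrable_bound)
  show "integrable M (\<lambda>x. C * (norm (d x))\<^sup>2)" by (rule integrable_mult_right) (rule dsq)
  show "AE x in M. norm (f x) \<le> norm (C * (norm (d x))\<^sup>2)"
    using assms(2) by (intro AE_I2) (metis real_norm_def abs_ge_self order_trans)
qed measurable

lemma integrable_kphi:
  "integrable M (\<lambda>x. kphi ((norm (Y x - p))\<^sup>2 / r\<^sup>2) * (norm (d x))\<^sup>2)"
proof (rule integrable_bounded_dsq)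
  show "(\<lambda>x. kphi ((norm (Y x - p))\<^sup>2 / r\<^sup>2) * (norm (d x))\<^sup>2) \<in> borel_measurable M" by measurable
  fix x
  have "0 \<le> (norm (Y x - p))\<^sup>2 / r\<^sup>2" by simp
  from kphi_bounds[OF this] show "\<bar>kphi ((norm (Y x - p))\<^sup>2 / r\<^sup>2) * (norm (d x))\<^sup>2\<bar> \<le> 1 * (norm (d x))\<^sup>2"
    by (simp add: abs_mult mult_left_le_one_le)
qed

text \<open>The test field is radial, e(|y - p|^2) (y - p) with e the difference of the two
  rescalings of \<open>kA\<close>. Its first variation splits into the mollified ratios at the two
  scales and a remainder that sees only the non-radial part of \<open>d\<close>.\<close>

lemma monotonicity_identity:
  assumes r: "0 < r1" "r1 \<le> r2" and "cball p r2 \<subseteq> W"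
  defines "D \<equiv> \<lambda>x. kB ((norm (Y x - p))\<^sup>2 / r1\<^sup>2) / r1 ^ 3 - kB ((norm (Y x - p))\<^sup>2 / r2\<^sup>2) / r2 ^ 3"
  shows "integrable M (\<lambda>x. D x * S p x)" "I r2 p - I r1 p = 2 * (LINT x|M. D x * S p x)"
proof -
  define e where "e s = kA (s / r1\<^sup>2) / r1 - kA (s / r2\<^sup>2) / r2" for s
  define e' where "e' s = kB (s / r2\<^sup>2) / r2 ^ 3 - kB (s / r1\<^sup>2) / r1 ^ 3" for s
  have r2: "0 < r2" using r by simp
  have e: "(e has_real_derivative e' s) (at s)" for s
  proof -
    have "((\<lambda>s. kA (s / r\<^sup>2)) has_real_derivative - kB (s / r\<^sup>2) * (1 / r\<^sup>2)) (at s)" for r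
      by (rule DERIV_chain'[OF DERIV_cdivide[OF DERIV_ident] kA_deriv])
    then have *: "((\<lambda>s. kA (s / r\<^sup>2) / r) has_real_derivative - (kB (s / r\<^sup>2) / r ^ 3)) (at s)" if "0 < r" for r
      using DERIV_cdivide[of "\<lambda>s. kA (s / r\<^sup>2)" "- kB (s / r\<^sup>2) * (1 / r\<^sup>2)" s UNIV r] that
      by (simp add: power3_eq_cube power2_eq_square mult_ac)
    show ?thesis unfolding e_def e'_def
      using DERIV_diff[OF *[OF r(1)] *[OF r2]] by simp
  qed
  define X where "X y = e ((norm (y - p))\<^sup>2) *\<^sub>R (y - p)" for y
  define X' where "X' y h = (2 * e' ((norm (y - p))\<^sup>2) * ((y - p) \<bullet> h)) *\<^sub>R (y - p) + e ((norm (y - p))\<^sup>2) *\<^sub>R h" for y h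
  have sq: "((\<lambda>y. (norm (y - p))\<^sup>2) has_derivative (\<lambda>h. 2 * ((y - p) \<bullet> h))) (at y)" for y
    unfolding power2_norm_eq_inner by (auto intro!: derivative_eq_intros simp: inner_commute)
  have X: "(X has_derivative X' y) (at y)" for y
  proof -
    have "((\<lambda>y. e ((norm (y - p))\<^sup>2)) has_derivative (\<lambda>h. e' ((norm (y - p))\<^sup>2) * (2 * ((y - p) \<bullet> h)))) (at y)"
      using has_derivative_compose[OF sq e[unfolded has_field_derivative_def]] .
    from has_derivative_scaleR[OF this has_derivative_diff[OF has_derivative_ident has_derivative_const[of p]]]
    show ?thesis unfolding X_def X'_def by (auto simp: algebra_simps)
  qed
  have ce: "continuous_on UNIV e" "continuous_on UNIV e'"
    using e DERIV_isCont continuous_at_imp_continuous_on apply blast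
    unfolding e'_def using r r2 by (intro continuous_intros continuous_on_compose2[OF kB_cont]) auto
  have c': "continuous_on UNIV (\<lambda>y. X' y h)" for h
    unfolding X'_def by (intro continuous_intros continuous_on_compose2[OF ce(1)] continuous_on_compose2[OF ce(2)]) auto
  \<comment> \<open>Beyond a radius, the rescaling of \<open>kA\<close> to that radius is 8 / (15
    sqrt s), whatever the radius. The difference e thus vanishes outside \<open>cball p r2\<close>,
    which makes the field admissible.\<close>
  have out: "e s = 0 \<and> e' s = 0" if "s \<ge> r2\<^sup>2" for s
  proof -
    have "s \<ge> r1\<^sup>2" using that r by (meson order_trans power_mono less_imp_le)
    have gen: "kA (s / r\<^sup>2) / r = 8 / (15 * sqrt s)" "kB (s / r\<^sup>2) / r ^ 3 = 4 / (15 * (s * sqrt s))" 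
      if "s \<ge> r\<^sup>2" "0 < r" for r
    proof -
      have "0 < r\<^sup>2" using that by simp
      then have q: "sqrt (s / r\<^sup>2) = sqrt s / r" "s > 0" using that by (simp add: real_sqrt_divide, linarith)
      show "kA (s / r\<^sup>2) / r = 8 / (15 * sqrt s)" 
        using that q by (cases "s = r\<^sup>2") (auto simp: kA_def q field_simps)
      show "kB (s / r\<^sup>2) / r ^ 3 = 4 / (15 * (s * sqrt s))" 
        using that q by (cases "s = r\<^sup>2") (auto simp: kB_def q field_simps eval_nat_numeral)
    qed
    show ?thesis using gen[of r1] gen[of r2] that \<open>s \<ge> r1\<^sup>2\<close> r r2 unfolding e_def e'_def by simp
  qed
  have out2: "X y = 0" if "y \<notin> cball p r2" for y
  proof -
    have "(norm (y - p))\<^sup>2 \<ge> r2\<^sup>2" using that r2 by (intro power_mono) (auto simp: dist_norm norm_minus_commute)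
    then show ?thesis using out by (simp add: X_def)
  qed
  have int0: "(LINT x|M. X' (Y x) (d x) \<bullet> d x) = 0"
    by (rule stat[OF X c' _ assms(3) out2]) auto
  \<comment> \<open>Write s and n for the squared norms of the radius vector and of d, and q for
    their inner product. Substituting q^2 = s n - S turns 2 e' q^2 + e n into (e + 2 s e') n - 2 e'
    S, and \<open>kphi_eq\<close> evaluates the bracket at both scales.\<close>
  have key: "X' (Y x) (d x) \<bullet> d x = kphi ((norm (Y x - p))\<^sup>2 / r1\<^sup>2) * (norm (d x))\<^sup>2 / r1
      - kphi ((norm (Y x - p))\<^sup>2 / r2\<^sup>2) * (norm (d x))\<^sup>2 / r2 + 2 * (D x * S p x)" for x
  proof -
    define s where "s = (norm (Y x - p))\<^sup>2"
    define q where "q = (Y x - p) \<bullet> d x"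
    define n where "n = (norm (d x))\<^sup>2"
    have s0: "0 \<le> s" by (simp add: s_def)
    have 1: "kphi (s / r\<^sup>2) / r = kA (s / r\<^sup>2) / r - 2 * s * (kB (s / r\<^sup>2) / r ^ 3)" if "r > 0" for r
      using that s0 kphi_eq[of "s / r\<^sup>2", symmetric] by (simp add: field_simps eval_nat_numeral)
    have lhs: "X' (Y x) (d x) \<bullet> d x = 2 * e' s * (q * q) + e s * n"
      unfolding X'_def s_def q_def n_def by (simp add: inner_add_left power2_norm_eq_inner)
    have "kphi (s / r1\<^sup>2) * n / r1 - kphi (s / r2\<^sup>2) * n / r2 = (kphi (s / r1\<^sup>2) / r1 - kphi (s / r2\<^sup>2) / r2) * n"
      by (simp add: field_simps)
    also have "\<dots> = (e s + 2 * s * e' s) * n"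
      unfolding 1[OF r(1)] 1[OF r2] e_def e'_def by (simp add: algebra_simps)
    finally have 2: "kphi (s / r1\<^sup>2) * n / r1 - kphi (s / r2\<^sup>2) * n / r2 = (e s + 2 * s * e' s) * n" .
    have 3: "D x = - e' s" by (simp add: D_def e'_def s_def)
    have 4: "S p x = s * n - q * q" by (simp add: S_def s_def n_def q_def power2_eq_square)
    show ?thesis unfolding lhs 3 4 unfolding s_def[symmetric] n_def[symmetric] 2
      by (simp add: algebra_simps)
  qed
  have Dint: "integrable M (\<lambda>x. D x * S p x)"
  proof (rule integrable_bounded_dsq[where C="(2/3) / r1 ^ 3 * r2\<^sup>2"])
    show "(\<lambda>x. D x * S p x) \<in> borel_measurable M" unfolding D_def S_def by measurable
    fix x
    have D0: "0 \<le> D x" unfolding D_def using kB_mono[OF _ r] by simp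
    have "D x * S p x \<le> (2/3) / r1 ^ 3 * r2\<^sup>2 * (norm (d x))\<^sup>2"
    proof (cases "(norm (Y x - p))\<^sup>2 \<ge> r2\<^sup>2")
      case True
      then have "D x = 0" using out unfolding D_def e'_def by fastforce
      then show ?thesis using r by simp
    next
      case False
      have "D x \<le> (2/3) / r1 ^ 3"
      proof -
        have "kB ((norm (Y x - p))\<^sup>2 / r1\<^sup>2) / r1 ^ 3 \<le> (2/3) / r1 ^ 3" 
          using kB_bounds r by (intro divide_right_mono) auto
        moreover have "0 \<le> kB ((norm (Y x - p))\<^sup>2 / r2\<^sup>2) / r2 ^ 3" using kB_bounds r2 by simp
        ultimately show ?thesis unfolding D_def by linarith
      qed
      moreover have "S p x \<le> r2\<^sup>2 * (norm (d x))\<^sup>2"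
        using False unfolding S_def by (smt (verit) mult_right_mono zero_le_power2)
      ultimately have "D x * S p x \<le> (2/3) / r1 ^ 3 * (r2\<^sup>2 * (norm (d x))\<^sup>2)"
        using S_nonneg D0 r by (intro mult_mono) auto
      then show ?thesis by (simp add: mult_ac)
    qed
    then show "\<bar>D x * S p x\<bar> \<le> (2/3) / r1 ^ 3 * r2\<^sup>2 * (norm (d x))\<^sup>2"
      using D0 S_nonneg by simp
  qed
  show "integrable M (\<lambda>x. D x * S p x)" by fact
  have "(LINT x|M. X' (Y x) (d x) \<bullet> d x) = I r1 p - I r2 p + 2 * (LINT x|M. D x * S p x)"
    unfolding key using Dint integrable_kphi by (simp add: I_def)
  then show "I r2 p - I r1 p = 2 * (LINT x|M. D x * S p x)" using int0 by simp
qed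

lemma monotonicity:
  assumes r: "0 < r1" "r1 \<le> r2" and "cball p r2 \<subseteq> W"
  shows "I r1 p \<le> I r2 p"
proof -
  have "0 \<le> (LINT x|M. (kB ((norm (Y x - p))\<^sup>2 / r1\<^sup>2) / r1 ^ 3 - kB ((norm (Y x - p))\<^sup>2 / r2\<^sup>2) / r2 ^ 3) * S p x)"
    using kB_mono[OF _ r] S_nonneg by (intro integral_nonneg_AE AE_I2) simp
  then show ?thesis using monotonicity_identity(2)[OF assms] by simp
qed

text \<open>At distance R from p inside the annulus, the weight in the identity is at least 1 / (6
  R^3) by \<open>kB_gap\<close>, so mass at a definite angle to the radius forces the density ratio
  to grow. The 3 is this 6 divided by the factor 2 of the identity.\<close>

lemma monotonicity_gap:
  assumes r: "0 < r1" "r1 \<le> r2" and "cball p r2 \<subseteq> W"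
    and [measurable]: "A \<in> sets M" and A: "\<And>x. x \<in> A \<Longrightarrow> r1 \<le> norm (Y x - p) \<and> 2 * norm (Y x - p) \<le> r2"
    and c: "0 \<le> c" "\<And>x. x \<in> A \<Longrightarrow> c * (norm (d x))\<^sup>2 \<le> S p x / (norm (Y x - p)) ^ 3"
  shows "c * (LINT x|M. indicator A x * (norm (d x))\<^sup>2) \<le> 3 * (I r2 p - I r1 p)"
proof -
  let ?D = "\<lambda>x. kB ((norm (Y x - p))\<^sup>2 / r1\<^sup>2) / r1 ^ 3 - kB ((norm (Y x - p))\<^sup>2 / r2\<^sup>2) / r2 ^ 3"
  have "(LINT x|M. c / 6 * (indicator A x * (norm (d x))\<^sup>2)) \<le> (LINT x|M. ?D x * S p x)"
  proof (rule integral_mono)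
    have "integrable M (\<lambda>x. indicator A x * (norm (d x))\<^sup>2)"
      by (rule integrable_bounded_dsq[where C=1], measurable) (simp add: indicator_def)
    then show "integrable M (\<lambda>x. c / 6 * (indicator A x * (norm (d x))\<^sup>2))" by simp
    show "integrable M (\<lambda>x. ?D x * S p x)" by (rule monotonicity_identity(1)[OF r assms(3)])
    fix x
    have D0: "0 \<le> ?D x" using kB_mono[OF _ r] by simp
    show "c / 6 * (indicator A x * (norm (d x))\<^sup>2) \<le> ?D x * S p x"
    proof (cases "x \<in> A")
      case True
      have "1 / (6 * (norm (Y x - p)) ^ 3) \<le> ?D x" using A[OF True] r by (intro kB_gap) auto
      then have "1 / (6 * (norm (Y x - p)) ^ 3) * S p x \<le> ?D x * S p x" by (rule mult_right_mono[OF _ S_nonneg])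
      moreover have "1 / (6 * (norm (Y x - p)) ^ 3) * S p x = (S p x / (norm (Y x - p)) ^ 3) / 6" by simp
      moreover have "c / 6 * (norm (d x))\<^sup>2 \<le> (S p x / (norm (Y x - p)) ^ 3) / 6" using c(2)[OF True] by simp
      ultimately have "c / 6 * (norm (d x))\<^sup>2 \<le> ?D x * S p x" by linarith
      then show ?thesis using True by simp
    next
      case False
      then show ?thesis using D0 S_nonneg by simp
    qed
  qed
  then show ?thesis using monotonicity_identity(2)[OF r assms(3)] by simp
qed

section \<open>The weight measure and the mollified density ratio\<close>

definition nu :: "'a measure" where "nu = density M (\<lambda>x. ennreal ((norm (d x))\<^sup>2))"

lemma sets_nu[measurable_cong, simp]: "sets nu = sets M" and space_nu[simp]: "space nu = space M"
  by (auto simp: nu_def)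

lemma finite_nu: "finite_measure nu"
proof
  have "emeasure nu (space nu) = (\<integral>\<^sup>+ x. ennreal ((norm (d x))\<^sup>2) \<partial>M)"
    unfolding nu_def by (subst emeasure_density) (auto intro!: nn_integral_cong)
  also have "\<dots> = ennreal (LINT x|M. (norm (d x))\<^sup>2)" by (rule nn_integral_eq_integral[OF dsq]) auto
  finally show "emeasure nu (space nu) \<noteq> \<infinity>" by simp
qed

lemma measure_nu: 
  assumes [measurable]: "A \<in> sets M"
  shows "measure nu A = (LINT x|M. indicator A x * (norm (d x))\<^sup>2)"
proof -
  have "measure nu A = (LINT x|nu. indicator A x)"
    using sets.sets_into_space[OF assms] by (simp add: Int_absorb2)
  also have "\<dots> = (LINT x|M. (norm (d x))\<^sup>2 *\<^sub>R indicator A x)"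
    unfolding nu_def by (rule integral_density) auto
  finally show ?thesis by (simp add: mult.commute)
qed

definition Yball :: "'b \<Rightarrow> real \<Rightarrow> 'a set" where "Yball p r = {x\<in>space M. dist p (Y x) < r}"

lemma Yball_sets[measurable]: "Yball p r \<in> sets M" unfolding Yball_def by measurable

lemma I_le_nu: 
  assumes "0 < r"
  shows "I r p \<le> measure nu (Yball p r) / r"
proof -
  have "(LINT x|M. kphi ((norm (Y x - p))\<^sup>2 / r\<^sup>2) * (norm (d x))\<^sup>2) \<le> (LINT x|M. indicator (Yball p r) x * (norm (d x))\<^sup>2)"
  proof (rule integral_mono[OF integrable_kphi])
    show "integrable M (\<lambda>x. indicator (Yball p r) x * (norm (d x))\<^sup>2)"
      by (rule integrable_bounded_dsq[where C=1], measurable) (simp add: indicator_def)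
    fix x assume x: "x \<in> space M"
    show "kphi ((norm (Y x - p))\<^sup>2 / r\<^sup>2) * (norm (d x))\<^sup>2 \<le> indicator (Yball p r) x * (norm (d x))\<^sup>2"
    proof (cases "x \<in> Yball p r")
      case True then show ?thesis using kphi_bounds[of "(norm (Y x - p))\<^sup>2 / r\<^sup>2"] by (simp add: mult_left_le_one_le)
    next
      case False
      then have "r \<le> norm (Y x - p)" using x by (auto simp: Yball_def dist_norm norm_minus_commute)
      then have "1 \<le> (norm (Y x - p))\<^sup>2 / r\<^sup>2" using assms by (simp add: power_mono)
      then show ?thesis using False by (cases "(norm (Y x - p))\<^sup>2 / r\<^sup>2 = 1") (auto simp: kphi_def)
    qed
  qed
  then show ?thesis unfolding I_def measure_nu[OF Yball_sets] using assms by (intro divide_right_mono) auto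
qed

text \<open>On the ball of half the radius the argument of \<open>kphi\<close> is at most 1/4, hence
  \<open>kphi\<close> is at least 9/16 > 1/2. The constant is this 2 times the radius 2 r by which
  \<open>I\<close> divides.\<close>

lemma nu_le_I: 
  assumes "0 < r"
  shows "measure nu (Yball p r) \<le> 4 * r * I (2 * r) p"
proof -
  have "(LINT x|M. indicator (Yball p r) x * (norm (d x))\<^sup>2) \<le> (LINT x|M. 2 * (kphi ((norm (Y x - p))\<^sup>2 / (2*r)\<^sup>2) * (norm (d x))\<^sup>2))"
  proof (rule integral_mono)
    show "integrable M (\<lambda>x. indicator (Yball p r) x * (norm (d x))\<^sup>2)"
      by (rule integrable_bounded_dsq[where C=1], measurable) (simp add: indicator_def)
    show "integrable M (\<lambda>x. 2 * (kphi ((norm (Y x - p))\<^sup>2 / (2*r)\<^sup>2) * (norm (d x))\<^sup>2))"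
      by (intro integrable_mult_right integrable_kphi)
    fix x
    show "indicator (Yball p r) x * (norm (d x))\<^sup>2 \<le> 2 * (kphi ((norm (Y x - p))\<^sup>2 / (2*r)\<^sup>2) * (norm (d x))\<^sup>2)"
    proof (cases "x \<in> Yball p r")
      case True
      then have "norm (Y x - p) \<le> r" by (auto simp: Yball_def dist_norm norm_minus_commute)
      then have "(norm (Y x - p))\<^sup>2 \<le> r\<^sup>2" by (intro power_mono) auto
      then have s: "(norm (Y x - p))\<^sup>2 / (2*r)\<^sup>2 \<le> 1/4" using assms by (simp add: field_simps power_mult_distrib)
      define s where "s = (norm (Y x - p))\<^sup>2 / (2*r)\<^sup>2"
      have "s \<le> 1/4" using s s_def by simp
      then have "(3/4)\<^sup>2 \<le> (1-s)\<^sup>2" by (intro power_mono) auto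
      then have "1 \<le> 2 * kphi s" using \<open>s \<le> 1/4\<close> by (simp add: kphi_def power2_eq_square)
      then have "1 * (norm (d x))\<^sup>2 \<le> (2 * kphi s) * (norm (d x))\<^sup>2" by (rule mult_right_mono) simp
      then show ?thesis using True by (simp add: s_def)
    next
      case False then show ?thesis using kphi_bounds[of "(norm (Y x - p))\<^sup>2 / (2*r)\<^sup>2"] by simp
    qed
  qed
  then show ?thesis unfolding I_def measure_nu[OF Yball_sets] using assms by (simp add: field_simps)
qed

end

lemma (in finite_measure) AE_pos_obtain:
  assumes "AE x in M. P x" "0 < measure M {x\<in>space M. Q x}"
  shows "\<exists>x\<in>space M. Q x \<and> P x"
proof (rule ccontr)
  assume *: "\<not> ?thesis"
  have "AE x in M. \<not> Q x"
    using assms(1) AE_space by eventually_elim (use * in auto)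
  then have "emeasure M {x\<in>space M. Q x} = 0" by (rule emeasure_eq_0_AE)
  then show False using assms(2) by (simp add: measure_def)
qed

section \<open>Upper and lower density bounds\<close>

context lattice_stationary
begin

text \<open>The value makes 4 * theta * C0 = 1/2, so that the covering estimate for a bad set
  returns at most half of its own mass.\<close>

definition theta :: real where "theta = 1 / (8 * C0)"

lemma theta_pos: "0 < theta" using C0 by (simp add: theta_def)

lemma I_measurable[measurable]: "(\<lambda>x. I r (Y x)) \<in> borel_measurable M"
  unfolding I_def by measurable

text \<open>Bad points have a density ratio too small for their weight. By monotonicity, small balls
  centred at them have mass at most 4 theta k times their radius, and the radii add up to at most C0
  times the integral of \<open>norm d\<close> over the bad set, up to \<eta>. As k times
  \<open>norm d\<close> is at most the squared norm there, the bad set has at most half of its own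
  mass plus a multiple of \<eta>, hence none.\<close>

lemma density_bad_null:
  fixes k :: nat
  assumes R: "0 < R" "\<And>y. y \<in> ball p0 R0 \<Longrightarrow> cball y R \<subseteq> W" and k: "1 \<le> k"
  shows "AE x in M. \<not> (Y x \<in> ball p0 R0 \<and> k \<le> norm (d x) \<and> I R (Y x) < theta * k)"
proof -
  define A where "A = {x\<in>space M. dist p0 (Y x) < R0 \<and> k \<le> norm (d x) \<and> I R (Y x) < theta * k}"
  have A[measurable]: "A \<in> sets M" unfolding A_def by measurable
  interpret nu: finite_measure nu by (rule finite_nu)
  define J where "J = (LINT x|M. indicator A x * norm (d x))"
  have intd: "integrable M (\<lambda>x. indicator A x * norm (d x))"
  proof (rule integrable_bounded_dsq[where C=1])
    fix x
    have "norm (d x) \<le> (norm (d x))\<^sup>2" if "x \<in> A" 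
    proof -
      have "1 \<le> norm (d x)" using that k unfolding A_def by auto
      then show ?thesis using mult_left_mono[of 1 "norm (d x)" "norm (d x)"] by (simp add: power2_eq_square)
    qed
    then show "\<bar>indicator A x * norm (d x)\<bar> \<le> 1 * (norm (d x))\<^sup>2" by (auto simp: indicator_def)
  qed measurable
  have int2: "integrable M (\<lambda>x. indicator A x * (norm (d x))\<^sup>2)"
    by (rule integrable_bounded_dsq[where C=1], measurable) (simp add: indicator_def)
  have kJ: "k * J \<le> measure nu A"
  proof -
    have "(LINT x|M. k * (indicator A x * norm (d x))) \<le> (LINT x|M. indicator A x * (norm (d x))\<^sup>2)"
      by (rule integral_mono) (use intd int2 in \<open>auto simp: indicator_def A_def power2_eq_square intro: mult_right_mono\<close>)
    then show ?thesis unfolding J_def measure_nu[OF A] by simp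
  qed
  have bound: "measure nu A \<le> 8 * theta * k * \<eta>" if \<eta>: "0 < \<eta>" "\<eta> < R / 2" for \<eta>
  proof (cases "A = {}")
    case True then show ?thesis using \<eta> theta_pos by simp
  next
    case False
    from cover[OF A False \<eta>(1)] obtain a \<rho> where a: "\<And>i::nat. a i \<in> Y ` A" and \<rho>: "\<And>i. 0 < \<rho> i" "\<And>i. \<rho> i < \<eta>"
      and cov: "Y ` A \<subseteq> (\<Union>i. ball (a i) (\<rho> i))" and sm: "summable \<rho>" "suminf \<rho> \<le> C0 * J + \<eta>"
      unfolding J_def by blast
    have b: "measure nu (Yball (a i) (\<rho> i)) \<le> 4 * theta * k * \<rho> i" for i
    proof -
      obtain x where x: "x \<in> A" "a i = Y x" using a by blast
      then have W: "cball (a i) R \<subseteq> W" using R(2) by (auto simp: A_def)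
      have "measure nu (Yball (a i) (\<rho> i)) \<le> 4 * \<rho> i * I (2 * \<rho> i) (a i)" by (rule nu_le_I[OF \<rho>(1)])
      also have "I (2 * \<rho> i) (a i) \<le> I R (a i)" using \<rho>(1)[of i] \<rho>(2)[of i] \<eta> by (intro monotonicity W) auto
      then have "4 * \<rho> i * I (2 * \<rho> i) (a i) \<le> 4 * \<rho> i * I R (a i)" using \<rho>(1)[of i] by simp
      also have "\<dots> \<le> 4 * \<rho> i * (theta * k)" using x \<rho>(1)[of i] by (intro mult_left_mono) (auto simp: A_def)
      finally show ?thesis by (simp add: mult_ac)
    qed
    have sb: "summable (\<lambda>i. 4 * theta * k * \<rho> i)" using sm(1) by (rule summable_mult)
    have s: "summable (\<lambda>i. measure nu (Yball (a i) (\<rho> i)))"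
      by (rule summable_comparison_test'[OF sb, of 0]) (use b in auto)
    have "A \<subseteq> (\<Union>i. Yball (a i) (\<rho> i))" using cov sets.sets_into_space[OF A] unfolding Yball_def ball_def by fastforce
    then have "measure nu A \<le> measure nu (\<Union>i. Yball (a i) (\<rho> i))"
      by (rule nu.finite_measure_mono) auto
    also have "\<dots> \<le> (\<Sum>i. measure nu (Yball (a i) (\<rho> i)))"
      by (rule nu.finite_measure_subadditive_countably) (use s in auto)
    also have "\<dots> \<le> (\<Sum>i. 4 * theta * k * \<rho> i)" by (rule suminf_le[OF b s sb])
    also have "\<dots> = 4 * theta * k * suminf \<rho>" using sm(1) by (rule suminf_mult)
    also have "\<dots> \<le> 4 * theta * k * (C0 * J + \<eta>)" using sm(2) theta_pos by (intro mult_left_mono) auto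
    also have "\<dots> = k * J / 2 + 4 * theta * k * \<eta>" using C0 by (simp add: theta_def field_simps)
    finally show ?thesis using kJ by simp
  qed
  have "measure nu A \<le> 0"
  proof (rule field_le_epsilon)
    fix e :: real assume e: "0 < e"
    define \<eta> where "\<eta> = min (R / 4) (e / (8 * theta * k))"
    have "0 < \<eta>" "\<eta> < R/2" using e R theta_pos k by (auto simp: \<eta>_def)
    from bound[OF this] have "measure nu A \<le> 8 * theta * k * \<eta>" .
    also have "\<dots> \<le> 8 * theta * k * (e / (8 * theta * k))" using theta_pos by (intro mult_left_mono) (auto simp: \<eta>_def)
    also have "\<dots> = e" using theta_pos k by simp
    finally show "measure nu A \<le> 0 + e" by simp
  qed
  moreover have "measure M A \<le> measure nu A"
  proof -
    have "(LINT x|M. indicator A x) \<le> (LINT x|M. indicator A x * (norm (d x))\<^sup>2)"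
    proof (rule integral_mono[OF _ int2])
      fix x
      have "1 \<le> (norm (d x))\<^sup>2" if "x \<in> A" using that k unfolding A_def by (auto simp: one_le_power)
      then show "indicator A x \<le> indicator A x * (norm (d x))\<^sup>2" by (auto simp: indicator_def)
      show "integrable M (indicat_real A)"
        by (rule integrable_real_indicator[OF A]) (simp add: emeasure_eq_measure)
    qed
    then show ?thesis unfolding measure_nu[OF A] by simp
  qed
  ultimately have "measure M A = 0" by (simp add: antisym)
  then have "emeasure M A = 0" by (simp add: emeasure_eq_measure)
  then have "AE x in M. x \<notin> A" by (intro AE_not_in) auto
  then show ?thesis using AE_space by eventually_elim (auto simp: A_def)
qed

text \<open>The bad sets are null for all integers k at once, and the floor of
  \<open>norm (d x)\<close> is the k that fits x. Since the norm is at least 1, its floor is at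
  least half of it, which accounts for the division by 2.\<close>

lemma density_bound:
  assumes "0 < R" "\<And>y. y \<in> ball p0 R0 \<Longrightarrow> cball y R \<subseteq> W"
  shows "AE x in M. Y x \<in> ball p0 R0 \<longrightarrow> 1 \<le> norm (d x) \<and> theta * norm (d x) / 2 \<le> I R (Y x) \<and> theta \<le> I R (Y x)"
proof -
  have "AE x in M. \<forall>k::nat. 1 \<le> k \<longrightarrow> \<not> (Y x \<in> ball p0 R0 \<and> k \<le> norm (d x) \<and> I R (Y x) < theta * k)"
    unfolding AE_all_countable using density_bad_null[OF assms] by (intro allI) (simp add: AE_conj_iff)
  then show ?thesis using d_AE
  proof eventually_elim
    case (elim x)
    show ?case
    proof (intro impI)
      assume x: "Y x \<in> ball p0 R0"
      define k where "k = nat \<lfloor>norm (d x)\<rfloor>"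
      have k: "1 \<le> k" "real k \<le> norm (d x)" "norm (d x) < real k + 1"
        using elim(2) unfolding k_def by (auto simp: le_nat_iff le_floor_iff)
      have "theta * k \<le> I R (Y x)" using elim(1) x k by force
      moreover have "theta * norm (d x) / 2 \<le> theta * k" using k theta_pos by (simp add: field_simps)
      moreover have "theta * 1 \<le> theta * k" using k theta_pos by (intro mult_left_mono) auto
      ultimately show "1 \<le> norm (d x) \<and> theta * norm (d x) / 2 \<le> I R (Y x) \<and> theta \<le> I R (Y x)" using elim(2) by simp
    qed
  qed
qed

text \<open>The density bound read in the other direction: the ratio at scale R is at most the total
  mass over R, and it dominates theta/2 times the weight.\<close>

lemma d_bounded:
  assumes "0 < R" "\<And>y. y \<in> ball p0 R0 \<Longrightarrow> cball y R \<subseteq> W"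
  shows "\<exists>L. AE x in M. Y x \<in> ball p0 R0 \<longrightarrow> norm (d x) \<le> L"
proof -
  interpret nu: finite_measure nu by (rule finite_nu)
  have "I R y \<le> measure nu (space nu) / R" for y
    using I_le_nu[OF assms(1), of y] nu.bounded_measure[of "Yball y R"] assms(1)
    by (meson divide_right_mono less_imp_le order_trans)
  moreover have "AE x in M. Y x \<in> ball p0 R0 \<longrightarrow> theta * norm (d x) / 2 \<le> I R (Y x)"
  proof -
    have "AE x in M. Y x \<in> ball p0 R0 \<longrightarrow> 1 \<le> norm (d x) \<and> theta * norm (d x) / 2 \<le> I R (Y x) \<and> theta \<le> I R (Y x)"
      by (rule density_bound[OF assms]) auto
    then show ?thesis by eventually_elim blast
  qed
  ultimately have "AE x in M. Y x \<in> ball p0 R0 \<longrightarrow> theta * norm (d x) / 2 \<le> measure nu (space nu) / R"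
    by (elim AE_mp, intro AE_I2) (meson order_trans)
  then have "AE x in M. Y x \<in> ball p0 R0 \<longrightarrow> norm (d x) \<le> measure nu (space nu) / R * (2 / theta)"
  proof eventually_elim
    case (elim x)
    show ?case
    proof
      assume "Y x \<in> ball p0 R0"
      then have "theta * norm (d x) / 2 * (2 / theta) \<le> measure nu (space nu) / R * (2 / theta)"
        using elim theta_pos by (intro mult_right_mono) auto
      then show "norm (d x) \<le> measure nu (space nu) / R * (2 / theta)" using theta_pos by simp
    qed
  qed
  then show ?thesis by blast
qed

text \<open>\<open>density_bound\<close> holds only almost everywhere. Every ball about q has
  positive mass, so a good point x' lies as near to q as desired; its ball of radius r is contained
  in the ball of radius 2 r about q.\<close>

lemma lower_density:
  assumes R: "0 < R" "\<And>y. y \<in> ball p0 R0 \<Longrightarrow> cball y R \<subseteq> W"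
    and q: "q \<in> Y ` space M" "q \<in> ball p0 R0" and r: "0 < r" "r \<le> R"
  shows "theta * r \<le> measure nu (Yball q (2 * r))"
proof -
  interpret nu: finite_measure nu by (rule finite_nu)
  have cr: "cball y r \<subseteq> W" if "y \<in> ball p0 R0" for y
    using R(2)[OF that] subset_cball[OF r(2)] by blast
  obtain x where x: "x \<in> space M" "q = Y x" using q by blast
  define s where "s = min r (R0 - dist p0 q)"
  have "0 < s" using q r by (auto simp: s_def)
  from AE_pos_obtain[OF density_bound[OF r(1) cr] mass_pos[OF x(1) this]]
  obtain x' where x': "x' \<in> space M" "dist (Y x') (Y x) < s" "Y x' \<in> ball p0 R0 \<longrightarrow> theta \<le> I r (Y x')"
    by blast
  have "dist p0 (Y x') \<le> dist p0 q + dist (Y x') q" by (metis dist_commute dist_triangle)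
  then have "theta \<le> I r (Y x')" using x' x by (simp add: s_def)
  also have "\<dots> \<le> measure nu (Yball (Y x') r) / r" by (rule I_le_nu[OF r(1)])
  finally have "theta * r \<le> measure nu (Yball (Y x') r)" using r by (simp add: field_simps)
  also have "\<dots> \<le> measure nu (Yball q (2 * r))"
  proof (rule nu.finite_measure_mono)
    have "dist q (Y z) < 2 * r" if "dist (Y x') (Y z) < r" for z
      using that x' x dist_triangle[of q "Y z" "Y x'"] by (simp add: s_def dist_commute)
    then show "Yball (Y x') r \<subseteq> Yball q (2 * r)" by (auto simp: Yball_def)
  qed auto
  finally show ?thesis .
qed

section \<open>Confinement of the support to thin cones\<close>

definition Dirs :: "real \<Rightarrow> 'b set" where
  "Dirs L = (\<lambda>v. v /\<^sub>R norm v) ` (\<Lambda> \<inter> cball 0 L - {0}) \<union> (\<lambda>v. - v /\<^sub>R norm v) ` (\<Lambda> \<inter> cball 0 L - {0})"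

lemma finite_Dirs: "finite (Dirs L)" using \<Lambda>_finite unfolding Dirs_def by auto

lemma norm_Dirs: "e \<in> Dirs L \<Longrightarrow> norm e = 1" by (auto simp: Dirs_def divide_simps split: if_splits)

lemma I_nonneg: "0 < r \<Longrightarrow> 0 \<le> I r p"
  unfolding I_def by (intro divide_nonneg_nonneg integral_nonneg_AE AE_I2 mult_nonneg_nonneg) (auto simp: kphi_bounds)

text \<open>The density ratio is bounded below, so it has an infimum over the radii; a radius t
  whose value is within \<epsilon> of that infimum works.\<close>

lemma I_small_gap:
  assumes "cball p R \<subseteq> W" "0 < R" "0 < \<epsilon>"
  shows "\<exists>t. 0 < t \<and> t \<le> R \<and> (\<forall>r. 0 < r \<and> r \<le> t \<longrightarrow> I t p - I r p < \<epsilon>)"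
proof -
  let ?S = "(\<lambda>r. I r p) ` {0<..R}"
  have bdd: "bdd_below ?S" by (intro bdd_belowI[of _ 0]) (auto intro: I_nonneg)
  have "?S \<noteq> {}" using assms by auto
  then obtain t where t: "0 < t" "t \<le> R" "I t p < Inf ?S + \<epsilon>"
    using cInf_lessD[of ?S "Inf ?S + \<epsilon>"] assms by auto
  have "Inf ?S \<le> I r p" if "0 < r" "r \<le> t" for r using that t by (intro cInf_lower bdd) auto
  then show ?thesis using t by (intro exI[of _ t]) (auto, smt (verit))
qed

text \<open>A point q of the support outside all cones has around it a ball whose mass is
  proportional to its radius, by \<open>lower_density\<close>. All admissible weights in that ball
  make a definite angle with the radius from p, so \<open>monotonicity_gap\<close> forces the
  density ratio to grow between half the distance of q and t by more than such a small scale
  allows.\<close>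

lemma thin_cones:
  assumes R: "0 < R" "0 < R0" "\<And>y. y \<in> ball p R0 \<Longrightarrow> cball y R \<subseteq> W"
    and L: "AE x in M. Y x \<in> ball p R0 \<longrightarrow> norm (d x) \<le> L"
    and \<kappa>: "0 < \<kappa>" "\<kappa> \<le> 1"
  shows "\<exists>r>0. \<forall>q\<in>Y ` space M. q \<noteq> p \<and> dist p q < r \<longrightarrow> (\<exists>e\<in>Dirs L. (1 - \<kappa>) * norm (q - p) < (q - p) \<bullet> e)"
proof -
  have pW: "cball p R \<subseteq> W" using R by simp
  \<comment> \<open>With z = q - p and \<rho> = \<kappa> |z| / 4, the ball has mass at least theta
    \<rho> / 2 and the angle constant is \<kappa> / (4 |z|). Their product is theta \<kappa>^2 / 32,
    and the factor 3 of \<open>monotonicity_gap\<close> makes it theta \<kappa>^2 / 96.\<close>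
  have "0 < theta * \<kappa>\<^sup>2 / 96" using theta_pos \<kappa> by simp
  from I_small_gap[OF pW R(1) this] obtain t where t: "0 < t" "t \<le> R" 
    and gap: "\<And>r. 0 < r \<Longrightarrow> r \<le> t \<Longrightarrow> I t p - I r p < theta * \<kappa>\<^sup>2 / 96" by blast
  define r where "r = min (t / 3) (R0 / 3)"
  show ?thesis
  proof (intro exI[of _ r] conjI ballI impI)
    show "0 < r" using t R by (simp add: r_def)
    fix q assume q: "q \<in> Y ` space M" "q \<noteq> p \<and> dist p q < r"
    define z where "z = q - p"
    have z: "0 < norm z" "norm z < t / 3" "norm z < R0 / 3"
      using q by (auto simp: z_def r_def dist_norm norm_minus_commute)
    show "\<exists>e\<in>Dirs L. (1 - \<kappa>) * norm (q - p) < (q - p) \<bullet> e"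
    proof (rule ccontr)
      assume neg: "\<not> ?thesis"
      define \<rho> where "\<rho> = \<kappa> * norm z / 4"
      have \<rho>: "0 < \<rho>" "\<rho> \<le> norm z / 4" using \<kappa> z by (auto simp: \<rho>_def mult_left_le_one_le)
      have fin: "finite (\<Lambda> \<inter> cball 0 L - {0})" using \<Lambda>_finite by auto
      \<comment> \<open>Only weights from the finite list enter, so that the angle estimate holds at
        every point of A. Up to a null set, A is the preimage of the ball of radius \<rho> about
        q.\<close>
      define A where "A = {x\<in>space M. dist q (Y x) < \<rho> \<and> d x \<in> \<Lambda> \<inter> cball 0 L - {0}}"
      have A[measurable]: "A \<in> sets M" 
      proof -
        have [measurable]: "\<Lambda> \<inter> cball 0 L - {0} \<in> sets borel" using fin by (intro borel_closed finite_imp_closed)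
        show ?thesis unfolding A_def by measurable
      qed
      have AE_A: "AE x in M. x \<in> A \<longleftrightarrow> x \<in> Yball q \<rho>"
        using L d_AE AE_space
      proof eventually_elim
        case (elim x)
        have "Y x \<in> ball p R0" if "dist q (Y x) < \<rho>"
        proof -
          have "dist p (Y x) \<le> norm z + dist q (Y x)" 
            using dist_triangle[of p "Y x" q] by (simp add: z_def dist_norm norm_minus_commute)
          then show ?thesis using that \<rho> z by simp
        qed
        then show ?case using elim by (auto simp: A_def Yball_def)
      qed
      have "measure nu A = measure nu (Yball q \<rho>)"
        unfolding measure_nu[OF A] measure_nu[OF Yball_sets]
        by (rule integral_cong_AE; (measurable)?) (use AE_A in \<open>eventually_elim, auto simp: indicator_def\<close>)
      moreover have "theta * (\<rho> / 2) \<le> measure nu (Yball q (2 * (\<rho> / 2)))"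
        by (rule lower_density[OF R(1,3) q(1)]) (use \<rho> z t R in \<open>auto simp: z_def dist_norm norm_minus_commute\<close>)
      ultimately have nuA: "theta * \<rho> / 2 \<le> measure nu A" by simp
      have y: "3/4 * norm z \<le> norm (Y x - p) \<and> norm (Y x - p) \<le> 5/4 * norm z \<and> norm ((Y x - p) - z) \<le> \<rho>" if "x \<in> A" for x
      proof -
        have 1: "norm ((Y x - p) - z) \<le> \<rho>" using that by (auto simp: A_def z_def dist_norm norm_minus_commute)
        have "norm (Y x - p) \<le> norm z + norm ((Y x - p) - z)" by (metis norm_triangle_sub)
        moreover have "norm z \<le> norm (Y x - p) + norm ((Y x - p) - z)" by (metis norm_triangle_sub norm_minus_commute)
        ultimately show ?thesis using 1 \<rho> by auto
      qed
      have Sb: "(\<kappa> / 4 / norm z) * (norm (d x))\<^sup>2 \<le> S p x / (norm (Y x - p)) ^ 3" if x: "x \<in> A" for x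
      proof -
        define w where "w = Y x - p"
        have w: "3/4 * norm z \<le> norm w" "norm w \<le> 5/4 * norm z" "norm (w - z) \<le> \<rho>" using y[OF x] by (auto simp: w_def)
        have w0: "0 < norm w" using w z by linarith
        \<comment> \<open>A point within \<rho> of one outside the cones of parameter \<kappa> is
          still outside the narrower cones of parameter \<kappa>/2; the room left in the estimate is
          \<kappa>^2 |z| / 8.\<close>
        have half: "w \<bullet> e \<le> (1 - \<kappa>/2) * norm w" if "e \<in> Dirs L" for e
        proof -
          have "z \<bullet> e \<le> (1 - \<kappa>) * norm z" using neg that by (auto simp: z_def not_less)
          moreover have "(w - z) \<bullet> e \<le> norm (w - z) * norm e" by (rule norm_cauchy_schwarz)
          ultimately have 1: "w \<bullet> e \<le> (1 - \<kappa>) * norm z + \<kappa> * norm z / 4"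
            using w(3) norm_Dirs[OF that] by (simp add: \<rho>_def inner_diff_left)
          have "norm z - \<kappa> * norm z / 4 \<le> norm w" using w(3) norm_triangle_sub[of z w] by (simp add: \<rho>_def norm_minus_commute)
          then have "(1 - \<kappa>/2) * (norm z - \<kappa> * norm z / 4) \<le> (1 - \<kappa>/2) * norm w" using \<kappa> by (intro mult_left_mono) auto
          moreover have "(1 - \<kappa>) * norm z + \<kappa> * norm z / 4 \<le> (1 - \<kappa>/2) * (norm z - \<kappa> * norm z / 4)"
          proof -
            have "(1 - \<kappa>/2) * (norm z - \<kappa> * norm z / 4) - ((1 - \<kappa>) * norm z + \<kappa> * norm z / 4) = \<kappa>\<^sup>2 * norm z / 8"
              by (simp add: field_simps power2_eq_square)
            moreover have "0 \<le> \<kappa>\<^sup>2 * norm z / 8" by simp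
            ultimately show ?thesis by linarith
          qed
          ultimately show ?thesis using 1 by linarith
        qed
        define e where "e = d x /\<^sub>R norm (d x)"
        have dx: "d x \<in> \<Lambda> \<inter> cball 0 L - {0}" using x by (simp add: A_def)
        \<comment> \<open>\<open>Dirs\<close> lists both signs of each weight because the support
          may leave p along d or against it. Here the two signs bound the absolute value of the
          inner product.\<close>
        have "e \<in> Dirs L" "- e \<in> Dirs L" using dx unfolding e_def Dirs_def by auto
        from half[OF this(1)] half[OF this(2)] have "\<bar>w \<bullet> e\<bar> \<le> (1 - \<kappa>/2) * norm w" by auto
        then have "(w \<bullet> e)\<^sup>2 \<le> ((1 - \<kappa>/2) * norm w)\<^sup>2" by (metis abs_ge_zero power2_abs power_mono)
        also have "\<dots> = (1 - \<kappa>/2)\<^sup>2 * (norm w)\<^sup>2" by (simp add: power_mult_distrib)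
        also have "(1 - \<kappa>/2)\<^sup>2 \<le> 1 - \<kappa>/2" using \<kappa> by (simp add: power2_eq_square mult_left_le_one_le)
        finally have 1: "(w \<bullet> e)\<^sup>2 \<le> (1 - \<kappa>/2) * (norm w)\<^sup>2" by (simp add: mult_right_mono)
        have de: "w \<bullet> d x = norm (d x) * (w \<bullet> e)" using dx by (simp add: e_def)
        have "S p x = (norm (d x))\<^sup>2 * ((norm w)\<^sup>2 - (w \<bullet> e)\<^sup>2)"
          unfolding S_def w_def[symmetric] de by (simp add: power_mult_distrib algebra_simps)
        also have "\<dots> \<ge> (norm (d x))\<^sup>2 * (\<kappa>/2 * (norm w)\<^sup>2)"
          using 1 by (intro mult_left_mono) (auto simp: algebra_simps)
        finally have "(norm (d x))\<^sup>2 * (\<kappa>/2 * (norm w)\<^sup>2) / norm w ^ 3 \<le> S p x / norm w ^ 3"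
          by (intro divide_right_mono) auto
        moreover have "(norm (d x))\<^sup>2 * (\<kappa>/2 * (norm w)\<^sup>2) / norm w ^ 3 = (norm (d x))\<^sup>2 * (\<kappa>/2 / norm w)"
          using w0 by (simp add: power2_eq_square power3_eq_cube)
        moreover have "\<kappa> / 4 / norm z \<le> \<kappa>/2 / norm w" 
        proof -
          have "norm w \<le> 2 * norm z" using w z by simp
          then show ?thesis using w0 z \<kappa> by (simp add: field_simps)
        qed
        ultimately show ?thesis unfolding w_def[symmetric]
          by (smt (verit) mult.commute mult_left_mono zero_le_power2)
      qed
      have "\<kappa> / 4 / norm z * measure nu A \<le> 3 * (I t p - I (norm z / 2) p)"
        unfolding measure_nu[OF A]
      proof (rule monotonicity_gap)
        show "cball p t \<subseteq> W" using pW subset_cball[OF t(2)] by blast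
        show "0 < norm z / 2" "norm z / 2 \<le> t" using z by linarith+
        show "A \<in> sets M" by fact
        show "norm z / 2 \<le> norm (Y x - p) \<and> 2 * norm (Y x - p) \<le> t" if "x \<in> A" for x using y[OF that] z by simp
        show "0 \<le> \<kappa> / 4 / norm z" using \<kappa> by simp
      qed (rule Sb)
      also have "\<dots> < 3 * (theta * \<kappa>\<^sup>2 / 96)" using gap[of "norm z / 2"] z by simp
      finally have "\<kappa> / 4 / norm z * measure nu A < theta * \<kappa>\<^sup>2 / 32" by simp
      moreover have "\<kappa> / 4 / norm z * (theta * \<rho> / 2) \<le> \<kappa> / 4 / norm z * measure nu A"
        using nuA \<kappa> z by (intro mult_left_mono) auto
      moreover have "\<kappa> / 4 / norm z * (theta * \<rho> / 2) = theta * \<kappa>\<^sup>2 / 32"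
        using z by (simp add: \<rho>_def power2_eq_square)
      ultimately show False by linarith
    qed
  qed
qed

end

section \<open>Stationary measures in a thin sector\<close>

text \<open>An averaged slice at the heights a to b. The primitive of a difference of two bumps is a
  cutoff in the height, and its derivative turns stationarity into a balance of fluxes through the
  two slices.\<close>

definition bump :: "(real \<Rightarrow> real) \<Rightarrow> real \<Rightarrow> real \<Rightarrow> bool" where
  "bump \<phi> a b \<longleftrightarrow> 0 < a \<and> a < b \<and> continuous_on UNIV \<phi> \<and> (\<forall>t. 0 \<le> \<phi> t) \<and> (\<forall>t. t \<notin> {a..b} \<longrightarrow> \<phi> t = 0) \<and>
     (\<phi> has_integral 1) {a..b}"

lemma bump_primitive:
  assumes "bump \<phi> a b"
  obtains F where "\<And>t. (F has_real_derivative \<phi> t) (at t)" "\<And>t. 0 \<le> F t \<and> F t \<le> 1" 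
    "\<And>t. t \<le> a \<Longrightarrow> F t = 0" "\<And>t. b \<le> t \<Longrightarrow> F t = 1"
proof -
  have ab: "0 < a" "a < b" and c: "continuous_on UNIV \<phi>" and nn: "\<And>t. 0 \<le> \<phi> t" 
    and out: "\<And>t. t \<notin> {a..b} \<Longrightarrow> \<phi> t = 0" and one: "(\<phi> has_integral 1) {a..b}"
    using assms by (auto simp: bump_def)
  define F where "F t = integral {0..t} \<phi>" for t
  have int: "\<phi> integrable_on {u..v}" for u v
    by (rule integrable_continuous_interval) (rule continuous_on_subset[OF c], simp)
  have zero: "F t = 0" if "t \<le> a" for t
  proof -
    have "\<phi> s = 0" if "s \<in> {0..t}" for s
    \<comment> \<open>Below a the bump vanishes because it lives on {a..b}; at a itself it vanishes
      by continuity from the left.\<close>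
    proof (cases "s = a")
      case True
      have "(\<phi> \<longlongrightarrow> \<phi> a) (at_left a)" 
        using c by (simp add: continuous_on_eq_continuous_at isCont_def filterlim_at_split)
      moreover have "(\<phi> \<longlongrightarrow> 0) (at_left a)" 
        by (rule tendsto_eventually) (auto simp: eventually_at_left_field intro!: exI[of _ "a - 1"] out)
      ultimately show ?thesis using True tendsto_unique[OF trivial_limit_at_left_real] by blast
    qed (use that \<open>t \<le> a\<close> out in auto)
    then show ?thesis unfolding F_def by (intro integral_unique has_integral_is_0) 
  qed
  have one': "F t = 1" if "b \<le> t" for t
    unfolding F_def by (rule integral_unique, rule has_integral_on_superset[OF one]) (use out that ab in auto)
  have deriv: "(F has_real_derivative \<phi> t) (at t)" for t
  proof (cases "t < a")
    case True
    have "\<forall>\<^sub>F s in nhds t. s \<in> {..<a}" using True by (intro eventually_nhds_in_open) auto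
    then have "\<forall>\<^sub>F s in nhds t. F s = 0" by eventually_elim (use zero in auto)
    then have "(F has_real_derivative 0) (at t)" 
      by (subst DERIV_cong_ev[where g="\<lambda>_. 0" and y=t]) auto
    then show ?thesis using out[of t] True by simp
  next
    case False
    have "((\<lambda>x. integral {0..x} \<phi>) has_real_derivative \<phi> t) (at t within {0..t+1})"
      by (rule integral_has_real_derivative) (use continuous_on_subset[OF c] False ab in auto)
    then show ?thesis unfolding F_def using False ab
      by (subst (asm) at_within_interior) (auto simp: F_def)
  qed
  have mono: "F s \<le> F t" if "s \<le> t" for s t
    by (rule DERIV_nonneg_imp_nondecreasing[OF that]) (use deriv nn in blast)
  have "0 \<le> F t \<and> F t \<le> 1" for t
    using mono[of "min t a" t] mono[of t "max t b"] zero[of "min t a"] one'[of "max t b"] by auto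
  then show thesis using that deriv zero one' by blast
qed

text \<open>A parabola cut off at its zeros; the product (t - a) (b - t) has integral (b - a)^3 / 6
  over the interval, whence the normalisation.\<close>

definition hat :: "real \<Rightarrow> real \<Rightarrow> real \<Rightarrow> real" where
  "hat a b t = max 0 ((t - a) * (b - t)) * 6 / (b - a) ^ 3"

lemma hat_bump:
  assumes "0 < a" "a < b"
  shows "bump (hat a b) a b"
proof -
  have "((\<lambda>t. (t - a) * (b - t)) has_integral
     ((b - a) * (b - a)\<^sup>2 / 2 - (b - a) ^ 3 / 3) - ((b - a) * (a - a)\<^sup>2 / 2 - (a - a) ^ 3 / 3)) {a..b}"
    by (rule fundamental_theorem_of_calculus)
      (use assms in \<open>auto simp flip: has_real_derivative_iff_has_vector_derivative intro!: derivative_eq_intros simp: power2_eq_square field_simps\<close>)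
  from has_integral_divide[OF has_integral_mult_left[OF this, of 6], of "(b - a) ^ 3"]
  have "((\<lambda>t. (t - a) * (b - t) * 6 / (b - a) ^ 3) has_integral 1) {a..b}"
    using assms by (simp add: power2_eq_square power3_eq_cube)
  then have "(hat a b has_integral 1) {a..b}"
    by (rule has_integral_eq[rotated]) (auto simp: hat_def)
  moreover have "continuous_on UNIV (hat a b)" unfolding hat_def[abs_def] by (intro continuous_intros) (use assms in auto)
  moreover have "hat a b t = 0" if "t \<notin> {a..b}" for t
  proof -
    have "(t - a) * (b - t) \<le> 0" using that assms by (auto simp: mult_le_0_iff)
    then show ?thesis by (simp add: hat_def)
  qed
  ultimately show ?thesis using assms by (auto simp: bump_def hat_def)
qed

lemma hat_le: "a < b \<Longrightarrow> hat a b t \<le> 2 / (b - a)"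
proof -
  assume ab: "a < b"
  have "0 \<le> (2 * t - a - b)\<^sup>2" by simp
  then have "(t - a) * (b - t) * 4 \<le> (b - a)\<^sup>2" by (simp add: power2_eq_square algebra_simps)
  then have "max 0 ((t - a) * (b - t)) \<le> (b - a)\<^sup>2 / 4" by (intro max.boundedI) auto
  then have "max 0 ((t - a) * (b - t)) * 6 / (b - a) ^ 3 \<le> (b - a)\<^sup>2 / 4 * 6 / (b - a) ^ 3"
    using ab by (intro divide_right_mono mult_right_mono) auto
  also have "\<dots> = (3/2) / (b - a)" using ab by (simp add: power2_eq_square power3_eq_cube divide_simps) (simp add: algebra_simps)?
  also have "\<dots> \<le> 2 / (b - a)" using ab by (intro divide_right_mono) auto
  finally show ?thesis by (simp add: hat_def)
qed

lemma hat_pos: "a < t \<Longrightarrow> t < b \<Longrightarrow> 0 < hat a b t"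
  by (auto simp: hat_def max_def)

lemma hat_measurable[measurable]: "hat a b \<in> borel_measurable borel"
  unfolding hat_def[abs_def] by measurable

text \<open>The measure in one cone, with the vertex moved to the origin and heights measured along
  e. \<open>thin\<close> says that the cone closes up towards the vertex, \<open>gap\<close> is the
  discreteness of the weights, and \<open>upper\<close> is linear growth of mass. In
  \<open>stat\<close> only the height is cut off: the transversal field X has no support condition,
  since it can be cut off where there is no mass.\<close>

locale sector = finite_measure M
  for M :: "'a measure" +
  fixes Y d :: "'a \<Rightarrow> 'b::euclidean_space" and e :: 'b and r1 L C C0 c0 :: real
  assumes Y[measurable]: "Y \<in> borel_measurable M"
    and d[measurable]: "d \<in> borel_measurable M"
    and e: "norm e = 1"
    and t_range: "\<And>x. x \<in> space M \<Longrightarrow> 0 < Y x \<bullet> e \<and> Y x \<bullet> e < r1"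
    and d_bound: "AE x in M. 1 \<le> norm (d x) \<and> norm (d x) \<le> L"
    and pars: "0 < r1" "1 \<le> L" "0 < C" "0 < C0" "0 < c0"
    and norm_Y: "\<And>x. x \<in> space M \<Longrightarrow> norm (Y x) \<le> L"
    and thin: "\<And>\<epsilon>. 0 < \<epsilon> \<Longrightarrow> \<exists>s>0. \<forall>x\<in>space M. Y x \<bullet> e < s \<longrightarrow> norm (Y x - (Y x \<bullet> e) *\<^sub>R e) \<le> \<epsilon> * (Y x \<bullet> e)"
    and gap: "AE x in M. (norm (d x))\<^sup>2 - (d x \<bullet> e)\<^sup>2 = 0 \<or> c0 \<le> (norm (d x))\<^sup>2 - (d x \<bullet> e)\<^sup>2"
    and upper: "\<And>s. 0 < s \<Longrightarrow> (LINT x|M. indicator {x. Y x \<bullet> e < s} x * (norm (d x))\<^sup>2) \<le> C * s"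
    and cover: "\<And>A \<eta>. A \<in> sets M \<Longrightarrow> A \<noteq> {} \<Longrightarrow> 0 < \<eta> \<Longrightarrow>
      \<exists>a \<rho>. (\<forall>i::nat. 0 < \<rho> i) \<and> Y ` A \<subseteq> (\<Union>i. ball (a i) (\<rho> i)) \<and>
        summable \<rho> \<and> suminf \<rho> \<le> C0 * (LINT x|M. indicator A x * norm (d x)) + \<eta>"
    and stat: "\<And>f f' a b X X'. 0 < a \<Longrightarrow> a < b \<Longrightarrow> b < r1 \<Longrightarrow> (\<And>t. (f has_real_derivative f' t) (at t)) \<Longrightarrow> continuous_on UNIV f' \<Longrightarrow>
      (\<And>t. t \<notin> {a..b} \<Longrightarrow> f t = 0 \<and> f' t = 0) \<Longrightarrow>
      (\<And>y. (X has_derivative X' y) (at y)) \<Longrightarrow> (\<And>h. continuous_on UNIV (\<lambda>y. X' y h)) \<Longrightarrow>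
      (LINT x|M. f' (Y x \<bullet> e) * (d x \<bullet> e) * (X (Y x) \<bullet> d x) + f (Y x \<bullet> e) * (X' (Y x) (d x) \<bullet> d x)) = 0"
begin

abbreviation "t x \<equiv> Y x \<bullet> e"
abbreviation "z x \<equiv> Y x - (Y x \<bullet> e) *\<^sub>R e"
abbreviation "perp x \<equiv> (norm (d x))\<^sup>2 - (d x \<bullet> e)\<^sup>2"

lemma ee: "e \<bullet> e = 1" using e by (simp add: power2_norm_eq_inner[symmetric])

lemma de_le: "\<bar>d x \<bullet> e\<bar> \<le> norm (d x)" using Cauchy_Schwarz_ineq2[of "d x" e] e by simp

lemma perp_nonneg: "0 \<le> perp x"
  using de_le[of x] by (simp add: abs_le_square_iff[symmetric])

lemma z_e: "z x \<bullet> e = 0" by (simp add: inner_diff_left ee)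

lemma norm_z: "x \<in> space M \<Longrightarrow> norm (z x) \<le> 2 * L"
proof -
  assume "x \<in> space M"
  have "norm (z x) \<le> norm (Y x) + norm ((Y x \<bullet> e) *\<^sub>R e)" by (rule norm_triangle_ineq4)
  moreover have "\<bar>Y x \<bullet> e\<bar> \<le> norm (Y x)" using Cauchy_Schwarz_ineq2[of "Y x" e] e by simp
  ultimately show ?thesis using norm_Y[OF \<open>x \<in> space M\<close>] e by simp
qed

lemma perp_zero_inner:
  assumes "perp x = 0"
  shows "z x \<bullet> d x = 0"
proof -
  define w where "w = d x - (d x \<bullet> e) *\<^sub>R e"
  have "w \<bullet> w = perp x"
    unfolding power2_norm_eq_inner by (simp add: w_def inner_diff_left inner_diff_right ee power2_eq_square inner_commute)
  then have "d x = (d x \<bullet> e) *\<^sub>R e" using assms by (simp add: w_def)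
  then have "z x \<bullet> d x = (d x \<bullet> e) * (z x \<bullet> e)" by (metis inner_scaleR_right)
  then show ?thesis by (simp add: z_e)
qed

lemma bdd_integrable:
  fixes f :: "'a \<Rightarrow> real"
  assumes [measurable]: "f \<in> borel_measurable M" and "\<And>x. x \<in> space M \<Longrightarrow> 1 \<le> norm (d x) \<Longrightarrow> norm (d x) \<le> L \<Longrightarrow> \<bar>f x\<bar> \<le> B"
  shows "integrable M f"
proof (rule Bochner_Integration.integrable_bound[of M "\<lambda>_. B"])
  show "AE x in M. norm (f x) \<le> norm B"
    using d_bound AE_space by eventually_elim (use assms(2) in fastforce)
qed auto

lemma flux_bound:
  "\<bar>z x \<bullet> d x\<bar> * \<bar>d x \<bullet> e\<bar> \<le> norm (z x) * (norm (d x))\<^sup>2"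
proof -
  have "\<bar>z x \<bullet> d x\<bar> * \<bar>d x \<bullet> e\<bar> \<le> (norm (z x) * norm (d x)) * norm (d x)"
    using Cauchy_Schwarz_ineq2 de_le by (intro mult_mono) auto
  then show ?thesis by (simp add: power2_eq_square mult_ac)
qed

lemma bump_cont_bdd:
  assumes "bump \<phi> a b"
  obtains B where "0 \<le> B" "\<And>t. \<phi> t \<le> B" "\<phi> \<in> borel_measurable borel"
proof -
  have c: "continuous_on UNIV \<phi>" using assms by (simp add: bump_def)
  have "bounded (\<phi> ` {a..b})" 
    by (intro compact_imp_bounded compact_continuous_image continuous_on_subset[OF c]) auto
  then obtain B where B: "0 < B" "\<And>t. t \<in> {a..b} \<Longrightarrow> \<bar>\<phi> t\<bar> \<le> B"
    unfolding bounded_pos by auto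
  have "\<phi> t \<le> B" for t using B(2)[of t] B(1) assms by (cases "t \<in> {a..b}") (auto simp: bump_def)
  then show thesis using that[of B] B(1) c borel_measurable_continuous_onI by force
qed

text \<open>Stationarity for the field f(t) z, where f rises over the first slice and falls over the
  second. The derivative of z contributes \<open>perp\<close>, and the derivative of f contributes
  the transversal flux through each slice, so two small fluxes leave little room for non-parallel
  weights in between.\<close>

lemma flux_inequality:
  assumes \<phi>1: "bump \<phi>1 a1 b1" and \<phi>2: "bump \<phi>2 a2 b2" and "b1 \<le> a2" "b2 < r1"
  shows "(LINT x|M. indicator {b1..a2} (t x) * perp x) \<le> (LINT x|M. \<phi>1 (t x) * (\<bar>z x \<bullet> d x\<bar> * \<bar>d x \<bullet> e\<bar>))
     + (LINT x|M. \<phi>2 (t x) * (\<bar>z x \<bullet> d x\<bar> * \<bar>d x \<bullet> e\<bar>))"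
proof -
  obtain F1 where F1: "\<And>t. (F1 has_real_derivative \<phi>1 t) (at t)" "\<And>t. 0 \<le> F1 t \<and> F1 t \<le> 1" 
    "\<And>t. t \<le> a1 \<Longrightarrow> F1 t = 0" "\<And>t. b1 \<le> t \<Longrightarrow> F1 t = 1" by (rule bump_primitive[OF \<phi>1]) blast
  obtain F2 where F2: "\<And>t. (F2 has_real_derivative \<phi>2 t) (at t)" "\<And>t. 0 \<le> F2 t \<and> F2 t \<le> 1" 
    "\<And>t. t \<le> a2 \<Longrightarrow> F2 t = 0" "\<And>t. b2 \<le> t \<Longrightarrow> F2 t = 1" by (rule bump_primitive[OF \<phi>2]) blast
  obtain B1 where B1: "0 \<le> B1" "\<And>t. \<phi>1 t \<le> B1" and [measurable]: "\<phi>1 \<in> borel_measurable borel" using bump_cont_bdd[OF \<phi>1] by blast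
  obtain B2 where B2: "0 \<le> B2" "\<And>t. \<phi>2 t \<le> B2" and [measurable]: "\<phi>2 \<in> borel_measurable borel" using bump_cont_bdd[OF \<phi>2] by blast
  have b1: "0 < a1" "a1 < b1" "continuous_on UNIV \<phi>1" "\<And>t. 0 \<le> \<phi>1 t" "\<And>t. t \<notin> {a1..b1} \<Longrightarrow> \<phi>1 t = 0" using \<phi>1 by (auto simp: bump_def)
  have b2: "0 < a2" "a2 < b2" "continuous_on UNIV \<phi>2" "\<And>t. 0 \<le> \<phi>2 t" "\<And>t. t \<notin> {a2..b2} \<Longrightarrow> \<phi>2 t = 0" using \<phi>2 by (auto simp: bump_def)
  define f where "f s = F1 s - F2 s" for s
  have "continuous_on UNIV F1" "continuous_on UNIV F2"
    using F1(1) F2(1) by (meson DERIV_continuous_on has_field_derivative_at_within)+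
  then have [measurable]: "f \<in> borel_measurable borel" unfolding f_def
    by (intro borel_measurable_continuous_onI continuous_intros)
  have f1: "\<bar>f s\<bar> \<le> 1" for s using F1(2)[of s] F2(2)[of s] by (auto simp: f_def)
  have f_nonneg: "0 \<le> f s" for s using F1(2)[of s] F2(2)[of s] F1(4)[of s] F2(3)[of s] assms(3) by (cases "b1 \<le> s") (auto simp: f_def)
  have f_one: "f s = 1" if "s \<in> {b1..a2}" for s using that F1(4)[of s] F2(3)[of s] by (simp add: f_def)
  have X: "((\<lambda>y. y - (y \<bullet> e) *\<^sub>R e) has_derivative (\<lambda>h. h - (h \<bullet> e) *\<^sub>R e)) (at y)" for y
    by (auto intro!: derivative_eq_intros)
  have eq: "(LINT x|M. (\<phi>1 (t x) - \<phi>2 (t x)) * (d x \<bullet> e) * (z x \<bullet> d x) + f (t x) * ((d x - (d x \<bullet> e) *\<^sub>R e) \<bullet> d x)) = 0"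
  proof (rule stat[where X="\<lambda>y. y - (y \<bullet> e) *\<^sub>R e" and X'="\<lambda>y h. h - (h \<bullet> e) *\<^sub>R e" and f=f and f'="\<lambda>s. \<phi>1 s - \<phi>2 s" and a=a1 and b=b2])
    show "(f has_real_derivative \<phi>1 s - \<phi>2 s) (at s)" for s
      unfolding f_def using DERIV_diff[OF F1(1) F2(1)] .
    show "continuous_on UNIV (\<lambda>s. \<phi>1 s - \<phi>2 s)" using b1 b2 by (intro continuous_intros)
    show "f s = 0 \<and> \<phi>1 s - \<phi>2 s = 0" if "s \<notin> {a1..b2}" for s
      using that F1(3)[of s] F2(3)[of s] F1(4)[of s] F2(4)[of s] b1 b2 assms(3)
      by (cases "s < a1") (auto simp: f_def)
  qed (use b1 b2 assms X in auto)
  define g where "g x = (z x \<bullet> d x) * (d x \<bullet> e)" for x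
  have [measurable]: "g \<in> borel_measurable M" unfolding g_def by measurable
  have gb: "\<bar>g x\<bar> \<le> 2 * L * L\<^sup>2" if "x \<in> space M" "norm (d x) \<le> L" for x
  proof -
    have "\<bar>g x\<bar> \<le> norm (z x) * (norm (d x))\<^sup>2" using flux_bound[of x] by (simp add: g_def abs_mult)
    also have "\<dots> \<le> 2 * L * L\<^sup>2" using norm_z[OF that(1)] that(2) pars by (intro mult_mono power_mono) auto
    finally show ?thesis .
  qed
  have perpb: "perp x \<le> L\<^sup>2" if "norm (d x) \<le> L" for x
    using power_mono[OF that, of 2] zero_le_power2[of "d x \<bullet> e"] by (simp, linarith)
  have ig: "integrable M (\<lambda>x. \<phi> (t x) * h x)" if "\<And>t. 0 \<le> \<phi> t" "\<And>t. \<phi> t \<le> B" "\<phi> \<in> borel_measurable borel" 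
    "h \<in> borel_measurable M" "\<And>x. \<bar>h x\<bar> = \<bar>g x\<bar>" for B and h :: "'a \<Rightarrow> real" and \<phi> :: "real \<Rightarrow> real"
  proof (rule bdd_integrable)
    note [measurable] = that(3,4)
    show "(\<lambda>x. \<phi> (t x) * h x) \<in> borel_measurable M" by measurable
    fix x assume "x \<in> space M" "norm (d x) \<le> L"
    then have "\<bar>h x\<bar> \<le> 2 * L * L\<^sup>2" using gb that(5) by simp
    then show "\<bar>\<phi> (t x) * h x\<bar> \<le> B * (2 * L * L\<^sup>2)"
      unfolding abs_mult using that(1,2) order_trans[OF that(1,2)] by (intro mult_mono) auto
  qed
  have i1: "integrable M (\<lambda>x. f (t x) * perp x)"
  proof (rule bdd_integrable)
    fix x assume "x \<in> space M" "norm (d x) \<le> L"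
    show "\<bar>f (t x) * perp x\<bar> \<le> 1 * L\<^sup>2" unfolding abs_mult
      using f1 perpb[OF \<open>norm (d x) \<le> L\<close>] perp_nonneg[of x] by (intro mult_mono) auto
  qed measurable
  have absg: "\<bar>z x \<bullet> d x\<bar> * \<bar>d x \<bullet> e\<bar> = \<bar>g x\<bar>" for x by (simp add: g_def abs_mult)
  have dd: "(d x - (d x \<bullet> e) *\<^sub>R e) \<bullet> d x = perp x" for x
    unfolding power2_norm_eq_inner by (simp add: inner_diff_left inner_diff_right power2_eq_square inner_commute)
  have I1: "integrable M (\<lambda>x. \<phi>1 (t x) * g x)" "integrable M (\<lambda>x. \<phi>1 (t x) * \<bar>g x\<bar>)" using b1 B1 by (intro ig[where B=B1]; simp)+
  have I2: "integrable M (\<lambda>x. \<phi>2 (t x) * g x)" "integrable M (\<lambda>x. \<phi>2 (t x) * \<bar>g x\<bar>)" using b2 B2 by (intro ig[where B=B2]; simp)+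
  have "(LINT x|M. (\<phi>1 (t x) - \<phi>2 (t x)) * (d x \<bullet> e) * (z x \<bullet> d x) + f (t x) * ((d x - (d x \<bullet> e) *\<^sub>R e) \<bullet> d x))
    = (LINT x|M. (\<phi>1 (t x) * g x - \<phi>2 (t x) * g x) + f (t x) * perp x)"
    unfolding dd by (intro Bochner_Integration.integral_cong) (auto simp: g_def algebra_simps)
  also have "\<dots> = (LINT x|M. \<phi>1 (t x) * g x) - (LINT x|M. \<phi>2 (t x) * g x) + (LINT x|M. f (t x) * perp x)"
    using I1 I2 i1 by simp
  finally have 1: "(LINT x|M. f (t x) * perp x) = (LINT x|M. \<phi>2 (t x) * g x) - (LINT x|M. \<phi>1 (t x) * g x)" using eq by simp
  have "(LINT x|M. indicator {b1..a2} (t x) * perp x) \<le> (LINT x|M. f (t x) * perp x)"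
  proof (rule integral_mono[OF _ i1])
    show "integrable M (\<lambda>x. indicator {b1..a2} (t x) * perp x)"
      by (rule bdd_integrable[where B="L\<^sup>2"]; (measurable)?) (use perpb perp_nonneg in \<open>auto simp: indicator_def\<close>)
    show "indicator {b1..a2} (t x) * perp x \<le> f (t x) * perp x" for x
      using f_one[of "t x"] f_nonneg perp_nonneg[of x] by (auto simp: indicator_def)
  qed
  moreover have "(LINT x|M. \<phi>2 (t x) * g x) \<le> (LINT x|M. \<phi>2 (t x) * \<bar>g x\<bar>)"
    by (rule integral_mono[OF I2]) (use b2 in \<open>auto intro: mult_left_mono\<close>)
  moreover have "- (LINT x|M. \<phi>1 (t x) * \<bar>g x\<bar>) \<le> (LINT x|M. \<phi>1 (t x) * g x)"
    unfolding Bochner_Integration.integral_minus[symmetric]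
  proof (rule integral_mono[OF _ I1(1)])
    show "- (\<phi>1 (t x) * \<bar>g x\<bar>) \<le> \<phi>1 (t x) * g x" for x
      using mult_left_mono[of "- \<bar>g x\<bar>" "g x" "\<phi>1 (t x)"] b1 by simp
  qed (use I1 in simp)
  ultimately show ?thesis unfolding absg 1 by linarith
qed

text \<open>On the slice the hat is at most 2 / s and the transversal part at most 2 \<epsilon> s,
  product 4 \<epsilon>; the mass below height 3 s is at most 3 C s.\<close>

lemma hat_flux:
  assumes s: "0 < s" and "0 < \<epsilon>" and thin_s: "\<And>x. x \<in> space M \<Longrightarrow> t x < 3 * s \<Longrightarrow> norm (z x) \<le> \<epsilon> * t x"
  shows "(LINT x|M. hat s (2 * s) (t x) * (norm (z x) * (norm (d x))\<^sup>2)) \<le> 12 * C * \<epsilon> * s"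
proof -
  have "(LINT x|M. hat s (2 * s) (t x) * (norm (z x) * (norm (d x))\<^sup>2)) \<le> (LINT x|M. 4 * \<epsilon> * (indicator {x. t x < 3 * s} x * (norm (d x))\<^sup>2))"
  proof (rule integral_mono)
    show "integrable M (\<lambda>x. hat s (2 * s) (t x) * (norm (z x) * (norm (d x))\<^sup>2))"
    proof (rule bdd_integrable)
      fix x assume x: "x \<in> space M" "norm (d x) \<le> L"
      show "\<bar>hat s (2 * s) (t x) * (norm (z x) * (norm (d x))\<^sup>2)\<bar> \<le> (2 / s) * (2 * L * L\<^sup>2)"
        unfolding abs_mult using hat_le[of s "2 * s" "t x"] hat_bump[of s "2 * s"] s norm_z[OF x(1)] x(2) pars
        by (intro mult_mono) (auto simp: bump_def intro: power_mono)
    qed measurable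
    show "integrable M (\<lambda>x. 4 * \<epsilon> * (indicator {x. t x < 3 * s} x * (norm (d x))\<^sup>2))"
    proof (rule bdd_integrable)
      show "(\<lambda>x. 4 * \<epsilon> * (indicator {x. t x < 3 * s} x * (norm (d x))\<^sup>2)) \<in> borel_measurable M"
        by measurable
      fix x assume "norm (d x) \<le> L"
      then show "\<bar>4 * \<epsilon> * (indicator {x. t x < 3 * s} x * (norm (d x))\<^sup>2)\<bar> \<le> 4 * \<epsilon> * L\<^sup>2"
        using \<open>0 < \<epsilon>\<close> by (auto simp: indicator_def intro: power_mono)
    qed
    fix x assume x: "x \<in> space M"
    show "hat s (2 * s) (t x) * (norm (z x) * (norm (d x))\<^sup>2) \<le> 4 * \<epsilon> * (indicator {x. t x < 3 * s} x * (norm (d x))\<^sup>2)"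
    proof (cases "t x \<in> {s..2 * s}")
      case True
      then have "norm (z x) \<le> \<epsilon> * t x" using thin_s[OF x] s by auto
      also have "\<dots> \<le> \<epsilon> * (2 * s)" using True \<open>0 < \<epsilon>\<close> by auto
      finally have "hat s (2 * s) (t x) * norm (z x) \<le> (2 / s) * (\<epsilon> * (2 * s))" 
        using hat_le[of s "2 * s" "t x"] s by (intro mult_mono) auto
      also have "\<dots> = 4 * \<epsilon>" using s by simp
      finally have "hat s (2 * s) (t x) * norm (z x) * (norm (d x))\<^sup>2 \<le> 4 * \<epsilon> * (norm (d x))\<^sup>2" by (rule mult_right_mono) simp
      then show ?thesis using True s by (simp add: mult_ac)
    next
      case False
      then have "hat s (2 * s) (t x) = 0" using hat_bump[of s "2 * s"] s unfolding bump_def by auto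
      then show ?thesis using \<open>0 < \<epsilon>\<close> by simp
    qed
  qed
  also have "\<dots> = 4 * \<epsilon> * (LINT x|M. indicator {x. t x < 3 * s} x * (norm (d x))\<^sup>2)" by simp
  also have "\<dots> \<le> 4 * \<epsilon> * (C * (3 * s))" using upper[of "3 * s"] s \<open>0 < \<epsilon>\<close> by (intro mult_left_mono) auto
  finally show ?thesis by (simp add: mult_ac)
qed

end

section \<open>Weights parallel to the axis of the sector\<close>

context sector
begin

lemma flux_integrable:
  assumes "\<And>s. 0 \<le> \<phi> s" "\<And>s. \<phi> s \<le> (B::real)" and [measurable]: "\<phi> \<in> borel_measurable borel"
  shows "integrable M (\<lambda>x. \<phi> (t x) * (norm (z x) * (norm (d x))\<^sup>2))" (is ?A)
    "integrable M (\<lambda>x. \<phi> (t x) * (\<bar>z x \<bullet> d x\<bar> * \<bar>d x \<bullet> e\<bar>))" (is ?B)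
proof -
  have b: "norm (z x) * (norm (d x))\<^sup>2 \<le> 2 * L * L\<^sup>2" if "x \<in> space M" "norm (d x) \<le> L" for x
    using norm_z[OF that(1)] that(2) pars by (intro mult_mono power_mono) auto
  have B: "0 \<le> B" using assms(1,2) order_trans by blast
  show ?A
  proof (rule bdd_integrable)
    fix x assume "x \<in> space M" "norm (d x) \<le> L"
    then show "\<bar>\<phi> (t x) * (norm (z x) * (norm (d x))\<^sup>2)\<bar> \<le> B * (2 * L * L\<^sup>2)"
      unfolding abs_mult[of "\<phi> (t x)"] using b assms(1,2) B by (intro mult_mono) auto
  qed measurable
  show ?B
  proof (rule bdd_integrable)
    fix x assume "x \<in> space M" "norm (d x) \<le> L"
    then have "\<bar>z x \<bullet> d x\<bar> * \<bar>d x \<bullet> e\<bar> \<le> 2 * L * L\<^sup>2" using b[of x] flux_bound[of x] by linarith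
    then show "\<bar>\<phi> (t x) * (\<bar>z x \<bullet> d x\<bar> * \<bar>d x \<bullet> e\<bar>)\<bar> \<le> B * (2 * L * L\<^sup>2)"
      unfolding abs_mult[of "\<phi> (t x)"] using assms(1,2) B by (intro mult_mono) auto
  qed measurable
qed

lemma hat_range: "0 < a \<Longrightarrow> a < b \<Longrightarrow> 0 \<le> hat a b s \<and> hat a b s \<le> 2 / (b - a)"
  using hat_le hat_bump by (auto simp: bump_def)

lemma hat_flux':
  assumes s: "0 < s" and "0 < \<epsilon>" and thin_s: "\<And>x. x \<in> space M \<Longrightarrow> t x < 3 * s \<Longrightarrow> norm (z x) \<le> \<epsilon> * t x"
  shows "(LINT x|M. hat s (2 * s) (t x) * (\<bar>z x \<bullet> d x\<bar> * \<bar>d x \<bullet> e\<bar>)) \<le> 12 * C * \<epsilon> * s"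
proof -
  have h: "0 \<le> hat s (2 * s) u" "hat s (2 * s) u \<le> 2 / (2 * s - s)" for u using hat_range[of s "2 * s"] s by auto
  have "(LINT x|M. hat s (2 * s) (t x) * (\<bar>z x \<bullet> d x\<bar> * \<bar>d x \<bullet> e\<bar>)) \<le> (LINT x|M. hat s (2 * s) (t x) * (norm (z x) * (norm (d x))\<^sup>2))"
    by (intro integral_mono flux_integrable[OF h] mult_left_mono flux_bound h) auto
  then show ?thesis using hat_flux[OF assms] by linarith
qed

lemma integrable_perp:
  assumes [measurable]: "S \<in> sets borel"
  shows "integrable M (\<lambda>x. indicator S (t x) * perp x)"
proof (rule bdd_integrable)
  fix x assume "norm (d x) \<le> L"
  then have "perp x \<le> L\<^sup>2" using power_mono[of "norm (d x)" L 2] zero_le_power2[of "d x \<bullet> e"] by (simp, linarith)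
  then show "\<bar>indicator S (t x) * perp x\<bar> \<le> L\<^sup>2" using perp_nonneg[of x] pars by (auto simp: indicator_def)
qed measurable

text \<open>Heights are positive on the whole space, so lowering the lower cut to 0 exhausts the
  sector; dominated convergence keeps the bound.\<close>

lemma perp_limit:
  assumes "0 < a0" and b: "\<And>a. 0 < a \<Longrightarrow> a < a0 \<Longrightarrow> (LINT x|M. indicator {2 * a..s} (t x) * perp x) \<le> B"
  shows "(LINT x|M. indicator {..s} (t x) * perp x) \<le> B"
proof -
  define a where "a n = a0 / (real n + 2)" for n :: nat
  have a: "0 < a n" for n using \<open>0 < a0\<close> by (simp add: a_def)
  have a2: "a n < a0" for n 
    unfolding a_def using divide_strict_left_mono[of 1 "real n + 2" a0] \<open>0 < a0\<close> by simp
  have alim: "a \<longlonglongrightarrow> 0" unfolding a_def using LIMSEQ_ignore_initial_segment[OF lim_const_over_n, of a0 2] by (simp add: add.commute)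
  have "(\<lambda>n. LINT x|M. indicator {2 * a n..s} (t x) * perp x) \<longlonglongrightarrow> (LINT x|M. indicator {..s} (t x) * perp x)"
  proof (rule integral_dominated_convergence)
    show "integrable M (\<lambda>x. indicator UNIV (t x) * perp x)" by (rule integrable_perp) auto
    show "AE x in M. (\<lambda>n. indicator {2 * a n..s} (t x) * perp x) \<longlonglongrightarrow> indicator {..s} (t x) * perp x"
    proof (rule AE_I2)
      fix x assume "x \<in> space M"
      then have "0 < t x / 2" using t_range by auto
      from order_tendstoD(2)[OF alim this] have "\<forall>\<^sub>F n in sequentially. indicator {2 * a n..s} (t x) * perp x = indicator {..s} (t x) * perp x"
        by eventually_elim (auto simp: indicator_def)
      then show "(\<lambda>n. indicator {2 * a n..s} (t x) * perp x) \<longlonglongrightarrow> indicator {..s} (t x) * perp x"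
        by (rule tendsto_eventually)
    qed
    show "AE x in M. norm (indicator {2 * a n..s} (t x) * perp x) \<le> indicator UNIV (t x) * perp x" for n
      using perp_nonneg by (intro AE_I2) (auto simp: indicator_def)
  qed measurable
  then show ?thesis by (rule LIMSEQ_le_const2) (use b a a2 in blast)
qed

text \<open>The flux through a hat at height s is of smaller order than s because the cone closes
  up, and the lower hat sits at a height a < s and costs no more.\<close>

lemma perp_small:
  assumes "0 < \<epsilon>"
  shows "\<exists>s0>0. \<forall>s. 0 < s \<and> s \<le> s0 \<longrightarrow> (LINT x|M. indicator {..s} (t x) * perp x) \<le> \<epsilon> * s"
proof -
  \<comment> \<open>Each of the two slices costs at most
    \<open>12 * C * \<epsilon>' * s\<close>.\<close>
  define \<epsilon>' where "\<epsilon>' = \<epsilon> / (24 * C)"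
  have e': "0 < \<epsilon>'" using assms pars by (simp add: \<epsilon>'_def)
  from thin[OF this] obtain s1 where s1: "0 < s1" "\<And>x. x \<in> space M \<Longrightarrow> t x < s1 \<Longrightarrow> norm (z x) \<le> \<epsilon>' * t x" by blast
  define s0 where "s0 = min (s1 / 3) (r1 / 3)"
  show ?thesis
  proof (intro exI[of _ s0] conjI allI impI)
    show "0 < s0" using s1 pars by (simp add: s0_def)
    fix s assume s: "0 < s \<and> s \<le> s0"
    show "(LINT x|M. indicator {..s} (t x) * perp x) \<le> \<epsilon> * s"
    proof (rule perp_limit)
      show "0 < s / 2" using s by simp
      fix a assume a: "0 < a" "a < s / 2"
      have "(LINT x|M. indicator {2 * a..s} (t x) * perp x) \<le> (LINT x|M. hat a (2 * a) (t x) * (\<bar>z x \<bullet> d x\<bar> * \<bar>d x \<bullet> e\<bar>))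
        + (LINT x|M. hat s (2 * s) (t x) * (\<bar>z x \<bullet> d x\<bar> * \<bar>d x \<bullet> e\<bar>))"
        by (rule flux_inequality[OF hat_bump hat_bump]) (use a s pars in \<open>auto simp: s0_def\<close>)
      also have "\<dots> \<le> 12 * C * \<epsilon>' * a + 12 * C * \<epsilon>' * s"
        by (intro add_mono hat_flux' e' s1) (use a s in \<open>auto simp: s0_def\<close>)
      also have "\<dots> \<le> 12 * C * \<epsilon>' * s + 12 * C * \<epsilon>' * s" using a s e' pars by (intro add_right_mono mult_left_mono) auto
      also have "\<dots> = \<epsilon> * s" using pars by (simp add: \<epsilon>'_def)
      finally show "(LINT x|M. indicator {2 * a..s} (t x) * perp x) \<le> \<epsilon> * s" .
    qed
  qed
qed

text \<open>By \<open>perp_small\<close>, weights with transversal part at least \<open>c0\<close>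
  have mass of smaller order than s below height s. They are covered by balls of small total radius,
  and projecting these to the axis shows that the heights hit have length at most s/4. At least half
  of the interval {s/2..s} is missed.\<close>

lemma good_slice:
  shows "\<exists>s0>0. \<forall>s. 0 < s \<and> s \<le> s0 \<longrightarrow> (\<exists>K. compact K \<and> K \<subseteq> {s/2..s} \<and> 0 < measure lebesgue K \<and> (\<forall>x\<in>space M. t x \<in> K \<longrightarrow> perp x < c0))"
proof -
  \<comment> \<open>With this choice C0 * L * (\<epsilon> s / c0) = s/16. The error allowed in the
    cover adds another s/16, and a ball of radius \<rho> projects to an interval of length 2 \<rho>,
    giving s/4 in total.\<close>
  define \<epsilon> where "\<epsilon> = c0 / (16 * C0 * L)"
  have "0 < \<epsilon>" using pars by (simp add: \<epsilon>_def)
  from perp_small[OF this] obtain s0 where s0: "0 < s0" 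
    "\<And>s. 0 < s \<Longrightarrow> s \<le> s0 \<Longrightarrow> (LINT x|M. indicator {..s} (t x) * perp x) \<le> \<epsilon> * s" by blast
  show ?thesis
  proof (intro exI[of _ s0] conjI allI impI)
    show "0 < s0" by fact
    fix s assume s: "0 < s \<and> s \<le> s0"
    define A where "A = {x\<in>space M. c0 \<le> perp x \<and> t x \<le> s}"
    have [measurable]: "A \<in> sets M" unfolding A_def by measurable
    have "\<exists>a \<rho>. (\<forall>i::nat. 0 < (\<rho> i::real)) \<and> t ` A \<subseteq> (\<Union>i. ball (a i) (\<rho> i)) \<and> summable \<rho> \<and> suminf \<rho> \<le> s / 8"
    proof (cases "A = {}")
      case True
      have "(\<lambda>n. (s / 8) * (1/2)^Suc n) sums (s / 8 * 1)" by (intro sums_mult power_half_series)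
      \<comment> \<open>Covers are supplied for nonempty sets only; with no bad points any positive
        radii of total s/8 serve.\<close>
      then show ?thesis using True s
        by (intro exI[of _ "\<lambda>_. 0"] exI[of _ "\<lambda>n. (s / 8) * (1/2)^Suc n"]) (auto simp: sums_iff)
    next
      case False
      have "0 < s / 16" using s by simp
      from cover[OF \<open>A \<in> sets M\<close> False this] obtain a \<rho> where a: "\<And>i::nat. 0 < \<rho> i" "Y ` A \<subseteq> (\<Union>i. ball (a i) (\<rho> i))"
        and sm: "summable \<rho>" "suminf \<rho> \<le> C0 * (LINT x|M. indicator A x * norm (d x)) + s / 16" by blast
      have ia: "integrable M (\<lambda>x. indicator A x :: real)" by (rule bdd_integrable[where B=1]) (auto simp: indicator_def)
      have "(LINT x|M. indicator A x * norm (d x)) \<le> (LINT x|M. L * indicator A x)"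
      proof (rule integral_mono_AE)
        show "integrable M (\<lambda>x. indicator A x * norm (d x))"
          by (rule bdd_integrable[where B=L]) (use pars in \<open>auto simp: indicator_def\<close>)
        show "AE x in M. indicator A x * norm (d x) \<le> L * indicator A x"
          using d_bound by eventually_elim (auto simp: indicator_def)
      qed (use ia in simp)
      also have "\<dots> = L * (LINT x|M. indicator A x)" by simp
      also have "(LINT x|M. indicator A x) \<le> \<epsilon> * s / c0"
      proof -
        have "(LINT x|M. c0 * indicator A x) \<le> (LINT x|M. indicator {..s} (t x) * perp x)"
          by (rule integral_mono[OF _ integrable_perp]) (use ia perp_nonneg in \<open>auto simp: indicator_def A_def\<close>)
        also have "\<dots> \<le> \<epsilon> * s" using s0 s by simp
        finally show ?thesis using pars by (simp add: field_simps)
      qed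
      finally have "(LINT x|M. indicator A x * norm (d x)) \<le> L * (\<epsilon> * s / c0)" using pars by simp
      then have "C0 * (LINT x|M. indicator A x * norm (d x)) \<le> C0 * (L * (\<epsilon> * s / c0))" using pars by (intro mult_left_mono) auto
      also have "\<dots> = s / 16" using pars by (simp add: \<epsilon>_def)
      finally have "suminf \<rho> \<le> s / 8" using sm by simp
      moreover have "t ` A \<subseteq> (\<Union>i. ball (a i \<bullet> e) (\<rho> i))"
      proof
        fix u assume "u \<in> t ` A"
        then obtain x where x: "x \<in> A" "u = t x" by blast
        then obtain i where i: "dist (a i) (Y x) < \<rho> i" using a(2) by fastforce
        have "\<bar>(a i - Y x) \<bullet> e\<bar> \<le> norm (a i - Y x) * norm e" by (rule Cauchy_Schwarz_ineq2)
        then have "dist (a i \<bullet> e) u < \<rho> i" using i x e by (simp add: dist_norm inner_diff_left)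
        then show "u \<in> (\<Union>i. ball (a i \<bullet> e) (\<rho> i))" by auto
      qed
      ultimately show ?thesis using a(1) sm(1) by (intro exI[of _ "\<lambda>i. a i \<bullet> e"] exI[of _ \<rho>] conjI) simp_all
    qed
    then obtain a \<rho> where \<rho>: "\<And>i::nat. 0 < (\<rho> i::real)" "t ` A \<subseteq> (\<Union>i. ball (a i) (\<rho> i))" "summable \<rho>" "suminf \<rho> \<le> s / 8" by blast
    define U where "U = (\<Union>i. ball (a i) (\<rho> i))"
    define K where "K = {s/2..s} - U"
    have "open U" by (auto simp: U_def)
    then have "compact K" unfolding K_def by (intro compact_diff) auto
    have "emeasure lborel U \<le> (\<Sum>i. emeasure lborel (ball (a i) (\<rho> i)))"
      unfolding U_def by (rule emeasure_subadditive_countably) auto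
    also have "\<dots> = (\<Sum>i. ennreal (2 * \<rho> i))"
    proof (intro arg_cong[where f=suminf] ext)
      fix i
      have "ball (a i) (\<rho> i) = {a i - \<rho> i<..<a i + \<rho> i}" by (auto simp: dist_real_def)
      then show "emeasure lborel (ball (a i) (\<rho> i)) = ennreal (2 * \<rho> i)" using \<rho>(1)[of i] by simp
    qed
    also have "\<dots> = ennreal (\<Sum>i. 2 * \<rho> i)" using \<rho> by (intro suminf_ennreal2) (auto intro: less_imp_le summable_mult)
    also have "(\<Sum>i. 2 * \<rho> i) = 2 * suminf \<rho>" using \<rho>(3) by (rule suminf_mult)
    also have "ennreal (2 * suminf \<rho>) \<le> ennreal (s / 4)" using \<rho>(4) by (intro ennreal_leI) auto
    finally have U: "emeasure lborel U \<le> ennreal (s / 4)" .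
    have "ennreal (s / 2) = emeasure lborel {s/2..s}" using s by simp
    also have "\<dots> \<le> emeasure lborel (K \<union> U)"
      using \<open>compact K\<close> \<open>open U\<close> by (intro emeasure_mono) (auto simp: K_def intro: borel_compact)
    also have "\<dots> \<le> emeasure lborel K + emeasure lborel U"
      using \<open>compact K\<close> \<open>open U\<close> by (intro emeasure_subadditive) (auto intro: borel_compact)
    also have "\<dots> \<le> emeasure lborel K + ennreal (s / 4)" using U by (rule add_left_mono)
    finally have m: "ennreal (s / 2) \<le> emeasure lborel K + ennreal (s / 4)" .
    have "0 < measure lebesgue K"
    proof (rule ccontr)
      assume "\<not> ?thesis"
      then have "measure lebesgue K = 0" by (simp add: zero_less_measure_iff)
      moreover have "emeasure lebesgue K = emeasure lborel K" using \<open>compact K\<close> by (simp add: borel_compact)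
      moreover have "emeasure lebesgue K = ennreal (measure lebesgue K)" 
        using \<open>compact K\<close> by (simp add: emeasure_eq_measure2 lmeasurable_compact fmeasurableD2)
      ultimately have "emeasure lborel K = 0" by simp
      then have "ennreal (s / 2) \<le> ennreal (s / 4)" using m by simp
      then show False using s by (simp add: ennreal_le_iff)
    qed
    moreover have "perp x < c0" if "x \<in> space M" "t x \<in> K" for x
    proof (rule ccontr)
      assume "\<not> perp x < c0"
      then have "x \<in> A" using that by (simp add: A_def K_def)
      then have "t x \<in> U" using \<rho>(2) unfolding U_def by (rule subsetD[rotated, OF imageI])
      then show False using that by (simp add: K_def)
    qed
    ultimately show "\<exists>K. compact K \<and> K \<subseteq> {s/2..s} \<and> 0 < measure lebesgue K \<and> (\<forall>x\<in>space M. t x \<in> K \<longrightarrow> perp x < c0)"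
      using \<open>compact K\<close> by (intro exI[of _ K] conjI ballI impI) (simp_all, simp add: K_def)
  qed
qed

text \<open>The upper slice is replaced by bumps that concentrate on a set K of good heights, where
  the flux vanishes identically. What remains is the lower flux, at most 12 C a, which tends to 0
  with the height a.\<close>

lemma perp_null: "\<exists>s>0. AE x in M. t x < s \<longrightarrow> perp x = 0"
proof -
  obtain s0 where s0: "0 < s0" "\<And>s. 0 < s \<Longrightarrow> s \<le> s0 \<Longrightarrow> (\<exists>K. compact K \<and> K \<subseteq> {s/2..s} \<and> 0 < measure lebesgue K \<and> (\<forall>x\<in>space M. t x \<in> K \<longrightarrow> perp x < c0))"
    using good_slice by blast
  define s where "s = min s0 (r1 / 3)"
  have s: "0 < s" "s \<le> s0" "2 * s < r1" using s0 pars by (auto simp: s_def)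
  from s0(2)[OF s(1,2)] obtain K where K: "compact K" "K \<subseteq> {s/2..s}" "0 < measure lebesgue K" "\<And>x. x \<in> space M \<Longrightarrow> t x \<in> K \<Longrightarrow> perp x < c0"
    by (elim exE conjE) blast
  have Kne: "K \<noteq> {}" using K(3) by auto
  from thin[OF zero_less_one] obtain s1 where s1: "0 < s1" "\<And>x. x \<in> space M \<Longrightarrow> t x < s1 \<Longrightarrow> norm (z x) \<le> 1 * t x" by blast
  \<comment> \<open>Continuous functions decreasing to the indicator of K. Their integrals
    \<open>J n\<close> stay above the measure of K, so normalising them to bumps does not blow up
    the flux.\<close>
  define \<phi> where "\<phi> n u = max 0 (1 - real n * infdist u K)" for n u
  have \<phi>c: "continuous_on UNIV (\<phi> n)" for n unfolding \<phi>_def by (intro continuous_intros)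
  have [measurable]: "\<phi> n \<in> borel_measurable borel" for n by (rule borel_measurable_continuous_onI[OF \<phi>c])
  have \<phi>b: "0 \<le> \<phi> n u" "\<phi> n u \<le> 1" for n u by (auto simp: \<phi>_def infdist_nonneg)
  define J where "J n = integral {s/4..2 * s} (\<phi> n)" for n
  define m where "m = measure lebesgue K"
  have Jm: "m \<le> J n" for n
  proof -
    have Kl: "K \<in> lmeasurable" using K(1) by (rule lmeasurable_compact)
    have eq: "\<phi> n u = 1" if "u \<in> K" for u using that by (simp add: \<phi>_def)
    have "(\<lambda>_. 1::real) integrable_on K" using Kl by (rule integrable_on_const)
    then have "\<phi> n integrable_on K" by (rule integrable_eq) (simp add: eq)
    then have "integral K (\<phi> n) \<le> J n" unfolding J_def using K(2) s \<phi>b(1)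
      by (intro integral_subset_le integrable_continuous_interval continuous_on_subset[OF \<phi>c]) auto
    moreover have "integral K (\<phi> n) = m" unfolding m_def lmeasure_integral[OF Kl] by (rule integral_cong) (simp add: eq)
    ultimately show ?thesis by simp
  qed
  have m: "0 < m" using K(3) by (simp add: m_def)
  have bumps: "bump (\<lambda>u. \<phi> n u / J n) (s/4) (2 * s)" if "4 / s \<le> real n" for n
  proof -
    have "\<phi> n u = 0" if "u \<notin> {s/4..2 * s}" for u
    proof -
      have "s / 4 \<le> infdist u K"
        unfolding infdist_notempty[OF Kne] using that K(2) s by (intro cINF_greatest Kne) (fastforce simp: dist_real_def)
      then have "(4 / s) * (s / 4) \<le> real n * infdist u K" using \<open>4 / s \<le> real n\<close> s by (intro mult_mono) auto
      then show ?thesis using s by (simp add: \<phi>_def)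
    qed
    moreover have "((\<lambda>u. \<phi> n u / J n) has_integral J n / J n) {s/4..2 * s}"
      unfolding J_def by (intro has_integral_divide integrable_integral integrable_continuous_interval continuous_on_subset[OF \<phi>c]) auto
    ultimately show ?thesis using Jm[of n] m s \<phi>b by (auto simp: bump_def intro!: continuous_intros \<phi>c)
  qed
  define g where "g = (\<lambda>x. \<bar>z x \<bullet> d x\<bar> * \<bar>d x \<bullet> e\<bar>)"
  have [measurable]: "g \<in> borel_measurable M" unfolding g_def by measurable
  have "(\<lambda>n. LINT x|M. \<phi> n (t x) * g x) \<longlonglongrightarrow> (LINT x|M. indicator K (t x) * g x)"
  proof (rule integral_dominated_convergence)
    show "integrable M g" using flux_integrable(2)[of "\<lambda>_. 1" 1] by (simp add: g_def)
    show "AE x in M. (\<lambda>n. \<phi> n (t x) * g x) \<longlonglongrightarrow> indicator K (t x) * g x"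
    proof (intro AE_I2 tendsto_mult_right)
      fix x
      show "(\<lambda>n. \<phi> n (t x)) \<longlonglongrightarrow> indicator K (t x)"
      proof (cases "t x \<in> K")
        case True then show ?thesis by (simp add: \<phi>_def)
      next
        case False
        then have p: "0 < infdist (t x) K" using K(1) Kne 
          by (metis compact_imp_closed in_closed_iff_infdist_zero infdist_nonneg less_eq_real_def)
        have "\<forall>\<^sub>F n in sequentially. 1 / infdist (t x) K \<le> real n" 
          by (rule eventually_at_top_linorderI[of "nat \<lceil>1 / infdist (t x) K\<rceil>"]) linarith
        then have "\<forall>\<^sub>F n in sequentially. \<phi> n (t x) = indicator K (t x)"
          by eventually_elim (use p False in \<open>auto simp: \<phi>_def field_simps\<close>)
        then show ?thesis by (rule tendsto_eventually)
      qed
    qed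
    show "AE x in M. norm (\<phi> n (t x) * g x) \<le> g x" for n
      using \<phi>b by (intro AE_I2) (auto simp: g_def abs_mult mult_left_le_one_le)
    show "(\<lambda>x. indicator K (t x) * g x) \<in> borel_measurable M"
    proof -
      have [measurable]: "K \<in> sets borel" using K(1) by (rule borel_compact)
      show ?thesis by measurable
    qed
  qed measurable
  \<comment> \<open>Over K the value of \<open>perp\<close> is below \<open>c0\<close>, hence zero
    almost everywhere by \<open>gap\<close>. The weight is then parallel to e and orthogonal to
    z.\<close>
  moreover have "(LINT x|M. indicator K (t x) * g x) = 0"
  proof (rule integral_eq_zero_AE)
    show "AE x in M. indicator K (t x) * g x = 0"
      using gap AE_space
    proof eventually_elim
      case (elim x)
      show ?case
      proof (cases "t x \<in> K")
        case True
        then have "perp x = 0" using elim K(4) by force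
        then show ?thesis using perp_zero_inner by (simp add: g_def)
      qed simp
    qed
  qed
  ultimately have lim0: "(\<lambda>n. LINT x|M. \<phi> n (t x) * g x) \<longlonglongrightarrow> 0" by simp
  have low: "(LINT x|M. indicator {2 * a..s/4} (t x) * perp x) \<le> 12 * C * a" if a: "0 < a" "2 * a \<le> s / 4" "3 * a \<le> s1" for a
  proof -
    have ev: "\<forall>\<^sub>F n in sequentially. (LINT x|M. indicator {2 * a..s/4} (t x) * perp x) \<le> 12 * C * a + (1 / m) * (LINT x|M. \<phi> n (t x) * g x)"
    proof (rule eventually_at_top_linorderI[of "nat \<lceil>4 / s\<rceil>"])
      fix n assume "nat \<lceil>4 / s\<rceil> \<le> n"
      then have n: "4 / s \<le> real n" by linarith
      have "(LINT x|M. indicator {2 * a..s/4} (t x) * perp x) \<le> (LINT x|M. hat a (2 * a) (t x) * (\<bar>z x \<bullet> d x\<bar> * \<bar>d x \<bullet> e\<bar>))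
        + (LINT x|M. \<phi> n (t x) / J n * (\<bar>z x \<bullet> d x\<bar> * \<bar>d x \<bullet> e\<bar>))"
        by (rule flux_inequality[OF hat_bump bumps[OF n]]) (use a s in auto)
      also have "(LINT x|M. hat a (2 * a) (t x) * (\<bar>z x \<bullet> d x\<bar> * \<bar>d x \<bullet> e\<bar>)) \<le> 12 * C * 1 * a"
        by (rule hat_flux') (use a s1 in auto)
      also have "(LINT x|M. \<phi> n (t x) / J n * (\<bar>z x \<bullet> d x\<bar> * \<bar>d x \<bullet> e\<bar>)) = (1 / J n) * (LINT x|M. \<phi> n (t x) * g x)"
        by (simp add: g_def mult_ac flip: integral_mult_right_zero)
      also have "\<dots> \<le> (1 / m) * (LINT x|M. \<phi> n (t x) * g x)"
        using Jm[of n] m \<phi>b by (intro mult_right_mono divide_left_mono integral_nonneg_AE AE_I2) (auto simp: g_def)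
      finally show "(LINT x|M. indicator {2 * a..s/4} (t x) * perp x) \<le> 12 * C * a + (1 / m) * (LINT x|M. \<phi> n (t x) * g x)" by simp
    qed
    have "(\<lambda>n. 12 * C * a + (1 / m) * (LINT x|M. \<phi> n (t x) * g x)) \<longlonglongrightarrow> 12 * C * a + (1 / m) * 0"
      by (intro tendsto_intros lim0)
    from tendsto_le[OF _ this tendsto_const ev] show ?thesis by simp
  qed
  have "(LINT x|M. indicator {..s/4} (t x) * perp x) \<le> 0"
  proof (rule field_le_epsilon)
    fix B :: real assume B: "0 < B"
    show "(LINT x|M. indicator {..s/4} (t x) * perp x) \<le> 0 + B"
    proof (rule perp_limit)
      show "0 < min (B / (12 * C)) (min (s/8) (s1/3))" using B pars s s1 by auto
      fix a assume a: "0 < a" "a < min (B / (12 * C)) (min (s/8) (s1/3))"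
      then have "(LINT x|M. indicator {2 * a..s/4} (t x) * perp x) \<le> 12 * C * a" by (intro low) auto
      also have "\<dots> \<le> B" using a pars by (auto simp: field_simps)
      finally show "(LINT x|M. indicator {2 * a..s/4} (t x) * perp x) \<le> 0 + B" by simp
    qed
  qed
  moreover have nn: "AE x in M. 0 \<le> indicator {..s/4} (t x) * perp x" using perp_nonneg by (intro AE_I2) simp
  ultimately have "(LINT x|M. indicator {..s/4} (t x) * perp x) = 0"
    using integral_nonneg_AE[OF nn] by linarith
  then have "AE x in M. indicator {..s/4} (t x) * perp x = 0"
    by (subst (asm) integral_nonneg_eq_0_iff_AE[OF integrable_perp nn]) auto
  then have "AE x in M. t x < s / 4 \<longrightarrow> perp x = 0" by eventually_elim (auto simp: indicator_def split: if_splits)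
  then show ?thesis using s by (intro exI[of _ "s/4"]) auto
qed

end

section \<open>Concentration of the measure on a ray\<close>

context sector
begin

text \<open>The two slices may come in either order, and f is recorded only through its support: in
  the applications the term with X' vanishes, either because X is constant or because the weights
  are parallel to e on the support of f.\<close>

lemma two_bumps:
  assumes \<phi>1: "bump \<phi>1 a1 b1" and \<phi>2: "bump \<phi>2 a2 b2" and "b1 < r1" "b2 < r1"
    and X: "\<And>y. (X has_derivative X' y) (at y)" "\<And>h. continuous_on UNIV (\<lambda>y. X' y h)"
  shows "\<exists>f. f \<in> borel_measurable borel \<and> (\<forall>u. u \<notin> {min a1 a2..max b1 b2} \<longrightarrow> f u = 0) \<and>
    (LINT x|M. (\<phi>1 (t x) - \<phi>2 (t x)) * (d x \<bullet> e) * (X (Y x) \<bullet> d x) + f (t x) * (X' (Y x) (d x) \<bullet> d x)) = 0"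
proof -
  obtain F1 where F1: "\<And>t. (F1 has_real_derivative \<phi>1 t) (at t)" 
    "\<And>t. t \<le> a1 \<Longrightarrow> F1 t = 0" "\<And>t. b1 \<le> t \<Longrightarrow> F1 t = 1" by (rule bump_primitive[OF \<phi>1]) blast
  obtain F2 where F2: "\<And>t. (F2 has_real_derivative \<phi>2 t) (at t)" 
    "\<And>t. t \<le> a2 \<Longrightarrow> F2 t = 0" "\<And>t. b2 \<le> t \<Longrightarrow> F2 t = 1" by (rule bump_primitive[OF \<phi>2]) blast
  have b1: "0 < a1" "a1 < b1" "continuous_on UNIV \<phi>1" "\<And>t. t \<notin> {a1..b1} \<Longrightarrow> \<phi>1 t = 0" using \<phi>1 by (auto simp: bump_def)
  have b2: "0 < a2" "a2 < b2" "continuous_on UNIV \<phi>2" "\<And>t. t \<notin> {a2..b2} \<Longrightarrow> \<phi>2 t = 0" using \<phi>2 by (auto simp: bump_def)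
  define f where "f s = F1 s - F2 s" for s
  have out: "f s = 0 \<and> \<phi>1 s - \<phi>2 s = 0" if "s \<notin> {min a1 a2..max b1 b2}" for s
    using that F1(2)[of s] F2(2)[of s] F1(3)[of s] F2(3)[of s] b1(1,2) b1(4)[of s] b2(1,2) b2(4)[of s]
    by (cases "s < min a1 a2") (auto simp: f_def min_def max_def split: if_splits)
  have "(LINT x|M. (\<phi>1 (t x) - \<phi>2 (t x)) * (d x \<bullet> e) * (X (Y x) \<bullet> d x) + f (t x) * (X' (Y x) (d x) \<bullet> d x)) = 0"
  proof (rule stat[where f=f and f'="\<lambda>s. \<phi>1 s - \<phi>2 s" and a="min a1 a2" and b="max b1 b2", OF _ _ _ _ _ out X])
    show "(f has_real_derivative \<phi>1 s - \<phi>2 s) (at s)" for s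
      unfolding f_def using DERIV_diff[OF F1(1) F2(1)] .
    show "continuous_on UNIV (\<lambda>s. \<phi>1 s - \<phi>2 s)" using b1 b2 by (intro continuous_intros)
  qed (use b1 b2 assms in auto)
  moreover have "continuous_on UNIV F1" "continuous_on UNIV F2"
    using F1(1) F2(1) by (meson DERIV_continuous_on has_field_derivative_at_within)+
  then have "f \<in> borel_measurable borel" unfolding f_def
    by (intro borel_measurable_continuous_onI continuous_intros)
  ultimately show ?thesis using out by blast
qed

text \<open>The constant field e has no derivative term, so the flux of
  \<open>(d x \<bullet> e)\<^sup>2\<close> through a slice does not depend on the height.\<close>

lemma mass_constancy:
  assumes "0 < a1" "a1 < b1" "b1 < r1" "0 < a2" "a2 < b2" "b2 < r1"
  shows "(LINT x|M. hat a1 b1 (t x) * (d x \<bullet> e)\<^sup>2) = (LINT x|M. hat a2 b2 (t x) * (d x \<bullet> e)\<^sup>2)"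
proof -
  have X: "((\<lambda>_. e) has_derivative (\<lambda>_. 0)) (at y)" for y :: 'b by simp
  have "(LINT x|M. (hat a1 b1 (t x) - hat a2 b2 (t x)) * (d x \<bullet> e) * (e \<bullet> d x)) = 0"
    using two_bumps[OF hat_bump hat_bump _ _ X] assms by auto
  moreover have "integrable M (\<lambda>x. hat a b (t x) * (d x \<bullet> e)\<^sup>2)" if "0 < a" "a < b" for a b
  proof (rule bdd_integrable)
    fix x assume "norm (d x) \<le> L"
    have "\<bar>d x \<bullet> e\<bar> \<le> L" using de_le[of x] \<open>norm (d x) \<le> L\<close> by simp
    then have "(d x \<bullet> e)\<^sup>2 \<le> L\<^sup>2" by (metis abs_ge_zero power2_abs power_mono)
    then show "\<bar>hat a b (t x) * (d x \<bullet> e)\<^sup>2\<bar> \<le> 2 / (b - a) * L\<^sup>2"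
      unfolding abs_mult using hat_range[OF that, of "t x"] that by (intro mult_mono) auto
  qed measurable
  ultimately show ?thesis using assms
    by (simp add: power2_eq_square inner_commute left_diff_distrib mult.assoc)
qed

text \<open>The field |z|^2 e has derivative term proportional to z \<bullet> d, which is zero for
  weights parallel to e. The transversal second moment through a slice is therefore independent of
  the height; near height a it is at most 2 L times the bound 12 C a of \<open>hat_flux\<close>, and
  a is arbitrarily small.\<close>

lemma z_null: "\<exists>s>0. s \<le> r1 \<and> (AE x in M. t x < s \<longrightarrow> z x = 0)"
proof -
  obtain s' where s': "0 < s'" "AE x in M. t x < s' \<longrightarrow> perp x = 0" using perp_null by blast
  from thin[OF zero_less_one] obtain s1 where s1: "0 < s1" "\<And>x. x \<in> space M \<Longrightarrow> t x < s1 \<Longrightarrow> norm (z x) \<le> 1 * t x" by blast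
  define s where "s = min s' r1 / 2"
  have s: "0 < s" "s < s'" "s < r1" using s' pars by (auto simp: s_def)
  define q where "q y = y - (y \<bullet> e) *\<^sub>R e" for y
  have X: "((\<lambda>y. (q y \<bullet> q y) *\<^sub>R e) has_derivative (\<lambda>h. (2 * (q y \<bullet> h)) *\<^sub>R e)) (at y)" for y
  proof -
    have qe: "q y \<bullet> e = 0" by (simp add: q_def inner_diff_left ee)
    have "(q has_derivative (\<lambda>h. h - (h \<bullet> e) *\<^sub>R e)) (at y)" unfolding q_def by (auto intro!: derivative_eq_intros)
    from has_derivative_inner[OF this this]
    have "((\<lambda>y. q y \<bullet> q y) has_derivative (\<lambda>h. 2 * (q y \<bullet> h))) (at y)"
    proof (rule has_derivative_eq_rhs, intro ext)
      fix h
      have "e \<bullet> q y = 0" using qe by (simp add: inner_commute)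
      then show "q y \<bullet> (h - (h \<bullet> e) *\<^sub>R e) + (h - (h \<bullet> e) *\<^sub>R e) \<bullet> q y = 2 * (q y \<bullet> h)"
        using qe by (simp add: inner_diff_left inner_diff_right inner_commute[of h "q y"])
    qed
    from has_derivative_scaleR_left[OF this] show ?thesis .
  qed
  have qc: "continuous_on UNIV (\<lambda>y. (2 * (q y \<bullet> h)) *\<^sub>R e)" for h unfolding q_def by (intro continuous_intros)
  define G where "G x = (d x \<bullet> e)\<^sup>2 * (z x \<bullet> z x)" for x
  have [measurable]: "G \<in> borel_measurable M" unfolding G_def by measurable
  have G_le: "G x \<le> 2 * L * (norm (z x) * (norm (d x))\<^sup>2)" if "x \<in> space M" for x
  proof -
    have "(d x \<bullet> e)\<^sup>2 \<le> (norm (d x))\<^sup>2" using perp_nonneg[of x] by simp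
    moreover have "z x \<bullet> z x \<le> 2 * L * norm (z x)" using norm_z[OF that]
      by (simp add: power2_norm_eq_inner[symmetric] power2_eq_square mult_right_mono)
    ultimately have "G x \<le> (norm (d x))\<^sup>2 * (2 * L * norm (z x))" unfolding G_def by (intro mult_mono) auto
    then show ?thesis by (simp add: mult_ac)
  qed
  have G0: "0 \<le> G x" for x by (simp add: G_def)
  have intG: "integrable M (\<lambda>x. hat a b (t x) * G x)" if "0 < a" "a < b" for a b
  proof (rule Bochner_Integration.integrable_bound)
    show "integrable M (\<lambda>x. 2 * L * (hat a b (t x) * (norm (z x) * (norm (d x))\<^sup>2)))"
      using hat_range[OF that] by (intro integrable_mult_right flux_integrable) auto
    show "AE x in M. norm (hat a b (t x) * G x) \<le> norm (2 * L * (hat a b (t x) * (norm (z x) * (norm (d x))\<^sup>2)))"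
    proof (rule AE_I2)
      fix x assume "x \<in> space M"
      from mult_left_mono[OF G_le[OF this], of "hat a b (t x)"]
      show "norm (hat a b (t x) * G x) \<le> norm (2 * L * (hat a b (t x) * (norm (z x) * (norm (d x))\<^sup>2)))"
        using hat_range[OF that, of "t x"] G0[of x] pars by (simp add: abs_mult mult_ac)
    qed
  qed measurable
  have main: "AE x in M. t x \<in> {b1<..<s} \<longrightarrow> z x = 0" if b1: "0 < b1" "b1 < s" for b1
  proof -
    have eq: "(LINT x|M. hat b1 s (t x) * G x) \<le> 24 * L * C * a" if a: "0 < a" "2 * a < b1" "3 * a \<le> s1" for a
    proof -
      obtain f where [measurable]: "f \<in> borel_measurable borel" and f: "\<And>u. u \<notin> {min a b1..max (2 * a) s} \<Longrightarrow> f u = 0"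
        and st: "(LINT x|M. (hat a (2 * a) (t x) - hat b1 s (t x)) * (d x \<bullet> e) * (((q (Y x) \<bullet> q (Y x)) *\<^sub>R e) \<bullet> d x) + f (t x) * (((2 * (q (Y x) \<bullet> d x)) *\<^sub>R e) \<bullet> d x)) = 0"
        using two_bumps[OF hat_bump hat_bump _ _ X qc, of a "2 * a" b1 s] a b1 s by fastforce
      have iG: "integrable M (\<lambda>x. hat a (2 * a) (t x) * G x - hat b1 s (t x) * G x)" using a b1 by (intro Bochner_Integration.integrable_diff intG) auto
      have ae: "AE x in M. (hat a (2 * a) (t x) - hat b1 s (t x)) * (d x \<bullet> e) * (((q (Y x) \<bullet> q (Y x)) *\<^sub>R e) \<bullet> d x) + f (t x) * (((2 * (q (Y x) \<bullet> d x)) *\<^sub>R e) \<bullet> d x)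
          = hat a (2 * a) (t x) * G x - hat b1 s (t x) * G x"
        using s'(2)
      proof eventually_elim
        case (elim x)
        \<comment> \<open>Below s' the weight is parallel to e and orthogonal to z; from s' on f
          vanishes, since both slices end at or below s < s'.\<close>
        have "f (t x) * (q (Y x) \<bullet> d x) = 0"
        proof (cases "t x < s'")
          case True
          then show ?thesis using elim perp_zero_inner[of x] by (simp add: q_def)
        next
          case False
          then show ?thesis using f[of "t x"] a b1 s by auto
        qed
        then show ?case by (auto simp: G_def q_def power2_eq_square inner_commute algebra_simps)
      qed
      have "(LINT x|M. hat a (2 * a) (t x) * G x - hat b1 s (t x) * G x) = 0"
      proof -
        have "(LINT x|M. hat a (2 * a) (t x) * G x - hat b1 s (t x) * G x) = (LINT x|M. (hat a (2 * a) (t x) - hat b1 s (t x)) * (d x \<bullet> e) * (((q (Y x) \<bullet> q (Y x)) *\<^sub>R e) \<bullet> d x) + f (t x) * (((2 * (q (Y x) \<bullet> d x)) *\<^sub>R e) \<bullet> d x))"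
          
            by (rule integral_cong_AE; (unfold q_def, measurable)?) (use ae in \<open>auto simp: q_def eq_commute\<close>)
        then show ?thesis using st by simp
      qed
      then have "(LINT x|M. hat b1 s (t x) * G x) = (LINT x|M. hat a (2 * a) (t x) * G x)"
        using intG a b1 by simp
      also have "\<dots> \<le> (LINT x|M. 2 * L * (hat a (2 * a) (t x) * (norm (z x) * (norm (d x))\<^sup>2)))"
      proof (rule integral_mono)
        show "integrable M (\<lambda>x. hat a (2 * a) (t x) * G x)" using a by (intro intG) auto
        show "integrable M (\<lambda>x. 2 * L * (hat a (2 * a) (t x) * (norm (z x) * (norm (d x))\<^sup>2)))"
          using hat_range[of a "2 * a"] a by (intro integrable_mult_right flux_integrable) auto
        show "hat a (2 * a) (t x) * G x \<le> 2 * L * (hat a (2 * a) (t x) * (norm (z x) * (norm (d x))\<^sup>2))" if "x \<in> space M" for x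
          using mult_left_mono[OF G_le[OF that], of "hat a (2 * a) (t x)"] hat_range[of a "2 * a" "t x"] a by (simp add: mult_ac)
      qed
      also have "\<dots> = 2 * L * (LINT x|M. hat a (2 * a) (t x) * (norm (z x) * (norm (d x))\<^sup>2))" by simp
      also have "\<dots> \<le> 2 * L * (12 * C * 1 * a)"
        using a s1 pars by (intro mult_left_mono hat_flux) auto
      finally show ?thesis by simp
    qed
    have nn: "AE x in M. 0 \<le> hat b1 s (t x) * G x" using hat_range[OF b1] G0 by (intro AE_I2) auto
    have "(LINT x|M. hat b1 s (t x) * G x) \<le> 0"
    proof (rule field_le_epsilon)
      fix B :: real assume B: "0 < B"
      define a where "a = min (B / (24 * L * C)) (min (b1/3) (s1/3))"
      have a: "0 < a" "2 * a < b1" "3 * a \<le> s1" using B pars b1 s1 by (auto simp: a_def)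
      have "24 * L * C * a \<le> 24 * L * C * (B / (24 * L * C))" using pars by (intro mult_left_mono) (auto simp: a_def)
      also have "\<dots> = B" using pars by simp
      finally show "(LINT x|M. hat b1 s (t x) * G x) \<le> 0 + B" using eq[OF a] by simp
    qed
    then have "(LINT x|M. hat b1 s (t x) * G x) = 0" using integral_nonneg_AE[OF nn] by linarith
    then have "AE x in M. hat b1 s (t x) * G x = 0"
      by (subst (asm) integral_nonneg_eq_0_iff_AE[OF intG nn]) (use b1 in auto)
    then show ?thesis using s'(2) d_bound
    proof eventually_elim
      case (elim x)
      show ?case
      proof
        assume tx: "t x \<in> {b1<..<s}"
        then have "0 < hat b1 s (t x)" by (auto intro: hat_pos)
        then have "G x = 0" using elim by simp
        moreover have "(d x \<bullet> e)\<^sup>2 = (norm (d x))\<^sup>2" using elim tx s by auto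
        ultimately show "z x = 0" using elim by (auto simp: G_def)
      qed
    qed
  qed
  \<comment> \<open>Countably many lower cuts decreasing to 0 reach every positive height with a
    single null set.\<close>
  have "AE x in M. \<forall>n::nat. t x \<in> {s / (real n + 2)<..<s} \<longrightarrow> z x = 0"
    unfolding AE_all_countable
  proof (intro allI main)
    fix n :: nat
    show "0 < s / (real n + 2)" using s by simp
    show "s / (real n + 2) < s" using divide_strict_left_mono[of 1 "real n + 2" s] s by simp
  qed
  then have "AE x in M. t x < s \<longrightarrow> z x = 0"
    using AE_space
  proof eventually_elim
    case (elim x)
    have "0 < t x" using t_range elim by blast
    moreover have "(\<lambda>n. s / (real n + 2)) \<longlonglongrightarrow> 0"
      using LIMSEQ_ignore_initial_segment[OF lim_const_over_n, of s 2] by (simp add: add.commute)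
    ultimately have "\<forall>\<^sub>F n in sequentially. s / (real n + 2) < t x" by (simp add: order_tendstoD)
    then obtain n :: nat where "s / (real n + 2) < t x" by (auto simp: eventually_sequentially)
    then show ?case using elim(1) by auto
  qed
  then show ?thesis using s by (intro exI[of _ s]) auto
qed

text \<open>Besides concentration on the ray, conservation of flux spreads mass: below s the flux
  density is the squared norm of d and at least 1, so if one slab carries mass, then every slab
  does.\<close>

lemma sector_structure:
  "\<exists>s>0. s \<le> r1 \<and> (AE x in M. t x < s \<longrightarrow> z x = 0) \<and>
    (\<forall>b1 b2 c1 c2. 0 < b1 \<longrightarrow> b1 < b2 \<longrightarrow> b2 < s \<longrightarrow> 0 < c1 \<longrightarrow> c1 < c2 \<longrightarrow> c2 < s \<longrightarrow>
      0 < measure M {x\<in>space M. t x \<in> {b1<..<b2}} \<longrightarrow> 0 < measure M {x\<in>space M. t x \<in> {c1<..<c2}})"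
proof -
  obtain s' where s': "0 < s'" "AE x in M. t x < s' \<longrightarrow> perp x = 0" using perp_null by blast
  obtain s1 where s1: "0 < s1" "s1 \<le> r1" "AE x in M. t x < s1 \<longrightarrow> z x = 0" using z_null by blast
  define s where "s = min s' s1"
  have s: "0 < s" "s \<le> r1" "s \<le> s'" "s \<le> s1" using s' s1 by (auto simp: s_def)
  have spread: "0 < measure M {x\<in>space M. t x \<in> {c1<..<c2}}" 
    if bc: "0 < b1" "b1 < b2" "b2 < s" "0 < c1" "c1 < c2" "c2 < s" and pos: "0 < measure M {x\<in>space M. t x \<in> {b1<..<b2}}"
    for b1 b2 c1 c2
  proof (rule ccontr)
    assume "\<not> 0 < measure M {x\<in>space M. t x \<in> {c1<..<c2}}"
    then have "measure M {x\<in>space M. t x \<in> {c1<..<c2}} = 0" by (simp add: zero_less_measure_iff)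
    then have "emeasure M {x\<in>space M. t x \<in> {c1<..<c2}} = 0" by (simp add: emeasure_eq_measure)
    then have "AE x in M. x \<notin> {x\<in>space M. t x \<in> {c1<..<c2}}" by (intro AE_not_in) auto
    then have "AE x in M. hat c1 c2 (t x) * (d x \<bullet> e)\<^sup>2 = 0"
      using AE_space
    proof eventually_elim
      case (elim x)
      then have "t x \<le> c1 \<or> c2 \<le> t x" by auto
      then have "(t x - c1) * (c2 - t x) \<le> 0" using bc by (auto simp: mult_le_0_iff)
      then show ?case by (simp add: hat_def)
    qed
    then have "(LINT x|M. hat c1 c2 (t x) * (d x \<bullet> e)\<^sup>2) = 0" by (rule integral_eq_zero_AE)
    then have 0: "(LINT x|M. hat b1 b2 (t x) * (d x \<bullet> e)\<^sup>2) = 0"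
      using mass_constancy[of b1 b2 c1 c2] bc s by simp
    have nn: "AE x in M. 0 \<le> hat b1 b2 (t x) * (d x \<bullet> e)\<^sup>2" using hat_range[OF bc(1,2)] by (intro AE_I2) auto
    have "integrable M (\<lambda>x. hat b1 b2 (t x) * (d x \<bullet> e)\<^sup>2)"
    proof (rule bdd_integrable)
      fix x assume "norm (d x) \<le> L"
      have "\<bar>d x \<bullet> e\<bar> \<le> L" using de_le[of x] \<open>norm (d x) \<le> L\<close> by simp
      then have "(d x \<bullet> e)\<^sup>2 \<le> L\<^sup>2" by (metis abs_ge_zero power2_abs power_mono)
      then show "\<bar>hat b1 b2 (t x) * (d x \<bullet> e)\<^sup>2\<bar> \<le> 2 / (b2 - b1) * L\<^sup>2"
        unfolding abs_mult using hat_range[OF bc(1,2), of "t x"] bc by (intro mult_mono) auto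
    qed measurable
    from integral_nonneg_eq_0_iff_AE[OF this nn] 0 have "AE x in M. hat b1 b2 (t x) * (d x \<bullet> e)\<^sup>2 = 0" by simp
    then have "AE x in M. t x \<notin> {b1<..<b2}"
      using s'(2) d_bound
    proof eventually_elim
      case (elim x)
      show ?case
      proof
        assume tx: "t x \<in> {b1<..<b2}"
        then have "0 < hat b1 b2 (t x)" by (auto intro: hat_pos)
        moreover have "(d x \<bullet> e)\<^sup>2 = (norm (d x))\<^sup>2" using elim tx bc s by auto
        ultimately show False using elim by auto
      qed
    qed
    then have "emeasure M {x\<in>space M. t x \<in> {b1<..<b2}} = 0" by (intro emeasure_eq_0_AE)
    then show False using pos by (simp add: measure_def)
  qed
  have "AE x in M. t x < s \<longrightarrow> z x = 0" using s1(3) by eventually_elim (use s in auto)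
  then show ?thesis using s spread by (intro exI[of _ s]) blast
qed

end

section \<open>Star structure of the support\<close>

lemma max0_sq_deriv: "((\<lambda>s::real. (max 0 s)\<^sup>2) has_real_derivative 2 * max 0 s) (at s)"
proof -
  have "((\<lambda>x::real. if x \<in> {..0} then 0 else x\<^sup>2) has_vector_derivative (if s \<in> {..0} then 0 else 2 * s)) (at s within UNIV)"
    by (rule has_vector_derivative_If_within_closures[where T="{0..}" and S="{..0}"])
      (auto simp flip: has_real_derivative_iff_has_vector_derivative intro!: derivative_eq_intros split: if_splits)
  moreover have "(\<lambda>x::real. if x \<in> {..0} then 0 else x\<^sup>2) = (\<lambda>s. (max 0 s)\<^sup>2)" by (auto simp: max_def)
  moreover have "(if s \<in> {..0} then 0 else 2 * s) = 2 * max 0 s" by auto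
  ultimately show ?thesis by (simp add: has_real_derivative_iff_has_vector_derivative)
qed

text \<open>Stationarity accepts C^1 fields, so squares of positive parts are smooth enough as
  building blocks: a finite sum g of bumps on balls that cover K is at least 9/16 on K and vanishes
  off the enlarged balls.\<close>

lemma C1_cutoff:
  fixes K Q :: "'b::euclidean_space set"
  assumes "compact K" "open Q" "K \<subseteq> Q"
  shows "\<exists>\<eta> \<eta>' K2. (\<forall>y. (\<eta> has_derivative (\<lambda>h. \<eta>' y \<bullet> h)) (at y)) \<and> continuous_on UNIV \<eta>' \<and> compact K2 \<and> K2 \<subseteq> Q \<and>
    (\<forall>y. y \<notin> K2 \<longrightarrow> \<eta> y = (0::real) \<and> \<eta>' y = 0) \<and> (\<forall>y\<in>K. \<eta> y = 1 \<and> \<eta>' y = 0)"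
proof -
  have "\<forall>k\<in>K. \<exists>r>0. cball k r \<subseteq> Q" using assms by (meson open_contains_cball subsetD)
  then obtain r where r: "\<And>k. k \<in> K \<Longrightarrow> 0 < r k \<and> cball k (r k) \<subseteq> Q" by metis
  have "K \<subseteq> (\<Union>k\<in>K. ball k (r k / 2))" using r by force
  then obtain F where F: "F \<subseteq> K" "finite F" "K \<subseteq> (\<Union>k\<in>F. ball k (r k / 2))"
    using compactE_image[OF assms(1), of K "\<lambda>k. ball k (r k / 2)"] by blast
  define P where "P s = (max 0 s)\<^sup>2" for s :: real
  have Pd: "(P has_real_derivative 2 * max 0 s) (at s)" for s unfolding P_def by (rule max0_sq_deriv)
  define w where "w k y = 1 - (norm (y - k))\<^sup>2 / (r k)\<^sup>2" for k y
  define w' where "w' k y = - (2 / (r k)\<^sup>2) *\<^sub>R (y - k)" for k y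
  have wd: "(w k has_derivative (\<lambda>h. w' k y \<bullet> h)) (at y)" for k y
    unfolding w_def w'_def power2_norm_eq_inner divide_inverse by (auto intro!: derivative_eq_intros simp: inner_commute algebra_simps)
  define g where "g y = (\<Sum>k\<in>F. P (w k y))" for y
  define g' where "g' y = (\<Sum>k\<in>F. (2 * max 0 (w k y)) *\<^sub>R w' k y)" for y
  have gd: "(g has_derivative (\<lambda>h. g' y \<bullet> h)) (at y)" for y
  proof -
    have "((\<lambda>y. P (w k y)) has_derivative (\<lambda>h. 2 * max 0 (w k y) * (w' k y \<bullet> h))) (at y)" for k
      using has_derivative_compose[OF wd Pd[unfolded has_field_derivative_def]] .
    then show ?thesis unfolding g_def g'_def inner_sum_left inner_scaleR_left by (intro has_derivative_sum)
  qed
  \<comment> \<open>Once g exceeds 1/2 the positive part is zero, so \<eta> is locally flat with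
    value 1 there; where g and its gradient vanish, so do \<eta> and its gradient.\<close>
  define \<eta> where "\<eta> y = 1 - P (1 - 2 * g y)" for y
  define \<eta>' where "\<eta>' y = (4 * max 0 (1 - 2 * g y)) *\<^sub>R g' y" for y
  have \<eta>d: "(\<eta> has_derivative (\<lambda>h. \<eta>' y \<bullet> h)) (at y)" for y
  proof -
    have "((\<lambda>y. 1 - 2 * g y) has_derivative (\<lambda>h. - (2 * (g' y \<bullet> h)))) (at y)" by (auto intro!: derivative_eq_intros gd)
    from has_derivative_compose[OF this Pd[unfolded has_field_derivative_def]]
    have "((\<lambda>y. 1 - P (1 - 2 * g y)) has_derivative (\<lambda>h. 0 - 2 * max 0 (1 - 2 * g y) * (- (2 * (g' y \<bullet> h))))) (at y)"
      by (rule has_derivative_diff[OF has_derivative_const])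
    then show ?thesis unfolding \<eta>_def \<eta>'_def by (simp add: mult_ac)
  qed
  have wc: "continuous_on UNIV (w k)" "continuous_on UNIV (w' k)" for k
    unfolding w_def w'_def by (auto intro!: continuous_intros simp: divide_inverse)
  have gc: "continuous_on UNIV g" "continuous_on UNIV g'"
    unfolding g_def g'_def P_def by (intro continuous_intros wc)+
  have \<eta>c: "continuous_on UNIV \<eta>'" unfolding \<eta>'_def by (intro continuous_intros gc)
  define K2 where "K2 = (\<Union>k\<in>F. cball k (r k))"
  have K2: "compact K2" "K2 \<subseteq> Q" unfolding K2_def using F r by (auto intro!: compact_UN)
  have out: "\<eta> y = 0 \<and> \<eta>' y = 0" if "y \<notin> K2" for y
  proof -
    have "max 0 (w k y) = 0" if "k \<in> F" for k
    proof -
      have "r k < norm (y - k)" "0 < r k" using \<open>y \<notin> K2\<close> that F r by (auto simp: K2_def dist_norm norm_minus_commute)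
      then have "(r k)\<^sup>2 \<le> (norm (y - k))\<^sup>2" by (intro power_mono) auto
      then have "1 \<le> (norm (y - k))\<^sup>2 / (r k)\<^sup>2" using \<open>0 < r k\<close> by simp
      then show ?thesis by (simp add: w_def)
    qed
    then have "g y = 0" "g' y = 0" by (simp_all add: g_def g'_def P_def)
    then show ?thesis by (simp add: \<eta>_def \<eta>'_def P_def)
  qed
  have inn: "\<eta> y = 1 \<and> \<eta>' y = 0" if yK: "y \<in> K" for y
  proof -
    obtain k where k: "k \<in> F" "dist k y < r k / 2" using subsetD[OF F(3) yK] by auto
    have "0 < r k" using k F r by auto
    have "(norm (y - k))\<^sup>2 \<le> (r k / 2)\<^sup>2" using k by (intro power_mono) (auto simp: dist_norm norm_minus_commute)
    then have "(norm (y - k))\<^sup>2 / (r k)\<^sup>2 \<le> 1/4" using \<open>0 < r k\<close> by (simp add: field_simps)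
    then have "3/4 \<le> w k y" by (simp add: w_def)
    then have "(3/4)\<^sup>2 \<le> P (w k y)" unfolding P_def by (intro power_mono) auto
    also have "P (w k y) \<le> g y" unfolding g_def by (rule member_le_sum) (use k F in \<open>auto simp: P_def\<close>)
    finally have "1 - 2 * g y \<le> 0" by (simp add: power2_eq_square)
    then show ?thesis by (simp add: \<eta>_def \<eta>'_def P_def)
  qed
  show ?thesis using \<eta>d \<eta>c K2 out inn by blast
qed

lemma finite_gap:
  assumes "finite F" "\<And>v. v \<in> F \<Longrightarrow> 0 \<le> (f v :: real)"
  shows "\<exists>c>0. \<forall>v\<in>F. f v = 0 \<or> c \<le> f v"
  using assms
proof (induction F)
  case empty
  then show ?case by (intro exI[of _ 1]) auto
next
  case (insert a F)
  then obtain c where c: "c > 0" "\<forall>v\<in>F. f v = 0 \<or> c \<le> f v" by auto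
  show ?case
  proof (cases "f a = 0")
    case True then show ?thesis using c by auto
  next
    case False
    then have "0 < f a" using insert.prems[of a] by simp
    then show ?thesis using c by (intro exI[of _ "min c (f a)"]) (auto simp: min_le_iff_disj)
  qed
qed

text \<open>The open one-sided cone around e whose opening angle has cosine 1 - \<kappa>, for unit e
  and \<kappa> below 1. The strict inequality excludes the apex.\<close>

definition ncone :: "real \<Rightarrow> 'b::real_inner \<Rightarrow> 'b set" where
  "ncone \<kappa> e = {y. (1 - \<kappa>) * norm y < y \<bullet> e}"

text \<open>For y in the cone of e, the squared distance of y/|y| from e is 2 minus twice the
  cosine, hence less than 2 \<kappa>, at most c^2 / 4. A common point would put two directions at
  distance less than the minimal distance c.\<close>

lemma cones_disjoint:
  fixes D :: "'b::real_inner set"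
  assumes "finite D" "\<And>e. e \<in> D \<Longrightarrow> norm e = 1"
  shows "\<exists>\<kappa>>0. \<kappa> \<le> 1/2 \<and> (\<forall>e\<in>D. \<forall>e'\<in>D. e \<noteq> e' \<longrightarrow> ncone \<kappa> e \<inter> ncone \<kappa> e' = {})"
proof -
  have "\<exists>c>0. \<forall>v\<in>D \<times> D. dist (fst v) (snd v) = 0 \<or> c \<le> dist (fst v) (snd v)"
    by (rule finite_gap) (use assms in auto)
  then obtain c where c: "c > 0" "\<And>e e'. e \<in> D \<Longrightarrow> e' \<in> D \<Longrightarrow> e \<noteq> e' \<Longrightarrow> c \<le> dist e e'" by force
  define \<kappa> where "\<kappa> = min (1/2) (c\<^sup>2 / 8)"
  have False if y: "y \<in> ncone \<kappa> e" "y \<in> ncone \<kappa> e'" and e: "e \<in> D" "e' \<in> D" "e \<noteq> e'" for y e e'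
  proof -
    have b: "(dist (y /\<^sub>R norm y) e)\<^sup>2 < c\<^sup>2 / 4 \<and> y \<noteq> 0" if "y \<in> ncone \<kappa> e" "e \<in> D" for e
    proof -
      have y0: "y \<noteq> 0" using that by (auto simp: ncone_def)
      have "(1 - \<kappa>) < (y /\<^sub>R norm y) \<bullet> e" using that y0 by (simp add: ncone_def field_simps)
      moreover have "(dist (y /\<^sub>R norm y) e)\<^sup>2 = 2 - 2 * ((y /\<^sub>R norm y) \<bullet> e)"
      proof -
        define w where "w = y /\<^sub>R norm y"
        have "norm w = 1" using y0 by (simp add: w_def)
        then have "w \<bullet> w = 1" "e \<bullet> e = 1" using assms(2)[OF that(2)] by (simp_all add: norm_eq_1)
        then show ?thesis unfolding w_def[symmetric] dist_norm power2_norm_eq_inner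
          by (simp add: inner_diff_left inner_diff_right inner_commute)
      qed
      ultimately show ?thesis using y0 by (auto simp: \<kappa>_def)
    qed
    have h: "dist (y /\<^sub>R norm y) e < c / 2" if "y \<in> ncone \<kappa> e" "e \<in> D" for e
      by (rule power2_less_imp_less) (use b[OF that] c in \<open>auto simp: power_divide\<close>)
    have "dist e e' < c" using h[OF y(1) e(1)] h[OF y(2) e(2)] dist_triangle2[of e e' "y /\<^sub>R norm y"] by (simp add: dist_commute)
    then show False using c(2)[OF e] by simp
  qed
  then show ?thesis using c by (intro exI[of _ \<kappa>]) (auto simp: \<kappa>_def)
qed

section \<open>Stationarity restricted to a cone\<close>

context lattice_stationary
begin

text \<open>Monotonicity handles radii up to R/2 and the trivial bound by the total mass the larger
  ones; C is large enough for both.\<close>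

lemma upper_density:
  assumes "cball p R \<subseteq> W" "0 < R"
  shows "\<exists>C>0. \<forall>s>0. measure nu (Yball p s) \<le> C * s"
proof -
  interpret nu: finite_measure nu by (rule finite_nu)
  define C where "C = 4 * I R p + 2 * measure nu (space nu) / R + 1"
  have I0: "0 \<le> I R p" using assms(2) by (rule I_nonneg)
  have "measure nu (Yball p s) \<le> C * s" if "s > 0" for s
  proof (cases "2 * s \<le> R")
    case True
    have "measure nu (Yball p s) \<le> 4 * s * I (2 * s) p" by (rule nu_le_I[OF that])
    also have "\<dots> \<le> 4 * s * I R p" using that True assms by (intro mult_left_mono monotonicity) auto
    also have "\<dots> \<le> C * s" using that assms by (auto simp: C_def algebra_simps)
    finally show ?thesis .
  next
    case False
    have "measure nu (Yball p s) \<le> measure nu (space nu) * 1" using nu.bounded_measure by simp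
    also have "\<dots> \<le> measure nu (space nu) * (2 * s / R)" using False assms by (intro mult_left_mono) (auto simp: field_simps)
    also have "\<dots> \<le> C * s" using that assms I0 by (auto simp: C_def algebra_simps)
    finally show ?thesis .
  qed
  moreover have "0 < C" using I0 assms by (auto simp: C_def intro!: add_nonneg_pos)
  ultimately show ?thesis by blast
qed

text \<open>Truncated by the height along e and not by the norm, to agree with the height coordinate
  of \<open>sector\<close>; by \<open>Sec_bound\<close> the two are comparable.\<close>

definition Sec :: "'b \<Rightarrow> real \<Rightarrow> 'b \<Rightarrow> real \<Rightarrow> 'b set" where
  "Sec p \<kappa> e s = {y. y - p \<in> ncone \<kappa> e \<and> (y - p) \<bullet> e < s}"

lemma open_Sec: "open (Sec p \<kappa> e s)"
  unfolding Sec_def ncone_def mem_Collect_eq by (intro open_Collect_conj open_Collect_less continuous_intros)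

lemma Sec_bound:
  assumes "\<kappa> \<le> 1/2" "y \<in> Sec p \<kappa> e s"
  shows "0 < (y - p) \<bullet> e" "norm (y - p) \<le> 2 * ((y - p) \<bullet> e)" "norm (y - p) < 2 * s"
proof -
  have 1: "(1 - \<kappa>) * norm (y - p) < (y - p) \<bullet> e" "(y - p) \<bullet> e < s" using assms by (auto simp: Sec_def ncone_def)
  have "(1/2) * norm (y - p) \<le> (1 - \<kappa>) * norm (y - p)" using assms by (intro mult_right_mono) auto
  then show "norm (y - p) \<le> 2 * ((y - p) \<bullet> e)" "norm (y - p) < 2 * s" using 1 by auto
  have "0 \<le> (1/2) * norm (y - p)" by simp
  then show "0 < (y - p) \<bullet> e" using 1 \<open>(1/2) * norm (y - p) \<le> (1 - \<kappa>) * norm (y - p)\<close> by linarith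
qed

text \<open>The field f(t) X does not vanish at the lateral boundary of the sector. The measure
  does: it sits in the cone of half the parameter, so a cutoff that is 1 on that cone and 0 near the
  boundary leaves the first variation unchanged.\<close>

lemma sector_stat:
  assumes \<kappa>: "0 < \<kappa>" "\<kappa> \<le> 1/2" and e: "norm e = 1" and SW: "Sec p \<kappa> e r1 \<subseteq> W"
    and thin: "\<And>x. x \<in> space M \<Longrightarrow> Y x \<in> Sec p \<kappa> e r1 \<Longrightarrow> Y x - p \<in> ncone (\<kappa>/2) e"
    and ab: "0 < a" "a < b" "b < r1" and f: "\<And>t. (f has_real_derivative f' t) (at t)" "continuous_on UNIV f'"
      "\<And>t. t \<notin> {a..b} \<Longrightarrow> f t = 0 \<and> f' t = 0"
    and X: "\<And>y. (X has_derivative X' y) (at y)" "\<And>h. continuous_on UNIV (\<lambda>y. X' y h)"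
  shows "(LINT x|M. indicator {x\<in>space M. Y x \<in> Sec p \<kappa> e r1} x *\<^sub>R (f' ((Y x - p) \<bullet> e) * (d x \<bullet> e) * (X (Y x - p) \<bullet> d x)
     + f ((Y x - p) \<bullet> e) * (X' (Y x - p) (d x) \<bullet> d x))) = 0"
proof -
  define Q where "Q = Sec p \<kappa> e r1"
  define S0 where "S0 = {y. (1 - \<kappa>/2) * norm (y - p) \<le> (y - p) \<bullet> e \<and> a \<le> (y - p) \<bullet> e \<and> (y - p) \<bullet> e \<le> b}"
  have S0Q: "S0 \<subseteq> Q"
  proof
    fix y assume y: "y \<in> S0"
    then have "y \<noteq> p" using ab by (auto simp: S0_def)
    then have "(1 - \<kappa>) * norm (y - p) < (1 - \<kappa>/2) * norm (y - p)" using \<kappa> by (intro mult_strict_right_mono) auto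
    then show "y \<in> Q" using y ab by (auto simp: S0_def Q_def Sec_def ncone_def)
  qed
  have "closed S0" unfolding S0_def by (intro closed_Collect_conj closed_Collect_le continuous_intros)
  moreover have "bounded S0"
  proof (rule bounded_subset[of "cball p (2 * r1)"])
    show "S0 \<subseteq> cball p (2 * r1)" using S0Q Sec_bound(3)[OF \<kappa>(2)] unfolding Q_def by (force simp: dist_norm norm_minus_commute)
  qed auto
  ultimately have S0c: "compact S0" by (simp add: compact_eq_bounded_closed)
  obtain T where T: "closed T" "Y ` space M = W \<inter> T" using image_closed by (auto simp: closedin_closed)
  \<comment> \<open>Every image point in the sector with height in {a..b} lies in this compact
    subset of the open sector. On it the cutoff is 1 with zero gradient and drops out.\<close>
  define K where "K = S0 \<inter> T"
  have K: "compact K" "K \<subseteq> Q" using S0c T S0Q by (auto simp: K_def)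
  have "open Q" unfolding Q_def by (rule open_Sec)
  from C1_cutoff[OF K(1) this K(2)] obtain \<eta> \<eta>' K2 where \<eta>: "\<And>y. (\<eta> has_derivative (\<lambda>h. \<eta>' y \<bullet> h)) (at y)" "continuous_on UNIV \<eta>'"
    "compact K2" "K2 \<subseteq> Q" "\<And>y. y \<notin> K2 \<Longrightarrow> \<eta> y = (0::real) \<and> \<eta>' y = 0" "\<And>y. y \<in> K \<Longrightarrow> \<eta> y = 1 \<and> \<eta>' y = 0"
    by (elim exE conjE) blast
  define V where "V y = (\<eta> y * f ((y - p) \<bullet> e)) *\<^sub>R X (y - p)" for y
  define V' where "V' y h = (\<eta> y * f ((y - p) \<bullet> e)) *\<^sub>R X' (y - p) h + (\<eta> y * (f' ((y - p) \<bullet> e) * (h \<bullet> e)) + (\<eta>' y \<bullet> h) * f ((y - p) \<bullet> e)) *\<^sub>R X (y - p)" for y h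
  have V: "(V has_derivative V' y) (at y)" for y
  proof -
    have "((\<lambda>y. (y - p) \<bullet> e) has_derivative (\<lambda>h. h \<bullet> e)) (at y)" by (auto intro!: derivative_eq_intros)
    from has_derivative_compose[OF this f(1)[unfolded has_field_derivative_def]]
    have fd: "((\<lambda>y. f ((y - p) \<bullet> e)) has_derivative (\<lambda>h. f' ((y - p) \<bullet> e) * (h \<bullet> e))) (at y)" .
    have "((\<lambda>y. y - p) has_derivative (\<lambda>h. h)) (at y)" by (auto intro!: derivative_eq_intros)
    from has_derivative_compose[OF this X(1)] have Xd: "((\<lambda>y. X (y - p)) has_derivative X' (y - p)) (at y)" .
    show ?thesis unfolding V_def V'_def
      by (rule has_derivative_scaleR[OF has_derivative_mult[OF \<eta>(1) fd] Xd])
  qed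
  have cont: "continuous_on UNIV f" "continuous_on UNIV \<eta>" "continuous_on UNIV X"
    using f(1) apply (meson DERIV_continuous_on has_field_derivative_at_within)
    using \<eta>(1) X(1) by (meson has_derivative_continuous continuous_at_imp_continuous_on)+
  have Vc: "continuous_on UNIV (\<lambda>y. V' y h)" for h
    unfolding V'_def by (intro continuous_intros \<eta>(2) cont continuous_on_compose2[OF cont(1)] continuous_on_compose2[OF f(2)]
        continuous_on_compose2[OF cont(3)] continuous_on_compose2[OF X(2)]) auto
  have "(LINT x|M. V' (Y x) (d x) \<bullet> d x) = 0"
    by (rule stat[OF V Vc \<eta>(3)]) (use \<eta>(4,5) SW in \<open>auto simp: Q_def V_def\<close>)
  moreover have "V' (Y x) (d x) \<bullet> d x = indicator {x\<in>space M. Y x \<in> Sec p \<kappa> e r1} x *\<^sub>R (f' ((Y x - p) \<bullet> e) * (d x \<bullet> e) * (X (Y x - p) \<bullet> d x)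
     + f ((Y x - p) \<bullet> e) * (X' (Y x - p) (d x) \<bullet> d x))" if x: "x \<in> space M" for x
  proof (cases "Y x \<in> Q")
    case False
    then have "Y x \<notin> K2" using \<eta>(4) by blast
    then show ?thesis using False x \<eta>(5) by (simp add: V'_def Q_def)
  next
    case True
    show ?thesis
    proof (cases "(Y x - p) \<bullet> e \<in> {a..b}")
      case False
      then show ?thesis using f(3) by (simp add: V'_def)
    next
      case in_ab: True
      have "Y x \<in> K" using thin[OF x] True in_ab T YW x by (auto simp: K_def S0_def Q_def ncone_def)
      then show ?thesis using True x \<eta>(6) by (simp add: V'_def Q_def inner_add_left algebra_simps)
    qed
  qed
  ultimately show ?thesis by (subst Bochner_Integration.integral_cong[OF refl, symmetric]) auto
qed

end

section \<open>From sectors to the star\<close>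

context lattice_stationary
begin

text \<open>The restriction of M to one cone satisfies the hypotheses of \<open>sector\<close>, and
  its almost everywhere conclusions become pointwise because open neighbourhoods of support points
  have positive mass. Either no point is left or the whole open segment is filled. The statement
  covers all heights up to s so that the finitely many directions can share one radius.\<close>

lemma sector_alternative:
  assumes \<kappa>: "0 < \<kappa>" "\<kappa> \<le> 1/2" and e: "norm e = 1" and r1: "0 < r1" and SW: "Sec p \<kappa> e r1 \<subseteq> W"
    and R: "cball p R \<subseteq> W" "0 < R" and seg: "\<And>t. 0 < t \<Longrightarrow> t < r1 \<Longrightarrow> p + t *\<^sub>R e \<in> W"
    and thin: "\<And>\<kappa>'. 0 < \<kappa>' \<Longrightarrow> \<exists>s>0. \<forall>x\<in>space M. Y x \<in> Sec p \<kappa> e s \<longrightarrow> Y x - p \<in> ncone \<kappa>' e"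
    and thin2: "\<And>x. x \<in> space M \<Longrightarrow> Y x \<in> Sec p \<kappa> e r1 \<Longrightarrow> Y x - p \<in> ncone (\<kappa>/2) e"
    and L: "AE x in M. Y x \<in> Sec p \<kappa> e r1 \<longrightarrow> norm (d x) \<le> L"
  shows "\<exists>s>0. \<forall>s'. 0 < s' \<and> s' \<le> s \<longrightarrow> Y ` space M \<inter> Sec p \<kappa> e s' = {} \<or> Y ` space M \<inter> Sec p \<kappa> e s' = {p + t *\<^sub>R e |t. 0 < t \<and> t < s'}"
proof -
  define A where "A = {x\<in>space M. Y x \<in> Sec p \<kappa> e r1}"
  have "Sec p \<kappa> e r1 \<in> sets borel" using open_Sec by simp
  then have A[measurable]: "A \<in> sets M" unfolding A_def by measurable
  define N where "N = restrict_space M A"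
  have spN: "space N = A" using sets.sets_into_space[OF A] by (auto simp: N_def space_restrict_space)
  have AM: "A \<subseteq> space M" by (rule sets.sets_into_space[OF A])
  have Aint: "A \<inter> space M \<in> sets M" using A by simp
  have AS: "Y x \<in> Sec p \<kappa> e r1" if "x \<in> A" for x using that by (simp add: A_def)
  note bounds = Sec_bound[OF \<kappa>(2)]
  \<comment> \<open>A single constant of \<open>sector\<close> bounds weights and positions: L
    serves the weights, 2 r1 the positions in the sector.\<close>
  define Lb where "Lb = max 1 (max L (2 * r1))"
  obtain C where C: "0 < C" "\<And>s. 0 < s \<Longrightarrow> measure nu (Yball p s) \<le> C * s" using upper_density[OF R] by blast
  have de: "(v \<bullet> e)\<^sup>2 \<le> (norm v)\<^sup>2" for v
    using Cauchy_Schwarz_ineq2[of v e] e by (simp add: abs_le_square_iff[symmetric])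
  \<comment> \<open>Finitely many lattice vectors have norm at most Lb, so the nonzero ones among
    their squared transversal parts have a positive lower bound. This is where discreteness
    enters.\<close>
  have "\<exists>c>0. \<forall>v\<in>\<Lambda> \<inter> cball 0 Lb. (norm v)\<^sup>2 - (v \<bullet> e)\<^sup>2 = 0 \<or> c \<le> (norm v)\<^sup>2 - (v \<bullet> e)\<^sup>2"
    by (rule finite_gap[OF \<Lambda>_finite]) (use de in auto)
  then obtain c0 where c0: "0 < c0" "\<And>v. v \<in> \<Lambda> \<Longrightarrow> norm v \<le> Lb \<Longrightarrow> (norm v)\<^sup>2 - (v \<bullet> e)\<^sup>2 = 0 \<or> c0 \<le> (norm v)\<^sup>2 - (v \<bullet> e)\<^sup>2"
    by auto
  have AEN: "AE x in N. d x \<in> \<Lambda> \<and> 1 \<le> norm (d x) \<and> norm (d x) \<le> Lb"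
    unfolding N_def AE_restrict_space_iff[OF Aint]
    using d_AE L AE_space by eventually_elim (auto simp: A_def Lb_def)
  have fM: "finite_measure M" by (rule finite_measure_axioms)
  have fN: "finite_measure N" unfolding N_def by (rule finite_measure_restrict_space) (use A in \<open>auto simp: finite_measure_axioms\<close>)
  interpret sector N "\<lambda>x. Y x - p" d e r1 Lb "2 * C" C0 c0
  proof (intro sector.intro sector_axioms.intro fN)
    show "(\<lambda>x. Y x - p) \<in> borel_measurable N" "d \<in> borel_measurable N"
      unfolding N_def by (intro measurable_restrict_space1; measurable)+
    show "norm e = 1" by fact
    show "0 < (Y x - p) \<bullet> e \<and> (Y x - p) \<bullet> e < r1" if "x \<in> space N" for x
      using bounds(1)[OF AS] AS[of x] that by (auto simp: spN Sec_def)
    show "AE x in N. 1 \<le> norm (d x) \<and> norm (d x) \<le> Lb" using AEN by eventually_elim auto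
    show "0 < r1" "1 \<le> Lb" "0 < 2 * C" "0 < C0" "0 < c0" using r1 C C0 c0 by (auto simp: Lb_def)
    show "norm (Y x - p) \<le> Lb" if "x \<in> space N" for x
      using bounds(3)[OF AS] that by (fastforce simp: spN Lb_def)
    show "AE x in N. (norm (d x))\<^sup>2 - (d x \<bullet> e)\<^sup>2 = 0 \<or> c0 \<le> (norm (d x))\<^sup>2 - (d x \<bullet> e)\<^sup>2"
      using AEN by eventually_elim (use c0 in blast)
  next
    fix \<epsilon> :: real assume \<epsilon>: "0 < \<epsilon>"
    \<comment> \<open>With y = Y x - p and height t, in a cone of parameter \<kappa>' the squared
      transversal part |y|^2 - t^2 is at most 2 \<kappa>' |y|^2, and |y| is at most 2 t, which gives
      8 \<kappa>' t^2.\<close>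
    define \<kappa>' where "\<kappa>' = min 1 (\<epsilon>\<^sup>2 / 8)"
    have \<kappa>': "0 < \<kappa>'" "\<kappa>' \<le> 1" "8 * \<kappa>' \<le> \<epsilon>\<^sup>2" using \<epsilon> by (auto simp: \<kappa>'_def)
    from thin[OF \<kappa>'(1)] obtain s where s: "s > 0" "\<And>x. x \<in> space M \<Longrightarrow> Y x \<in> Sec p \<kappa> e s \<Longrightarrow> Y x - p \<in> ncone \<kappa>' e" by blast
    show "\<exists>s>0. \<forall>x\<in>space N. (Y x - p) \<bullet> e < s \<longrightarrow> norm (Y x - p - ((Y x - p) \<bullet> e) *\<^sub>R e) \<le> \<epsilon> * ((Y x - p) \<bullet> e)"
    proof (intro exI[of _ s] conjI ballI impI)
      show "0 < s" by fact
      fix x assume x: "x \<in> space N" "(Y x - p) \<bullet> e < s"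
      define y t where "y = Y x - p" and "t = (Y x - p) \<bullet> e"
      have xM: "x \<in> space M" using x AM by (auto simp: spN)
      have "Y x \<in> Sec p \<kappa> e s" using AS[of x] x by (auto simp: spN Sec_def)
      from s(2)[OF xM this] have c: "(1 - \<kappa>') * norm y < t" by (simp add: ncone_def y_def t_def)
      have t: "0 < t" "norm y \<le> 2 * t" using bounds(1,2)[OF AS[of x]] x by (auto simp: spN y_def t_def)
      have "((1 - \<kappa>') * norm y)\<^sup>2 \<le> t\<^sup>2" using c \<kappa>' by (intro power_mono) auto
      moreover have "((1 - \<kappa>') * norm y)\<^sup>2 = (norm y)\<^sup>2 - 2 * \<kappa>' * (norm y)\<^sup>2 + \<kappa>'\<^sup>2 * (norm y)\<^sup>2"
        by (simp add: power2_eq_square algebra_simps)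
      moreover have "0 \<le> \<kappa>'\<^sup>2 * (norm y)\<^sup>2" by simp
      ultimately have "(norm y)\<^sup>2 - t\<^sup>2 \<le> 2 * \<kappa>' * (norm y)\<^sup>2" by linarith
      also have "\<dots> \<le> 2 * \<kappa>' * (2 * t)\<^sup>2" using t \<kappa>' by (intro mult_left_mono power_mono) auto
      also have "\<dots> = 8 * \<kappa>' * t\<^sup>2" by (simp add: power2_eq_square)
      also have "\<dots> \<le> \<epsilon>\<^sup>2 * t\<^sup>2" using \<kappa>' by (intro mult_right_mono) auto
      finally have "(norm y)\<^sup>2 - t\<^sup>2 \<le> (\<epsilon> * t)\<^sup>2" by (simp add: power_mult_distrib)
      moreover have "(norm (y - t *\<^sub>R e))\<^sup>2 = (norm y)\<^sup>2 - t\<^sup>2"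
      proof -
        have "e \<bullet> e = 1" using e by (simp add: norm_eq_1)
        moreover have "t = y \<bullet> e" by (simp add: t_def y_def)
        ultimately show ?thesis unfolding power2_norm_eq_inner
          by (simp add: inner_diff_left inner_diff_right inner_commute power2_eq_square)
      qed
      ultimately have "(norm (y - t *\<^sub>R e))\<^sup>2 \<le> (\<epsilon> * t)\<^sup>2" by linarith
      moreover have "0 \<le> \<epsilon> * t" using \<epsilon> t(1) by simp
      ultimately have "norm (y - t *\<^sub>R e) \<le> \<epsilon> * t" by (rule power2_le_imp_le)
      then show "norm (Y x - p - ((Y x - p) \<bullet> e) *\<^sub>R e) \<le> \<epsilon> * ((Y x - p) \<bullet> e)" by (simp add: y_def t_def)
    qed
  next
    fix s :: real assume s: "0 < s"
    have "(LINT x|N. indicator {x. (Y x - p) \<bullet> e < s} x * (norm (d x))\<^sup>2)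
      = (LINT x|M. indicator A x *\<^sub>R (indicator {x. (Y x - p) \<bullet> e < s} x * (norm (d x))\<^sup>2))"
      unfolding N_def by (rule integral_restrict_space[OF Aint])
    also have "\<dots> \<le> (LINT x|M. indicator (Yball p (2 * s)) x * (norm (d x))\<^sup>2)"
    proof (rule integral_mono)
      have [measurable]: "{x. (Y x - p) \<bullet> e < s} \<inter> space M \<in> sets M" by measurable
      show "integrable M (\<lambda>x. indicator A x *\<^sub>R (indicator {x. (Y x - p) \<bullet> e < s} x * (norm (d x))\<^sup>2))"
        by (rule integrable_bounded_dsq[where C=1]) (auto simp: indicator_def)
      show "integrable M (\<lambda>x. indicator (Yball p (2 * s)) x * (norm (d x))\<^sup>2)"
        by (rule integrable_bounded_dsq[where C=1], measurable) (simp add: indicator_def)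
      fix x assume x: "x \<in> space M"
      have "x \<in> Yball p (2 * s)" if "x \<in> A" "(Y x - p) \<bullet> e < s"
        using bounds(2)[OF AS[OF that(1)]] that(2) x by (auto simp: Yball_def dist_norm norm_minus_commute)
      then show "indicator A x *\<^sub>R (indicator {x. (Y x - p) \<bullet> e < s} x * (norm (d x))\<^sup>2) \<le> indicator (Yball p (2 * s)) x * (norm (d x))\<^sup>2"
        by (auto simp: indicator_def)
    qed
    also have "\<dots> = measure nu (Yball p (2 * s))" by (rule measure_nu[symmetric]) simp
    also have "\<dots> \<le> C * (2 * s)" using C(2)[of "2 * s"] s by simp
    finally show "(LINT x|N. indicator {x. (Y x - p) \<bullet> e < s} x * (norm (d x))\<^sup>2) \<le> 2 * C * s" by simp
  next
    fix B and \<eta> :: real assume B: "B \<in> sets N" "B \<noteq> {}" "0 < \<eta>"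
    have BM: "B \<in> sets M" "B \<subseteq> A" using B(1) sets_restrict_space_iff[OF Aint] by (auto simp: N_def)
    have eq: "(LINT x|N. indicator B x * norm (d x)) = (LINT x|M. indicator B x * norm (d x))"
      unfolding N_def integral_restrict_space[OF Aint] using BM(2)
      by (intro Bochner_Integration.integral_cong) (auto simp: indicator_def)
    from cover[OF BM(1) B(2,3)] obtain a \<rho> where a: "\<And>i::nat. 0 < \<rho> i" "Y ` B \<subseteq> (\<Union>i. ball (a i) (\<rho> i))" "summable \<rho>"
      "suminf \<rho> \<le> C0 * (LINT x|M. indicator B x * norm (d x)) + \<eta>" by blast
    have "(\<lambda>x. Y x - p) ` B \<subseteq> (\<Union>i. ball (a i - p) (\<rho> i))"
    proof
      fix y assume "y \<in> (\<lambda>x. Y x - p) ` B"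
      then obtain x where "x \<in> B" "y = Y x - p" by blast
      then obtain i where "Y x \<in> ball (a i) (\<rho> i)" using a(2) by blast
      then show "y \<in> (\<Union>i. ball (a i - p) (\<rho> i))" using \<open>y = Y x - p\<close> by (auto simp: dist_norm)
    qed
    then show "\<exists>a \<rho>. (\<forall>i::nat. 0 < \<rho> i) \<and> (\<lambda>x. Y x - p) ` B \<subseteq> (\<Union>i. ball (a i) (\<rho> i)) \<and>
        summable \<rho> \<and> suminf \<rho> \<le> C0 * (LINT x|N. indicator B x * norm (d x)) + \<eta>"
      unfolding eq using a by (intro exI[of _ "\<lambda>i. a i - p"] exI[of _ \<rho>]) auto
  next
    fix f f' and a b :: real and X :: "'b \<Rightarrow> 'b" and X'
    assume *: "0 < a" "a < b" "b < r1" "\<And>t. (f has_real_derivative f' t) (at t)" "continuous_on UNIV f'"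
      "\<And>t. t \<notin> {a..b} \<Longrightarrow> f t = 0 \<and> f' t = 0" "\<And>y. (X has_derivative X' y) (at y)" "\<And>h. continuous_on UNIV (\<lambda>y. X' y h)"
    have "(LINT x|M. indicator A x *\<^sub>R (f' ((Y x - p) \<bullet> e) * (d x \<bullet> e) * (X (Y x - p) \<bullet> d x)
       + f ((Y x - p) \<bullet> e) * (X' (Y x - p) (d x) \<bullet> d x))) = 0"
      unfolding A_def by (rule sector_stat[OF \<kappa> e SW thin2 *])
    then show "(LINT x|N. f' ((Y x - p) \<bullet> e) * (d x \<bullet> e) * (X (Y x - p) \<bullet> d x) + f ((Y x - p) \<bullet> e) * (X' (Y x - p) (d x) \<bullet> d x)) = 0"
      unfolding N_def integral_restrict_space[OF Aint] .
  qed
  obtain s where s: "0 < s" "s \<le> r1" and z0: "AE x in N. (Y x - p) \<bullet> e < s \<longrightarrow> Y x - p - ((Y x - p) \<bullet> e) *\<^sub>R e = 0"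
    and spread: "\<And>b1 b2 c1 c2. 0 < b1 \<Longrightarrow> b1 < b2 \<Longrightarrow> b2 < s \<Longrightarrow> 0 < c1 \<Longrightarrow> c1 < c2 \<Longrightarrow> c2 < s \<Longrightarrow>
      0 < measure N {x\<in>space N. (Y x - p) \<bullet> e \<in> {b1<..<b2}} \<Longrightarrow> 0 < measure N {x\<in>space N. (Y x - p) \<bullet> e \<in> {c1<..<c2}}"
    using sector_structure by (elim exE conjE) blast
  \<comment> \<open>Lets an almost everywhere statement be contradicted by one point: if a statement
    fails on an open set of positions, a single support point there already gives that set positive
    mass.\<close>
  have Npos: "0 < measure N {x\<in>space N. Y x \<in> U}" if U: "open U" and x: "x \<in> A" "Y x \<in> U" for U x
  proof -
    have "open (U \<inter> Sec p \<kappa> e r1)" using U open_Sec by blast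
    then obtain \<rho> where \<rho>: "0 < \<rho>" "ball (Y x) \<rho> \<subseteq> U \<inter> Sec p \<kappa> e r1"
      using AS[OF x(1)] x(2) by (meson IntI open_contains_ball)
    have "U \<in> sets borel" using U by simp
    then have m: "{x\<in>space N. Y x \<in> U} \<in> sets M" unfolding spN A_def
      using \<open>Sec p \<kappa> e r1 \<in> sets borel\<close> by measurable
    have "0 < measure M {x'\<in>space M. dist (Y x') (Y x) < \<rho>}" using x AM by (intro mass_pos \<rho>) auto
    also have "\<dots> \<le> measure M {x\<in>space N. Y x \<in> U}"
    proof (rule finite_measure.finite_measure_mono[OF fM _ m])
      show "{x'\<in>space M. dist (Y x') (Y x) < \<rho>} \<subseteq> {x\<in>space N. Y x \<in> U}"
        using \<rho>(2) by (auto simp: spN A_def subset_iff dist_commute)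
    qed
    also have "\<dots> = measure N {x\<in>space N. Y x \<in> U}"
      unfolding N_def by (subst measure_restrict_space[OF Aint]) (auto simp: space_restrict_space)
    finally show ?thesis .
  qed
  have ray: "Y x - p = ((Y x - p) \<bullet> e) *\<^sub>R e" if x: "x \<in> A" "(Y x - p) \<bullet> e < s" for x
  proof (rule ccontr)
    assume neq: "\<not> ?thesis"
    define U where "U = {y. (y - p) \<bullet> e < s \<and> y - p \<noteq> ((y - p) \<bullet> e) *\<^sub>R e}"
    have "open U" unfolding U_def by (intro open_Collect_conj open_Collect_less open_Collect_neq continuous_intros)
    from Npos[OF this x(1)] have "0 < measure N {x\<in>space N. Y x \<in> U}" using x neq by (simp add: U_def)
    from AE_pos_obtain[OF z0 this] show False by (auto simp: U_def)
  qed
  obtain T where T: "closed T" "Y ` space M = W \<inter> T" using image_closed by (auto simp: closedin_closed)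
  \<comment> \<open>One support point gives one slab of positive mass, so every slab below s has
    positive mass and contains points of the ray. The ray lies in the closure of the image, and the
    image is relatively closed in W.\<close>
  have all: "p + t' *\<^sub>R e \<in> Y ` space M" if x: "x \<in> A" "(Y x - p) \<bullet> e < s" and t': "0 < t'" "t' < s" for x t'
  proof -
    define t where "t = (Y x - p) \<bullet> e"
    have t: "0 < t" "t < s" using bounds(1)[OF AS[OF x(1)]] x by (auto simp: t_def)
    define U where "U = {y. t/2 < (y - p) \<bullet> e \<and> (y - p) \<bullet> e < (t + s)/2}"
    have "open U" unfolding U_def by (intro open_Collect_conj open_Collect_less continuous_intros)
    from Npos[OF this x(1)] have "0 < measure N {x\<in>space N. Y x \<in> U}" using t by (simp add: U_def t_def)
    then have pos: "0 < measure N {x\<in>space N. (Y x - p) \<bullet> e \<in> {t/2<..<(t+s)/2}}" by (simp add: U_def)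
    have "p + t' *\<^sub>R e \<in> closure T"
      unfolding closure_approachable
    proof (intro allI impI)
      fix \<delta> :: real assume "0 < \<delta>"
      define c1 c2 where "c1 = max (t'/2) (t' - \<delta>/2)" and "c2 = min ((t'+s)/2) (t' + \<delta>/2)"
      have c: "0 < c1" "c1 < c2" "c2 < s" "t' - \<delta> < c1" "c2 < t' + \<delta>" using t' \<open>0 < \<delta>\<close> by (auto simp: c1_def c2_def min_def max_def)
      have "0 < measure N {x\<in>space N. (Y x - p) \<bullet> e \<in> {c1<..<c2}}"
        by (rule spread[OF _ _ _ c(1-3) pos]) (use t in auto)
      then have "{x\<in>space N. (Y x - p) \<bullet> e \<in> {c1<..<c2}} \<noteq> {}" by (metis measure_empty less_irrefl)
      then obtain x' where x': "x' \<in> A" "(Y x' - p) \<bullet> e \<in> {c1<..<c2}" unfolding spN by blast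
      have "Y x' = p + ((Y x' - p) \<bullet> e) *\<^sub>R e" using ray[OF x'(1)] x'(2) c by (simp add: algebra_simps)
      then have "dist (Y x') (p + t' *\<^sub>R e) = norm (((Y x' - p) \<bullet> e - t') *\<^sub>R e)"
        by (metis add_diff_cancel_left dist_norm scaleR_diff_left)
      also have "\<dots> < \<delta>" using x'(2) c e by auto
      finally show "\<exists>y\<in>T. dist y (p + t' *\<^sub>R e) < \<delta>" using x' T AM by blast
    qed
    then show ?thesis using T seg[of t'] t' s by auto
  qed
  show ?thesis
  proof (intro exI[of _ s] conjI allI impI)
    show "0 < s" by fact
    fix s' assume s': "0 < s' \<and> s' \<le> s"
    have sub: "y \<in> {p + t *\<^sub>R e |t. 0 < t \<and> t < s'}" if y: "y \<in> Y ` space M \<inter> Sec p \<kappa> e s'" for y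
    proof -
      obtain x where x: "x \<in> space M" "y = Y x" using y by blast
      have "Y x \<in> Sec p \<kappa> e r1" "(Y x - p) \<bullet> e < s'" using y x s' s by (auto simp: Sec_def)
      then have "x \<in> A" using x by (simp add: A_def)
      have "y = p + ((Y x - p) \<bullet> e) *\<^sub>R e" using ray[OF \<open>x \<in> A\<close>] \<open>(Y x - p) \<bullet> e < s'\<close> s' x(2) by (simp add: algebra_simps)
      then show ?thesis using bounds(1)[OF \<open>Y x \<in> Sec p \<kappa> e r1\<close>] \<open>(Y x - p) \<bullet> e < s'\<close> by blast
    qed
    show "Y ` space M \<inter> Sec p \<kappa> e s' = {} \<or> Y ` space M \<inter> Sec p \<kappa> e s' = {p + t *\<^sub>R e |t. 0 < t \<and> t < s'}"
    proof (cases "Y ` space M \<inter> Sec p \<kappa> e s' = {}")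
      case False
      then obtain x where x: "x \<in> space M" "Y x \<in> Sec p \<kappa> e s'" by blast
      then have "x \<in> A" "(Y x - p) \<bullet> e < s" using s s' by (auto simp: A_def Sec_def)
      have "p + t *\<^sub>R e \<in> Y ` space M \<inter> Sec p \<kappa> e s'" if "0 < t" "t < s'" for t
      proof -
        have "e \<bullet> e = 1" using e by (simp add: norm_eq_1)
        then have "p + t *\<^sub>R e \<in> Sec p \<kappa> e s'" using that \<kappa> e by (simp add: Sec_def ncone_def)
        then show ?thesis using all[OF \<open>x \<in> A\<close> \<open>(Y x - p) \<bullet> e < s\<close> that(1)] that s' by auto
      qed
      then show ?thesis using sub by blast
    qed blast
  qed
qed

text \<open>The thin cones at p have disjoint apertures, so each can be examined alone; E collects
  the directions whose segment is filled. The finitely many sector heights have a positive minimum,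
  which serves as radius.\<close>

theorem star_structure:
  assumes "x0 \<in> space M"
  defines "p \<equiv> Y x0"
  shows "\<exists>r E. 0 < r \<and> finite E \<and> (\<forall>e\<in>E. norm e = 1 \<and> (\<exists>v\<in>\<Lambda>. v \<noteq> 0 \<and> (e = v /\<^sub>R norm v \<or> e = - v /\<^sub>R norm v))) \<and>
    cball p r \<subseteq> W \<and> Y ` space M \<inter> ball p r = {p} \<union> {p + t *\<^sub>R e |t e. e \<in> E \<and> 0 < t \<and> t < r}"
proof -
  have "p \<in> W" using YW assms by simp
  then obtain R' where R': "0 < R'" "cball p R' \<subseteq> W" using W by (meson open_contains_cball)
  \<comment> \<open>Halved so that balls of radius R about points of \<open>ball p R\<close> stay in
    W.\<close>
  define R where "R = R' / 2"
  have R: "0 < R" "cball p R \<subseteq> W" using R' by (auto simp: R_def)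
  have Rb: "cball y R \<subseteq> W" if "y \<in> ball p R" for y
  proof -
    have "cball y R \<subseteq> cball p R'"
    proof
      fix z assume "z \<in> cball y R"
      then show "z \<in> cball p R'" using that dist_triangle[of p z y] by (auto simp: R_def)
    qed
    then show ?thesis using R' by blast
  qed
  obtain L where L: "AE x in M. Y x \<in> ball p R \<longrightarrow> norm (d x) \<le> L" using d_bounded[of R p R, OF R(1) Rb] by blast
  define D where "D = Dirs L"
  have D: "finite D" "\<And>e. e \<in> D \<Longrightarrow> norm e = 1" using finite_Dirs norm_Dirs by (auto simp: D_def)
  obtain \<kappa> where \<kappa>: "0 < \<kappa>" "\<kappa> \<le> 1/2" and disj: "\<And>e e'. e \<in> D \<Longrightarrow> e' \<in> D \<Longrightarrow> e \<noteq> e' \<Longrightarrow> ncone \<kappa> e \<inter> ncone \<kappa> e' = {}"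
  proof -
    have "\<exists>\<kappa>>0. \<kappa> \<le> 1/2 \<and> (\<forall>e\<in>D. \<forall>e'\<in>D. e \<noteq> e' \<longrightarrow> ncone \<kappa> e \<inter> ncone \<kappa> e' = {})"
      by (rule cones_disjoint[OF D(1)]) (rule D(2))
    then show thesis using that by (elim exE conjE) blast
  qed
  have ncone_mono: "ncone k e \<subseteq> ncone k' e" if "k \<le> k'" for k k' :: real and e :: 'b
  proof
    fix y assume "y \<in> ncone k e"
    moreover have "(1 - k') * norm y \<le> (1 - k) * norm y" using that by (intro mult_right_mono) auto
    ultimately show "y \<in> ncone k' e" by (simp add: ncone_def)
  qed
  have thin: "\<exists>r>0. \<forall>q\<in>Y ` space M. q \<noteq> p \<and> dist p q < r \<longrightarrow> (\<exists>e\<in>D. q - p \<in> ncone k e)" if "0 < k" "k \<le> 1" for k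
    using thin_cones[OF R(1) R(1) Rb L that] by (simp add: ncone_def D_def)
  obtain r0 where r0: "0 < r0" "\<And>q. q \<in> Y ` space M \<Longrightarrow> q \<noteq> p \<Longrightarrow> dist p q < r0 \<Longrightarrow> (\<exists>e\<in>D. q - p \<in> ncone (\<kappa>/2) e)"
  proof -
    have "0 < \<kappa>/2" "\<kappa>/2 \<le> 1" using \<kappa> by auto
    from thin[OF this] show thesis using that by (elim exE conjE) blast
  qed
  define r1 where "r1 = min r0 R / 2"
  have r1: "0 < r1" "2 * r1 \<le> R" "2 * r1 \<le> r0" using r0 R by (auto simp: r1_def)
  have SecR: "dist p y < 2 * r1" if "y \<in> Sec p \<kappa> e r1" for y e
    using Sec_bound(3)[OF \<kappa>(2) that] by (simp add: dist_norm norm_minus_commute)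
  \<comment> \<open>\<open>thin_cones\<close> yields some direction for the narrower cone;
    disjointness of the cones of parameter \<kappa> identifies it with e.\<close>
  have uniq: "Y x - p \<in> ncone k e" if x: "x \<in> space M" "Y x - p \<in> ncone \<kappa> e" and e: "e \<in> D" and k: "0 < k" "k \<le> \<kappa>" and ex: "\<exists>e\<in>D. Y x - p \<in> ncone k e" for x e k
    using ex disj[OF e] x(2) ncone_mono[OF k(2)] by blast
  have alt: "\<exists>s>0. \<forall>s'. 0 < s' \<and> s' \<le> s \<longrightarrow> Y ` space M \<inter> Sec p \<kappa> e s' = {} \<or> Y ` space M \<inter> Sec p \<kappa> e s' = {p + t *\<^sub>R e |t. 0 < t \<and> t < s'}" if e: "e \<in> D" for e
  proof (rule sector_alternative[OF \<kappa> D(2)[OF e] r1(1) _ R(2,1)])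
    have "Sec p \<kappa> e r1 \<subseteq> ball p R" using SecR r1 by force
    then show "Sec p \<kappa> e r1 \<subseteq> W" using R by force
    show "AE x in M. Y x \<in> Sec p \<kappa> e r1 \<longrightarrow> norm (d x) \<le> L"
      using L by eventually_elim (use \<open>Sec p \<kappa> e r1 \<subseteq> ball p R\<close> in blast)
    show "p + t *\<^sub>R e \<in> W" if "0 < t" "t < r1" for t
    proof -
      have "p + t *\<^sub>R e \<in> cball p R" using that r1 D(2)[OF e] by (simp add: dist_norm)
      then show ?thesis using R by blast
    qed
    show "Y x - p \<in> ncone (\<kappa>/2) e" if x: "x \<in> space M" "Y x \<in> Sec p \<kappa> e r1" for x
    proof (rule uniq[OF x(1) _ e])
      show "Y x - p \<in> ncone \<kappa> e" using x by (simp add: Sec_def)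
      then have "Y x \<noteq> p" by (auto simp: ncone_def)
      then show "\<exists>e\<in>D. Y x - p \<in> ncone (\<kappa>/2) e" using r0(2)[of "Y x"] SecR[OF x(2)] r1 x(1) by auto
    qed (use \<kappa> in auto)
    fix k' :: real assume k': "0 < k'"
    define k where "k = min k' \<kappa>"
    have k: "0 < k" "k \<le> 1" "k \<le> \<kappa>" "k \<le> k'" using k' \<kappa> by (auto simp: k_def)
    obtain r where r: "0 < r" "\<And>q. q \<in> Y ` space M \<Longrightarrow> q \<noteq> p \<Longrightarrow> dist p q < r \<Longrightarrow> (\<exists>e\<in>D. q - p \<in> ncone k e)"
      using thin[OF k(1,2)] by (elim exE conjE) blast
    show "\<exists>s>0. \<forall>x\<in>space M. Y x \<in> Sec p \<kappa> e s \<longrightarrow> Y x - p \<in> ncone k' e"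
    proof (intro exI[of _ "r/2"] conjI ballI impI)
      show "0 < r / 2" using r by simp
      fix x assume x: "x \<in> space M" "Y x \<in> Sec p \<kappa> e (r/2)"
      have "Y x - p \<in> ncone k e"
      proof (rule uniq[OF x(1) _ e])
        show c: "Y x - p \<in> ncone \<kappa> e" using x by (simp add: Sec_def)
        have "dist p (Y x) < r" using Sec_bound(3)[OF \<kappa>(2) x(2)] by (simp add: dist_norm norm_minus_commute)
        moreover have "Y x \<noteq> p" using c by (auto simp: ncone_def)
        ultimately show "\<exists>e\<in>D. Y x - p \<in> ncone k e" using r(2)[of "Y x"] x(1) by auto
      qed (use k in auto)
      then show "Y x - p \<in> ncone k' e" using ncone_mono[OF k(4)] by blast
    qed
  qed
  then have "\<forall>e\<in>D. \<exists>s>0. \<forall>s'. 0 < s' \<and> s' \<le> s \<longrightarrow> Y ` space M \<inter> Sec p \<kappa> e s' = {} \<or> Y ` space M \<inter> Sec p \<kappa> e s' = {p + t *\<^sub>R e |t. 0 < t \<and> t < s'}"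
    by (rule ballI)
  from bchoice[OF this] obtain s where s0: "\<forall>e\<in>D. 0 < s e \<and> (\<forall>s'. 0 < s' \<and> s' \<le> s e \<longrightarrow>
      Y ` space M \<inter> Sec p \<kappa> e s' = {} \<or> Y ` space M \<inter> Sec p \<kappa> e s' = {p + t *\<^sub>R e |t. 0 < t \<and> t < s'})" ..
  have s: "0 < s e" "0 < s' \<Longrightarrow> s' \<le> s e \<Longrightarrow>
      Y ` space M \<inter> Sec p \<kappa> e s' = {} \<or> Y ` space M \<inter> Sec p \<kappa> e s' = {p + t *\<^sub>R e |t. 0 < t \<and> t < s'}" if "e \<in> D" for e s'
    using bspec[OF s0 that] by simp_all
  define r where "r = Min (insert r1 (s ` D))"
  have r: "0 < r" "r \<le> r1" "\<And>e. e \<in> D \<Longrightarrow> r \<le> s e" using D(1) r1 s(1) by (auto simp: r_def)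
  define E where "E = {e\<in>D. Y ` space M \<inter> Sec p \<kappa> e r = {p + t *\<^sub>R e |t. 0 < t \<and> t < r}}"
  have "Y ` space M \<inter> ball p r \<subseteq> {p} \<union> {p + t *\<^sub>R e |t e. e \<in> E \<and> 0 < t \<and> t < r}"
  proof
    fix q assume q: "q \<in> Y ` space M \<inter> ball p r"
    show "q \<in> {p} \<union> {p + t *\<^sub>R e |t e. e \<in> E \<and> 0 < t \<and> t < r}"
    proof (cases "q = p")
      case False
      then obtain e where e: "e \<in> D" "q - p \<in> ncone (\<kappa>/2) e" using r0(2)[of q] q r r1 by auto
      have "(q - p) \<bullet> e \<le> norm (q - p)" using norm_cauchy_schwarz[of "q - p" e] D(2)[OF e(1)] by simp
      then have "(q - p) \<bullet> e < r" using q by (simp add: dist_norm norm_minus_commute)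
      moreover have "q - p \<in> ncone \<kappa> e" using e(2) ncone_mono[of "\<kappa>/2" \<kappa> e] \<kappa> by auto
      ultimately have "q \<in> Y ` space M \<inter> Sec p \<kappa> e r" using q by (simp add: Sec_def)
      with s(2)[OF e(1) r(1) r(3)[OF e(1)]] have "e \<in> E" "q \<in> {p + t *\<^sub>R e |t. 0 < t \<and> t < r}" using e(1) unfolding E_def by blast+
      then show ?thesis by blast
    qed simp
  qed
  moreover have "{p} \<union> {p + t *\<^sub>R e |t e. e \<in> E \<and> 0 < t \<and> t < r} \<subseteq> Y ` space M \<inter> ball p r"
  proof -
    have "p + t *\<^sub>R e \<in> Y ` space M \<inter> ball p r" if "e \<in> E" "0 < t" "t < r" for t e
    proof -
      have "p + t *\<^sub>R e \<in> Y ` space M \<inter> Sec p \<kappa> e r" using that unfolding E_def by blast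
      moreover have "norm e = 1" using that D by (simp add: E_def)
      ultimately show ?thesis using that by (simp add: dist_norm)
    qed
    moreover have "p \<in> Y ` space M \<inter> ball p r" using assms r by auto
    ultimately show ?thesis by auto
  qed
  ultimately have "Y ` space M \<inter> ball p r = {p} \<union> {p + t *\<^sub>R e |t e. e \<in> E \<and> 0 < t \<and> t < r}" by (rule subset_antisym)
  moreover have "cball p r \<subseteq> W"
  proof -
    have "cball p r \<subseteq> cball p R" using r r1 by (intro subset_cball) auto
    then show ?thesis using R by blast
  qed
  moreover have "finite E" using D by (simp add: E_def)
  moreover have "norm e = 1 \<and> (\<exists>v\<in>\<Lambda>. v \<noteq> 0 \<and> (e = v /\<^sub>R norm v \<or> e = - v /\<^sub>R norm v))" if "e \<in> E" for e
  proof
    have "e \<in> Dirs L" using that by (simp add: E_def D_def)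
    then show "norm e = 1" by (rule norm_Dirs)
    show "\<exists>v\<in>\<Lambda>. v \<noteq> 0 \<and> (e = v /\<^sub>R norm v \<or> e = - v /\<^sub>R norm v)"
      using \<open>e \<in> Dirs L\<close> unfolding Dirs_def by (elim UnE imageE) blast+
  qed
  ultimately show ?thesis using r(1) by (intro exI[of _ r] exI[of _ E] conjI ballI) simp_all
qed

end

section \<open>Graphs assembled from local arcs\<close>

lemma arc_subsegment_edge:
  fixes c :: "real \<Rightarrow> 'a::euclidean_space"
  assumes c: "arc c" and ab: "0 \<le> a" "a < b" "b \<le> 1" and V: "c a \<in> V" "c b \<in> V"
  shows "embedded_edge B V (c ` {a<..<b})"
proof -
  define \<gamma> where "\<gamma> = subpath a b c"
  have arc: "arc \<gamma>" unfolding \<gamma>_def by (rule arc_subpath_arc[OF c]) (use ab in auto)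
  obtain h where h: "homeomorphism {0..1} (path_image \<gamma>) \<gamma> h" using homeomorphism_arc[OF arc] .
  have "\<gamma> ` {0<..<1} = c ` {a<..<b}"
  proof -
    have "(\<lambda>x. (b - a) * x + a) ` {0<..<1} = {a<..<b}"
    proof (intro subset_antisym subsetI)
      fix y assume y: "y \<in> {a<..<b}"
      have "(y - a) / (b - a) \<in> {0<..<1}" "y = (b - a) * ((y - a) / (b - a)) + a" using y ab by (auto simp: field_simps)
      then show "y \<in> (\<lambda>x. (b - a) * x + a) ` {0<..<1}" by blast
    next
      fix y assume "y \<in> (\<lambda>x. (b - a) * x + a) ` {0<..<1}"
      then obtain x where x: "0 < x" "x < 1" "y = (b - a) * x + a" by auto
      have "(b - a) * x < b - a" using mult_strict_left_mono[of x 1 "b - a"] x ab by simp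
      moreover have "0 < (b - a) * x" using x ab by simp
      ultimately have "a < y" "y < b" unfolding x(3) by linarith+
      then show "y \<in> {a<..<b}" by simp
    qed
    moreover have "\<gamma> ` {0<..<1} = c ` ((\<lambda>x. (b - a) * x + a) ` {0<..<1})"
      by (simp only: \<gamma>_def subpath_def image_image)
    ultimately show ?thesis by (simp only:)
  qed
  then have hom: "homeomorphism {0<..<1} (c ` {a<..<b}) \<gamma> h"
    by (intro homeomorphism_of_subsets[OF h, where T''="{}"]) auto
  have cont: "continuous_on {0..1} \<gamma>" using arc by (simp add: arc_def path_def)
  have "(\<gamma> \<longlongrightarrow> c a) (at_right 0)"
    using continuous_on_Icc_at_rightD[OF cont] by (simp add: \<gamma>_def subpath_def)
  moreover have "(\<gamma> \<longlongrightarrow> c b) (at_left 1)"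
    using continuous_on_Icc_at_leftD[OF cont] by (simp add: \<gamma>_def subpath_def)
  ultimately show ?thesis
    unfolding embedded_edge_def edge_end_def using hom V by blast
qed

lemma finite_neighbours:
  fixes Z :: "real set"
  assumes "finite Z" "0 \<in> Z" "1 \<in> Z" "0 < \<tau>" "\<tau> < 1" "\<tau> \<notin> Z" "Z \<subseteq> {0..1}"
  obtains a b where "a \<in> Z" "b \<in> Z" "a < \<tau>" "\<tau> < b" "{a<..<b} \<inter> Z = {}"
proof
  let ?A = "{z\<in>Z. z < \<tau>}" and ?B = "{z\<in>Z. \<tau> < z}"
  have A: "finite ?A" "?A \<noteq> {}" and B: "finite ?B" "?B \<noteq> {}" using assms by auto
  show "Max ?A \<in> Z" "Max ?A < \<tau>" using Max_in[OF A] by auto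
  show "Min ?B \<in> Z" "\<tau> < Min ?B" using Min_in[OF B] by auto
  show "{Max ?A<..<Min ?B} \<inter> Z = {}"
  proof (rule ccontr)
    assume "\<not> ?thesis"
    then obtain z where z: "z \<in> Z" "Max ?A < z" "z < Min ?B" by auto
    have "z \<le> Max ?A \<or> Min ?B \<le> z"
    proof (cases "z < \<tau>")
      case True
      then show ?thesis using z by (intro disjI1 Max_ge A) auto
    next
      case False
      then have "\<tau> < z" using z assms(6) by (cases "z = \<tau>") auto
      then show ?thesis using z by (intro disjI2 Min_le B) auto
    qed
    then show False using z by auto
  qed
qed

text \<open>The open subsegment is connected and open in G, as the interior of the arc is. It is
  also closed in G - V, since its closure adds only its two end points, which belong to V. A
  nonempty clopen part of a component is all of it.\<close>

lemma arc_subsegment_component: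
  fixes c :: "real \<Rightarrow> 'a::euclidean_space"
  assumes c: "arc c" and sub: "path_image c \<subseteq> G" and op: "openin (top_of_set G) (c ` {0<..<1})"
    and ab: "0 \<le> a" "a < b" "b \<le> 1" and V: "c a \<in> V" "c b \<in> V" "c ` {a<..<b} \<inter> V = {}" and x: "x \<in> c ` {a<..<b}"
  shows "c ` {a<..<b} = connected_component_set (G - V) x"
proof -
  let ?S = "c ` {a<..<b}"
  have cont: "continuous_on {0..1} c" using c by (simp add: arc_def path_def)
  have sub1: "{a<..<b} \<subseteq> {0<..<1}" "{a<..<b} \<subseteq> {0..1}" "{a..b} \<subseteq> {0..1}" using ab by auto
  have SG: "?S \<subseteq> G - V" using V(3) sub sub1 by (auto simp: path_image_def)
  have conn: "connected ?S" by (intro connected_continuous_image continuous_on_subset[OF cont sub1(2)]) simp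
  obtain h where h: "homeomorphism {0..1} (path_image c) c h" using homeomorphism_arc[OF c] .
  have h1: "homeomorphism {0<..<1} (c ` {0<..<1}) c h"
    by (rule homeomorphism_of_subsets[OF h, where T''="{}"]) auto
  have "openin (top_of_set (c ` {0<..<1})) ?S"
    by (rule homeomorphism_imp_open_map[OF h1]) (use sub1 in \<open>auto intro!: open_subset\<close>)
  then have "openin (top_of_set G) ?S" using op by (rule openin_trans)
  then have o: "openin (top_of_set (G - V)) ?S" using SG by (meson openin_subset_trans Diff_subset)
  have eq: "?S = (G - V) \<inter> c ` {a..b}"
  proof -
    have "c ` {a..b} = insert (c a) (insert (c b) ?S)"
    proof -
      have "{a..b} = insert a (insert b {a<..<b})" using ab by auto
      then show ?thesis by simp
    qed
    then show ?thesis using V SG by auto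
  qed
  have "compact (c ` {a..b})" by (intro compact_continuous_image continuous_on_subset[OF cont sub1(3)]) simp
  then have cl: "closedin (top_of_set (G - V)) ?S" unfolding eq by (intro closedin_closed_Int compact_imp_closed)
  let ?X = "connected_component_set (G - V) x"
  have "?S \<subseteq> ?X" using conn x SG by (intro connected_component_maximal) auto
  have XG: "?X \<subseteq> G - V" by (rule connected_component_subset)
  have "openin (top_of_set ?X) ?S" "closedin (top_of_set ?X) ?S"
    using o cl \<open>?S \<subseteq> ?X\<close> XG by (meson openin_subset_trans, meson closedin_subset_trans)
  moreover have "connected ?X" by simp
  ultimately have "?S = {} \<or> ?S = ?X" using connected_clopen[of ?X] by blast
  then show ?thesis using x by blast
qed

text \<open>P is required of all subsegments because vertices coming from other arcs may later
  subdivide an arc. Relative openness of the interiors rules out branching inside an arc, and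
  confinement to U serves local finiteness.\<close>

definition arc_system :: "'a::euclidean_space set \<Rightarrow> ('a set \<Rightarrow> bool) \<Rightarrow> 'a set \<Rightarrow> (real \<Rightarrow> 'a) set \<Rightarrow> bool" where
  "arc_system G P U C \<longleftrightarrow> finite C \<and> (\<forall>c\<in>C. arc c \<and> path_image c \<subseteq> G \<inter> U \<and> openin (top_of_set G) (c ` {0<..<1}) \<and>
     (\<forall>a b. 0 \<le> a \<longrightarrow> a < b \<longrightarrow> b \<le> 1 \<longrightarrow> P (c ` {a<..<b})))"

text \<open>The domain is exhausted by compact sets, and each shell is covered by finitely many
  local arc systems. Centres and end points of all arcs are the vertices, and the edges are the
  components of the rest. Vertices at which only two edges meet are harmless.\<close>

lemma locally_finite_graph_from_arcs:
  fixes B G :: "'a::euclidean_space set"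
  assumes "open B" and G: "closedin (top_of_set B) G"
    and loc: "\<And>p U. p \<in> G \<Longrightarrow> open U \<Longrightarrow> p \<in> U \<Longrightarrow>
      \<exists>C N. arc_system G P U C \<and> open N \<and> p \<in> N \<and> G \<inter> N - {p} \<subseteq> (\<Union>c\<in>C. c ` {0<..<1})"
  shows "\<exists>V E. locally_finite_embedded_graph B G V E \<and> (\<forall>e\<in>E. P e)"
proof -
  obtain K where K: "\<And>n. compact (K n)" "\<And>n. K n \<subseteq> B" "\<And>n. K n \<subseteq> interior (K (Suc n))" "\<Union>(range K) = B"
    and Kex: "\<And>S. compact S \<Longrightarrow> S \<subseteq> B \<Longrightarrow> \<exists>N. \<forall>n\<ge>N. S \<subseteq> K n"
    by (rule open_Union_compact_subsets[OF assms(1)]) blast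
  have KS: "K n \<subseteq> K (Suc n)" for n using K(3)[of n] interior_subset by blast
  have Kmono: "K m \<subseteq> K n" if "m \<le> n" for m n by (rule lift_Suc_mono_le[of K, OF KS that])
  have GB: "G \<subseteq> B" using G closedin_subset by fastforce
  obtain T where T: "closed T" "G = B \<inter> T" using G by (auto simp: closedin_closed)
  define D where "D m = (if m = 0 then G \<inter> K 0 else G \<inter> (K m - interior (K (m - 1))))" for m
  \<comment> \<open>Arcs made for shell m avoid \<open>K (m - 2)\<close>, so a compact set inside
    \<open>K j\<close> meets arcs of shells m < j + 2 only. The shell has room for this, as it
    avoids the interior of \<open>K (m - 1)\<close>, which contains
    \<open>K (m - 2)\<close>.\<close>
  define U where "U m = (if m < 2 then UNIV else - K (m - 2))" for m
  have Uopen: "open (U m)" for m unfolding U_def using K(1) compact_imp_closed by auto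
  have DU: "D m \<subseteq> U m" for m
  proof (cases "m < 2")
    case False
    then have "m - 1 = Suc (m - 2)" by simp
    then have "K (m - 2) \<subseteq> interior (K (m - 1))" using K(3) by metis
    then show ?thesis using False by (auto simp: D_def U_def)
  qed (simp add: U_def)
  have Dcompact: "compact (D m)" for m
  proof -
    have "G \<inter> K m = K m \<inter> T" for m using T K(2) by blast
    then have "compact (G \<inter> K m)" for m using K(1) T(1) by (simp add: compact_Int_closed)
    moreover have "G \<inter> (K m - interior (K (m - 1))) = G \<inter> K m - interior (K (m - 1))" by blast
    ultimately show ?thesis by (auto simp: D_def intro!: compact_diff)
  qed
  have DG: "D m \<subseteq> G" for m by (auto simp: D_def)
  have GD: "G \<subseteq> (\<Union>m. D m)"
  proof
    fix x assume x: "x \<in> G"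
    then obtain n where "x \<in> K n" using GB K(4) by blast
    define m where "m = (LEAST n. x \<in> K n)"
    have m: "x \<in> K m" unfolding m_def using \<open>x \<in> K n\<close> by (rule LeastI)
    have "x \<notin> K (m - 1)" if "m \<noteq> 0" using not_less_Least[of "m - 1" "\<lambda>n. x \<in> K n"] that by (auto simp: m_def)
    then have "x \<in> D m" using x m interior_subset by (auto simp: D_def)
    then show "x \<in> (\<Union>m. D m)" by blast
  qed
  have "\<exists>F C. finite F \<and> F \<subseteq> D m \<and> arc_system G P (U m) C \<and> D m \<subseteq> F \<union> (\<Union>c\<in>C. c ` {0<..<1})" for m
  proof -
    have "\<forall>p\<in>D m. \<exists>CN. arc_system G P (U m) (fst CN) \<and> open (snd CN) \<and> p \<in> snd CN \<and> G \<inter> snd CN - {p} \<subseteq> (\<Union>c\<in>fst CN. c ` {0<..<1})"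
    proof
      fix p assume "p \<in> D m"
      then have "p \<in> G" "p \<in> U m" using DG[of m] DU[of m] by auto
      from loc[OF this(1) Uopen this(2)] obtain C N
        where "arc_system G P (U m) C \<and> open N \<and> p \<in> N \<and> G \<inter> N - {p} \<subseteq> (\<Union>c\<in>C. c ` {0<..<1})" by (elim exE) (rule that)
      then show "\<exists>CN. arc_system G P (U m) (fst CN) \<and> open (snd CN) \<and> p \<in> snd CN \<and> G \<inter> snd CN - {p} \<subseteq> (\<Union>c\<in>fst CN. c ` {0<..<1})"
        by (intro exI[of _ "(C, N)"]) simp
    qed
    from bchoice[OF this] obtain CN where CN: "\<forall>p\<in>D m. arc_system G P (U m) (fst (CN p)) \<and> open (snd (CN p)) \<and> p \<in> snd (CN p) \<and>
      G \<inter> snd (CN p) - {p} \<subseteq> (\<Union>c\<in>fst (CN p). c ` {0<..<1})" ..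
    obtain F where F: "F \<subseteq> D m" "finite F" "D m \<subseteq> (\<Union>p\<in>F. snd (CN p))"
    proof (rule compactE_image[OF Dcompact[of m], of "D m" "\<lambda>p. snd (CN p)"])
      show "open (snd (CN p))" if "p \<in> D m" for p using CN that by blast
      show "D m \<subseteq> (\<Union>p\<in>D m. snd (CN p))" using CN by blast
    qed blast
    define C where "C = (\<Union>p\<in>F. fst (CN p))"
    have "arc_system G P (U m) (fst (CN p))" if "p \<in> F" for p using CN F(1) that by blast
    then have "arc_system G P (U m) C" using F(2) unfolding C_def arc_system_def by (metis (no_types, lifting) UN_E finite_UN_I)
    moreover have "D m \<subseteq> F \<union> (\<Union>c\<in>C. c ` {0<..<1})"
    proof
      fix x assume x: "x \<in> D m"
      then obtain p where p: "p \<in> F" "x \<in> snd (CN p)" using F(3) by blast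
      then have "x = p \<or> x \<in> (\<Union>c\<in>fst (CN p). c ` {0<..<1})" using CN F(1) x DG by blast
      then show "x \<in> F \<union> (\<Union>c\<in>C. c ` {0<..<1})" using p by (auto simp: C_def)
    qed
    ultimately show ?thesis using F by blast
  qed
  then have "\<forall>m. \<exists>FC. finite (fst FC) \<and> fst FC \<subseteq> D m \<and> arc_system G P (U m) (snd FC) \<and> D m \<subseteq> fst FC \<union> (\<Union>c\<in>snd FC. c ` {0<..<1})"
    by (metis fst_conv snd_conv)
  from choice[OF this] obtain FC where FC: "\<forall>m. finite (fst (FC m)) \<and> fst (FC m) \<subseteq> D m \<and> arc_system G P (U m) (snd (FC m)) \<and> 
    D m \<subseteq> fst (FC m) \<union> (\<Union>c\<in>snd (FC m). c ` {0<..<1})" ..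
  define F C where "F m = fst (FC m)" and "C m = snd (FC m)" for m
  have F: "finite (F m)" "F m \<subseteq> D m" "arc_system G P (U m) (C m)" "D m \<subseteq> F m \<union> (\<Union>c\<in>C m. c ` {0<..<1})" for m
    using FC by (auto simp: F_def C_def)
  have Cfin: "finite (C m)" for m using F(3) by (simp add: arc_system_def)
  have arcs: "arc c" "path_image c \<subseteq> G \<inter> U m" "openin (top_of_set G) (c ` {0<..<1})" 
    "0 \<le> a \<Longrightarrow> a < b \<Longrightarrow> b \<le> 1 \<Longrightarrow> P (c ` {a<..<b})" if "c \<in> C m" for c m a b
    using F(3)[of m] that unfolding arc_system_def by blast+
  define Vm where "Vm m = F m \<union> (\<lambda>c. c 0) ` C m \<union> (\<lambda>c. c 1) ` C m" for m
  have Vm: "finite (Vm m)" "Vm m \<subseteq> G \<inter> U m" for m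
  proof -
    show "finite (Vm m)" using F(1) Cfin by (simp add: Vm_def)
    have "c 0 \<in> path_image c" "c 1 \<in> path_image c" for c :: "real \<Rightarrow> 'a" by (auto simp: path_image_def)
    then show "Vm m \<subseteq> G \<inter> U m" using F(2)[of m] DG DU arcs(2) unfolding Vm_def by blast
  qed
  define V where "V = (\<Union>m. Vm m)"
  define E where "E = components (G - V)"
  have VG: "V \<subseteq> G" using Vm(2) by (auto simp: V_def)
  have UK: "m < j + 2" if "x \<in> U m" "x \<in> K j" for x m j
  proof (rule ccontr)
    assume neg: "\<not> m < j + 2"
    then have "K j \<subseteq> K (m - 2)" by (intro Kmono) auto
    then show False using that neg by (auto simp: U_def)
  qed
  have Vfin: "finite (V \<inter> S)" if "compact S" "S \<subseteq> B" for S
  proof -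
    from Kex[OF that] obtain j where j: "S \<subseteq> K j" by blast
    have "V \<inter> S \<subseteq> (\<Union>m\<in>{..<j+2}. Vm m)"
    proof
      fix x assume x: "x \<in> V \<inter> S"
      then obtain m where m: "x \<in> Vm m" by (auto simp: V_def)
      then have "m < j + 2" using Vm(2) x j by (intro UK[of x]) blast+
      then show "x \<in> (\<Union>m\<in>{..<j+2}. Vm m)" using m by blast
    qed
    then show ?thesis by (rule finite_subset) (use Vm(1) in auto)
  qed
  \<comment> \<open>The parameters at which an arc meets a vertex, both ends included. They are
    finite because the arc is compact in B; consecutive ones delimit the edges, so each arc
    contributes finitely many.\<close>
  define Z where "Z c = {t\<in>{0..1::real}. c t \<in> V}" for c
  have Zfin: "finite (Z c)" if c: "c \<in> C m" for c m
  proof -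
    have "compact (path_image c)" using arcs(1)[OF c] by (simp add: arc_imp_path compact_path_image)
    then have "finite (V \<inter> path_image c)" using arcs(2)[OF c] GB by (intro Vfin) auto
    moreover have "c ` Z c \<subseteq> V \<inter> path_image c" by (auto simp: Z_def path_image_def)
    ultimately have "finite (c ` Z c)" by (rule rev_finite_subset)
    moreover have "inj_on c (Z c)" using arcs(1)[OF c] unfolding arc_def Z_def by (auto elim!: inj_on_subset)
    ultimately show ?thesis by (rule finite_imageD)
  qed
  have edge: "\<exists>m c a b. c \<in> C m \<and> a \<in> Z c \<and> b \<in> Z c \<and> a < b \<and> x \<in> c ` {a<..<b} \<and> e = c ` {a<..<b}" 
    if e: "e \<in> E" and x: "x \<in> e" for e x
  proof -
    have ex: "e = connected_component_set (G - V) x" using e x unfolding E_def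
      by (metis (no_types, lifting) components_iff connected_component_eq mem_Collect_eq)
    have xG: "x \<in> G - V" using e x in_components_subset unfolding E_def by blast
    then obtain m where m: "x \<in> D m" using GD by blast
    have "x \<notin> F m" using xG by (auto simp: V_def Vm_def)
    then obtain c where c: "c \<in> C m" "x \<in> c ` {0<..<1}" using F(4)[of m] m by blast
    then obtain \<tau> where \<tau>: "0 < \<tau>" "\<tau> < 1" "x = c \<tau>" by auto
    have Z01: "0 \<in> Z c" "1 \<in> Z c" using c(1) by (auto simp: Z_def V_def Vm_def)
    have "\<tau> \<notin> Z c" using xG \<tau> by (auto simp: Z_def)
    moreover have "Z c \<subseteq> {0..1}" by (auto simp: Z_def)
    ultimately obtain a b where ab: "a \<in> Z c" "b \<in> Z c" "a < \<tau>" "\<tau> < b" "{a<..<b} \<inter> Z c = {}"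
      using finite_neighbours[OF Zfin[OF c(1)] Z01 \<tau>(1,2)] by blast
    have ab1: "0 \<le> a" "a < b" "b \<le> 1" "c a \<in> V" "c b \<in> V" using ab by (auto simp: Z_def)
    have xs: "x \<in> c ` {a<..<b}" using ab \<tau> by auto
    have "c ` {a<..<b} = connected_component_set (G - V) x"
      by (rule arc_subsegment_component[OF arcs(1)[OF c(1)] _ arcs(3)[OF c(1)] ab1 _ xs])
        (use arcs(2)[OF c(1)] ab ab1 in \<open>auto simp: Z_def\<close>)
    then show ?thesis using c(1) ab ab1 xs ex by blast
  qed
  have edge_ex: "\<exists>x. x \<in> e" if "e \<in> E" for e using that in_components_nonempty unfolding E_def by blast
  have EP: "P e \<and> embedded_edge B V e" if e: "e \<in> E" for e
  proof -
    obtain x where "x \<in> e" using edge_ex[OF e] by blast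
    from edge[OF e this] obtain m c a b where c: "c \<in> C m" "a \<in> Z c" "b \<in> Z c" "a < b" "e = c ` {a<..<b}" by blast
    then have ab: "0 \<le> a" "b \<le> 1" "c a \<in> V" "c b \<in> V" by (auto simp: Z_def)
    show ?thesis unfolding c(5) using arcs(4)[OF c(1) ab(1) c(4) ab(2)] arc_subsegment_edge[OF arcs(1)[OF c(1)] ab(1) c(4) ab(2-4)] by blast
  qed
  have Efin: "finite {e\<in>E. e \<inter> S \<noteq> {}}" if "compact S" "S \<subseteq> B" for S
  proof -
    from Kex[OF that] obtain j where j: "S \<subseteq> K j" by blast
    have "{e\<in>E. e \<inter> S \<noteq> {}} \<subseteq> (\<Union>m\<in>{..<j+2}. \<Union>c\<in>C m. (\<lambda>(a, b). c ` {a<..<b}) ` (Z c \<times> Z c))"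
    proof
      fix e assume "e \<in> {e\<in>E. e \<inter> S \<noteq> {}}"
      then obtain x where x: "e \<in> E" "x \<in> e" "x \<in> S" by blast
      from edge[OF x(1,2)] obtain m c a b where c: "c \<in> C m" "a \<in> Z c" "b \<in> Z c" "a < b" "x \<in> c ` {a<..<b}" "e = c ` {a<..<b}" by blast
      have "{a<..<b} \<subseteq> {0..1}" using c by (auto simp: Z_def)
      then have "x \<in> U m" using c(5) arcs(2)[OF c(1)] by (auto simp: path_image_def)
      then have "m < j + 2" using x j by (intro UK[of x]) auto
      moreover have "e \<in> (\<lambda>(a, b). c ` {a<..<b}) ` (Z c \<times> Z c)" using c by (intro image_eqI[of _ _ "(a, b)"]) auto
      ultimately show "e \<in> (\<Union>m\<in>{..<j+2}. \<Union>c\<in>C m. (\<lambda>(a, b). c ` {a<..<b}) ` (Z c \<times> Z c))" using c(1) by blast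
    qed
    moreover have "finite (\<Union>m\<in>{..<j+2}. \<Union>c\<in>C m. (\<lambda>(a, b). c ` {a<..<b}) ` (Z c \<times> Z c))"
      using Cfin Zfin by (intro finite_UN_I finite_imageI finite_cartesian_product) auto
    ultimately show ?thesis by (rule finite_subset)
  qed
  have UE: "\<Union>E = G - V" by (simp add: E_def)
  have "pairwise disjnt E" using pairwise_disjoint_components[of "G - V"] unfolding E_def disjnt_def .
  then have "locally_finite_embedded_graph B G V E"
    unfolding locally_finite_embedded_graph_def UE using GB VG EP Vfin Efin by blast
  then show ?thesis using EP by blast
qed

section \<open>Hausdorff measure of the Hessian metric\<close>

lemma ediam_empty[simp]: "ediam d {} = 0"
  by (simp add: ediam_def bot_ennreal)

lemma hausdorff1_pre_antimono: "\<epsilon> \<le> \<epsilon>' \<Longrightarrow> hausdorff1_pre S d \<epsilon>' E \<le> hausdorff1_pre S d \<epsilon> E"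
  unfolding hausdorff1_pre_def by (intro INF_superset_mono) (auto intro: order_trans ennreal_leI)

lemma hausdorff1_outer_mono: "A \<subseteq> A' \<Longrightarrow> hausdorff1_outer S d A \<le> hausdorff1_outer S d A'"
  unfolding hausdorff1_outer_def hausdorff1_pre_def by (intro SUP_mono' INF_superset_mono) auto

lemma hausdorff1_outer_empty[simp]: "hausdorff1_outer S d {} = 0"
  using hausdorff1_outer_measure_space[of S d] by (simp add: outer_measure_space_def positive_def)

lemma hausdorff1_outer_countable:
  "hausdorff1_outer S d (\<Union>i. E (i::nat)) \<le> (\<Sum>i. hausdorff1_outer S d (E i))"
  unfolding hausdorff1_outer_def[of S d "\<Union>i. E i"]
proof (rule SUP_least)
  fix \<epsilon> :: real assume "\<epsilon> \<in> {0<..}"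
  then have "hausdorff1_pre S d \<epsilon> (\<Union>i. E i) \<le> (\<Sum>i. hausdorff1_pre S d \<epsilon> (E i))"
    by (simp add: hausdorff1_pre_subadditive)
  also have "\<dots> \<le> (\<Sum>i. hausdorff1_outer S d (E i))"
    using \<open>\<epsilon> \<in> _\<close> by (intro suminf_le) (auto simp: hausdorff1_outer_def intro: SUP_upper)
  finally show "hausdorff1_pre S d \<epsilon> (\<Union>i. E i) \<le> (\<Sum>i. hausdorff1_outer S d (E i))" .
qed

lemma hausdorff1_outer_Un:
  "hausdorff1_outer S d (A \<union> A') \<le> hausdorff1_outer S d A + hausdorff1_outer S d A'"
proof -
  have "hausdorff1_outer S d (\<Union>i. binaryset A A' i) \<le> (\<Sum>i. hausdorff1_outer S d (binaryset A A' i))"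
    by (rule hausdorff1_outer_countable)
  also have "\<dots> = hausdorff1_outer S d A + hausdorff1_outer S d A'"
    by (rule suminf_binaryset_eq) simp
  finally show ?thesis by (simp add: UN_binaryset_eq)
qed

text \<open>A covering set of diameter below c cannot meet both A and A', so every fine cover of the
  union splits into disjoint covers of the two parts.\<close>

lemma hausdorff1_outer_separated:
  assumes c: "0 < c" and sep: "\<And>x y. x \<in> A \<Longrightarrow> y \<in> A' \<Longrightarrow> ennreal c \<le> d x y"
  shows "hausdorff1_outer S d A + hausdorff1_outer S d A' \<le> hausdorff1_outer S d (A \<union> A')"
proof -
  have pre: "hausdorff1_pre S d \<epsilon> A + hausdorff1_pre S d \<epsilon> A' \<le> hausdorff1_pre S d \<epsilon> (A \<union> A')" if \<epsilon>: "0 < \<epsilon>" "\<epsilon> < c" for \<epsilon>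
    unfolding hausdorff1_pre_def[of S d \<epsilon> "A \<union> A'"]
  proof (rule INF_greatest)
    fix X assume "X \<in> {X :: nat \<Rightarrow> 'a set. (\<forall>i. X i \<subseteq> S \<and> ediam d (X i) \<le> ennreal \<epsilon>) \<and> A \<union> A' \<subseteq> (\<Union>i. X i)}"
    then have X: "\<And>i. X i \<subseteq> S" "\<And>i. ediam d (X i) \<le> ennreal \<epsilon>" "A \<union> A' \<subseteq> (\<Union>i. X i)" by auto
    define Y where "Y i = (if X i \<inter> A = {} then {} else X i)" for i
    define Y' where "Y' i = (if X i \<inter> A' = {} then {} else X i)" for i
    have "hausdorff1_pre S d \<epsilon> A \<le> (\<Sum>i. ediam d (Y i))"
      unfolding hausdorff1_pre_def by (rule INF_lower) (use X in \<open>auto simp: Y_def; blast\<close>)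
    moreover have "hausdorff1_pre S d \<epsilon> A' \<le> (\<Sum>i. ediam d (Y' i))"
      unfolding hausdorff1_pre_def by (rule INF_lower) (use X in \<open>auto simp: Y'_def; blast\<close>)
    moreover have "ediam d (Y i) + ediam d (Y' i) \<le> ediam d (X i)" for i
    proof -
      have "X i \<inter> A = {} \<or> X i \<inter> A' = {}"
      proof (rule ccontr)
        assume "\<not> ?thesis"
        then obtain x y where xy: "x \<in> X i" "x \<in> A" "y \<in> X i" "y \<in> A'" by blast
        have "d x y \<le> ediam d (X i)" unfolding ediam_def using xy by (meson SUP_upper2 order_refl)
        then have "ennreal c \<le> ennreal \<epsilon>" using sep[OF xy(2,4)] X(2)[of i] by (meson order_trans)
        then show False using \<epsilon> by (simp add: ennreal_le_iff)
      qed
      then show ?thesis by (auto simp: Y_def Y'_def)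
    qed
    ultimately have 0: "hausdorff1_pre S d \<epsilon> A + hausdorff1_pre S d \<epsilon> A' \<le> (\<Sum>i. ediam d (Y i)) + (\<Sum>i. ediam d (Y' i))"
      and 1: "(\<Sum>i. ediam d (Y i) + ediam d (Y' i)) \<le> (\<Sum>i. ediam d (X i))"
      by (auto intro: add_mono suminf_le)
    note 0
    also have "(\<Sum>i. ediam d (Y i)) + (\<Sum>i. ediam d (Y' i)) = (\<Sum>i. ediam d (Y i) + ediam d (Y' i))"
      by (simp add: suminf_add)
    finally show "hausdorff1_pre S d \<epsilon> A + hausdorff1_pre S d \<epsilon> A' \<le> (\<Sum>i. ediam d (X i))" using 1 by (rule order_trans)
  qed
  \<comment> \<open>The two suprema run over independent scales; refining both to a common scale
    below c only increases the left side.\<close>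
  have "hausdorff1_pre S d \<epsilon>1 A + hausdorff1_pre S d \<epsilon>2 A' \<le> hausdorff1_outer S d (A \<union> A')" if \<epsilon>: "0 < \<epsilon>1" "0 < \<epsilon>2" for \<epsilon>1 \<epsilon>2
  proof -
    define \<epsilon> where "\<epsilon> = min (min \<epsilon>1 \<epsilon>2) (c / 2)"
    have e: "0 < \<epsilon>" "\<epsilon> < c" "\<epsilon> \<le> \<epsilon>1" "\<epsilon> \<le> \<epsilon>2" using \<epsilon> c by (auto simp: \<epsilon>_def)
    have "hausdorff1_pre S d \<epsilon>1 A + hausdorff1_pre S d \<epsilon>2 A' \<le> hausdorff1_pre S d \<epsilon> A + hausdorff1_pre S d \<epsilon> A'"
      by (intro add_mono hausdorff1_pre_antimono e)
    also have "\<dots> \<le> hausdorff1_pre S d \<epsilon> (A \<union> A')" by (rule pre[OF e(1,2)])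
    also have "\<dots> \<le> hausdorff1_outer S d (A \<union> A')" unfolding hausdorff1_outer_def by (rule SUP_upper) (use e in simp)
    finally show ?thesis .
  qed
  then have "(SUP \<epsilon>2\<in>{0<..}. SUP \<epsilon>1\<in>{0<..}. hausdorff1_pre S d \<epsilon>1 A + hausdorff1_pre S d \<epsilon>2 A') \<le> hausdorff1_outer S d (A \<union> A')"
    by (intro SUP_least) auto
  moreover have "(SUP \<epsilon>1\<in>{0<..}. hausdorff1_pre S d \<epsilon>1 A + q) = hausdorff1_outer S d A + q" for q
    unfolding hausdorff1_outer_def by (rule ennreal_SUP_add_left) auto
  moreover have "(SUP \<epsilon>2\<in>{0<..}. q + hausdorff1_pre S d \<epsilon>2 A') = q + hausdorff1_outer S d A'" for q
    unfolding hausdorff1_outer_def by (subst (1 2) add.commute) (rule ennreal_SUP_add_left, auto)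
  ultimately show ?thesis by simp
qed

text \<open>Caratheodory's criterion for metric outer measures, for the sublevel sets of a function whose
  disjoint closed sublevel and superlevel sets have positive distance.\<close>

lemma hausdorff1_sublevel_measurable:
  fixes f :: "'a \<Rightarrow> real"
  assumes sep: "\<And>s s'. s < s' \<Longrightarrow> \<exists>c>0. \<forall>x\<in>S. \<forall>y\<in>S. f x \<le> s \<and> s' \<le> f y \<longrightarrow> ennreal c \<le> d x y"
  shows "{x\<in>S. f x < r} \<in> sets (hausdorff1 S d)"
proof -
  let ?H = "hausdorff1_outer S d"
  let ?E = "{x\<in>S. f x < r}"
  have "?H (?E \<inter> A) + ?H ((S - ?E) \<inter> A) \<le> ?H A" if A: "A \<subseteq> S" for A
  proof (cases "?H A = top")
    case False
    \<comment> \<open>Levels increasing to r. The part of the sublevel set up to \<open>s n\<close>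
      is separated from its complement; the rest is cut into rings between consecutive
      levels.\<close>
    define s where "s n = r - 1 / (real n + 1)" for n :: nat
    have s_mono: "s n < s (Suc n)" "s n < r" for n by (auto simp: s_def field_simps)
    have s_mono': "s m \<le> s n" if "m \<le> n" for m n by (rule lift_Suc_mono_le[of s, OF less_imp_le[OF s_mono(1)] that])
    have addH: "?H (A1 \<union> A2) = ?H A1 + ?H A2" if "A1 \<subseteq> S" "A2 \<subseteq> S" "\<And>x. x \<in> A1 \<Longrightarrow> f x \<le> a" "\<And>x. x \<in> A2 \<Longrightarrow> b \<le> f x" "a < b" for A1 A2 a b
    proof -
      obtain c where c: "0 < c" "\<And>x y. x \<in> S \<Longrightarrow> y \<in> S \<Longrightarrow> f x \<le> a \<Longrightarrow> b \<le> f y \<Longrightarrow> ennreal c \<le> d x y" using sep[OF \<open>a < b\<close>] by blast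
      have "?H A1 + ?H A2 \<le> ?H (A1 \<union> A2)" by (rule hausdorff1_outer_separated[OF c(1)]) (use c(2) that in blast)
      then show ?thesis by (intro antisym hausdorff1_outer_Un)
    qed
    define R where "R n = {x\<in>A. s n < f x \<and> f x \<le> s (Suc n)}" for n
    have RS: "R n \<subseteq> S" "R n \<subseteq> A" for n using A by (auto simp: R_def)
    \<comment> \<open>Rings of equal parity are separated from each other by a whole ring, so their
      outer measures add up to at most that of A. With both parities the series converges and its
      tails, the cost of replacing E by the level \<open>s n\<close>, tend to 0.\<close>
    have sums: "(\<Sum>k<N. ?H (R (2 * k + i))) \<le> ?H A" for N i
    proof -
      have "(\<Sum>k<N. ?H (R (2 * k + i))) = ?H (\<Union>k<N. R (2 * k + i))"
      proof (induction N)
        case (Suc N)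
        show ?case
        proof (cases N)
          case 0 then show ?thesis by (simp add: lessThan_Suc)
        next
          case (Suc N')
          have "?H ((\<Union>k<N. R (2 * k + i)) \<union> R (2 * N + i)) = ?H (\<Union>k<N. R (2 * k + i)) + ?H (R (2 * N + i))"
          proof (rule addH[where a="s (2 * N' + i + 1)" and b="s (2 * N + i)"])
            show "f x \<le> s (2 * N' + i + 1)" if x: "x \<in> (\<Union>k<N. R (2 * k + i))" for x
            proof -
              obtain k where "k < N" "x \<in> R (2 * k + i)" using x by blast
              then have "f x \<le> s (Suc (2 * k + i))" by (simp add: R_def)
              also have "\<dots> \<le> s (2 * N' + i + 1)" using \<open>k < N\<close> Suc by (intro s_mono') auto
              finally show ?thesis .
            qed
            show "s (2 * N' + i + 1) < s (2 * N + i)" using s_mono(1)[of "2 * N' + i + 1"] Suc by simp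
          qed (use RS in \<open>auto simp: R_def\<close>)
          moreover have "(\<Union>k<Suc N. R (2 * k + i)) = (\<Union>k<N. R (2 * k + i)) \<union> R (2 * N + i)" by (auto simp: less_Suc_eq)
          ultimately show ?thesis using Suc.IH by simp
        qed
      qed simp
      also have "\<dots> \<le> ?H A" by (intro hausdorff1_outer_mono) (use RS in blast)
      finally show ?thesis .
    qed
    have tot: "(\<Sum>n<N. ?H (R n)) \<le> 2 * ?H A" for N
    proof -
      have "(\<Sum>n<N. ?H (R n)) \<le> (\<Sum>n\<in>(\<lambda>k. 2 * k) ` {..<N} \<union> (\<lambda>k. 2 * k + 1) ` {..<N}. ?H (R n))"
      proof (rule sum_mono2)
        show "{..<N} \<subseteq> (\<lambda>k. 2 * k) ` {..<N} \<union> (\<lambda>k. 2 * k + 1) ` {..<N}"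
        proof
          fix n assume "n \<in> {..<N}"
          then have "n div 2 \<in> {..<N}" "n = 2 * (n div 2) \<or> n = 2 * (n div 2) + 1" by auto
          then show "n \<in> (\<lambda>k. 2 * k) ` {..<N} \<union> (\<lambda>k. 2 * k + 1) ` {..<N}" by blast
        qed
      qed auto
      also have "\<dots> \<le> (\<Sum>n\<in>(\<lambda>k. 2 * k) ` {..<N}. ?H (R n)) + (\<Sum>n\<in>(\<lambda>k. 2 * k + 1) ` {..<N}. ?H (R n))"
        by (subst sum.union_disjoint) (auto, presburger)
      also have "\<dots> = (\<Sum>k<N. ?H (R (2 * k + 0))) + (\<Sum>k<N. ?H (R (2 * k + 1)))"
        by (subst (1 2) sum.reindex) (auto simp: inj_on_def)
      also have "\<dots> \<le> ?H A + ?H A" by (intro add_mono sums)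
      finally show ?thesis by (simp add: mult_2)
    qed
    define h where "h n = enn2real (?H (R n))" for n
    have Hfin: "?H (R n) < top" for n
    proof -
      have "?H (R n) \<le> ?H A" by (intro hausdorff1_outer_mono RS)
      moreover have "?H A < top" using False by (simp add: top.not_eq_extremum[symmetric])
      ultimately show ?thesis by (rule order_le_less_trans)
    qed
    then have h: "?H (R n) = ennreal (h n)" for n by (simp add: h_def)
    have h0: "0 \<le> h n" for n by (simp add: h_def)
    have "summable h"
    proof (rule summableI_nonneg_bounded[OF h0])
      fix N
      have "ennreal (\<Sum>n<N. h n) \<le> 2 * ?H A" using tot[of N] by (simp add: h h0)
      then have "enn2real (ennreal (\<Sum>n<N. h n)) \<le> enn2real (2 * ?H A)" using False
        by (intro enn2real_mono) (auto simp: ennreal_mult_less_top top.not_eq_extremum)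
      then show "(\<Sum>n<N. h n) \<le> enn2real (2 * ?H A)" using h0 by (simp add: sum_nonneg)
    qed
    then have tail: "(\<lambda>n. \<Sum>i. h (i + n)) \<longlonglongrightarrow> 0" by (rule suminf_exist_split2)
    have step: "?H (?E \<inter> A) + ?H ((S - ?E) \<inter> A) \<le> ?H A + ennreal (\<Sum>i. h (i + n))" for n
    proof -
      define An where "An = {x\<in>A. f x \<le> s n}"
      have "?E \<inter> A \<subseteq> An \<union> (\<Union>i. R (i + n))"
      proof
        fix x assume x: "x \<in> ?E \<inter> A"
        show "x \<in> An \<union> (\<Union>i. R (i + n))"
        proof (cases "f x \<le> s n")
          case False
          have ex: "\<exists>m. f x \<le> s m"
          proof -
            obtain m :: nat where "1 / (r - f x) < real m" using reals_Archimedean2 by blast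
            then have "1 / (real m + 1) \<le> r - f x" using x by (simp add: field_simps)
            then show ?thesis by (intro exI[of _ m]) (simp add: s_def)
          qed
          define m where "m = (LEAST m. f x \<le> s m)"
          have m: "f x \<le> s m" unfolding m_def using ex by (rule LeastI_ex)
          have "n < m" using m False s_mono'[of m n] by (meson leI order_trans)
          then have "\<not> f x \<le> s (m - 1)" unfolding m_def by (intro not_less_Least) (simp add: m_def[symmetric])
          then have "x \<in> R (m - 1)" using x m \<open>n < m\<close> by (auto simp: R_def)
          moreover have "m - 1 = (m - 1 - n) + n" using \<open>n < m\<close> by simp
          ultimately have "x \<in> R ((m - 1 - n) + n)" by (simp only:)
          then show ?thesis by (rule UnI2[OF UN_I[OF UNIV_I]])
        qed (use x in \<open>auto simp: An_def\<close>)
      qed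
      then have "?H (?E \<inter> A) \<le> ?H (An \<union> (\<Union>i. R (i + n)))" by (rule hausdorff1_outer_mono)
      also have "\<dots> \<le> ?H An + ?H (\<Union>i. R (i + n))" by (rule hausdorff1_outer_Un)
      also have "?H (\<Union>i. R (i + n)) \<le> (\<Sum>i. ?H (R (i + n)))" by (rule hausdorff1_outer_countable)
      also have "(\<Sum>i. ?H (R (i + n))) = ennreal (\<Sum>i. h (i + n))"
        unfolding h using \<open>summable h\<close> by (intro suminf_ennreal2 h0) (simp add: summable_iff_shift)
      finally have 1: "?H (?E \<inter> A) \<le> ?H An + ennreal (\<Sum>i. h (i + n))" by (simp add: add_left_mono)
      have "?H An + ?H ((S - ?E) \<inter> A) = ?H (An \<union> (S - ?E) \<inter> A)"
        by (rule addH[symmetric, where a="s n" and b=r]) (use A s_mono in \<open>auto simp: An_def\<close>)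
      also have "\<dots> \<le> ?H A" by (intro hausdorff1_outer_mono) (auto simp: An_def)
      finally have 2: "?H An + ?H ((S - ?E) \<inter> A) \<le> ?H A" .
      have "?H (?E \<inter> A) + ?H ((S - ?E) \<inter> A) \<le> (?H An + ennreal (\<Sum>i. h (i + n))) + ?H ((S - ?E) \<inter> A)"
        using 1 by (rule add_right_mono)
      also have "\<dots> = (?H An + ?H ((S - ?E) \<inter> A)) + ennreal (\<Sum>i. h (i + n))" by (simp add: add_ac)
      also have "\<dots> \<le> ?H A + ennreal (\<Sum>i. h (i + n))" using 2 by (rule add_right_mono)
      finally show ?thesis .
    qed
    show ?thesis
    proof (rule ennreal_le_epsilon)
      fix e :: real assume "0 < e"
      from order_tendstoD(2)[OF tail this] obtain n where "(\<Sum>i. h (i + n)) < e" by (auto simp: eventually_sequentially)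
      then have "?H A + ennreal (\<Sum>i. h (i + n)) \<le> ?H A + ennreal e" by (intro add_left_mono ennreal_leI) simp
      with step[of n] show "?H (?E \<inter> A) + ?H ((S - ?E) \<inter> A) \<le> ?H A + ennreal e" by (rule order_trans)
    qed
  qed simp
  moreover have "?H A \<le> ?H (?E \<inter> A) + ?H ((S - ?E) \<inter> A)" if "A \<subseteq> S" for A
  proof -
    have "A = (?E \<inter> A) \<union> ((S - ?E) \<inter> A)" using that by blast
    then show ?thesis using hausdorff1_outer_Un by metis
  qed
  ultimately show ?thesis unfolding sets_hausdorff1 lambda_system_def by (auto intro: antisym)
qed

lemma space_hausdorff1: "space (hausdorff1 S d) = S"
  using hausdorff1_measure_space[of S d] unfolding hausdorff1_def measure_space_def
  by (simp add: sigma_algebra.space_measure_of_eq)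

section \<open>The Hessian metric in dual coordinates\<close>

lemma gradient_form_has_derivative:
  fixes f :: "real^'n::finite \<Rightarrow> real"
  assumes "f differentiable (at x)"
  shows "(f has_derivative (\<lambda>h. gradient_form f x \<bullet> h)) (at x)"
proof -
  let ?D = "frechet_derivative f (at x)"
  have D: "(f has_derivative ?D) (at x)" using assms by (simp add: frechet_derivative_works)
  then have lin: "linear ?D" by (rule has_derivative_linear)
  have "?D h = gradient_form f x \<bullet> h" for h
  proof -
    have "?D h = ?D (\<Sum>i\<in>UNIV. h $ i *\<^sub>R axis i 1)"
      using basis_expansion[of h] by (simp add: scalar_mult_eq_scaleR)
    also have "\<dots> = (\<Sum>i\<in>UNIV. h $ i * ?D (axis i 1))"
      by (simp add: linear_sum[OF lin] linear_scale[OF lin])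
    also have "\<dots> = gradient_form f x \<bullet> h"
      by (simp add: gradient_form_def partial_deriv_def inner_vec_def mult.commute)
    finally show ?thesis .
  qed
  then have "?D = (\<lambda>h. gradient_form f x \<bullet> h)" by (rule ext)
  then show ?thesis using D by metis
qed

lemma has_derivative_imp_gradient_form:
  fixes f :: "real^'n::finite \<Rightarrow> real"
  assumes "(f has_derivative (\<lambda>h. g \<bullet> h)) (at x)"
  shows "gradient_form f x = g"
proof -
  have "frechet_derivative f (at x) = (\<lambda>h. g \<bullet> h)" using frechet_derivative_at[OF assms] by simp
  then show ?thesis by (simp add: gradient_form_def partial_deriv_def inner_axis vec_eq_iff)
qed

lemma has_integral_inner_const: "(f has_integral i) A \<Longrightarrow> ((\<lambda>x. f x \<bullet> c) has_integral (i \<bullet> c)) A"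
  by (drule has_integral_linear[OF _ bounded_linear_inner_left[of c]]) (simp add: o_def)

lemma smooth_on_partial: "smooth_on S f \<Longrightarrow> smooth_on S (partial_deriv i f)"
  unfolding smooth_on_def by (metis Ck_on.simps(2))

lemma smooth_on_continuous: "smooth_on S f \<Longrightarrow> continuous_on S f"
  unfolding smooth_on_def by (metis Ck_on.simps(1))

lemma smooth_on_differentiable: "smooth_on S f \<Longrightarrow> open S \<Longrightarrow> x \<in> S \<Longrightarrow> f differentiable (at x)"
  unfolding smooth_on_def by (metis Ck_on.simps(2) differentiable_on_def at_within_open)

lemma partial_deriv_along:
  assumes "f differentiable (at (z + a *\<^sub>R axis i 1))"
  shows "((\<lambda>a. f (z + a *\<^sub>R axis i 1)) has_real_derivative partial_deriv i f (z + a *\<^sub>R axis i 1)) (at a)"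
proof -
  have "((\<lambda>a. z + a *\<^sub>R axis i 1) has_derivative (\<lambda>h. h *\<^sub>R axis i 1)) (at a)" by (auto intro!: derivative_eq_intros)
  from has_derivative_compose[OF this gradient_form_has_derivative[OF assms]]
  show ?thesis unfolding has_field_derivative_def by (simp add: gradient_form_def inner_axis mult.commute[of _ "partial_deriv i f _"])
qed

text \<open>The mean value theorem in direction i for the difference in direction j, followed by the
  mean value theorem in direction j.\<close>

lemma second_difference:
  assumes S: "open S" "smooth_on S f" and s: "0 < s"
    and sub: "\<And>a b. 0 \<le> a \<Longrightarrow> a \<le> s \<Longrightarrow> 0 \<le> b \<Longrightarrow> b \<le> s \<Longrightarrow> x + a *\<^sub>R axis i 1 + b *\<^sub>R axis j 1 \<in> S"
  shows "\<exists>a b. 0 \<le> a \<and> a \<le> s \<and> 0 \<le> b \<and> b \<le> s \<and>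
    f (x + s *\<^sub>R axis i 1 + s *\<^sub>R axis j 1) - f (x + s *\<^sub>R axis i 1) - f (x + s *\<^sub>R axis j 1) + f x
      = s\<^sup>2 * partial_deriv j (partial_deriv i f) (x + a *\<^sub>R axis i 1 + b *\<^sub>R axis j 1)"
proof -
  define \<phi> where "\<phi> a = f (x + s *\<^sub>R axis j 1 + a *\<^sub>R axis i 1) - f (x + a *\<^sub>R axis i 1)" for a
  have dif: "f differentiable (at y)" "partial_deriv i f differentiable (at y)" if "y \<in> S" for y
    using smooth_on_differentiable S smooth_on_partial that by blast+
  have in1: "x + s *\<^sub>R axis j 1 + a *\<^sub>R axis i 1 \<in> S" "x + a *\<^sub>R axis i 1 \<in> S" if "0 \<le> a" "a \<le> s" for a
    using sub[of a s] sub[of a 0] that s by (auto simp: add_ac)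
  have "(\<phi> has_real_derivative partial_deriv i f (x + s *\<^sub>R axis j 1 + a *\<^sub>R axis i 1) - partial_deriv i f (x + a *\<^sub>R axis i 1)) (at a)"
    if "0 \<le> a" "a \<le> s" for a
    unfolding \<phi>_def using in1[OF that] dif by (intro DERIV_diff partial_deriv_along) auto
  from MVT2[OF s, of \<phi>, OF this] obtain a where a: "0 < a" "a < s"
    "\<phi> s - \<phi> 0 = s * (partial_deriv i f (x + s *\<^sub>R axis j 1 + a *\<^sub>R axis i 1) - partial_deriv i f (x + a *\<^sub>R axis i 1))" by auto
  define \<psi> where "\<psi> b = partial_deriv i f (x + a *\<^sub>R axis i 1 + b *\<^sub>R axis j 1)" for b
  have "(\<psi> has_real_derivative partial_deriv j (partial_deriv i f) (x + a *\<^sub>R axis i 1 + b *\<^sub>R axis j 1)) (at b)"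
    if "0 \<le> b" "b \<le> s" for b
    unfolding \<psi>_def using sub[of a b] a that dif by (intro partial_deriv_along) auto
  from MVT2[OF s, of \<psi>, OF this] obtain b where b: "0 < b" "b < s"
    "\<psi> s - \<psi> 0 = s * partial_deriv j (partial_deriv i f) (x + a *\<^sub>R axis i 1 + b *\<^sub>R axis j 1)" by auto
  have e1: "\<psi> s - \<psi> 0 = partial_deriv i f (x + s *\<^sub>R axis j 1 + a *\<^sub>R axis i 1) - partial_deriv i f (x + a *\<^sub>R axis i 1)"
    by (simp add: \<psi>_def add_ac)
  have e2: "\<phi> s - \<phi> 0 = f (x + s *\<^sub>R axis i 1 + s *\<^sub>R axis j 1) - f (x + s *\<^sub>R axis i 1) - f (x + s *\<^sub>R axis j 1) + f x"
    by (simp add: \<phi>_def add_ac)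
  have "\<phi> s - \<phi> 0 = s * (s * partial_deriv j (partial_deriv i f) (x + a *\<^sub>R axis i 1 + b *\<^sub>R axis j 1))"
    unfolding a(3) e1[symmetric] b(3) by simp
  then have "f (x + s *\<^sub>R axis i 1 + s *\<^sub>R axis j 1) - f (x + s *\<^sub>R axis i 1) - f (x + s *\<^sub>R axis j 1) + f x
      = s\<^sup>2 * partial_deriv j (partial_deriv i f) (x + a *\<^sub>R axis i 1 + b *\<^sub>R axis j 1)"
    unfolding e2 by (simp add: power2_eq_square)
  then show ?thesis using a(1,2) b(1,2) by (intro exI[of _ a] exI[of _ b]) simp
qed

text \<open>The second difference over a small square is symmetric in i and j, so each mixed
  derivative takes the same value at some point of the square; continuity moves both points to the
  corner x.\<close>

lemma mixed_partials_commute: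
  assumes S: "open S" "smooth_on S f" and x: "x \<in> S"
  shows "partial_deriv j (partial_deriv i f) x = partial_deriv i (partial_deriv j f) x" (is "?F x = ?G x")
proof (rule ccontr)
  assume neq: "?F x \<noteq> ?G x"
  define e where "e = \<bar>?F x - ?G x\<bar> / 2"
  have e: "0 < e" using neq by (simp add: e_def)
  obtain r where r: "0 < r" "ball x r \<subseteq> S" using S(1) x by (meson openE)
  have "isCont ?F x" "isCont ?G x"
    using smooth_on_continuous smooth_on_partial S x by (meson continuous_on_eq_continuous_at)+
  then obtain d1 d2 where d: "0 < d1" "\<And>y. dist y x < d1 \<Longrightarrow> dist (?F y) (?F x) < e" 
    "0 < d2" "\<And>y. dist y x < d2 \<Longrightarrow> dist (?G y) (?G x) < e"
    unfolding continuous_at_eps_delta dist_real_def using e by metis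
  define s where "s = min r (min d1 d2) / 3"
  have s: "0 < s" "3 * s \<le> r" "3 * s \<le> d1" "3 * s \<le> d2" using r d by (auto simp: s_def)
  have near: "dist (x + a *\<^sub>R axis k 1 + b *\<^sub>R axis l 1) x < 3 * s" if "0 \<le> a" "a \<le> s" "0 \<le> b" "b \<le> s" for a b and k l :: 'a
  proof -
    have "norm (a *\<^sub>R axis k (1::real) + b *\<^sub>R axis l (1::real)) \<le> norm (a *\<^sub>R axis k (1::real)) + norm (b *\<^sub>R axis l (1::real))" by (rule norm_triangle_ineq)
    then show ?thesis using that s by (simp add: dist_norm add.assoc)
  qed
  have inS: "x + a *\<^sub>R axis k 1 + b *\<^sub>R axis l 1 \<in> S" if "0 \<le> a" "a \<le> s" "0 \<le> b" "b \<le> s" for a b and k l :: 'a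
    using near[OF that, of k l] s r by (auto simp: dist_commute subset_iff)
  from second_difference[OF S s(1) inS, of i j] obtain a b where ab: "0 \<le> a" "a \<le> s" "0 \<le> b" "b \<le> s"
    "f (x + s *\<^sub>R axis i 1 + s *\<^sub>R axis j 1) - f (x + s *\<^sub>R axis i 1) - f (x + s *\<^sub>R axis j 1) + f x = s\<^sup>2 * ?F (x + a *\<^sub>R axis i 1 + b *\<^sub>R axis j 1)"
    by blast
  from second_difference[OF S s(1) inS, of j i] obtain a' b' where ab': "0 \<le> a'" "a' \<le> s" "0 \<le> b'" "b' \<le> s"
    "f (x + s *\<^sub>R axis j 1 + s *\<^sub>R axis i 1) - f (x + s *\<^sub>R axis j 1) - f (x + s *\<^sub>R axis i 1) + f x = s\<^sup>2 * ?G (x + a' *\<^sub>R axis j 1 + b' *\<^sub>R axis i 1)"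
    by blast
  have "s\<^sup>2 * ?F (x + a *\<^sub>R axis i 1 + b *\<^sub>R axis j 1) = s\<^sup>2 * ?G (x + a' *\<^sub>R axis j 1 + b' *\<^sub>R axis i 1)"
    unfolding ab(5)[symmetric] ab'(5)[symmetric] by (simp add: add_ac)
  then have eq: "?F (x + a *\<^sub>R axis i 1 + b *\<^sub>R axis j 1) = ?G (x + a' *\<^sub>R axis j 1 + b' *\<^sub>R axis i 1)" using s by simp
  have "dist (?F (x + a *\<^sub>R axis i 1 + b *\<^sub>R axis j 1)) (?F x) < e" using d(2) near[OF ab(1-4), of i j] s by force
  moreover have "dist (?G (x + a' *\<^sub>R axis j 1 + b' *\<^sub>R axis i 1)) (?G x) < e" using d(4) near[OF ab'(1-4), of j i] s by force
  ultimately have "\<bar>?F x - ?G x\<bar> < 2 * e" unfolding dist_real_def eq by linarith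
  then show False by (simp add: e_def)
qed

locale hessian_dom =
  fixes B :: "(real^'n::finite) set" and u :: "real^'n \<Rightarrow> real"
  assumes dom: "hessian_domain B u"
begin

abbreviation "Y \<equiv> gradient_form u"
abbreviation "h \<equiv> hessian u"

lemma open_B: "open B" using dom by (simp add: hessian_domain_def)
lemma smooth_u: "smooth_on B u" using dom by (simp add: hessian_domain_def)

lemma hessian_sym: "x \<in> B \<Longrightarrow> transpose (h x) = h x"
  using mixed_partials_commute[OF open_B smooth_u] by (simp add: hessian_def transpose_def vec_eq_iff)

lemma hessian_pos: "x \<in> B \<Longrightarrow> w \<noteq> 0 \<Longrightarrow> 0 < w \<bullet> (h x *v w)"
  using dom by (simp add: hessian_domain_def)

text \<open>Differentiating component i of the gradient gives row i of the transposed Hessian;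
  symmetry removes the transpose.\<close>

lemma Y_deriv: "x \<in> B \<Longrightarrow> (Y has_derivative (\<lambda>w. h x *v w)) (at x)"
proof -
  assume x: "x \<in> B"
  have "((\<lambda>x. Y x $ i) has_derivative (\<lambda>w. (h x *v w) $ i)) (at x)" for i
  proof -
    have "(partial_deriv i u has_derivative (\<lambda>w. gradient_form (partial_deriv i u) x \<bullet> w)) (at x)"
      by (intro gradient_form_has_derivative smooth_on_differentiable[OF _ open_B x] smooth_on_partial smooth_u)
    moreover have "gradient_form (partial_deriv i u) x \<bullet> w = (h x *v w) $ i" for w
    proof -
      have "(h x *v w) $ i = (transpose (h x) *v w) $ i" by (simp add: hessian_sym[OF x])
      also have "\<dots> = gradient_form (partial_deriv i u) x \<bullet> w"
        by (simp add: matrix_vector_mult_def transpose_def hessian_def gradient_form_def inner_vec_def)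
      finally show ?thesis by simp
    qed
    moreover have "(\<lambda>x. Y x $ i) = partial_deriv i u" by (simp add: gradient_form_def)
    ultimately show ?thesis by simp
  qed
  then show ?thesis by (subst has_derivative_componentwise_within) (auto simp: Basis_vec_def inner_axis)
qed

lemma Y_cont: "continuous_on B Y"
  using Y_deriv by (meson continuous_at_imp_continuous_on has_derivative_continuous)

lemma hessian_cont: "continuous_on B (\<lambda>x. h x *v w)"
proof -
  have "continuous_on B (\<lambda>x. h x $ i $ j)" for i j
    unfolding hessian_def using smooth_on_continuous[OF smooth_on_partial[OF smooth_on_partial[OF smooth_u]]] by simp
  then have "continuous_on B (\<lambda>x. (h x *v w) $ i)" for i
    unfolding matrix_vector_mult_def by (simp add: continuous_intros)
  then show ?thesis by (subst continuous_on_componentwise) (auto simp: Basis_vec_def inner_axis)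
qed

lemma hessian_cont2: "continuous_on (B \<times> UNIV) (\<lambda>(x, w). h x *v w)"
proof -
  have c: "continuous_on B (\<lambda>x. h x $ i $ j)" for i j
    unfolding hessian_def using smooth_on_continuous[OF smooth_on_partial[OF smooth_on_partial[OF smooth_u]]] by simp
  have "continuous_on (B \<times> UNIV) (\<lambda>p. (h (fst p) *v snd p) $ i)" for i
    unfolding matrix_vector_mult_def vec_lambda_beta
    by (intro continuous_intros continuous_on_compose2[OF c]) auto
  then show ?thesis unfolding case_prod_unfold by (subst continuous_on_componentwise) (auto simp: Basis_vec_def inner_axis)
qed

text \<open>Extreme values over K times the unit sphere, extended to all vectors by
  homogeneity.\<close>

lemma hessian_bounds:
  assumes "compact K" "K \<subseteq> B"
  shows "\<exists>c C. 0 < c \<and> 0 < C \<and> (\<forall>x\<in>K. \<forall>w. c * (norm w)\<^sup>2 \<le> w \<bullet> (h x *v w) \<and> norm (h x *v w) \<le> C * norm w)"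
proof (cases "K = {}")
  case False
  let ?S = "K \<times> sphere (0::real^'n) 1"
  obtain w0 :: "real^'n" where "w0 \<in> Basis" using nonempty_Basis by blast
  then have "w0 \<in> sphere 0 1" by simp
  then have ne: "?S \<noteq> {}" using False by blast
  have comp: "compact ?S" using assms by (intro compact_Times) auto
  have sub: "?S \<subseteq> B \<times> UNIV" using assms by auto
  have c1: "continuous_on ?S (\<lambda>p. snd p \<bullet> (h (fst p) *v snd p))" "continuous_on ?S (\<lambda>p. norm (h (fst p) *v snd p))"
    using continuous_on_subset[OF hessian_cont2 sub] unfolding case_prod_unfold by (intro continuous_intros; simp)+
  obtain p where p: "p \<in> ?S" "\<And>q. q \<in> ?S \<Longrightarrow> snd p \<bullet> (h (fst p) *v snd p) \<le> snd q \<bullet> (h (fst q) *v snd q)"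
    using continuous_attains_inf[OF comp ne c1(1)] by blast
  obtain p' where p': "p' \<in> ?S" "\<And>q. q \<in> ?S \<Longrightarrow> norm (h (fst q) *v snd q) \<le> norm (h (fst p') *v snd p')"
    using continuous_attains_sup[OF comp ne c1(2)] by blast
  define c where "c = snd p \<bullet> (h (fst p) *v snd p)"
  define C where "C = norm (h (fst p') *v snd p') + 1"
  have "0 < c" unfolding c_def using p(1) assms(2) by (intro hessian_pos) auto
  moreover have "0 < C" by (simp add: C_def add_nonneg_pos)
  moreover have "c * (norm w)\<^sup>2 \<le> w \<bullet> (h x *v w) \<and> norm (h x *v w) \<le> C * norm w" if x: "x \<in> K" for x w
  proof (cases "w = 0")
    case False
    define v where "v = w /\<^sub>R norm w"
    have v: "(x, v) \<in> ?S" "w = norm w *\<^sub>R v" using x False by (auto simp: v_def)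
    have hv: "h x *v w = norm w *\<^sub>R (h x *v v)" by (subst v(2)) (simp add: matrix_vector_mult_scaleR)
    have "c \<le> v \<bullet> (h x *v v)" using p(2)[OF v(1)] by (simp add: c_def)
    then have "c * (norm w)\<^sup>2 \<le> (v \<bullet> (h x *v v)) * (norm w)\<^sup>2" by (rule mult_right_mono) simp
    also have "\<dots> = (norm w *\<^sub>R v) \<bullet> (norm w *\<^sub>R (h x *v v))" by (simp add: power2_eq_square)
    also have "\<dots> = w \<bullet> (h x *v w)" using v(2) hv by simp
    finally have 1: "c * (norm w)\<^sup>2 \<le> w \<bullet> (h x *v w)" .
    have "norm (h x *v v) \<le> C" using p'(2)[OF v(1)] by (simp add: C_def)
    then have "norm (h x *v w) \<le> C * norm w" unfolding hv using mult_left_mono[of "norm (h x *v v)" C "norm w"] by (simp add: mult.commute)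
    then show ?thesis using 1 by simp
  qed simp
  ultimately show ?thesis by blast
qed (intro exI[of _ 1], simp)

end

section \<open>Lengths, measurability and covers in the Hessian metric\<close>

context hessian_dom
begin

text \<open>Up to its first exit from a small Euclidean ball the path moves where the metric
  dominates c times the Euclidean one, and its length there is at least that of its projection to
  the line through x and the exit point. The minimum accounts for end points outside the
  ball.\<close>

lemma path_length_lower:
  assumes sub: "cball x t \<subseteq> B" and t: "0 < t" and c: "0 < c" "\<And>z w. z \<in> cball x t \<Longrightarrow> c * (norm w)\<^sup>2 \<le> w \<bullet> (h z *v w)"
    and \<gamma>: "valid_path \<gamma>" "pathstart \<gamma> = x" "pathfinish \<gamma> = y"
  shows "ennreal (sqrt c * min (norm (y - x)) t) \<le> g_length u \<gamma>"
proof (cases "x = y")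
  case False
  define m where "m = min (norm (y - x)) t"
  have m: "0 < m" "m \<le> t" "m \<le> norm (y - x)" using False t by (auto simp: m_def)
  have cont: "continuous_on {0..1} \<gamma>" using \<gamma>(1) by (simp add: valid_path_def piecewise_C1_differentiable_on_def)
  obtain T where T: "finite T" "\<gamma> C1_differentiable_on ({0..1} - T)"
    using \<gamma>(1) by (auto simp: valid_path_def piecewise_C1_differentiable_on_def)
  obtain D where D: "\<And>s. s \<in> {0..1} - T \<Longrightarrow> (\<gamma> has_vector_derivative D s) (at s)" "continuous_on ({0..1} - T) D"
    using T(2) unfolding C1_differentiable_on_def by blast
  have g0: "\<gamma> 0 = x" "\<gamma> 1 = y" using \<gamma> by (auto simp: pathstart_def pathfinish_def)
  \<comment> \<open>Its infimum \<tau> is the first time at which the path is at distance m from x;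
    up to then it stays in \<open>cball x t\<close>, whatever it does later.\<close>
  define A where "A = {0..1} \<inter> (\<lambda>s. norm (\<gamma> s - x)) -` {m..}"
  have "closed A" unfolding A_def by (intro continuous_closed_preimage continuous_intros cont)
  have "1 \<in> A" using m g0 by (simp add: A_def)
  have bdd: "bdd_below A" by (auto simp: A_def intro!: bdd_belowI[of _ 0])
  define \<tau> where "\<tau> = Inf A"
  have "\<tau> \<in> A" unfolding \<tau>_def using \<open>closed A\<close> \<open>1 \<in> A\<close> bdd by (intro closed_contains_Inf) auto
  then have \<tau>: "0 \<le> \<tau>" "\<tau> \<le> 1" "m \<le> norm (\<gamma> \<tau> - x)" by (auto simp: A_def)
  have "\<tau> \<noteq> 0" using \<tau>(3) m(1) g0 by auto
  then have "0 < \<tau>" using \<tau> by simp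
  have before: "\<gamma> s \<in> cball x t" if "0 \<le> s" "s < \<tau>" for s
  proof -
    have "s \<notin> A" using that(2) cInf_lower[OF _ bdd] unfolding \<tau>_def by force
    then show ?thesis using that \<tau> m by (auto simp: A_def dist_norm norm_minus_commute)
  qed
  define A' where "A' = {0<..<\<tau>} - T"
  have A'sub: "A' \<subseteq> {0..1} - T" using \<tau> by (auto simp: A'_def)
  have A'b: "A' \<in> sets borel" unfolding A'_def using finite_imp_closed[OF T(1)] by (intro sets.Diff) auto
  have D': "vector_derivative \<gamma> (at s) = D s" if "s \<in> A'" for s using D(1) A'sub that by (intro vector_derivative_at) auto
  define e where "e = (\<gamma> \<tau> - x) /\<^sub>R norm (\<gamma> \<tau> - x)"
  have "0 < norm (\<gamma> \<tau> - x)" using \<tau>(3) m(1) by linarith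
  then have ne: "norm e = 1" by (simp add: e_def)
  have "(D has_integral \<gamma> \<tau> - \<gamma> 0) {0..\<tau>}"
    by (rule fundamental_theorem_of_calculus_interior_strong[OF T(1)])
      (use \<tau> D(1) in \<open>auto intro: continuous_on_subset[OF cont]\<close>)
  from has_integral_mult_right[OF has_integral_inner_const[OF this, of e], of "sqrt c"]
  have int1: "((\<lambda>s. sqrt c * (D s \<bullet> e)) has_integral sqrt c * norm (\<gamma> \<tau> - x)) {0..\<tau>}"
  proof -
    have "(\<gamma> \<tau> - x) \<bullet> e = norm (\<gamma> \<tau> - x)"
      using \<open>0 < norm (\<gamma> \<tau> - x)\<close> by (simp add: e_def dot_square_norm power2_eq_square)
    then show ?thesis using \<open>((\<lambda>s. sqrt c * (D s \<bullet> e)) has_integral sqrt c * ((\<gamma> \<tau> - \<gamma> 0) \<bullet> e)) {0..\<tau>}\<close> g0(1) by simp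
  qed
  define \<psi> where "\<psi> s = indicator A' s *\<^sub>R (sqrt c * (D s \<bullet> e))" for s
  define \<Phi> where "\<Phi> s = indicator A' s *\<^sub>R (sqrt c * norm (D s))" for s
  have "(\<psi> has_integral sqrt c * norm (\<gamma> \<tau> - x)) {0..\<tau>}"
    by (rule has_integral_spike_finite[OF _ _ int1, of "T \<union> {0, \<tau>}"]) (use T(1) in \<open>auto simp: \<psi>_def A'_def\<close>)
  then have \<psi>int: "(\<psi> has_integral sqrt c * norm (\<gamma> \<tau> - x)) UNIV"
    by (rule has_integral_on_superset) (auto simp: \<psi>_def A'_def)
  have cD: "continuous_on A' D" by (rule continuous_on_subset[OF D(2) A'sub])
  have meas: "\<psi> \<in> borel_measurable lborel" "\<Phi> \<in> borel_measurable lborel"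
  proof -
    have "(\<lambda>s. indicator A' s *\<^sub>R (sqrt c * (D s \<bullet> e))) \<in> borel_measurable borel"
      by (intro borel_measurable_continuous_on_indicator A'b continuous_intros cD)
    then show "\<psi> \<in> borel_measurable lborel" unfolding \<psi>_def by simp
    have "(\<lambda>s. indicator A' s *\<^sub>R (sqrt c * norm (D s))) \<in> borel_measurable borel"
      by (intro borel_measurable_continuous_on_indicator A'b continuous_intros cD)
    then show "\<Phi> \<in> borel_measurable lborel" unfolding \<Phi>_def by simp
  qed
  have ptw: "ennreal (\<Phi> s) \<le> ennreal (g_norm u (\<gamma> s) (vector_derivative \<gamma> (at s))) * indicator {0..1} s" for s
  proof (cases "s \<in> A'")
    case True
    then have "\<gamma> s \<in> cball x t" using before by (auto simp: A'_def)
    from c(2)[OF this, of "D s"] have "sqrt (c * (norm (D s))\<^sup>2) \<le> g_norm u (\<gamma> s) (D s)" by (simp add: g_norm_def)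
    then have "sqrt c * norm (D s) \<le> g_norm u (\<gamma> s) (vector_derivative \<gamma> (at s))" using D'[OF True] by (simp add: real_sqrt_mult)
    then show ?thesis using True A'sub by (auto simp: \<Phi>_def intro!: ennreal_leI)
  qed (simp add: \<Phi>_def)
  have le: "(\<integral>\<^sup>+ s. ennreal (\<Phi> s) \<partial>lborel) \<le> g_length u \<gamma>"
    unfolding g_length_def by (rule nn_integral_mono) (rule ptw)
  have \<Phi>0: "0 \<le> \<Phi> s" for s using c(1) by (simp add: \<Phi>_def)
  \<comment> \<open>The gauge integral of the projected velocity exists in any case, by the
    fundamental theorem. Comparison needs Lebesgue integrability, which follows when the integral of
    \<Phi> is finite; otherwise the length is infinite and the bound trivial.\<close>
  show ?thesis
  proof (cases "(\<integral>\<^sup>+ s. ennreal (\<Phi> s) \<partial>lborel) = \<infinity>")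
    case True
    then show ?thesis using le by (simp add: top_unique)
  next
    case False
    then have "(\<integral>\<^sup>+ s. ennreal (\<Phi> s) \<partial>lborel) < \<infinity>" by (simp add: top.not_eq_extremum)
    then have \<Phi>i: "integrable lborel \<Phi>" using meas(2) \<Phi>0 by (intro integrableI_nonneg) auto
    have \<psi>\<Phi>: "\<bar>\<psi> s\<bar> \<le> \<Phi> s" for s
      using Cauchy_Schwarz_ineq2[of "D s" e] ne c(1) by (auto simp: \<psi>_def \<Phi>_def abs_mult intro!: mult_left_mono)
    then have \<psi>i: "integrable lborel \<psi>"
      using meas(1) \<Phi>0 by (intro Bochner_Integration.integrable_bound[OF \<Phi>i]) auto
    have "sqrt c * norm (\<gamma> \<tau> - x) = (LINT s|lborel. \<psi> s)"
      using has_integral_unique[OF \<psi>int has_integral_integral_lborel[OF \<psi>i]] .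
    also have "\<dots> \<le> (LINT s|lborel. \<Phi> s)" using \<psi>\<Phi> by (intro integral_mono \<psi>i \<Phi>i) (meson abs_ge_self order_trans)
    finally have "ennreal (sqrt c * norm (\<gamma> \<tau> - x)) \<le> ennreal (LINT s|lborel. \<Phi> s)" by (rule ennreal_leI)
    also have "\<dots> = (\<integral>\<^sup>+ s. ennreal (\<Phi> s) \<partial>lborel)" using nn_integral_eq_integral[OF \<Phi>i] \<Phi>0 by simp
    finally have "ennreal (sqrt c * norm (\<gamma> \<tau> - x)) \<le> g_length u \<gamma>" using le by (rule order_trans)
    moreover have "ennreal (sqrt c * m) \<le> ennreal (sqrt c * norm (\<gamma> \<tau> - x))"
      using \<tau>(3) c(1) by (intro ennreal_leI mult_left_mono) auto
    ultimately show ?thesis unfolding m_def by (rule order_trans[rotated])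
  qed
qed (use t in simp)

lemma g_dist_lower:
  assumes "cball x t \<subseteq> B" "0 < t" "0 < c" "\<And>z w. z \<in> cball x t \<Longrightarrow> c * (norm w)\<^sup>2 \<le> w \<bullet> (h z *v w)"
  shows "ennreal (sqrt c * min (norm (y - x)) t) \<le> g_dist B u x y"
  unfolding g_dist_def using path_length_lower[OF assms] by (intro INF_greatest) auto

abbreviation "H \<equiv> g_hausdorff1 B u"

text \<open>The sublevel criterion for the distance from a truncated at r: between levels up to r
  the separation comes from the lower bound on path lengths inside \<open>cball a r\<close>, and
  levels above r are not attained.\<close>

lemma ball_in_sets:
  assumes sub: "cball a r \<subseteq> B" and r: "0 < r"
  shows "ball a r \<in> sets H"
proof -
  obtain c where c: "0 < c" "\<And>z w. z \<in> cball a r \<Longrightarrow> c * (norm w)\<^sup>2 \<le> w \<bullet> (h z *v w)"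
    using hessian_bounds[OF compact_cball sub] by blast
  have "{x\<in>B. min (dist a x) r < r} \<in> sets H"
  proof (rule hausdorff1_sublevel_measurable)
    fix s s' :: real assume s: "s < s'"
    show "\<exists>c>0. \<forall>x\<in>B. \<forall>y\<in>B. min (dist a x) r \<le> s \<and> s' \<le> min (dist a y) r \<longrightarrow> ennreal c \<le> g_dist B u x y"
    proof (cases "s' \<le> r")
      case True
      show ?thesis
      proof (intro exI[of _ "sqrt c * min (s' - s) (r - s)"] conjI ballI impI)
        show "0 < sqrt c * min (s' - s) (r - s)" using c s True by simp
        fix x y assume xy: "min (dist a x) r \<le> s \<and> s' \<le> min (dist a y) r"
        then have d: "dist a x \<le> s" "s' \<le> dist a y" using s True by auto
        have inc: "cball x (r - s) \<subseteq> cball a r"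
        proof
          fix z assume "z \<in> cball x (r - s)"
          then show "z \<in> cball a r" using d(1) dist_triangle[of a z x] by simp
        qed
        have "s' - s \<le> norm (y - x)" using d dist_triangle[of a y x] by (simp add: dist_norm norm_minus_commute)
        then have "sqrt c * min (s' - s) (r - s) \<le> sqrt c * min (norm (y - x)) (r - s)" using c(1) by (intro mult_left_mono) auto
        then have "ennreal (sqrt c * min (s' - s) (r - s)) \<le> ennreal (sqrt c * min (norm (y - x)) (r - s))" by (rule ennreal_leI)
        also have "\<dots> \<le> g_dist B u x y"
          by (rule g_dist_lower[OF _ _ c(1) c(2)]) (use inc sub s True in auto)
        finally show "ennreal (sqrt c * min (s' - s) (r - s)) \<le> g_dist B u x y" .
      qed
    next
      case False
      then show ?thesis by (intro exI[of _ 1]) auto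
    qed
  qed
  moreover have "{x\<in>B. min (dist a x) r < r} = ball a r" using sub by auto
  ultimately show ?thesis by simp
qed

lemma open_in_sets:
  assumes "open S" "S \<subseteq> B"
  shows "S \<in> sets H"
proof -
  let ?F = "{ball a r |a r. 0 < r \<and> cball a r \<subseteq> S}"
  obtain F' where F': "F' \<subseteq> ?F" "countable F'" "\<Union>F' = \<Union>?F" using Lindelof[of ?F] by blast
  have "\<Union>?F = S"
  proof (intro subset_antisym subsetI)
    fix x assume "x \<in> S"
    then obtain r where "0 < r" "cball x r \<subseteq> S" using assms(1) by (meson open_contains_cball)
    then show "x \<in> \<Union>?F" by (intro UnionI[of "ball x r"]) auto
  qed (use ball_subset_cball in blast)
  moreover have "\<Union>F' \<in> sets H"
    by (intro sets.countable_Union F'(2)) (use F'(1) assms(2) ball_in_sets in blast)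
  ultimately show ?thesis using F'(3) by simp
qed

lemma space_H[simp]: "space H = B" by (rule space_hausdorff1)

lemma id_measurable: "(\<lambda>x. x) \<in> measurable H borel"
proof (rule borel_measurableI)
  fix S :: "(real^'n) set" assume "open S"
  then show "(\<lambda>x. x) -` S \<inter> space H \<in> sets H" using open_B by (simp add: vimage_def) (intro open_in_sets, auto)
qed

lemma continuous_measurable:
  assumes "open U" "U \<subseteq> B" "continuous_on U f" "G \<subseteq> U"
  shows "f \<in> borel_measurable (restrict_space H G)"
proof -
  have "(\<lambda>x. x) \<in> measurable (restrict_space H G) (restrict_space borel U)"
    using assms by (intro measurable_restrict_space2 measurable_restrict_space1 id_measurable) (auto simp: space_restrict_space)
  from measurable_compose[OF this borel_measurable_continuous_on_restrict[OF assms(3)]] show ?thesis by simp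
qed

text \<open>A nearly optimal cover of A at a fine scale is pushed forward: the part of A in a
  covering set of g-diameter \<delta> has Euclidean diameter at most \<delta> / sqrt c, so its image
  lies in a ball of radius C \<delta> / sqrt c about any of its points.\<close>

lemma hausdorff_cover:
  assumes sub: "cball x0 (2 * \<rho>) \<subseteq> B" and \<rho>: "0 < \<rho>" 
    and c: "0 < c" "\<And>z w. z \<in> cball x0 (2 * \<rho>) \<Longrightarrow> c * (norm w)\<^sup>2 \<le> w \<bullet> (h z *v w)"
    and C: "0 < C" "\<And>x y. x \<in> ball x0 \<rho> \<Longrightarrow> y \<in> ball x0 \<rho> \<Longrightarrow> norm (F x - F y) \<le> C * norm (x - y)"
    and A: "A \<in> sets H" "A \<noteq> {}" "A \<subseteq> ball x0 \<rho>" "emeasure H A < \<infinity>" and \<eta>: "0 < \<eta>"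
  shows "\<exists>a r. (\<forall>i::nat. a i \<in> F ` A \<and> 0 < r i \<and> r i < \<eta>) \<and> F ` A \<subseteq> (\<Union>i. ball (a i) (r i)) \<and>
        summable r \<and> suminf r \<le> (C / sqrt c) * measure H A + (\<eta> :: real)"
proof -
  define k where "k = C / sqrt c"
  have k: "0 < k" using C c by (simp add: k_def)
  \<comment> \<open>Staying below sqrt c * \<rho> removes the truncation in
    \<open>g_dist_lower\<close>; the bound k \<epsilon> \<le> \<eta>/4 keeps the radii below
    \<eta>.\<close>
  define \<epsilon> where "\<epsilon> = min (sqrt c * \<rho> / 2) (\<eta> / (4 * k))"
  have \<epsilon>: "0 < \<epsilon>" "\<epsilon> < sqrt c * \<rho>" "k * \<epsilon> \<le> \<eta> / 4" using \<rho> c \<eta> k by (auto simp: \<epsilon>_def min_def field_simps)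
  have eH: "emeasure H A = ennreal (measure H A)" using A(4) by (simp add: emeasure_eq_ennreal_measure)
  have "hausdorff1_pre B (g_dist B u) \<epsilon> A \<le> emeasure H A"
    unfolding emeasure_hausdorff1[OF A(1)] hausdorff1_outer_def by (rule SUP_upper) (use \<epsilon> in simp)
  also have "\<dots> < ennreal (measure H A + \<eta> / (4 * k))" unfolding eH using \<eta> k by (intro ennreal_lessI) (auto simp: add_nonneg_pos)
  finally obtain X where X: "\<And>i. X i \<subseteq> B" "\<And>i::nat. ediam (g_dist B u) (X i) \<le> ennreal \<epsilon>" "A \<subseteq> (\<Union>i. X i)"
    and sX: "(\<Sum>i. ediam (g_dist B u) (X i)) < ennreal (measure H A + \<eta> / (4 * k))"
    unfolding hausdorff1_pre_def INF_less_iff by blast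
  define \<delta> where "\<delta> i = enn2real (ediam (g_dist B u) (X i))" for i
  have \<delta>: "ediam (g_dist B u) (X i) = ennreal (\<delta> i)" "0 \<le> \<delta> i" "\<delta> i \<le> \<epsilon>" for i
  proof -
    show 1: "ediam (g_dist B u) (X i) = ennreal (\<delta> i)" unfolding \<delta>_def using X(2)[of i] by (simp add: ennreal_enn2real_if top_unique) (metis ennreal_neq_top top_unique)
    show "0 \<le> \<delta> i" by (simp add: \<delta>_def)
    show "\<delta> i \<le> \<epsilon>" using X(2)[of i] \<epsilon>(1) unfolding 1 by (simp add: ennreal_le_iff)
  qed
  have sums: "summable \<delta>" "suminf \<delta> \<le> measure H A + \<eta> / (4 * k)"
  proof -
    have fin: "(\<Sum>i. ennreal (\<delta> i)) < ennreal (measure H A + \<eta> / (4 * k))" using sX by (simp add: \<delta>(1))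
    then have "(\<Sum>i. ennreal (\<delta> i)) \<noteq> top" by auto
    then show s: "summable \<delta>" using \<delta>(2) by (intro summable_suminf_not_top) auto
    have "ennreal (suminf \<delta>) < ennreal (measure H A + \<eta> / (4 * k))" using fin suminf_ennreal2[OF \<delta>(2) s] by simp
    then show "suminf \<delta> \<le> measure H A + \<eta> / (4 * k)" using suminf_nonneg[OF s \<delta>(2)] by (simp add: ennreal_less_iff)
  qed
  obtain a0 where "a0 \<in> A" using A(2) by blast
  \<comment> \<open>Covering sets that miss A get the default \<open>a0\<close>, so that all centres
    are images of points of A.\<close>
  define b where "b i = (if X i \<inter> A = {} then a0 else (SOME x. x \<in> X i \<inter> A))" for i
  have bA: "b i \<in> A" "X i \<inter> A \<noteq> {} \<Longrightarrow> b i \<in> X i" for i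
    using \<open>a0 \<in> A\<close> someI_ex[of "\<lambda>x. x \<in> X i \<inter> A"] unfolding b_def by auto
  \<comment> \<open>The geometric term makes every radius positive and the inclusion in the open
    ball strict. It adds \<eta>/2 in total, to the \<eta>/4 lost in choosing the cover.\<close>
  define r where "r i = k * \<delta> i + \<eta> * (1/2) ^ Suc i / 2" for i
  have geo: "(\<lambda>i. \<eta> * (1/2) ^ Suc i / 2) sums (\<eta> * 1 / 2)" by (intro sums_divide sums_mult power_half_series)
  have r0: "0 < r i" for i using k \<delta>(2)[of i] \<eta> by (auto simp: r_def intro!: add_nonneg_pos)
  have r1: "r i < \<eta>" for i
  proof -
    have "k * \<delta> i \<le> k * \<epsilon>" using \<delta>(3) k by (intro mult_left_mono) auto
    moreover have "(1/2::real) ^ Suc i \<le> 1" by (intro power_le_one) auto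
    then have "\<eta> * (1/2) ^ Suc i / 2 \<le> \<eta> * 1 / 2" using \<eta> by (intro divide_right_mono mult_left_mono) auto
    ultimately show ?thesis using \<epsilon>(3) \<eta> unfolding r_def by linarith
  qed
  have rs: "r sums (k * suminf \<delta> + \<eta> * 1 / 2)" unfolding r_def
    by (intro sums_add sums_mult summable_sums sums(1) geo)
  have cov: "F ` A \<subseteq> (\<Union>i. ball (F (b i)) (r i))"
  proof
    fix y assume "y \<in> F ` A"
    then obtain x where x: "x \<in> A" "y = F x" by blast
    then obtain i where i: "x \<in> X i" using X(3) by blast
    then have bi: "b i \<in> X i" using bA x by blast
    have xb: "b i \<in> ball x0 \<rho>" "x \<in> ball x0 \<rho>" using subsetD[OF A(3) bA(1)] subsetD[OF A(3) x(1)] by auto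
    have inc: "cball (b i) \<rho> \<subseteq> cball x0 (2 * \<rho>)"
    proof
      fix z assume "z \<in> cball (b i) \<rho>"
      then show "z \<in> cball x0 (2 * \<rho>)" using xb(1) dist_triangle[of x0 z "b i"] by simp
    qed
    have "ennreal (sqrt c * min (norm (x - b i)) \<rho>) \<le> g_dist B u (b i) x"
      by (rule g_dist_lower[OF _ \<rho> c(1) c(2)]) (use inc sub in auto)
    also have "\<dots> \<le> ediam (g_dist B u) (X i)" unfolding ediam_def using i bi by (meson SUP_upper2 order_refl)
    finally have 1: "sqrt c * min (norm (x - b i)) \<rho> \<le> \<delta> i" unfolding \<delta>(1) using \<delta>(2) by (simp add: ennreal_le_iff)
    then have "sqrt c * min (norm (x - b i)) \<rho> < sqrt c * \<rho>" using \<delta>(3)[of i] \<epsilon>(2) by linarith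
    then have "min (norm (x - b i)) \<rho> < \<rho>" using c(1) by simp
    then have "sqrt c * norm (x - b i) \<le> \<delta> i" using 1 by (simp add: min_def split: if_splits)
    then have "k * (sqrt c * norm (x - b i)) \<le> k * \<delta> i" using k by (intro mult_left_mono) auto
    then have "C * norm (x - b i) \<le> k * \<delta> i" using c(1) by (simp add: k_def)
    then have "norm (F x - F (b i)) \<le> k * \<delta> i" using C(2)[OF xb(2,1)] by linarith
    also have "\<dots> < r i" using \<eta> by (simp add: r_def)
    finally show "y \<in> (\<Union>i. ball (F (b i)) (r i))" using x(2) by (auto simp: dist_norm norm_minus_commute)
  qed
  have "suminf r \<le> k * measure H A + \<eta>"
  proof -
    have "suminf r = k * suminf \<delta> + \<eta> * 1 / 2" using rs by (simp add: sums_iff)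
    also have "\<dots> \<le> k * (measure H A + \<eta> / (4 * k)) + \<eta> * 1 / 2" using sums(2) k by (intro add_right_mono mult_left_mono) auto
    also have "\<dots> = k * measure H A + 3 * \<eta> / 4" using k by (simp add: field_simps)
    also have "\<dots> \<le> k * measure H A + \<eta>" using \<eta> by simp
    finally show ?thesis .
  qed
  then show ?thesis using bA(1) r0 r1 cov rs unfolding k_def
    by (intro exI[of _ "\<lambda>i. F (b i)"] exI[of _ r]) (auto simp: sums_iff)
qed

end

section \<open>Test functions of finite regularity\<close>

lemma partial_deriv_eqI:
  fixes f :: "real^'n::finite \<Rightarrow> real"
  assumes "\<And>x. (f has_derivative (\<lambda>h. g x \<bullet> h)) (at x)"
  shows "partial_deriv i f = (\<lambda>x. g x $ i)"
  using has_derivative_imp_gradient_form[OF assms] by (intro ext) (metis gradient_form_def vec_lambda_beta)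

section \<open>Calculus of k times differentiable functions\<close>

lemma Ck_on_Suc_gradient:
  assumes "Ck_on (Suc k) UNIV f"
  shows "(f has_derivative (\<lambda>h. gradient_form f x \<bullet> h)) (at x)"
  using assms by (intro gradient_form_has_derivative) (auto simp: differentiable_on_def)

lemma Ck_on_SucI:
  fixes f :: "real^'n::finite \<Rightarrow> real"
  assumes "\<And>x. (f has_derivative (\<lambda>h. g x \<bullet> h)) (at x)" "\<And>i. Ck_on k UNIV (\<lambda>x. g x $ i)"
  shows "Ck_on (Suc k) UNIV f"
  using assms partial_deriv_eqI[OF assms(1)] by (auto simp: differentiable_on_def differentiable_def)

lemma Ck_on_lower: "Ck_on (Suc k) UNIV f \<Longrightarrow> Ck_on k UNIV f"
proof (induction k arbitrary: f)
  case 0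
  then show ?case by (simp add: differentiable_imp_continuous_on)
next
  case (Suc k)
  then show ?case by (metis Ck_on.simps(2))
qed

lemma Ck_on_const: "Ck_on k UNIV (\<lambda>_. c)"
proof (induction k arbitrary: c)
  case (Suc k)
  show ?case by (rule Ck_on_SucI[where g="\<lambda>_. 0"]) (use Suc in auto)
qed simp

lemma Ck_on_coord: "Ck_on k UNIV (\<lambda>x :: real^'n::finite. x $ j)"
proof (cases k)
  case (Suc k')
  show ?thesis unfolding Suc
  proof (rule Ck_on_SucI[where g="\<lambda>_. axis j 1"])
    show "((\<lambda>x. x $ j) has_derivative (\<lambda>h. axis j 1 \<bullet> h)) (at x)" for x :: "real^'n"
      by (simp add: inner_axis' bounded_linear_imp_has_derivative bounded_linear_vec_nth)
  qed (rule Ck_on_const)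
qed (simp add: continuous_intros)

lemma Ck_on_add: "Ck_on k UNIV f \<Longrightarrow> Ck_on k UNIV g \<Longrightarrow> Ck_on k UNIV (\<lambda>x. f x + g x)"
proof (induction k arbitrary: f g)
  case (Suc k)
  note d = Ck_on_Suc_gradient[OF Suc.prems(1)] Ck_on_Suc_gradient[OF Suc.prems(2)]
  show ?case
  proof (rule Ck_on_SucI[where g="\<lambda>x. gradient_form f x + gradient_form g x"])
    show "((\<lambda>x. f x + g x) has_derivative (\<lambda>h. (gradient_form f x + gradient_form g x) \<bullet> h)) (at x)" for x
      using has_derivative_add[OF d] by (simp add: inner_add_left)
    show "Ck_on k UNIV (\<lambda>x. (gradient_form f x + gradient_form g x) $ i)" for i
      using Suc by (simp add: gradient_form_def)
  qed
qed (simp add: continuous_on_add)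

lemma Ck_on_mult: "Ck_on k UNIV f \<Longrightarrow> Ck_on k UNIV g \<Longrightarrow> Ck_on k UNIV (\<lambda>x. f x * g x)"
proof (induction k arbitrary: f g)
  case (Suc k)
  note d = Ck_on_Suc_gradient[OF Suc.prems(1)] Ck_on_Suc_gradient[OF Suc.prems(2)]
  show ?case
  proof (rule Ck_on_SucI[where g="\<lambda>x. f x *\<^sub>R gradient_form g x + g x *\<^sub>R gradient_form f x"])
    show "((\<lambda>x. f x * g x) has_derivative (\<lambda>h. (f x *\<^sub>R gradient_form g x + g x *\<^sub>R gradient_form f x) \<bullet> h)) (at x)" for x
      using has_derivative_mult[OF d] by (simp add: inner_add_left mult.commute)
    show "Ck_on k UNIV (\<lambda>x. (f x *\<^sub>R gradient_form g x + g x *\<^sub>R gradient_form f x) $ i)" for i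
    proof -
      have "Ck_on k UNIV f" "Ck_on k UNIV g" using Suc.prems by (auto intro: Ck_on_lower simp del: Ck_on.simps)
      moreover have "Ck_on k UNIV (partial_deriv i f)" "Ck_on k UNIV (partial_deriv i g)" using Suc.prems by auto
      ultimately have "Ck_on k UNIV (\<lambda>x. f x * partial_deriv i g x + g x * partial_deriv i f x)"
        by (intro Ck_on_add Suc.IH)
      then show ?thesis by (simp add: gradient_form_def)
    qed
  qed
qed (simp add: continuous_on_mult)

text \<open>The functions s^(-m) exp (-1/s), extended by 0. The exponent m is there because the
  linear span of the family is closed under differentiation, which makes regularity of every order
  an induction.\<close>

definition flat_exp :: "nat \<Rightarrow> real \<Rightarrow> real" where
  "flat_exp m s = (if s \<le> 0 then 0 else (inverse s) ^ m * exp (- inverse s))"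

lemma flat_exp_tendsto: "(flat_exp m \<longlongrightarrow> 0) (at 0)"
proof -
  have "((\<lambda>s. (inverse s) ^ m / exp (inverse s)) \<longlongrightarrow> 0) (at_right (0::real))"
    by (rule filterlim_compose[OF tendsto_power_div_exp_0 filterlim_inverse_at_top_right])
  then have "(flat_exp m \<longlongrightarrow> 0) (at_right 0)"
    by (rule Lim_transform_eventually) (auto simp: flat_exp_def eventually_at_right_field exp_minus divide_inverse intro!: exI[of _ 1])
  moreover have "(flat_exp m \<longlongrightarrow> 0) (at_left 0)"
    by (rule tendsto_eventually) (auto simp: flat_exp_def eventually_at_left_field intro!: exI[of _ "-1"])
  ultimately show ?thesis by (simp add: filterlim_at_split)
qed

lemma flat_exp_deriv: "(flat_exp m has_real_derivative flat_exp (m + 2) s - m * flat_exp (m + 1) s) (at s)"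
proof -
  consider "s < 0" | "s = 0" | "s > 0" by linarith
  then show ?thesis
  proof cases
    case 1
    have "((\<lambda>_. 0) has_real_derivative 0) (at s)" by simp
    then have "(flat_exp m has_real_derivative 0) (at s)"
      by (rule has_field_derivative_transform_within_open[of _ _ _ "{..<0}"]) (use 1 in \<open>auto simp: flat_exp_def\<close>)
    then show ?thesis using 1 by (simp add: flat_exp_def)
  next
    case 2
    \<comment> \<open>At 0 the difference quotient is again a member of the family, with exponent m
      + 1.\<close>
    have "((\<lambda>h. (flat_exp m (0 + h) - flat_exp m 0) / h) \<longlongrightarrow> 0) (at 0)"
    proof (rule Lim_transform_eventually[OF flat_exp_tendsto[of "m + 1"]])
      show "\<forall>\<^sub>F h in at 0. flat_exp (m + 1) h = (flat_exp m (0 + h) - flat_exp m 0) / h"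
        by (auto simp: flat_exp_def divide_inverse eventually_at_filter)
    qed
    then show ?thesis unfolding 2 DERIV_def by (simp add: flat_exp_def)
  next
    case 3
    have "((\<lambda>s. (inverse s) ^ m * exp (- inverse s)) has_real_derivative
       (inverse s) ^ (m + 2) * exp (- inverse s) - m * ((inverse s) ^ (m + 1) * exp (- inverse s))) (at s)"
    proof -
      have i: "(inverse has_real_derivative - (inverse s * inverse s)) (at s)"
        using DERIV_inverse[of s UNIV] 3 by (simp add: power2_eq_square numeral_2_eq_2)
      have p: "((\<lambda>s. (inverse s) ^ m) has_real_derivative - m * (inverse s) ^ (m + 1)) (at s)"
        using DERIV_power[OF i, of m] by (cases m) (simp_all add: algebra_simps)
      have e: "((\<lambda>s. exp (- inverse s)) has_real_derivative exp (- inverse s) * (inverse s * inverse s)) (at s)"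
        using DERIV_fun_exp[OF DERIV_minus[OF i]] by simp
      show ?thesis using DERIV_mult[OF p e] by (simp add: algebra_simps)
    qed
    then have "(flat_exp m has_real_derivative
       (inverse s) ^ (m + 2) * exp (- inverse s) - m * ((inverse s) ^ (m + 1) * exp (- inverse s))) (at s)"
      by (rule has_field_derivative_transform_within_open[of _ _ _ "{0<..}"]) (use 3 in \<open>auto simp: flat_exp_def\<close>)
    then show ?thesis using 3 by (simp add: flat_exp_def)
  qed
qed

lemma Ck_on_flat_exp:
  fixes r :: real
  shows "Ck_on k UNIV (\<lambda>x :: real^'n::finite. flat_exp m (r - x \<bullet> x))"
proof (induction k arbitrary: m)
  case 0
  have "continuous_on UNIV (flat_exp m)" by (rule DERIV_continuous_on[OF has_field_derivative_at_within[OF flat_exp_deriv]])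
  moreover have "continuous_on UNIV (\<lambda>x :: real^'n. r - x \<bullet> x)" by (intro continuous_intros)
  ultimately show ?case unfolding Ck_on.simps(1) by (rule continuous_on_compose2) simp
next
  case (Suc k)
  let ?D = "\<lambda>x :: real^'n. flat_exp (m + 2) (r - x \<bullet> x) + (- real m) * flat_exp (m + 1) (r - x \<bullet> x)"
  show ?case
  proof (rule Ck_on_SucI[where g="\<lambda>x. (- 2 * ?D x) *\<^sub>R x"])
    fix x :: "real^'n"
    have "((\<lambda>x. r - x \<bullet> x) has_derivative (\<lambda>h. - (2 * (x \<bullet> h)))) (at x)" by (auto intro!: derivative_eq_intros simp: inner_commute)
    from has_derivative_compose[OF this flat_exp_deriv[unfolded has_field_derivative_def]]
    have "((\<lambda>x. flat_exp m (r - x \<bullet> x)) has_derivative (\<lambda>h. (flat_exp (m + 2) (r - x \<bullet> x) - real m * flat_exp (m + 1) (r - x \<bullet> x)) * - (2 * (x \<bullet> h)))) (at x)" .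
    then show "((\<lambda>x. flat_exp m (r - x \<bullet> x)) has_derivative (\<lambda>h. ((- 2 * ?D x) *\<^sub>R x) \<bullet> h)) (at x)"
      by (simp add: algebra_simps)
    have "Ck_on k UNIV (\<lambda>x. (- 2) * ?D x * x $ i)" for i
    proof -
      have "Ck_on k UNIV ?D" by (rule Ck_on_add[OF Suc.IH Ck_on_mult[OF Ck_on_const Suc.IH]])
      then show ?thesis by (rule Ck_on_mult[OF Ck_on_mult[OF Ck_on_const] Ck_on_coord])
    qed
    then show "Ck_on k UNIV (\<lambda>x. ((- 2 * ?D x) *\<^sub>R x) $ i)" for i by simp
  qed
qed

lemma smooth_bump_exists:
  assumes "0 < (r::real)"
  shows "\<exists>\<rho> :: real^'n::finite \<Rightarrow> real. (\<forall>k. Ck_on k UNIV \<rho>) \<and> (\<forall>x. 0 \<le> \<rho> x) \<and> (\<forall>x. x \<notin> ball 0 r \<longrightarrow> \<rho> x = 0) \<and>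
    (\<rho> has_integral 1) (cbox (- r *\<^sub>R One) (r *\<^sub>R One))"
proof -
  let ?f = "\<lambda>x :: real^'n. flat_exp 0 (r\<^sup>2 - x \<bullet> x)"
  let ?C = "cbox (- r *\<^sub>R One) (r *\<^sub>R One) :: (real^'n) set"
  have C: "Ck_on k UNIV ?f" for k by (rule Ck_on_flat_exp)
  have cont: "continuous_on UNIV ?f" using C[of 0] by simp
  have nn: "0 \<le> ?f x" for x by (simp add: flat_exp_def)
  have out: "?f x = 0" if "x \<notin> ball 0 r" for x
  proof -
    have "r\<^sup>2 \<le> (norm x)\<^sup>2" using that assms by (intro power_mono) auto
    then show ?thesis by (simp add: flat_exp_def power2_norm_eq_inner)
  qed
  define Z where "Z = integral ?C ?f"
  have Zi: "(?f has_integral Z) ?C" unfolding Z_def by (intro integrable_integral integrable_continuous continuous_on_subset[OF cont]) auto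
  have "Z \<noteq> 0"
  proof
    assume "Z = 0"
    have 0: "0 \<in> box (- r *\<^sub>R One) (r *\<^sub>R (One :: real^'n))" using assms by (simp add: mem_box)
    have "?f 0 = 0"
    proof (rule has_integral_0_cbox_imp_0[OF continuous_on_subset[OF cont] nn])
      show "(?f has_integral 0) ?C" using Zi \<open>Z = 0\<close> by simp
      show "box (- r *\<^sub>R One) (r *\<^sub>R One :: real^'n) \<noteq> {}" using 0 by blast
      show "0 \<in> ?C" using 0 box_subset_cbox by blast
    qed auto
    then show False using assms by (simp add: flat_exp_def)
  qed
  moreover have "0 \<le> Z" using Zi nn by (rule has_integral_nonneg)
  ultimately have "0 < Z" by simp
  have "((\<lambda>x. (1 / Z) * ?f x) has_integral (1 / Z) * Z) ?C" by (rule has_integral_mult_right[OF Zi])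
  then have "((\<lambda>x. (1 / Z) * ?f x) has_integral 1) ?C" using \<open>0 < Z\<close> by simp
  moreover have "Ck_on k UNIV (\<lambda>x. (1 / Z) * ?f x)" for k by (intro Ck_on_mult Ck_on_const C)
  ultimately show ?thesis using \<open>0 < Z\<close> nn out by (intro exI[of _ "\<lambda>x. (1 / Z) * ?f x"]) auto
qed

lemma integral_param_has_derivative:
  fixes f :: "real^'n::finite \<Rightarrow> real" and F G
  assumes F: "\<And>x w. ((\<lambda>x. F x w) has_derivative (\<lambda>h. G x w \<bullet> h)) (at x)"
    and c: "continuous_on UNIV (\<lambda>p :: (real^'n) \<times> (real^'n). G (fst p) (snd p))"
    and cF: "\<And>x. continuous_on UNIV (F x :: real^'n \<Rightarrow> real)"
  shows "((\<lambda>x. integral (cbox a b) (F x)) has_derivative (\<lambda>h. integral (cbox a b) (G x) \<bullet> h)) (at x)"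
proof -
  have cG: "continuous_on (cbox a b) (G x)" by (rule continuous_on_compose2[OF c, of _ "\<lambda>w. (x, w)", simplified]) (intro continuous_intros)
  have Gi: "G x integrable_on cbox a b" by (rule integrable_continuous[OF cG])
  have "((\<lambda>x. integral (cbox a b) (F x)) has_derivative integral (cbox a b) (\<lambda>w. blinfun_inner_right (G x w))) (at x within UNIV)"
  proof (rule leibniz_rule)
    show "((\<lambda>x. F x w) has_derivative blinfun_apply (blinfun_inner_right (G x w))) (at x within UNIV)" for x w using F by simp
    show "F x integrable_on cbox a b" for x by (intro integrable_continuous continuous_on_subset[OF cF]) simp
    show "continuous_on (UNIV \<times> cbox a b) (\<lambda>(x, t). blinfun_inner_right (G x t))"
      unfolding case_prod_unfold by (intro bounded_linear.continuous_on[OF bounded_linear_blinfun_inner_right] continuous_on_subset[OF c]) simp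
  qed auto
  moreover have "blinfun_apply (integral (cbox a b) (\<lambda>w. blinfun_inner_right (G x w))) h = integral (cbox a b) (G x) \<bullet> h" for h
  proof -
    have "(\<lambda>w. blinfun_inner_right (G x w)) integrable_on cbox a b"
      by (intro integrable_continuous bounded_linear.continuous_on[OF bounded_linear_blinfun_inner_right] cG)
    then have "blinfun_apply (integral (cbox a b) (\<lambda>w. blinfun_inner_right (G x w))) h = integral (cbox a b) (\<lambda>w. G x w \<bullet> h)"
      by (simp add: blinfun_apply_integral)
    also have "\<dots> = integral (cbox a b) (G x) \<bullet> h"
      using has_integral_inner_const[OF integrable_integral[OF Gi], of h] by (rule integral_unique)
    finally show ?thesis .
  qed
  then have "blinfun_apply (integral (cbox a b) (\<lambda>w. blinfun_inner_right (G x w))) = (\<lambda>h. integral (cbox a b) (G x) \<bullet> h)"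
    by (rule ext)
  ultimately show ?thesis by (simp only:)
qed

text \<open>All derivatives fall on the kernel, so continuity of f suffices; the induction runs over
  all kernels at once.\<close>

lemma Ck_on_convolution:
  fixes f \<rho> :: "real^'n::finite \<Rightarrow> real"
  assumes f: "continuous_on UNIV f" and \<rho>: "\<And>k. Ck_on k UNIV \<rho>"
  shows "Ck_on k UNIV (\<lambda>x. integral (cbox a b) (\<lambda>w. f w * \<rho> (x - w)))"
  using \<rho>
proof (induction k arbitrary: \<rho>)
  case (0 \<rho>)
  have c: "continuous_on UNIV \<rho>" using 0[of 0] by simp
  have "continuous_on (UNIV \<times> cbox a b) (\<lambda>(x, w). f w * \<rho> (x - w))"
    unfolding case_prod_unfold by (intro continuous_intros continuous_on_compose2[OF f] continuous_on_compose2[OF c]) auto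
  then show ?case by (simp add: integral_continuous_on_param)
next
  case (Suc k \<rho>)
  note d = Ck_on_Suc_gradient[OF Suc.prems]
  have c\<rho>: "continuous_on UNIV \<rho>" using Suc.prems[of 0] by simp
  have cg: "continuous_on UNIV (gradient_form \<rho>)"
  proof -
    have "continuous_on UNIV (\<lambda>x. gradient_form \<rho> x $ i)" for i using Suc.prems[of 1] by (simp add: gradient_form_def)
    then show ?thesis by (subst continuous_on_componentwise) (auto simp: Basis_vec_def inner_axis)
  qed
  show ?case
  proof (rule Ck_on_SucI[where g="\<lambda>x. integral (cbox a b) (\<lambda>w. f w *\<^sub>R gradient_form \<rho> (x - w))"])
    show "((\<lambda>x. integral (cbox a b) (\<lambda>w. f w * \<rho> (x - w))) has_derivative
        (\<lambda>h. integral (cbox a b) (\<lambda>w. f w *\<^sub>R gradient_form \<rho> (x - w)) \<bullet> h)) (at x)" for x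
    proof (rule integral_param_has_derivative)
      fix x w :: "real^'n"
      have "((\<lambda>x. x - w) has_derivative (\<lambda>h. h)) (at x)" by (auto intro!: derivative_eq_intros)
      from has_derivative_mult_right[OF has_derivative_compose[OF this d], of "f w"]
      show "((\<lambda>x. f w * \<rho> (x - w)) has_derivative (\<lambda>h. (f w *\<^sub>R gradient_form \<rho> (x - w)) \<bullet> h)) (at x)" by simp
    qed (intro continuous_intros continuous_on_compose2[OF f] continuous_on_compose2[OF cg] continuous_on_compose2[OF c\<rho>]; simp)+
    fix i
    have "integral (cbox a b) (\<lambda>w. f w *\<^sub>R gradient_form \<rho> (x - w)) $ i = integral (cbox a b) (\<lambda>w. f w * partial_deriv i \<rho> (x - w))" for x
    proof -
      have "(\<lambda>w. f w *\<^sub>R gradient_form \<rho> (x - w)) integrable_on cbox a b"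
        by (intro integrable_continuous continuous_intros continuous_on_compose2[OF f] continuous_on_compose2[OF cg]) auto
      from has_integral_inner_const[OF integrable_integral[OF this], of "axis i 1"]
      show ?thesis by (simp add: inner_axis gradient_form_def integral_unique)
    qed
    then show "Ck_on k UNIV (\<lambda>x. integral (cbox a b) (\<lambda>w. f w *\<^sub>R gradient_form \<rho> (x - w)) $ i)"
    proof -
      have "Ck_on k UNIV (partial_deriv i \<rho>)" for k using Suc.prems[of "Suc k"] by simp
      then have "Ck_on k UNIV (\<lambda>x. integral (cbox a b) (\<lambda>w. f w * partial_deriv i \<rho> (x - w)))" by (rule Suc.IH)
      then show ?thesis by (simp only: \<open>\<And>x. integral (cbox a b) (\<lambda>w. f w *\<^sub>R gradient_form \<rho> (x - w)) $ i = integral (cbox a b) (\<lambda>w. f w * partial_deriv i \<rho> (x - w))\<close>)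
    qed
  qed
qed

lemma C1_support_gradient_zero:
  fixes f :: "'b::euclidean_space \<Rightarrow> real"
  assumes "(f has_derivative (\<lambda>h. g \<bullet> h)) (at x)" "closed K" "\<And>y. y \<notin> K \<Longrightarrow> f y = 0" "x \<notin> K"
  shows "g = 0"
proof -
  have "((\<lambda>_. 0) has_derivative (\<lambda>h. 0)) (at x)" by simp
  then have "(f has_derivative (\<lambda>h. 0)) (at x)"
    by (rule has_derivative_transform_within_open[of _ _ _ _ "- K"]) (use assms in auto)
  from has_derivative_unique[OF assms(1) this] have "(\<lambda>h. g \<bullet> h) = (\<lambda>h. 0)" .
  then have "g \<bullet> g = 0" by (rule fun_cong)
  then show ?thesis by simp
qed

text \<open>Mollification: the gradient of the smoothed function is an average of g over a ball so
  small that g is nearly constant on it. It bridges the smooth functions against which a current is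
  closed and the C^1 functions obtained from vector fields in dual coordinates.\<close>

lemma smooth_approximation:
  fixes f :: "real^'n::finite \<Rightarrow> real"
  assumes f: "\<And>x. (f has_derivative (\<lambda>h. g x \<bullet> h)) (at x)" and g: "continuous_on UNIV g"
    and K: "compact K" "\<And>x. x \<notin> K \<Longrightarrow> f x = 0" and \<epsilon>: "0 < \<epsilon>"
  shows "\<exists>\<phi>. smooth_on UNIV \<phi> \<and> (\<forall>x. \<phi> x \<noteq> 0 \<longrightarrow> (\<exists>y\<in>K. dist x y \<le> \<epsilon>)) \<and> (\<forall>x. norm (gradient_form \<phi> x - g x) \<le> \<epsilon>)"
proof -
  have g0: "g x = 0" if "x \<notin> K" for x
    by (rule C1_support_gradient_zero[OF f compact_imp_closed[OF K(1)]]) (use that K in auto)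
  have cf: "continuous_on UNIV f" using f by (meson continuous_at_imp_continuous_on has_derivative_continuous)
  obtain R where R: "0 < R" "\<And>x. x \<in> K \<Longrightarrow> norm x \<le> R" using compact_imp_bounded[OF K(1)] by (auto simp: bounded_pos)
  \<comment> \<open>Shifts have length below 1, so for norm x \<le> R + 1 both points stay in this
    ball; for larger norms both lie off K and both gradients are zero.\<close>
  have "uniformly_continuous_on (cball 0 (R + 2)) g"
    by (intro compact_uniformly_continuous continuous_on_subset[OF g]) auto
  then obtain \<delta> where \<delta>: "0 < \<delta>" "\<And>x y. norm x \<le> R + 2 \<Longrightarrow> norm y \<le> R + 2 \<Longrightarrow> dist y x < \<delta> \<Longrightarrow> dist (g y) (g x) < \<epsilon>"
    unfolding uniformly_continuous_on_def using \<epsilon> by (metis mem_cball_0)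
  define r where "r = min (min \<delta> 1) \<epsilon> / 2"
  have r: "0 < r" "r < \<delta>" "r < 1" "r < \<epsilon>" using \<delta> \<epsilon> by (auto simp: r_def)
  obtain \<rho> :: "real^'n \<Rightarrow> real" where \<rho>: "\<And>k. Ck_on k UNIV \<rho>" "\<And>x. 0 \<le> \<rho> x" "\<And>x. x \<notin> ball 0 r \<Longrightarrow> \<rho> x = 0"
    and one: "(\<rho> has_integral 1) (cbox (- r *\<^sub>R One) (r *\<^sub>R One))" using smooth_bump_exists[OF r(1)] by (elim exE conjE) blast
  have c\<rho>: "continuous_on UNIV \<rho>" using \<rho>(1)[of 0] by simp
  let ?C = "cbox (- r *\<^sub>R One) (r *\<^sub>R One) :: (real^'n) set"
  have ballC: "ball 0 r \<subseteq> ?C"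
  proof
    fix v :: "real^'n" assume "v \<in> ball 0 r"
    then have "\<bar>v \<bullet> i\<bar> \<le> r" if "i \<in> Basis" for i using Basis_le_norm[OF that, of v] by simp
    then show "v \<in> ?C" by (fastforce simp: mem_box abs_le_iff)
  qed
  obtain a b where ab: "K \<subseteq> cbox a b" using bounded_subset_cbox_symmetric[OF compact_imp_bounded[OF K(1)]] by blast
  define \<phi> where "\<phi> x = integral (cbox a b) (\<lambda>w. f w * \<rho> (x - w))" for x
  have sm: "smooth_on UNIV \<phi>" unfolding smooth_on_def \<phi>_def using Ck_on_convolution[OF cf \<rho>(1)] by blast
  \<comment> \<open>Two forms of the convolution: with x in the kernel it is smooth, with x in f its
    gradient is an average of g.\<close>
  have eq: "\<phi> x = integral ?C (\<lambda>v. f (x - v) * \<rho> v)" for x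
  proof -
    have 1: "((\<lambda>w. f w * \<rho> (x - w)) has_integral \<phi> x) (cbox a b)"
      unfolding \<phi>_def by (intro integrable_integral integrable_continuous continuous_intros continuous_on_compose2[OF cf] continuous_on_compose2[OF c\<rho>]) auto
    from has_integral_affinity[OF this, of "-1" x]
    have "((\<lambda>v. f (x - v) * \<rho> v) has_integral \<phi> x) ((\<lambda>v. x - v) ` cbox a b)" by (simp add: algebra_simps)
    then have 2: "((\<lambda>v. f (x - v) * \<rho> v) has_integral \<phi> x) UNIV"
    proof (rule has_integral_on_superset)
      fix v assume "v \<notin> (\<lambda>v. x - v) ` cbox a b"
      moreover have "x - (x - v) \<in> (\<lambda>v. x - v) ` cbox a b" if "x - v \<in> cbox a b" using that by (rule imageI)
      ultimately have "x - v \<notin> cbox a b" by auto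
      then show "f (x - v) * \<rho> v = 0" using ab K(2) by auto
    qed simp
    have "((\<lambda>v. f (x - v) * \<rho> v) has_integral integral ?C (\<lambda>v. f (x - v) * \<rho> v)) ?C"
      by (intro integrable_integral integrable_continuous continuous_intros continuous_on_compose2[OF cf] continuous_on_compose2[OF c\<rho>]) auto
    then have "((\<lambda>v. f (x - v) * \<rho> v) has_integral integral ?C (\<lambda>v. f (x - v) * \<rho> v)) UNIV"
    proof (rule has_integral_on_superset)
      fix v assume "v \<notin> ?C"
      then have "v \<notin> ball 0 r" using ballC by (rule contra_subsetD[rotated])
      then show "f (x - v) * \<rho> v = 0" using \<rho>(3)[of v] by simp
    qed simp
    then show ?thesis using has_integral_unique[OF 2] by blast
  qed
  have grad: "gradient_form \<phi> x = integral ?C (\<lambda>v. \<rho> v *\<^sub>R g (x - v))" for x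
  proof (rule has_derivative_imp_gradient_form)
    have "((\<lambda>x. integral ?C (\<lambda>v. f (x - v) * \<rho> v)) has_derivative (\<lambda>h. integral ?C (\<lambda>v. \<rho> v *\<^sub>R g (x - v)) \<bullet> h)) (at x)"
    proof (rule integral_param_has_derivative)
      fix x v :: "real^'n"
      have "((\<lambda>x. x - v) has_derivative (\<lambda>h. h)) (at x)" by (auto intro!: derivative_eq_intros)
      from has_derivative_mult_left[OF has_derivative_compose[OF this f], of "\<rho> v"]
      show "((\<lambda>x. f (x - v) * \<rho> v) has_derivative (\<lambda>h. (\<rho> v *\<^sub>R g (x - v)) \<bullet> h)) (at x)" by (simp add: mult.commute)
    qed (intro continuous_intros continuous_on_compose2[OF cf] continuous_on_compose2[OF g] continuous_on_compose2[OF c\<rho>]; simp)+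
    then show "(\<phi> has_derivative (\<lambda>h. integral ?C (\<lambda>v. \<rho> v *\<^sub>R g (x - v)) \<bullet> h)) (at x)" unfolding eq[abs_def] .
  qed
  have close: "norm (g (x - v) - g x) \<le> \<epsilon>" if "v \<in> ball 0 r" for x v
  proof (cases "norm x \<le> R + 1")
    case True
    have "norm (x - v) \<le> norm x + norm v" by (rule norm_triangle_ineq4)
    then have "dist (g (x - v)) (g x) < \<epsilon>" using True that r by (intro \<delta>(2)) (auto simp: dist_norm)
    then show ?thesis by (simp add: dist_norm)
  next
    case False
    have "norm x \<le> norm (x - v) + norm v" using norm_triangle_sub[of x v] by simp
    then have "x \<notin> K" "x - v \<notin> K" using False R that r by force+
    then show ?thesis using g0 \<epsilon> by simp
  qed
  have "norm (gradient_form \<phi> x - g x) \<le> \<epsilon>" for x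
  proof -
    have i1: "((\<lambda>v. \<rho> v *\<^sub>R g (x - v)) has_integral gradient_form \<phi> x) ?C"
      unfolding grad by (intro integrable_integral integrable_continuous continuous_intros continuous_on_compose2[OF g] continuous_on_compose2[OF c\<rho>]) auto
    have i2: "((\<lambda>v. \<rho> v *\<^sub>R g x) has_integral g x) ?C" using has_integral_scaleR_left[OF one, of "g x"] by simp
    have i3: "((\<lambda>v. \<rho> v * \<epsilon>) has_integral \<epsilon>) ?C" using has_integral_mult_left[OF one, of \<epsilon>] by simp
    have le: "norm (\<rho> v *\<^sub>R g (x - v) - \<rho> v *\<^sub>R g x) \<le> \<rho> v * \<epsilon>" for v
    proof (cases "v \<in> ball 0 r")
      case True
      then show ?thesis using close[OF True, of x] \<rho>(2)[of v] by (simp add: scaleR_diff_right[symmetric] mult_left_mono)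
    qed (simp add: \<rho>(3))
    have "norm (integral ?C (\<lambda>v. \<rho> v *\<^sub>R g (x - v) - \<rho> v *\<^sub>R g x)) \<le> integral ?C (\<lambda>v. \<rho> v * \<epsilon>)"
      by (rule integral_norm_bound_integral) (use has_integral_diff[OF i1 i2] i3 le in \<open>auto simp: has_integral_integrable\<close>)
    then show ?thesis unfolding integral_unique[OF has_integral_diff[OF i1 i2]] integral_unique[OF i3] .
  qed
  moreover have "\<exists>y\<in>K. dist x y \<le> \<epsilon>" if "\<phi> x \<noteq> 0" for x
  proof (rule ccontr)
    assume far: "\<not> ?thesis"
    have "f (x - v) * \<rho> v = 0" for v
    proof (cases "v \<in> ball 0 r")
      case True
      then have "x - v \<notin> K" using far r by (force simp: dist_norm)
      then show ?thesis using K(2) by simp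
    qed (simp add: \<rho>(3))
    then have "integral ?C (\<lambda>v. f (x - v) * \<rho> v) = 0" by (intro integral_unique has_integral_is_0)
    then show False using that by (simp only: eq)
  qed
  ultimately show ?thesis using sm by blast
qed

section \<open>Gradient cycles in dual coordinates\<close>

lemma covector_norm_ge_1: "\<delta> \<noteq> 0 \<Longrightarrow> 1 \<le> norm (covector \<delta>)"
proof -
  assume "\<delta> \<noteq> 0"
  then obtain i where "\<delta> $ i \<noteq> 0" by (auto simp: vec_eq_iff)
  then have "1 \<le> \<bar>covector \<delta> $ i\<bar>" by (simp add: covector_def)
  also have "\<dots> \<le> norm (covector \<delta>)" by (rule component_le_norm_cart)
  finally show ?thesis .
qed

lemma finite_covectors: "finite (range covector \<inter> cball (0 :: real^'n::finite) r)"
proof -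
  let ?k = "\<lceil>r\<rceil>"
  have "range covector \<inter> cball (0 :: real^'n) r \<subseteq> (\<lambda>f. \<chi> i. real_of_int (f i)) ` (PiE UNIV (\<lambda>_. {-?k..?k}))"
  proof
    fix v :: "real^'n" assume v: "v \<in> range covector \<inter> cball 0 r"
    then obtain \<delta> where \<delta>: "v = covector \<delta>" by blast
    have "\<bar>covector \<delta> $ i\<bar> \<le> r" for i using component_le_norm_cart[of "covector \<delta>" i] v \<delta> by auto
    then have "\<bar>real_of_int (\<delta> $ i)\<bar> \<le> r" for i by (simp add: covector_def)
    then have "\<delta> $ i \<in> {-?k..?k}" for i by (smt (verit) atLeastAtMost_iff le_of_int_ceiling of_int_le_iff of_int_minus)
    then have "(\<lambda>i. \<delta> $ i) \<in> PiE UNIV (\<lambda>_. {-?k..?k})" by auto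
    then show "v \<in> (\<lambda>f. \<chi> i. real_of_int (f i)) ` (PiE UNIV (\<lambda>_. {-?k..?k}))"
      unfolding \<delta> covector_def by (rule image_eqI[rotated]) simp
  qed
  then show ?thesis by (rule finite_subset) (intro finite_imageI finite_PiE; simp)
qed

context hessian_dom
begin

lemma hessian_inverse:
  assumes x: "x \<in> B"
  shows "h x *v (matrix_inv (h x) *v w) = w" "matrix_inv (h x) *v (h x *v w) = w"
proof -
  have "inj ((*v) (h x))"
  proof (rule injI)
    fix a b assume "h x *v a = h x *v b"
    then have "(a - b) \<bullet> (h x *v (a - b)) = 0" by (simp add: matrix_vector_mult_diff_distrib)
    then show "a = b" using hessian_pos[OF x, of "a - b"] by force
  qed
  then have "\<exists>A. A ** h x = mat 1" by (simp add: matrix_left_invertible_injective)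
  then have "\<exists>A. h x ** A = mat 1 \<and> A ** h x = mat 1" by (metis matrix_left_right_inverse)
  then have "h x ** matrix_inv (h x) = mat 1 \<and> matrix_inv (h x) ** h x = mat 1"
    unfolding matrix_inv_def by (rule someI_ex)
  then show "h x *v (matrix_inv (h x) *v w) = w" "matrix_inv (h x) *v (h x *v w) = w"
    by (simp_all add: matrix_vector_mul_assoc)
qed

text \<open>The Hessian maps the flow field to the covector itself, and normalisation divides by a
  positive root. In dual coordinates the unit tangent therefore points along an integral
  vector.\<close>

lemma unit_flow_properties:
  assumes x: "x \<in> B" and \<delta>: "\<delta> \<noteq> 0"
  defines "v \<equiv> unit_flow_field u \<delta> x"
  shows "\<exists>w>0. h x *v v = w *\<^sub>R covector \<delta>" "v \<bullet> (h x *v v) = 1"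
proof -
  define z where "z = flow_field u \<delta> x"
  have hz: "h x *v z = covector \<delta>" unfolding z_def flow_field_def by (rule hessian_inverse(1)[OF x])
  have "covector \<delta> \<noteq> 0" using covector_norm_ge_1[OF \<delta>] by auto
  then have "z \<noteq> 0" using hz by auto
  define q where "q = covector \<delta> \<bullet> z"
  have "0 < z \<bullet> (h x *v z)" by (rule hessian_pos[OF x \<open>z \<noteq> 0\<close>])
  then have q: "0 < q" unfolding hz q_def by (simp add: inner_commute)
  have v: "v = (1 / sqrt q) *\<^sub>R z" by (simp add: v_def unit_flow_field_def q_def z_def inverse_eq_divide)
  have hv: "h x *v v = (1 / sqrt q) *\<^sub>R covector \<delta>" unfolding v by (simp add: matrix_vector_mult_scaleR hz)
  then show "\<exists>w>0. h x *v v = w *\<^sub>R covector \<delta>" using q by (intro exI[of _ "1 / sqrt q"]) simp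
  have "v \<bullet> (h x *v v) = (1 / sqrt q) * (1 / sqrt q) * q"
    unfolding hv unfolding v q_def by (simp add: inner_commute)
  also have "\<dots> = 1" using q by (simp add: field_simps)
  finally show "v \<bullet> (h x *v v) = 1" .
qed

end

locale gradient_cycle = hessian_dom B u for B :: "(real^'n::finite) set" and u +
  fixes T :: "'n lattice_current" and \<delta> :: "real^'n \<Rightarrow> 'n lattice" and \<xi> :: "real^'n \<Rightarrow> real^'n"
  assumes closed_T: "closed_current B T"
    and rect: "rectifiable_current B u T \<delta> \<xi>"
    and flow: "AE x in g_hausdorff1 B u. x \<in> current_support B T \<longrightarrow> \<delta> x \<noteq> 0 \<and> \<xi> x = unit_flow_field u (\<delta> x) x"
begin

abbreviation "G \<equiv> current_support B T"
abbreviation "dd x \<equiv> covector (\<delta> x)"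

lemma G_sub: "G \<subseteq> B" by (auto simp: current_support_def)

lemma G_closed: "closedin (top_of_set B) G"
proof -
  have "\<exists>U. open U \<and> x \<in> U \<and> U \<subseteq> B - G" if x: "x \<in> B - G" for x
  proof -
    obtain U where U: "open U" "x \<in> U" "U \<subseteq> B" "\<not> (\<exists>\<beta>. test_form U \<beta> \<and> T \<beta> \<noteq> 0)" using x by (auto simp: current_support_def)
    then have "U \<inter> G = {}" by (auto simp: current_support_def)
    then show ?thesis using U by blast
  qed
  then have "open (B - G)" by (subst open_subopen) blast
  then have "closed (- (B - G))" unfolding closed_def double_complement .
  moreover have "G = B \<inter> - (B - G)" using G_sub by blast
  ultimately show ?thesis by (metis closedin_closed_Int)
qed

lemma G_sets: "G \<in> sets H" using rect by (simp add: rectifiable_current_def rectifiable1_def Let_def)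

lemma xi_measurable: "(\<lambda>x. indicator G x *\<^sub>R \<xi> x) \<in> borel_measurable H"
  using rect by (simp add: rectifiable_current_def set_borel_measurable_def Let_def)

lemma d_integrable: "compact K \<Longrightarrow> K \<subseteq> B \<Longrightarrow> integrable H (\<lambda>x. indicator (G \<inter> K) x *\<^sub>R dd x)"
  using rect by (simp add: rectifiable_current_def set_integrable_def Let_def)

lemma T_eq: "test_form B \<beta> \<Longrightarrow> T \<beta> = (LINT x|H. indicator G x *\<^sub>R ((\<beta> x \<bullet> \<xi> x) *\<^sub>R dd x))"
  using rect by (simp add: rectifiable_current_def set_lebesgue_integral_def Let_def)

lemma AE_good: "AE x in H. x \<in> G \<longrightarrow> \<delta> x \<noteq> 0 \<and> (\<exists>w>0. h x *v \<xi> x = w *\<^sub>R dd x) \<and> \<xi> x \<bullet> (h x *v \<xi> x) = 1"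
  using flow
proof eventually_elim
  case (elim x)
  then show ?case using unit_flow_properties[of x "\<delta> x"] G_sub by auto
qed

text \<open>Smooth approximations supported in one compact neighbourhood have gradients uniformly
  close to g; closedness annihilates each of them, and dominated convergence passes to g.\<close>

lemma C1_closed:
  assumes f: "\<And>x. (f has_derivative (\<lambda>w. g x \<bullet> w)) (at x)" and g: "continuous_on UNIV g"
    and K: "compact K" "K \<subseteq> B" "\<And>x. x \<notin> K \<Longrightarrow> f x = (0::real)"
  shows "integrable H (\<lambda>x. indicator G x *\<^sub>R ((g x \<bullet> \<xi> x) *\<^sub>R dd x))"
    "(LINT x|H. indicator G x *\<^sub>R ((g x \<bullet> \<xi> x) *\<^sub>R dd x)) = 0"
proof -
  obtain \<epsilon>0 where \<epsilon>0: "0 < \<epsilon>0" "(\<Union>x\<in>K. cball x \<epsilon>0) \<subseteq> B"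
    using compact_subset_open_imp_cball_epsilon_subset[OF K(1) open_B K(2)] .
  define K2 where "K2 = (\<Union>x\<in>K. cball x \<epsilon>0)"
  have K2: "compact K2" "K2 \<subseteq> B" using compact_minkowski_sum_cball[OF K(1)] \<epsilon>0 by (auto simp: K2_def)
  define e where "e n = min \<epsilon>0 (1 / (real n + 1))" for n :: nat
  have e: "0 < e n" "e n \<le> \<epsilon>0" "e n \<le> 1" for n using \<epsilon>0 by (auto simp: e_def min_le_iff_disj)
  have "\<forall>n. \<exists>\<phi>. smooth_on UNIV \<phi> \<and> (\<forall>x. \<phi> x \<noteq> 0 \<longrightarrow> (\<exists>y\<in>K. dist x y \<le> e n)) \<and> (\<forall>x. norm (gradient_form \<phi> x - g x) \<le> e n)"
    using smooth_approximation[OF f g K(1,3) e(1)] by blast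
  from choice[OF this] obtain \<phi> where \<phi>: "\<forall>n. smooth_on UNIV (\<phi> n) \<and> (\<forall>x. \<phi> n x \<noteq> 0 \<longrightarrow> (\<exists>y\<in>K. dist x y \<le> e n)) \<and>
    (\<forall>x. norm (gradient_form (\<phi> n) x - g x) \<le> e n)" ..
  have sm: "smooth_on UNIV (\<phi> n)" for n using \<phi> by blast
  have near: "norm (gradient_form (\<phi> n) x - g x) \<le> e n" for n x using \<phi> by blast
  have supp: "\<phi> n x = 0" if "x \<notin> K2" for n x
  proof (rule ccontr)
    assume "\<phi> n x \<noteq> 0"
    then obtain y where y: "y \<in> K" "dist x y \<le> e n" using \<phi> by blast
    then have "x \<in> cball y \<epsilon>0" using e(2)[of n] by (simp add: dist_commute)
    then show False using that y(1) by (auto simp: K2_def)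
  qed
  have gd: "(\<phi> n has_derivative (\<lambda>w. gradient_form (\<phi> n) x \<bullet> w)) (at x)" for n x
    by (intro gradient_form_has_derivative smooth_on_differentiable[OF sm]) auto
  have cl: "closed K2" by (rule compact_imp_closed[OF K2(1)])
  have gsupp: "gradient_form (\<phi> n) x = 0" if "x \<notin> K2" for n x
    by (rule C1_support_gradient_zero[OF gd cl supp that])
  have g_supp: "g x = 0" if "x \<notin> K2" for x
  proof (rule C1_support_gradient_zero[OF f compact_imp_closed[OF K(1)] K(3)])
    show "x \<notin> K" using that \<epsilon>0(1) by (force simp: K2_def)
  qed
  have tst: "test_function B q" if "smooth_on UNIV q" "\<And>x. x \<notin> K2 \<Longrightarrow> q x = 0" for q
  proof -
    have "{x. q x \<noteq> 0} \<subseteq> K2" using that(2) by blast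
    then have "closure {x. q x \<noteq> 0} \<subseteq> K2" using cl by (rule closure_minimal)
    moreover have "compact (closure {x. q x \<noteq> 0})"
      unfolding compact_closure using compact_imp_bounded[OF K2(1)] \<open>{x. q x \<noteq> 0} \<subseteq> K2\<close> by (rule bounded_subset)
    ultimately show ?thesis using that(1) K2(2) by (auto simp: test_function_def)
  qed
  have T0: "T (gradient_form (\<phi> n)) = 0" for n using closed_T tst[OF sm supp] by (simp add: closed_current_def)
  have "test_form B (gradient_form (\<phi> n))" for n
    unfolding test_form_def
  proof
    fix i
    have "(\<lambda>x. gradient_form (\<phi> n) x $ i) = partial_deriv i (\<phi> n)" by (simp add: gradient_form_def)
    then show "test_function B (\<lambda>x. gradient_form (\<phi> n) x $ i)"
      using tst[OF smooth_on_partial[OF sm, of i n]] gsupp[of _ n] by (metis zero_index)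
  qed
  then have Tn: "(LINT x|H. indicator G x *\<^sub>R ((gradient_form (\<phi> n) x \<bullet> \<xi> x) *\<^sub>R dd x)) = 0" for n using T0 T_eq by simp
  obtain c C where c: "0 < c" "0 < C" "\<forall>x\<in>K2. \<forall>w. c * (norm w)\<^sup>2 \<le> w \<bullet> (h x *v w) \<and> norm (h x *v w) \<le> C * norm w"
    using hessian_bounds[OF K2] by blast
  have "bounded (g ` K2)" by (intro compact_imp_bounded compact_continuous_image continuous_on_subset[OF g] K2) auto
  then obtain N where N: "0 < N" "\<And>x. x \<in> K2 \<Longrightarrow> norm (g x) \<le> N" by (auto simp: bounded_pos)
  \<comment> \<open>The dominating function: c |\<xi>|^2 is at most the squared g-norm 1, so \<xi>
    has Euclidean norm at most 1 / sqrt c, and N + 1 bounds g and all approximating gradients on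
    K2.\<close>
  let ?w = "\<lambda>x. ((N + 1) / sqrt c) * norm (indicator (G \<inter> K2) x *\<^sub>R dd x)"
  have wi: "integrable H ?w" using d_integrable[OF K2] by (intro integrable_mult_right integrable_norm)
  have meas: "(\<lambda>x. indicator G x *\<^sub>R ((q x \<bullet> \<xi> x) *\<^sub>R dd x)) \<in> borel_measurable H"
    if "continuous_on UNIV q" "\<And>x. x \<notin> K2 \<Longrightarrow> q x = 0" for q
  proof -
    have [measurable]: "q \<in> borel_measurable H" using measurable_compose[OF id_measurable borel_measurable_continuous_onI[OF that(1)]] by simp
    have [measurable]: "(\<lambda>x. indicator (G \<inter> K2) x *\<^sub>R dd x) \<in> borel_measurable H" using d_integrable[OF K2] by auto
    note xi_measurable[measurable]
    have "(\<lambda>x. (q x \<bullet> (indicator G x *\<^sub>R \<xi> x)) *\<^sub>R (indicator (G \<inter> K2) x *\<^sub>R dd x)) \<in> borel_measurable H" by measurable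
    moreover have "(\<lambda>x. (q x \<bullet> (indicator G x *\<^sub>R \<xi> x)) *\<^sub>R (indicator (G \<inter> K2) x *\<^sub>R dd x)) = (\<lambda>x. indicator G x *\<^sub>R ((q x \<bullet> \<xi> x) *\<^sub>R dd x))"
    proof
      fix x
      show "(q x \<bullet> (indicator G x *\<^sub>R \<xi> x)) *\<^sub>R (indicator (G \<inter> K2) x *\<^sub>R dd x) = indicator G x *\<^sub>R ((q x \<bullet> \<xi> x) *\<^sub>R dd x)"
        using that(2)[of x] by (cases "x \<in> K2") (auto simp: indicator_def)
    qed
    ultimately show ?thesis by simp
  qed
  have bnd: "AE x in H. norm (indicator G x *\<^sub>R ((q x \<bullet> \<xi> x) *\<^sub>R dd x)) \<le> ?w x"
    if q: "\<And>x. x \<notin> K2 \<Longrightarrow> q x = 0" "\<And>x. x \<in> K2 \<Longrightarrow> norm (q x) \<le> N + 1" for q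
    using AE_good
  proof eventually_elim
    case (elim x)
    show ?case
    proof (cases "x \<in> G \<inter> K2")
      case True
      then have "c * (norm (\<xi> x))\<^sup>2 \<le> 1" using elim c(3) by (metis IntD1 IntD2)
      then have "sqrt (c * (norm (\<xi> x))\<^sup>2) \<le> 1" by (simp add: real_sqrt_le_1_iff)
      then have "norm (\<xi> x) \<le> 1 / sqrt c" using c(1) by (simp add: real_sqrt_mult field_simps)
      then have "norm (q x) * norm (\<xi> x) \<le> (N + 1) * (1 / sqrt c)" using q(2)[of x] True N(1) by (intro mult_mono) auto
      then have "\<bar>q x \<bullet> \<xi> x\<bar> \<le> (N + 1) / sqrt c" using Cauchy_Schwarz_ineq2[of "q x" "\<xi> x"] by simp
      then have "\<bar>q x \<bullet> \<xi> x\<bar> * norm (dd x) \<le> (N + 1) / sqrt c * norm (dd x)" by (rule mult_right_mono) simp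
      then show ?thesis using True by simp
    next
      case False
      then have 0: "indicator G x *\<^sub>R ((q x \<bullet> \<xi> x) *\<^sub>R dd x) = 0" using q(1) by (cases "x \<in> G") auto
      show ?thesis unfolding 0 using N(1) c(1) by simp
    qed
  qed
  have cg: "continuous_on UNIV (gradient_form (\<phi> n))" for n
  proof -
    have "continuous_on UNIV (\<lambda>x. gradient_form (\<phi> n) x $ i)" for i
      using smooth_on_continuous[OF smooth_on_partial[OF sm, of i n]] by (simp add: gradient_form_def)
    then show ?thesis by (subst continuous_on_componentwise) (auto simp: Basis_vec_def inner_axis)
  qed
  have elim0: "e \<longlonglongrightarrow> 0"
  proof (rule tendsto_sandwich[of "\<lambda>_. 0" _ _ "\<lambda>n. 1 / (real n + 1)"])
    show "(\<lambda>n. 1 / (real n + 1)) \<longlonglongrightarrow> 0"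
      using LIMSEQ_ignore_initial_segment[OF lim_const_over_n[of "1::real"], of 1] by (simp add: add.commute)
  qed (use e(1) in \<open>auto simp: e_def intro!: always_eventually less_imp_le\<close>)
  have gN: "norm (g x) \<le> N + 1" if "x \<in> K2" for x using N(2)[OF that] by simp
  have lim: "(\<lambda>n. LINT x|H. indicator G x *\<^sub>R ((gradient_form (\<phi> n) x \<bullet> \<xi> x) *\<^sub>R dd x)) \<longlonglongrightarrow> (LINT x|H. indicator G x *\<^sub>R ((g x \<bullet> \<xi> x) *\<^sub>R dd x))"
  proof (rule integral_dominated_convergence[OF meas[OF g g_supp] meas[OF cg gsupp] wi])
    show "AE x in H. (\<lambda>n. indicator G x *\<^sub>R ((gradient_form (\<phi> n) x \<bullet> \<xi> x) *\<^sub>R dd x)) \<longlonglongrightarrow> indicator G x *\<^sub>R ((g x \<bullet> \<xi> x) *\<^sub>R dd x)"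
    proof (intro AE_I2 tendsto_intros)
      fix x
      show "(\<lambda>n. gradient_form (\<phi> n) x) \<longlonglongrightarrow> g x"
        by (rule Lim_null_comparison[OF always_eventually elim0, THEN LIM_zero_cancel]) (use near in auto)
    qed
    show "AE x in H. norm (indicator G x *\<^sub>R ((gradient_form (\<phi> n) x \<bullet> \<xi> x) *\<^sub>R dd x)) \<le> ?w x" for n
    proof (rule bnd[OF gsupp])
      fix x assume "x \<in> K2"
      have "norm (gradient_form (\<phi> n) x) \<le> norm (g x) + norm (gradient_form (\<phi> n) x - g x)" by (rule norm_triangle_sub)
      then show "norm (gradient_form (\<phi> n) x) \<le> N + 1" using N(2)[OF \<open>x \<in> K2\<close>] near[of n x] e(3)[of n] by linarith
    qed
  qed
  then show "(LINT x|H. indicator G x *\<^sub>R ((g x \<bullet> \<xi> x) *\<^sub>R dd x)) = 0"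
    using Tn by (simp add: LIMSEQ_const_iff)
  have "AE x in H. norm (indicator G x *\<^sub>R ((g x \<bullet> \<xi> x) *\<^sub>R dd x)) \<le> ?w x"
    by (rule bnd[OF g_supp gN]) auto
  then have "AE x in H. norm (indicator G x *\<^sub>R ((g x \<bullet> \<xi> x) *\<^sub>R dd x)) \<le> norm (?w x)"
    by eventually_elim (rule order_trans, assumption, simp only: real_norm_def abs_ge_self)
  then show "integrable H (\<lambda>x. indicator G x *\<^sub>R ((g x \<bullet> \<xi> x) *\<^sub>R dd x))"
    by (intro Bochner_Integration.integrable_bound[OF wi] meas[OF g]) (auto simp: g_supp)
qed

end

section \<open>Charts by the gradient map\<close>

context gradient_cycle
begin

text \<open>If the mass were zero, every form supported in Q would integrate to zero, against the
  definition of the support.\<close>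

lemma support_mass:
  assumes x: "x \<in> G" and Q: "open Q" "x \<in> Q" "Q \<subseteq> B"
  shows "emeasure H (G \<inter> Q) \<noteq> 0"
proof
  assume 0: "emeasure H (G \<inter> Q) = 0"
  obtain \<beta> where \<beta>: "test_form Q \<beta>" "T \<beta> \<noteq> 0" using x Q by (auto simp: current_support_def)
  then have "test_form B \<beta>" using Q(3) by (auto simp: test_form_def test_function_def)
  then have "T \<beta> = (LINT x|H. indicator G x *\<^sub>R ((\<beta> x \<bullet> \<xi> x) *\<^sub>R dd x))" by (rule T_eq)
  also have "\<dots> = 0"
  proof (rule integral_eq_zero_AE)
    have "G \<inter> Q \<in> null_sets H" using 0 G_sets open_in_sets[OF Q(1,3)] by auto
    then have "AE x in H. x \<notin> G \<inter> Q" by (rule AE_not_in)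
    then show "AE x in H. indicator G x *\<^sub>R ((\<beta> x \<bullet> \<xi> x) *\<^sub>R dd x) = 0"
    proof eventually_elim
      case (elim x)
      show ?case
      proof (cases "x \<in> Q")
        case False
        have "\<beta> x $ i = 0" for i
        proof (rule ccontr)
          assume "\<beta> x $ i \<noteq> 0"
          then have "x \<in> {x. \<beta> x $ i \<noteq> 0}" by simp
          then have "x \<in> closure {x. \<beta> x $ i \<noteq> 0}" by (rule subsetD[OF closure_subset])
          moreover have "closure {x. \<beta> x $ i \<noteq> 0} \<subseteq> Q" using \<beta>(1) by (simp add: test_form_def test_function_def)
          ultimately show False using False by (meson subsetD)
        qed
        then have "\<beta> x = 0" by (simp add: vec_eq_iff)
        then show ?thesis by simp
      qed (use elim in auto)
    qed
  qed
  finally show False using \<beta>(2) by simp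
qed

text \<open>Along a segment in the convex ball the gradient strictly increases in the direction of
  the segment, because the Hessian is positive; hence \<open>Y\<close> is injective there, and
  invariance of domain makes it open. The doubled ball inside B is the margin that
  \<open>hausdorff_cover\<close> asks for.\<close>

lemma chart:
  assumes x0: "x0 \<in> B" and Q: "open Q" "x0 \<in> Q"
  shows "\<exists>\<rho> Yi. 0 < \<rho> \<and> cball x0 (2 * \<rho>) \<subseteq> B \<inter> Q \<and> open (Y ` ball x0 \<rho>) \<and> homeomorphism (ball x0 \<rho>) (Y ` ball x0 \<rho>) Y Yi \<and>
    (\<exists>C>0. \<forall>x\<in>ball x0 \<rho>. \<forall>y\<in>ball x0 \<rho>. norm (Y x - Y y) \<le> C * norm (x - y))"
proof -
  have "open (B \<inter> Q)" using open_B Q by blast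
  then obtain r where r: "0 < r" "cball x0 r \<subseteq> B \<inter> Q" using x0 Q(2) by (meson IntI open_contains_cball)
  define \<rho> where "\<rho> = r / 2"
  have \<rho>: "0 < \<rho>" "cball x0 (2 * \<rho>) \<subseteq> B \<inter> Q" using r by (auto simp: \<rho>_def)
  let ?U = "ball x0 \<rho>"
  have UB: "?U \<subseteq> cball x0 (2 * \<rho>)" using \<rho> by auto
  have UB': "?U \<subseteq> B" using UB \<rho> by blast
  obtain c C where c: "0 < c" "0 < C" "\<forall>x\<in>cball x0 (2*\<rho>). \<forall>w. c * (norm w)\<^sup>2 \<le> w \<bullet> (h x *v w) \<and> norm (h x *v w) \<le> C * norm w"
    using hessian_bounds[of "cball x0 (2*\<rho>)"] \<rho> by auto
  have lip: "norm (Y x - Y y) \<le> C * norm (x - y)" if "x \<in> ?U" "y \<in> ?U" for x y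
  proof (rule differentiable_bound[OF convex_ball _ _ that(1,2)])
    show "(Y has_derivative (\<lambda>w. h z *v w)) (at z within ?U)" if "z \<in> ?U" for z
      by (rule has_derivative_at_withinI[OF Y_deriv[OF subsetD[OF UB' that]]])
    show "onorm (\<lambda>w. h z *v w) \<le> C" if "z \<in> ?U" for z
    proof (rule onorm_le)
      fix w
      show "norm (h z *v w) \<le> C * norm w" using bspec[OF c(3) subsetD[OF UB that]] by simp
    qed
  qed
  have inj: "inj_on Y ?U"
  proof (rule inj_onI)
    fix x y assume xy: "x \<in> ?U" "y \<in> ?U" "Y x = Y y"
    define q where "q s = Y (y + s *\<^sub>R (x - y)) \<bullet> (x - y)" for s :: real
    have inU: "y + s *\<^sub>R (x - y) \<in> ?U" if "0 \<le> s" "s \<le> 1" for s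
    proof -
      have "y + s *\<^sub>R (x - y) = (1 - s) *\<^sub>R y + s *\<^sub>R x" by (simp add: algebra_simps)
      then show ?thesis using convexD[OF convex_ball xy(2,1), of "1 - s" s] that by simp
    qed
    have "(q has_real_derivative (x - y) \<bullet> (h (y + s *\<^sub>R (x - y)) *v (x - y))) (at s)" if "0 \<le> s" "s \<le> 1" for s
    proof -
      have "((\<lambda>s. y + s *\<^sub>R (x - y)) has_derivative (\<lambda>a. a *\<^sub>R (x - y))) (at s)" by (auto intro!: derivative_eq_intros)
      moreover have "(Y has_derivative (\<lambda>w. h (y + s *\<^sub>R (x - y)) *v w)) (at (y + s *\<^sub>R (x - y)))" by (rule Y_deriv[OF subsetD[OF UB' inU[OF that]]])
      ultimately have "((\<lambda>s. Y (y + s *\<^sub>R (x - y))) has_derivative (\<lambda>a. h (y + s *\<^sub>R (x - y)) *v (a *\<^sub>R (x - y)))) (at s)"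
        by (rule has_derivative_compose)
      from has_derivative_inner_left[OF this, of "x - y"]
      show ?thesis unfolding q_def has_field_derivative_def
        by (rule has_derivative_eq_rhs) (auto simp: matrix_vector_mult_scaleR inner_commute)
    qed
    from MVT2[of 0 1 q, OF _ this] obtain s where s: "0 < s" "s < 1"
      "q 1 - q 0 = (x - y) \<bullet> (h (y + s *\<^sub>R (x - y)) *v (x - y))" by auto
    have "q 1 - q 0 = 0" using xy(3) by (simp add: q_def)
    show "x = y"
    proof (rule ccontr)
      assume "x \<noteq> y"
      then have ne: "x - y \<noteq> 0" by simp
      have "y + s *\<^sub>R (x - y) \<in> B" by (rule subsetD[OF UB' inU]) (use s in auto)
      from hessian_pos[OF this ne] show False using s(3) \<open>q 1 - q 0 = 0\<close> by simp
    qed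
  qed
  have cont: "continuous_on ?U Y" using continuous_on_subset[OF Y_cont UB'] .
  have op: "open (Y ` ?U)" by (rule invariance_of_domain[OF cont open_ball inj])
  have "continuous_on (Y ` ?U) (the_inv_into ?U Y)"
    by (rule continuous_on_inverse_open[OF open_ball cont order_refl]) (rule the_inv_into_f_f[OF inj])
  then have "homeomorphism ?U (Y ` ?U) Y (the_inv_into ?U Y)"
    using cont inj by (auto simp: homeomorphism_def the_inv_into_f_f)
  then show ?thesis using \<rho> op lip c(2) by (intro exI[of _ \<rho>] exI[of _ "the_inv_into ?U Y"] conjI exI[of _ C] ballI) simp_all
qed

text \<open>On a gradient cycle \<open>h \<xi>\<close> is a positive multiple \<open>w\<close> of the weight covector, and \<open>w\<close> is the density of the
  measure. Writing it as the quotient of the norms avoids the measurability of the inverse Hessian.\<close>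

lemma chart_stationary:
  assumes \<rho>: "0 < \<rho>" "cball x0 (2 * \<rho>) \<subseteq> B" and W: "open (Y ` ball x0 \<rho>)" and hom: "homeomorphism (ball x0 \<rho>) (Y ` ball x0 \<rho>) Y Yi"
    and lip: "0 < C1" "\<And>x y. x \<in> ball x0 \<rho> \<Longrightarrow> y \<in> ball x0 \<rho> \<Longrightarrow> norm (Y x - Y y) \<le> C1 * norm (x - y)"
  shows "\<exists>M C0. lattice_stationary M Y dd (Y ` ball x0 \<rho>) (range covector) C0 \<and> space M = G \<inter> ball x0 \<rho>"
proof -
  let ?U = "ball x0 \<rho>"
  let ?K = "cball x0 (2 * \<rho>)"
  let ?W = "Y ` ?U"
  have UK: "?U \<subseteq> ?K" using \<rho> by auto
  have UB: "?U \<subseteq> B" using UK \<rho> by blast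
  have Uo: "open ?U" by simp
  have Us: "?U \<in> sets H" using open_in_sets[OF Uo UB] .
  define \<Omega> where "\<Omega> = G \<inter> ?U"
  have \<Omega>s: "\<Omega> \<in> sets H" using G_sets Us by (auto simp: \<Omega>_def)
  have \<Omega>i: "\<Omega> \<inter> space H \<in> sets H" using \<Omega>s sets.sets_into_space[OF \<Omega>s] by (simp add: Int_absorb2)
  have \<Omega>U: "\<Omega> \<subseteq> ?U" by (auto simp: \<Omega>_def)
  obtain c C where c: "0 < c" "0 < C" "\<forall>x\<in>?K. \<forall>w. c * (norm w)\<^sup>2 \<le> w \<bullet> (h x *v w) \<and> norm (h x *v w) \<le> C * norm w"
    using hessian_bounds[of ?K] \<rho> by auto
  define N where "N = restrict_space H \<Omega>"
  have spN: "space N = \<Omega>" using sets.sets_into_space[OF \<Omega>s] by (auto simp: N_def space_restrict_space)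
  have sN: "A \<in> sets N \<longleftrightarrow> A \<in> sets H \<and> A \<subseteq> \<Omega>" for A unfolding N_def sets_restrict_space_iff[OF \<Omega>i] by auto
  have dK: "integrable H (\<lambda>x. indicator (G \<inter> ?K) x *\<^sub>R dd x)" by (rule d_integrable) (use \<rho> in auto)
  have dN: "integrable N dd"
  proof -
    have "integrable H (\<lambda>x. indicator ?U x *\<^sub>R (indicator (G \<inter> ?K) x *\<^sub>R dd x))" using dK Us by (rule integrable_mult_indicator[rotated])
    moreover have "(\<lambda>x. indicator ?U x *\<^sub>R (indicator (G \<inter> ?K) x *\<^sub>R dd x)) = (\<lambda>x. indicator \<Omega> x *\<^sub>R dd x)"
      using UK by (auto simp: \<Omega>_def indicator_def fun_eq_iff)
    ultimately show ?thesis unfolding N_def integrable_restrict_space[OF \<Omega>i] by simp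
  qed
  then have [measurable]: "dd \<in> borel_measurable N" by auto
  have [measurable]: "\<xi> \<in> borel_measurable N"
  proof -
    have "(\<lambda>x. indicator ?U x *\<^sub>R (indicator G x *\<^sub>R \<xi> x)) \<in> borel_measurable H" using xi_measurable Us by measurable
    moreover have "(\<lambda>x. indicator ?U x *\<^sub>R (indicator G x *\<^sub>R \<xi> x)) = (\<lambda>x. indicator \<Omega> x *\<^sub>R \<xi> x)"
      by (auto simp: \<Omega>_def indicator_def fun_eq_iff)
    ultimately show ?thesis unfolding N_def borel_measurable_restrict_space_iff[OF \<Omega>i] by simp
  qed
  have contN: "f \<in> borel_measurable N" if "continuous_on B f" for f :: "real^'n \<Rightarrow> real^'n"
    unfolding N_def using continuous_measurable[OF open_B subset_refl that, of \<Omega>] \<Omega>U UB by blast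
  have [measurable]: "Y \<in> borel_measurable N" by (rule contN[OF Y_cont])
  have [measurable]: "(\<lambda>x. h x *v \<xi> x) \<in> borel_measurable N"
  proof -
    have [measurable]: "(\<lambda>x. h x *v axis j 1) \<in> borel_measurable N" for j by (rule contN[OF hessian_cont])
    have "(\<lambda>x. \<Sum>j\<in>UNIV. (\<xi> x \<bullet> axis j 1) *\<^sub>R (h x *v axis j 1)) \<in> borel_measurable N" by measurable
    moreover have "(\<Sum>j\<in>UNIV. (\<xi> x \<bullet> axis j 1) *\<^sub>R (h x *v axis j 1)) = h x *v \<xi> x" for x
    proof -
      have "h x *v \<xi> x = h x *v (\<Sum>j\<in>UNIV. \<xi> x $ j *\<^sub>R axis j 1)" using basis_expansion[of "\<xi> x"] by (simp add: scalar_mult_eq_scaleR)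
      also have "\<dots> = (\<Sum>j\<in>UNIV. \<xi> x $ j *\<^sub>R (h x *v axis j 1))"
        by (simp add: linear_sum[OF matrix_vector_mul_linear] matrix_vector_mult_scaleR)
      finally show ?thesis by (simp add: inner_axis)
    qed
    ultimately show ?thesis by simp
  qed
  define \<omega> where "\<omega> x = norm (h x *v \<xi> x) / norm (dd x)" for x
  have [measurable]: "\<omega> \<in> borel_measurable N" unfolding \<omega>_def by measurable
  have \<omega>0: "0 \<le> \<omega> x" for x by (simp add: \<omega>_def)
  define M where "M = density N (\<lambda>x. ennreal (\<omega> x))"
  have spM: "space M = \<Omega>" and sM[simp]: "sets M = sets N" by (simp_all add: M_def spN)
  define L where "L = C / sqrt c"
  \<comment> \<open>The norm of h \<xi> equals \<omega> |d|. It is at most C |\<xi>| \<le> C / sqrt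
    c and, by Cauchy-Schwarz from \<xi> \<bullet> h \<xi> = 1, at least 1 / |\<xi>| \<ge> sqrt c. So
    Hausdorff measure and Euclidean length of the image are comparable.\<close>
  have good: "AE x in N. 1 \<le> norm (dd x) \<and> h x *v \<xi> x = \<omega> x *\<^sub>R dd x \<and> sqrt c \<le> \<omega> x * norm (dd x) \<and> \<omega> x * norm (dd x) \<le> L"
    unfolding N_def AE_restrict_space_iff[OF \<Omega>i] using AE_good
  proof eventually_elim
    case (elim x)
    show ?case
    proof
      assume x: "x \<in> \<Omega>"
      then have xK: "x \<in> ?K" "x \<in> G" using UK by (auto simp: \<Omega>_def)
      then obtain w where w: "0 < w" "h x *v \<xi> x = w *\<^sub>R dd x" and one: "\<xi> x \<bullet> (h x *v \<xi> x) = 1" and d1: "1 \<le> norm (dd x)"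
        using elim covector_norm_ge_1 by blast
      have dn: "dd x \<noteq> 0" using d1 by (metis norm_zero not_one_le_zero)
      have wx: "\<omega> x = w" using dn w by (simp add: \<omega>_def)
      have nh: "\<omega> x * norm (dd x) = norm (h x *v \<xi> x)" using w wx by simp
      have "c * (norm (\<xi> x))\<^sup>2 \<le> 1" using c(3) xK(1) one by metis
      then have "sqrt (c * (norm (\<xi> x))\<^sup>2) \<le> 1" by (simp add: real_sqrt_le_1_iff)
      then have sq: "sqrt c * norm (\<xi> x) \<le> 1" by (simp add: real_sqrt_mult)
      then have "norm (\<xi> x) \<le> 1 / sqrt c" using c(1) by (simp add: field_simps)
      moreover have "norm (h x *v \<xi> x) \<le> C * norm (\<xi> x)" using c(3) xK(1) by blast
      ultimately have "norm (h x *v \<xi> x) \<le> C * (1 / sqrt c)" using c(2) by (meson mult_left_mono less_imp_le order_trans)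
      moreover have "sqrt c \<le> norm (h x *v \<xi> x)"
      proof -
        have "1 \<le> norm (\<xi> x) * norm (h x *v \<xi> x)" using norm_cauchy_schwarz[of "\<xi> x" "h x *v \<xi> x"] one by simp
        then have "sqrt c * 1 \<le> sqrt c * (norm (\<xi> x) * norm (h x *v \<xi> x))" using c(1) by (intro mult_left_mono) auto
        also have "\<dots> = (sqrt c * norm (\<xi> x)) * norm (h x *v \<xi> x)" by simp
        also have "\<dots> \<le> 1 * norm (h x *v \<xi> x)" using sq by (rule mult_right_mono) simp
        finally show ?thesis by simp
      qed
      ultimately show "1 \<le> norm (dd x) \<and> h x *v \<xi> x = \<omega> x *\<^sub>R dd x \<and> sqrt c \<le> \<omega> x * norm (dd x) \<and> \<omega> x * norm (dd x) \<le> L"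
        using d1 w wx nh by (simp add: L_def)
    qed
  qed
  have ndN: "integrable N (\<lambda>x. norm (dd x))" using dN by (rule integrable_norm)
  have \<omega>i: "integrable N \<omega>"
  proof (rule Bochner_Integration.integrable_bound)
    show "integrable N (\<lambda>x. L * norm (dd x))" using ndN by simp
    show "AE x in N. norm (\<omega> x) \<le> norm (L * norm (dd x))" using good
    proof eventually_elim
      case (elim x)
      have "\<omega> x * 1 \<le> \<omega> x * norm (dd x)" using elim \<omega>0 by (intro mult_left_mono) auto
      moreover have "L * 1 \<le> L * norm (dd x)" using elim c by (intro mult_left_mono) (auto simp: L_def)
      ultimately show ?case using elim \<omega>0[of x] by simp
    qed
  qed simp
  have Mint: "integrable M f \<longleftrightarrow> integrable N (\<lambda>x. \<omega> x *\<^sub>R f x)" "(LINT x|M. f x) = (LINT x|N. \<omega> x *\<^sub>R f x)"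
    if "f \<in> borel_measurable N" for f :: "real^'n \<Rightarrow> real"
    unfolding M_def using that \<omega>0 by (intro integrable_density integral_density; simp)+
  have finM: "finite_measure M"
  proof
    have "emeasure M (space M) = (\<integral>\<^sup>+ x. ennreal (\<omega> x) \<partial>N)" unfolding M_def by (subst emeasure_density) (auto intro!: nn_integral_cong simp: indicator_def)
    also have "\<dots> = ennreal (LINT x|N. \<omega> x)" by (rule nn_integral_eq_integral[OF \<omega>i]) (simp add: \<omega>0)
    finally show "emeasure M (space M) \<noteq> \<infinity>" by simp
  qed
  have AEM: "AE x in M. P x" if "AE x in N. P x" for P unfolding M_def using that by (subst AE_density) auto
  have dsq: "integrable M (\<lambda>x. (norm (dd x))\<^sup>2)"
  proof (subst Mint(1))
    show "integrable N (\<lambda>x. \<omega> x *\<^sub>R (norm (dd x))\<^sup>2)"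
    proof (rule Bochner_Integration.integrable_bound)
      show "integrable N (\<lambda>x. L * norm (dd x))" using ndN by simp
      show "AE x in N. norm (\<omega> x *\<^sub>R (norm (dd x))\<^sup>2) \<le> norm (L * norm (dd x))" using good
      proof eventually_elim
        case (elim x)
        have "(\<omega> x * norm (dd x)) * norm (dd x) \<le> L * norm (dd x)" using elim by (intro mult_right_mono) auto
        moreover have "0 \<le> \<omega> x * (norm (dd x))\<^sup>2" using \<omega>0 by simp
        ultimately show ?case by (simp add: power2_eq_square mult_ac)
      qed
    qed simp
  qed simp
  have Hfin: "emeasure H A < \<infinity> \<and> sqrt c * measure H A \<le> (LINT x|M. indicator A x * norm (dd x))" if A: "A \<in> sets N" for A
  proof -
    have AH: "A \<in> sets H" "A \<subseteq> \<Omega>" using A sN by auto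
    note A[measurable]
    have eq: "emeasure N A = emeasure H A" "measure N A = measure H A" unfolding N_def using AH(2) \<Omega>i
      by (auto simp: emeasure_restrict_space measure_restrict_space)
    have "emeasure N A = (\<integral>\<^sup>+ x. indicator A x \<partial>N)" using A by simp
    also have "\<dots> \<le> (\<integral>\<^sup>+ x. ennreal (norm (dd x)) \<partial>N)"
    proof (rule nn_integral_mono_AE)
      show "AE x in N. indicator A x \<le> ennreal (norm (dd x))" using good
      proof eventually_elim
        case (elim x)
        then have "ennreal 1 \<le> ennreal (norm (dd x))" by (intro ennreal_leI) auto
        then show ?case by (auto simp: indicator_def)
      qed
    qed
    also have "\<dots> = ennreal (LINT x|N. norm (dd x))" by (rule nn_integral_eq_integral[OF ndN]) simp
    finally have fin: "emeasure N A < \<infinity>" by (auto simp: order_le_less_trans)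
    have "(LINT x|N. sqrt c * indicator A x) \<le> (LINT x|N. \<omega> x *\<^sub>R (indicator A x * norm (dd x)))"
    proof (rule integral_mono_AE)
      show "integrable N (\<lambda>x. sqrt c * indicator A x)" using A fin by simp
      show "integrable N (\<lambda>x. \<omega> x *\<^sub>R (indicator A x * norm (dd x)))"
      proof (rule Bochner_Integration.integrable_bound[OF \<omega>i[THEN Bochner_Integration.integrable_add, OF ndN[THEN integrable_mult_right, of L]]])
        show "(\<lambda>x. \<omega> x *\<^sub>R (indicator A x * norm (dd x))) \<in> borel_measurable N" using A by measurable
        show "AE x in N. norm (\<omega> x *\<^sub>R (indicator A x * norm (dd x))) \<le> norm (\<omega> x + L * norm (dd x))" using good
        proof eventually_elim
          case (elim x)
          have "L * 1 \<le> L * norm (dd x)" using elim c by (intro mult_left_mono) (auto simp: L_def)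
          then have "\<omega> x * norm (dd x) \<le> \<omega> x + L * norm (dd x)" "0 \<le> \<omega> x + L * norm (dd x)" using elim \<omega>0[of x] c by (auto simp: L_def)
          then show ?case using \<omega>0[of x] by (auto simp: indicator_def)
        qed
      qed
      show "AE x in N. sqrt c * indicator A x \<le> \<omega> x *\<^sub>R (indicator A x * norm (dd x))" using good
        by eventually_elim (auto simp: indicator_def)
    qed
    also have "\<dots> = (LINT x|M. indicator A x * norm (dd x))" using A by (intro Mint(2)[symmetric]) measurable
    also have "(LINT x|N. sqrt c * indicator A x) = sqrt c * measure N A" using sets.sets_into_space[OF A] by (simp add: Int_absorb2)
    finally show ?thesis using fin eq by simp
  qed
  \<comment> \<open>The constant C1 / c is C1 / sqrt c from the cover times 1 / sqrt c from the
    lower bound on \<omega> |d|.\<close>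
  have "lattice_stationary M Y dd ?W (range covector) (C1 / c)"
  proof (intro lattice_stationary.intro finM lattice_stationary_axioms.intro)
    show "Y \<in> borel_measurable M" "dd \<in> borel_measurable M" unfolding M_def by simp_all
    show "open ?W" by (rule W)
    show "Y x \<in> ?W" if "x \<in> space M" for x using that spM \<Omega>U by blast
    show "integrable M (\<lambda>x. (norm (dd x))\<^sup>2)" by (rule dsq)
    show "AE x in M. dd x \<in> range covector \<and> 1 \<le> norm (dd x)" by (rule AEM) (use good in \<open>auto elim: eventually_mono\<close>)
    show "finite (range covector \<inter> cball (0 :: real^'n) r)" for r by (rule finite_covectors)
    show "0 < C1 / c" using lip c by simp
  next
    fix A and \<eta> :: real assume A: "A \<in> sets M" "A \<noteq> {}" "0 < \<eta>"
    have AN: "A \<in> sets N" using A by simp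
    then have AH: "A \<in> sets H" "A \<subseteq> ?U" using sN \<Omega>U by auto
    have "\<exists>a r. (\<forall>i::nat. a i \<in> Y ` A \<and> 0 < r i \<and> r i < \<eta>) \<and> Y ` A \<subseteq> (\<Union>i. ball (a i) (r i)) \<and>
        summable r \<and> suminf r \<le> (C1 / sqrt c) * measure H A + \<eta>"
      by (rule hausdorff_cover[OF \<rho>(2,1) c(1) _ lip AH(1) A(2) AH(2) _ A(3)]) (use c(3) Hfin[OF AN] in auto)
    moreover have "(C1 / sqrt c) * measure H A \<le> C1 / c * (LINT x|M. indicator A x * norm (dd x))"
    proof -
      have "(C1 / c) * (sqrt c * measure H A) \<le> C1 / c * (LINT x|M. indicator A x * norm (dd x))"
        using Hfin[OF AN] lip c by (intro mult_left_mono) auto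
      moreover have "(C1 / c) * (sqrt c * measure H A) = (C1 / sqrt c) * measure H A"
        using c(1) by (simp add: field_simps)
      ultimately show ?thesis by simp
    qed
    ultimately show "\<exists>a \<rho>. (\<forall>i::nat. a i \<in> Y ` A \<and> 0 < \<rho> i \<and> \<rho> i < \<eta>) \<and> Y ` A \<subseteq> (\<Union>i. ball (a i) (\<rho> i)) \<and>
        summable \<rho> \<and> suminf \<rho> \<le> C1 / c * (LINT x|M. indicator A x * norm (dd x)) + \<eta>"
      by (elim exE conjE) (intro exI conjI, assumption+, linarith)
  next
    fix X :: "real^'n \<Rightarrow> real^'n" and X' and K :: "(real^'n) set"
    assume X: "\<And>y. (X has_derivative X' y) (at y)" "\<And>v. continuous_on UNIV (\<lambda>y. X' y v)" "compact K" "K \<subseteq> ?W" "\<And>y. y \<notin> K \<Longrightarrow> X y = 0"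
    have linX: "linear (X' y)" for y using X(1) by (rule has_derivative_linear)
    define K' where "K' = Yi ` K"
    have K': "compact K'" "K' \<subseteq> ?U" unfolding K'_def using X(3,4) hom
      by (auto intro!: compact_continuous_image continuous_on_subset[of ?W] simp: homeomorphism_def)
    have oK': "open (- K')" using compact_imp_closed[OF K'(1)] by (rule open_Compl)
    have YK: "Y x \<in> K \<Longrightarrow> x \<in> K'" if "x \<in> ?U" for x using that hom unfolding K'_def homeomorphism_def by force
    \<comment> \<open>Component i of the field pulled back to the domain and extended by zero off
      the chart: the C^1 function to be tested in component i of the current.\<close>
    define f where "f i x = (if x \<in> ?U then X (Y x) $ i else 0)" for i x
    define g where "g i x = (if x \<in> ?U then (\<chi> k. X' (Y x) (h x *v axis k 1) $ i) else 0)" for i x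
    have YnK: "Y x \<notin> K" if "x \<in> ?U" "x \<notin> K'" for x using YK[OF that(1)] that(2) by blast
    have fK: "f i x = 0" if "x \<notin> K'" for i x
      using X(5)[OF YnK[OF _ that]] by (cases "x \<in> ?U") (simp_all add: f_def)
    have X'0: "X' y v = 0" if "y \<notin> K" for y v
    proof -
      have "((\<lambda>_. 0) has_derivative (\<lambda>v. 0)) (at y)" by simp
      then have "(X has_derivative (\<lambda>v. 0)) (at y)"
        by (rule has_derivative_transform_within_open[of _ _ _ _ "- K"]) (use X(3,5) that compact_imp_closed in auto)
      from has_derivative_unique[OF X(1) this] show ?thesis by (rule fun_cong)
    qed
    have gK: "g i x = 0" if "x \<notin> K'" for i x
      using X'0[OF YnK[OF _ that]] by (cases "x \<in> ?U") (simp_all add: g_def vec_eq_iff)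
    have gin: "g i x \<bullet> w = X' (Y x) (h x *v w) $ i" if "x \<in> ?U" for i x w
    proof -
      have "h x *v w = (\<Sum>k\<in>UNIV. w $ k *\<^sub>R (h x *v axis k 1))"
      proof -
        have "h x *v w = h x *v (\<Sum>j\<in>UNIV. w $ j *\<^sub>R axis j 1)" using basis_expansion[of w] by (simp add: scalar_mult_eq_scaleR)
        then show ?thesis by (simp add: linear_sum[OF matrix_vector_mul_linear] matrix_vector_mult_scaleR)
      qed
      then have "X' (Y x) (h x *v w) = (\<Sum>k\<in>UNIV. w $ k *\<^sub>R X' (Y x) (h x *v axis k 1))"
        by (simp add: linear_sum[OF linX] linear_scale[OF linX])
      then show ?thesis using that by (simp add: g_def inner_vec_def mult.commute)
    qed
    have fd: "(f i has_derivative (\<lambda>w. g i x \<bullet> w)) (at x)" for i x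
    proof (cases "x \<in> ?U")
      case True
      have "((\<lambda>x. X (Y x)) has_derivative (\<lambda>w. X' (Y x) (h x *v w))) (at x)"
        using has_derivative_compose[OF Y_deriv X(1)] True UB by blast
      from has_derivative_compose[OF this bounded_linear_imp_has_derivative[OF bounded_linear_vec_nth, of i]]
      have "((\<lambda>x. X (Y x) $ i) has_derivative (\<lambda>w. g i x \<bullet> w)) (at x)" using gin[OF True] by simp
      then show ?thesis by (rule has_derivative_transform_within_open[OF _ Uo True]) (simp add: f_def)
    next
      case False
      then have xK: "x \<in> - K'" using K' by blast
      have "((\<lambda>_. 0) has_derivative (\<lambda>w. 0)) (at x)" by simp
      then have "(f i has_derivative (\<lambda>w. 0)) (at x)"
        by (rule has_derivative_transform_within_open[OF _ oK' xK]) (simp add: fK)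
      moreover have "g i x = 0" using gK xK by simp
      ultimately show ?thesis by simp
    qed
    have gc: "continuous_on UNIV (g i)" for i
    proof -
      have "continuous_on ?U (\<lambda>x. X' (Y x) (h x *v axis k 1) $ i)" for k
      proof -
        have "continuous_on ?U (\<lambda>x. \<Sum>l\<in>UNIV. ((h x *v axis k 1) $ l) *\<^sub>R X' (Y x) (axis l 1))"
          by (intro continuous_intros continuous_on_compose2[OF X(2)] continuous_on_subset[OF hessian_cont UB] continuous_on_subset[OF Y_cont UB]) auto
        moreover have eq: "(\<Sum>l\<in>UNIV. (v $ l) *\<^sub>R X' y (axis l 1)) = X' y v" for v y
        proof -
          have "X' y v = X' y (\<Sum>j\<in>UNIV. v $ j *\<^sub>R axis j 1)" using basis_expansion[of v] by (simp add: scalar_mult_eq_scaleR)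
          then show ?thesis by (simp add: linear_sum[OF linX] linear_scale[OF linX])
        qed
        ultimately have "continuous_on ?U (\<lambda>x. X' (Y x) (h x *v axis k 1))" by (simp only: eq)
        then show ?thesis by (intro continuous_intros)
      qed
      then have "continuous_on ?U (\<lambda>x. (\<chi> k. X' (Y x) (h x *v axis k 1) $ i))"
        by (intro continuous_on_vec_lambda)
      then have 1: "continuous_on ?U (g i)" by (rule continuous_on_eq) (simp add: g_def)
      have "continuous_on (- K') (\<lambda>_. 0 :: real^'n)" by simp
      then have 2: "continuous_on (- K') (g i)" by (rule continuous_on_eq) (simp add: gK)
      have "continuous_on (?U \<union> - K') (g i)" by (intro continuous_on_open_Un 1 2 Uo oK')
      moreover have "?U \<union> - K' = UNIV" using K'(2) by blast
      ultimately show ?thesis by simp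
    qed
    have K'B: "K' \<subseteq> B" using K'(2) UB by blast
    note C1 = C1_closed[OF fd gc K'(1) K'B fK]
    \<comment> \<open>Testing the current with f i gives a vector identity, of which component i is
      kept; the sum over i is the inner product with d that occurs in the first variation.\<close>
    have eqN: "(LINT x|N. (g i x \<bullet> \<xi> x) * (dd x $ i)) = 0" "integrable N (\<lambda>x. (g i x \<bullet> \<xi> x) * (dd x $ i))" for i
    proof -
      have comp: "(indicator G x *\<^sub>R ((g i x \<bullet> \<xi> x) *\<^sub>R dd x)) \<bullet> axis i 1 = indicator \<Omega> x *\<^sub>R ((g i x \<bullet> \<xi> x) * (dd x $ i))" for x
      proof (cases "x \<in> ?U")
        case True
        then show ?thesis by (auto simp: \<Omega>_def indicator_def inner_axis)
      next
        case False
        then have "g i x = 0" by (simp add: g_def)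
        then show ?thesis by simp
      qed
      have "(LINT x|H. (indicator G x *\<^sub>R ((g i x \<bullet> \<xi> x) *\<^sub>R dd x)) \<bullet> axis i 1) = 0"
        using C1(2)[of i] by (subst integral_inner_left) (use C1(1)[of i] in auto)
      then show "(LINT x|N. (g i x \<bullet> \<xi> x) * (dd x $ i)) = 0"
        unfolding comp N_def integral_restrict_space[OF \<Omega>i] .
      have "integrable H (\<lambda>x. (indicator G x *\<^sub>R ((g i x \<bullet> \<xi> x) *\<^sub>R dd x)) \<bullet> axis i 1)" using C1(1)[of i] by (rule integrable_inner_left)
      then show "integrable N (\<lambda>x. (g i x \<bullet> \<xi> x) * (dd x $ i))" unfolding comp N_def integrable_restrict_space[OF \<Omega>i] .
    qed
    have X'meas: "(\<lambda>x. X' (Y x) (dd x) \<bullet> dd x) \<in> borel_measurable N"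
    proof -
      have [measurable]: "(\<lambda>x. X' (Y x) v) \<in> borel_measurable N" for v
        using measurable_compose[OF \<open>Y \<in> borel_measurable N\<close> borel_measurable_continuous_onI[OF X(2)[of v]]] .
      have "(\<lambda>x. (\<Sum>l\<in>UNIV. (dd x \<bullet> axis l 1) *\<^sub>R X' (Y x) (axis l 1)) \<bullet> dd x) \<in> borel_measurable N" by measurable
      moreover have eq: "(\<Sum>l\<in>UNIV. (v \<bullet> axis l 1) *\<^sub>R X' y (axis l 1)) = X' y v" for v y
      proof -
        have "X' y v = X' y (\<Sum>j\<in>UNIV. v $ j *\<^sub>R axis j 1)" using basis_expansion[of v] by (simp add: scalar_mult_eq_scaleR)
        then show ?thesis by (simp add: linear_sum[OF linX] linear_scale[OF linX] inner_axis)
      qed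
      ultimately show ?thesis by (simp only: eq)
    qed
    have "(LINT x|M. X' (Y x) (dd x) \<bullet> dd x) = (LINT x|N. \<omega> x *\<^sub>R (X' (Y x) (dd x) \<bullet> dd x))" by (rule Mint(2)[OF X'meas])
    also have "\<dots> = (LINT x|N. (\<Sum>i\<in>UNIV. (g i x \<bullet> \<xi> x) * (dd x $ i)))"
    proof (rule integral_cong_AE)
      show "(\<lambda>x. \<omega> x *\<^sub>R (X' (Y x) (dd x) \<bullet> dd x)) \<in> borel_measurable N" using X'meas by measurable
      show "(\<lambda>x. \<Sum>i\<in>UNIV. (g i x \<bullet> \<xi> x) * (dd x $ i)) \<in> borel_measurable N" using eqN(2) by (intro borel_measurable_sum) auto
      show "AE x in N. \<omega> x *\<^sub>R (X' (Y x) (dd x) \<bullet> dd x) = (\<Sum>i\<in>UNIV. (g i x \<bullet> \<xi> x) * (dd x $ i))"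
        using good AE_space
      proof eventually_elim
        case (elim x)
        then have xU: "x \<in> ?U" using spN \<Omega>U by blast
        have "g i x \<bullet> \<xi> x = \<omega> x * (X' (Y x) (dd x) $ i)" for i
          using elim gin[OF xU, of i "\<xi> x"] by (simp add: linear_scale[OF linX])
        then show ?case by (simp add: inner_vec_def sum_distrib_left mult.assoc)
      qed
    qed
    also have "\<dots> = (\<Sum>i\<in>UNIV. LINT x|N. (g i x \<bullet> \<xi> x) * (dd x $ i))" by (rule Bochner_Integration.integral_sum) (rule eqN(2))
    also have "\<dots> = 0" by (simp add: eqN(1))
    finally show "(LINT x|M. X' (Y x) (dd x) \<bullet> dd x) = 0" .
  next
    have "closedin (top_of_set ?U) \<Omega>"
    proof -
      obtain S where S: "closed S" "G = B \<inter> S" using G_closed by (auto simp: closedin_closed)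
      have "\<Omega> = ?U \<inter> S" using S UB by (auto simp: \<Omega>_def)
      then show ?thesis using S by (simp add: closedin_closed_Int)
    qed
    then show "closedin (top_of_set ?W) (Y ` space M)" unfolding spM by (rule homeomorphism_imp_closed_map[OF hom])
  next
    fix x and r :: real assume x: "x \<in> space M" and r: "0 < r"
    have xU: "x \<in> G" "x \<in> ?U" using x spM by (auto simp: \<Omega>_def)
    define Q where "Q = ?U \<inter> Y -` ball (Y x) r"
    have Qo: "open Q" unfolding Q_def by (rule continuous_open_preimage[OF continuous_on_subset[OF Y_cont UB] Uo open_ball])
    have QB: "Q \<subseteq> B" using UB by (auto simp: Q_def)
    have eq: "{x'\<in>space M. dist (Y x') (Y x) < r} = G \<inter> Q" by (auto simp: spM \<Omega>_def Q_def dist_commute)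
    have GQ: "G \<inter> Q \<in> sets N" using sN G_sets open_in_sets[OF Qo QB] by (auto simp: \<Omega>_def Q_def)
    have "emeasure H (G \<inter> Q) \<noteq> 0" by (rule support_mass[OF xU(1) Qo _ QB]) (use xU r in \<open>simp add: Q_def\<close>)
    then have "0 < measure H (G \<inter> Q)" using Hfin[OF GQ] by (simp add: measure_def enn2real_positive_iff zero_less_iff_neq_zero)
    then have pos: "0 < (LINT x|M. indicator (G \<inter> Q) x * norm (dd x))" using Hfin[OF GQ] c(1) by (smt (verit) mult_pos_pos real_sqrt_gt_zero)
    show "0 < measure M {x'\<in>space M. dist (Y x') (Y x) < r}"
    proof (rule ccontr)
      assume "\<not> ?thesis"
      then have "measure M (G \<inter> Q) = 0" unfolding eq by (simp add: zero_less_measure_iff)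
      then have "emeasure M (G \<inter> Q) = 0" using finite_measure.emeasure_eq_measure[OF finM] by simp
      then have "AE x in M. x \<notin> G \<inter> Q" using GQ by (intro AE_not_in null_setsI) auto
      then have "AE x in M. indicator (G \<inter> Q) x * norm (dd x) = 0" by eventually_elim auto
      then have "(LINT x|M. indicator (G \<inter> Q) x * norm (dd x)) = 0" by (rule integral_eq_zero_AE)
      then show False using pos by simp
    qed
  qed
  then show ?thesis using spM unfolding \<Omega>_def by blast
qed

end

section \<open>Arcs of the support\<close>

context gradient_cycle
begin

text \<open>The segments of the star are pulled back by the local inverse of \<open>Y\<close>. A
  straight line in an integral direction pulls back to a trajectory of the gradient flow, by the
  derivative of the inverse map.\<close>

lemma star_arcs:
  assumes p: "p \<in> G" and UQ: "ball p \<rho> \<subseteq> B \<inter> Q" and \<rho>: "0 < \<rho>"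
    and W: "open (Y ` ball p \<rho>)" and hom: "homeomorphism (ball p \<rho>) (Y ` ball p \<rho>) Y Yi"
    and r: "0 < r" "finite E" "cball (Y p) r \<subseteq> Y ` ball p \<rho>"
    and E: "\<And>e. e \<in> E \<Longrightarrow> norm e = 1 \<and> (\<exists>v\<in>range covector. v \<noteq> 0 \<and> (e = v /\<^sub>R norm v \<or> e = - v /\<^sub>R norm v))"
    and star: "Y ` (G \<inter> ball p \<rho>) \<inter> ball (Y p) r = {Y p} \<union> {Y p + t *\<^sub>R e |t e. e \<in> E \<and> 0 < t \<and> t < r}"
  shows "\<exists>C N. arc_system G (gradient_flowline B u) Q C \<and> open N \<and> p \<in> N \<and> G \<inter> N - {p} \<subseteq> (\<Union>c\<in>C. c ` {0<..<1})"
proof -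
  let ?U = "ball p \<rho>"
  let ?W = "Y ` ?U"
  have YiY: "Yi (Y x) = x" if "x \<in> ?U" for x using hom that by (simp add: homeomorphism_def)
  have YYi: "Y (Yi y) = y" and YiU: "Yi y \<in> ?U" if "y \<in> ?W" for y using hom that unfolding homeomorphism_def by auto
  have cYi: "continuous_on ?W Yi" using hom by (simp add: homeomorphism_def)
  have UB: "?U \<subseteq> B" using UQ by blast
  \<comment> \<open>The star is known inside an open ball of radius r only; halving keeps the closed
    segments with their outer ends inside it.\<close>
  define r' where "r' = r / 2"
  have r': "0 < r'" "r' < r" using r by (auto simp: r'_def)
  have pU: "p \<in> ?U" using \<rho> by simp
  define c where "c e t = Yi (Y p + (t * r') *\<^sub>R e)" for e t
  have segW: "Y p + s *\<^sub>R e \<in> ?W" if "e \<in> E" "0 \<le> s" "s \<le> r'" for e s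
  proof -
    have "Y p + s *\<^sub>R e \<in> cball (Y p) r" using E[OF that(1)] that r' by (simp add: dist_norm)
    then show ?thesis using r(3) by blast
  qed
  have tr: "0 \<le> t * r'" "t * r' \<le> r'" if "0 \<le> t" "t \<le> 1" for t using that r' by (auto simp: mult_left_le_one_le)
  have Yc: "Y (c e t) = Y p + (t * r') *\<^sub>R e" if "e \<in> E" "0 \<le> t" "t \<le> 1" for e t
    unfolding c_def by (rule YYi[OF segW[OF that(1) tr[OF that(2,3)]]])
  have cG: "c e t \<in> G \<inter> ?U" if e: "e \<in> E" and t: "0 \<le> t" "t \<le> 1" for e t
  proof -
    have "Y p + (t * r') *\<^sub>R e \<in> Y ` (G \<inter> ?U)"
    proof (cases "t = 0")
      case True
      then show ?thesis using p pU by auto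
    next
      case False
      then have "0 < t * r'" using t r' by simp
      moreover have "t * r' < r" using tr(2)[OF t] r' by linarith
      ultimately have "Y p + (t * r') *\<^sub>R e \<in> {Y p + t *\<^sub>R e |t e. e \<in> E \<and> 0 < t \<and> t < r}"
        using e unfolding mem_Collect_eq by (intro exI[of _ "t * r'"] exI[of _ e] conjI refl)
      then have "Y p + (t * r') *\<^sub>R e \<in> Y ` (G \<inter> ?U) \<inter> ball (Y p) r" unfolding star by (rule UnI2)
      then show ?thesis by (rule IntD1)
    qed
    then obtain x where x: "Y p + (t * r') *\<^sub>R e = Y x" "x \<in> G \<inter> ?U" by (rule imageE)
    have "c e t = x" unfolding c_def x(1) using x(2) by (intro YiY) simp
    then show ?thesis using x(2) by simp
  qed
  have on_arc: "x \<in> c e ` {0<..<1}" if x: "x \<in> ?U" "Y x = Y p + \<tau> *\<^sub>R e" and \<tau>: "0 < \<tau>" "\<tau> < r'" for x \<tau> e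
  proof (rule image_eqI)
    show "x = c e (\<tau> / r')" unfolding c_def using YiY[OF x(1)] x(2) r' by simp
    show "\<tau> / r' \<in> {0<..<1}" using \<tau> by simp
  qed
  have near: "x = p \<or> (\<exists>e\<in>E. \<exists>\<tau>. 0 < \<tau> \<and> \<tau> < r' \<and> Y x = Y p + \<tau> *\<^sub>R e)" if x: "x \<in> G" "x \<in> ?U" "Y x \<in> ball (Y p) r'" for x
  proof -
    have "Y x \<in> Y ` (G \<inter> ?U) \<inter> ball (Y p) r" using x r' by auto
    then consider "Y x = Y p" | t e where "Y x = Y p + t *\<^sub>R e" "e \<in> E" "0 < t" "t < r" unfolding star by blast
    then show ?thesis
    proof cases
      case 1
      then show ?thesis using YiY[OF x(2)] YiY[OF pU] by metis
    next
      case (2 t e)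
      then have "t < r'" using x(3) E[OF 2(2)] by (simp add: dist_norm)
      then show ?thesis using 2 by blast
    qed
  qed
  have arc: "arc (c e)" if e: "e \<in> E" for e
    unfolding arc_def path_def
  proof
    show "continuous_on {0..1} (c e)" unfolding c_def
      by (intro continuous_on_compose2[OF cYi] continuous_intros image_subsetI segW[OF e] tr) auto
    show "inj_on (c e) {0..1}"
    proof (rule inj_onI)
      fix s t assume st: "s \<in> {0..1}" "t \<in> {0..1}" "c e s = c e t"
      have "Y p + (s * r') *\<^sub>R e = Y p + (t * r') *\<^sub>R e" using Yc[OF e, of s] Yc[OF e, of t] st by auto
      then have "(s * r' - t * r') *\<^sub>R e = 0" by (simp add: scaleR_diff_left)
      moreover have "e \<noteq> 0" using E[OF e] by auto
      ultimately show "s = t" using r' by simp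
    qed
  qed
  have opn: "openin (top_of_set G) (c e ` {0<..<1})" if e: "e \<in> E" for e
  proof -
    define Sg where "Sg e' = (\<lambda>s. Y p + (s * r') *\<^sub>R e') ` {0..1}" for e'
    \<comment> \<open>The open ball without the centre and without all other closed segments; its
      preimage cuts exactly the open arc out of G.\<close>
    define Z where "Z = ball (Y p) r' - ({Y p} \<union> (\<Union>e'\<in>E - {e}. Sg e'))"
    have "closed (Sg e')" for e' unfolding Sg_def
      by (intro compact_imp_closed compact_continuous_image continuous_intros) auto
    then have "open Z" unfolding Z_def using r(2) by (intro open_Diff closed_Un closed_UN) auto
    then have op: "open (?U \<inter> Y -` Z)" by (intro continuous_open_preimage continuous_on_subset[OF Y_cont UB]) auto
    have "c e ` {0<..<1} = G \<inter> (?U \<inter> Y -` Z)"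
    proof (intro subset_antisym subsetI)
      fix x assume "x \<in> c e ` {0<..<1}"
      then obtain t where t: "0 < t" "t < 1" "x = c e t" by auto
      have Yx: "Y x = Y p + (t * r') *\<^sub>R e" using Yc[OF e] t by simp
      have e0: "e \<noteq> 0" "norm e = 1" using E[OF e] by auto
      have "t * r' < r'" using t r' by simp
      then have "Y x \<in> ball (Y p) r'" unfolding Yx using t r' e0 by (simp add: dist_norm)
      moreover have "Y x \<noteq> Y p" unfolding Yx using t r' e0 by simp
      moreover have "Y x \<notin> Sg e'" if e': "e' \<in> E - {e}" for e'
      proof
        assume "Y x \<in> Sg e'"
        then obtain s where s: "0 \<le> s" "s \<le> 1" "(t * r') *\<^sub>R e = (s * r') *\<^sub>R e'" unfolding Yx Sg_def by auto
        have e1: "norm e' = 1" using E[of e'] e' by blast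
        have "norm ((t * r') *\<^sub>R e) = t * r'" "norm ((s * r') *\<^sub>R e') = s * r'" using e0 e1 t s(1,2) r' by simp_all
        then have "t * r' = s * r'" using s(3) by simp
        then have "(t * r') *\<^sub>R e = (t * r') *\<^sub>R e'" using s(3) by (simp only:)
        then show False using t r' e' by auto
      qed
      ultimately have "Y x \<in> Z" unfolding Z_def by blast
      then show "x \<in> G \<inter> (?U \<inter> Y -` Z)" using cG[OF e, of t] t by auto
    next
      fix x assume x: "x \<in> G \<inter> (?U \<inter> Y -` Z)"
      then have xb: "x \<in> G" "x \<in> ?U" "Y x \<in> ball (Y p) r'" "Y x \<noteq> Y p" and xZ: "\<And>e'. e' \<in> E - {e} \<Longrightarrow> Y x \<notin> Sg e'"
        unfolding Z_def by auto
      from near[OF xb(1-3)] xb(4) obtain e' \<tau> where e': "e' \<in> E" "0 < \<tau>" "\<tau> < r'" "Y x = Y p + \<tau> *\<^sub>R e'" by blast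
      have "Y x \<in> Sg e'" unfolding Sg_def by (rule image_eqI[of _ _ "\<tau> / r'"]) (use e' r' in auto)
      then have "e' = e" using xZ[of e'] e'(1) by blast
      then show "x \<in> c e ` {0<..<1}" using on_arc[OF xb(2) e'(4,2,3)] by simp
    qed
    then show ?thesis using op by (simp add: openin_open_Int)
  qed
  have dYi: "(Yi has_derivative (\<lambda>w. matrix_inv (h (Yi y)) *v w)) (at y)" if y: "y \<in> ?W" for y
  proof (rule has_derivative_inverse_basic[OF Y_deriv _ _ _ W y YYi])
    show "Yi y \<in> B" using YiU[OF y] UB by blast
    then show "(\<lambda>w. matrix_inv (h (Yi y)) *v w) \<circ> (\<lambda>w. h (Yi y) *v w) = id" using hessian_inverse(2) by (auto simp: o_def)
    show "bounded_linear (\<lambda>w. matrix_inv (h (Yi y)) *v w)" by (rule matrix_vector_mul_bounded_linear)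
    show "continuous (at y) Yi" using cYi y unfolding continuous_on_eq_continuous_at[OF W] by (rule bspec)
  qed
  have fl: "gradient_flowline B u (c e ` {a<..<b})" if e: "e \<in> E" and ab: "0 \<le> a" "a < b" "b \<le> 1" for e a b
  proof -
    obtain v where v: "v \<in> range covector" "v \<noteq> 0" "e = v /\<^sub>R norm v \<or> e = - v /\<^sub>R norm v" using E[OF e] by blast
    then obtain \<delta>' where \<delta>': "v = covector \<delta>'" by blast
    have mn: "covector (- \<delta>') = - covector \<delta>'" by (simp add: covector_def vec_eq_iff)
    \<comment> \<open>The direction e is a normalised lattice vector up to sign, and the sign is
      absorbed into the class, so l e is an integral covector. Time along the flow is then the arc
      parameter times r' / l.\<close>
    define l where "l = norm v"
    have l: "0 < l" using v by (simp add: l_def)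
    have "\<exists>\<delta>0. covector \<delta>0 = l *\<^sub>R e" using v(3)
    proof
      assume "e = v /\<^sub>R norm v"
      then show ?thesis using l \<delta>' by (intro exI[of _ \<delta>']) (simp add: l_def)
    next
      assume "e = - v /\<^sub>R norm v"
      then show ?thesis using l \<delta>' mn by (intro exI[of _ "- \<delta>'"]) (simp add: l_def)
    qed
    then obtain \<delta>0 where \<delta>0: "covector \<delta>0 = l *\<^sub>R e" by blast
    have "\<delta>0 \<noteq> 0"
    proof
      assume "\<delta>0 = 0"
      then have "l *\<^sub>R e = 0" unfolding \<delta>0[symmetric] by (simp add: covector_def vec_eq_iff)
      then show False using l E[OF e] by auto
    qed
    define I where "I = {a * r' / l<..<b * r' / l}"
    define xx where "xx \<tau> = Yi (Y p + \<tau> *\<^sub>R covector \<delta>0)" for \<tau>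
    have conv: "c e t = xx (t * r' / l)" for t using l by (simp add: c_def xx_def \<delta>0)
    have "c e ` {a<..<b} = xx ` I"
    proof (intro subset_antisym subsetI)
      fix x assume "x \<in> c e ` {a<..<b}"
      then obtain t where "a < t" "t < b" "x = c e t" by auto
      then show "x \<in> xx ` I" unfolding I_def conv using l r' by (intro image_eqI[of _ _ "t * r' / l"]) (auto simp: divide_strict_right_mono)
    next
      fix x assume "x \<in> xx ` I"
      then obtain \<tau> where \<tau>: "a * r' / l < \<tau>" "\<tau> < b * r' / l" "x = xx \<tau>" by (auto simp: I_def)
      have "x = c e (\<tau> * l / r')" unfolding conv \<tau>(3) using l r' by simp
      moreover have "\<tau> * l / r' \<in> {a<..<b}" using \<tau>(1,2) l r' by (simp add: field_simps)
      ultimately show "x \<in> c e ` {a<..<b}" by blast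
    qed
    moreover have "xx \<tau> \<in> B \<and> (xx has_vector_derivative flow_field u \<delta>0 (xx \<tau>)) (at \<tau>)" if \<tau>: "\<tau> \<in> I" for \<tau>
    proof -
      have 1: "a * r' < \<tau> * l" "\<tau> * l < b * r'" using \<tau> l by (auto simp: I_def field_simps)
      have "0 \<le> a * r'" using ab r' by simp
      moreover have "b * r' \<le> r'" using ab r' by (simp add: mult_left_le_one_le)
      ultimately have "0 \<le> \<tau> * l" "\<tau> * l \<le> r'" using 1 by linarith+
      from segW[OF e this] have inW: "Y p + \<tau> *\<^sub>R covector \<delta>0 \<in> ?W" by (simp add: \<delta>0)
      have "((\<lambda>\<tau>. Y p + \<tau> *\<^sub>R covector \<delta>0) has_derivative (\<lambda>a. a *\<^sub>R covector \<delta>0)) (at \<tau>)" by (auto intro!: derivative_eq_intros)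
      from has_derivative_compose[OF this dYi[OF inW]]
      have "(xx has_derivative (\<lambda>a. matrix_inv (h (xx \<tau>)) *v (a *\<^sub>R covector \<delta>0))) (at \<tau>)" unfolding xx_def .
      then show ?thesis using YiU[OF inW] UB unfolding has_vector_derivative_def flow_field_def
        by (auto simp: matrix_vector_mult_scaleR xx_def)
    qed
    moreover have "I \<noteq> {}"
    proof -
      have "a * r' / l < b * r' / l" using ab l r' by (simp add: divide_strict_right_mono)
      then show ?thesis by (simp add: I_def)
    qed
    moreover have "open I" "is_interval I" by (simp_all add: I_def is_interval_oo)
    ultimately show ?thesis unfolding gradient_flowline_def using \<open>\<delta>0 \<noteq> 0\<close>
      by (intro exI[of _ \<delta>0] exI[of _ I] exI[of _ xx]) simp
  qed
  have "arc_system G (gradient_flowline B u) Q (c ` E)"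
    unfolding arc_system_def
  proof (intro conjI ballI allI impI)
    show "finite (c ` E)" using r(2) by simp
    fix ce assume "ce \<in> c ` E"
    then obtain e where e: "e \<in> E" "ce = c e" by blast
    show "arc ce" "openin (top_of_set G) (ce ` {0<..<1})" using arc opn e by simp_all
    show "path_image ce \<subseteq> G \<inter> Q" unfolding path_image_def e(2) using cG[OF e(1)] UQ by auto
    show "gradient_flowline B u (ce ` {a<..<b})" if "0 \<le> a" "a < b" "b \<le> 1" for a b using fl[OF e(1) that] e(2) by simp
  qed
  moreover have "open (?U \<inter> Y -` ball (Y p) r')" by (intro continuous_open_preimage continuous_on_subset[OF Y_cont UB]) auto
  moreover have "p \<in> ?U \<inter> Y -` ball (Y p) r'" using pU r' by simp
  moreover have "G \<inter> (?U \<inter> Y -` ball (Y p) r') - {p} \<subseteq> (\<Union>c\<in>c ` E. c ` {0<..<1})"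
  proof
    fix x assume x: "x \<in> G \<inter> (?U \<inter> Y -` ball (Y p) r') - {p}"
    then have xb: "x \<in> G" "x \<in> ?U" "Y x \<in> ball (Y p) r'" "x \<noteq> p" by auto
    from near[OF xb(1-3)] xb(4) obtain e' \<tau> where e': "e' \<in> E" "0 < \<tau>" "\<tau> < r'" "Y x = Y p + \<tau> *\<^sub>R e'" by blast
    have "x \<in> c e' ` {0<..<1}" by (rule on_arc[OF xb(2) e'(4,2,3)])
    then show "x \<in> (\<Union>c\<in>c ` E. c ` {0<..<1})" using e'(1) by blast
  qed
  ultimately show ?thesis by blast
qed

end

lemma (in gradient_cycle) local_arcs:
  assumes p: "p \<in> G" and Q: "open Q" "p \<in> Q"
  shows "\<exists>C N. arc_system G (gradient_flowline B u) Q C \<and> open N \<and> p \<in> N \<and> G \<inter> N - {p} \<subseteq> (\<Union>c\<in>C. c ` {0<..<1})"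
proof -
  have "p \<in> B" using p G_sub by blast
  from chart[OF this Q] obtain \<rho> Yi C1 where \<rho>: "0 < \<rho>" "cball p (2 * \<rho>) \<subseteq> B \<inter> Q" and W: "open (Y ` ball p \<rho>)"
    and hom: "homeomorphism (ball p \<rho>) (Y ` ball p \<rho>) Y Yi"
    and C1: "0 < C1" "\<forall>x\<in>ball p \<rho>. \<forall>y\<in>ball p \<rho>. norm (Y x - Y y) \<le> C1 * norm (x - y)"
    by (elim exE conjE) (rule that; assumption)
  have sub: "cball p (2 * \<rho>) \<subseteq> B" using \<rho>(2) by blast
  have lip: "norm (Y x - Y y) \<le> C1 * norm (x - y)" if "x \<in> ball p \<rho>" "y \<in> ball p \<rho>" for x y
    using C1(2) that by blast
  have "\<exists>M C0. lattice_stationary M Y dd (Y ` ball p \<rho>) (range covector) C0 \<and> space M = G \<inter> ball p \<rho>"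
    by (rule chart_stationary[OF \<rho>(1) sub W hom C1(1) lip])
  then obtain M C0 where ls: "lattice_stationary M Y dd (Y ` ball p \<rho>) (range covector) C0" and sp: "space M = G \<inter> ball p \<rho>"
    by (elim exE conjE) (rule that; assumption)
  have "p \<in> space M" using p \<rho>(1) by (simp add: sp)
  from lattice_stationary.star_structure[OF ls this] obtain r E where r: "0 < r" "finite E"
    and E: "\<forall>e\<in>E. norm e = 1 \<and> (\<exists>v\<in>range covector. v \<noteq> 0 \<and> (e = v /\<^sub>R norm v \<or> e = - v /\<^sub>R norm v))"
    and rW: "cball (Y p) r \<subseteq> Y ` ball p \<rho>"
    and star: "Y ` space M \<inter> ball (Y p) r = {Y p} \<union> {Y p + t *\<^sub>R e |t e. e \<in> E \<and> 0 < t \<and> t < r}"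
    by (elim exE conjE) (rule that; assumption)
  have "ball p \<rho> \<subseteq> cball p (2 * \<rho>)" using \<rho>(1) by auto
  then have UQ: "ball p \<rho> \<subseteq> B \<inter> Q" using \<rho>(2) by (rule order_trans)
  show ?thesis
    by (rule star_arcs[OF p UQ \<rho>(1) W hom r rW bspec[OF E] star[unfolded sp]])
qed

theorem theorem1p8:
  fixes B :: "(real^'n::finite) set" and u :: "real^'n \<Rightarrow> real"
    and T :: "'n lattice_current" and \<Gamma> :: "(real^'n) set"
  assumes "hessian_domain B u"
    and "weighted_gradient_cycle B u T"
    and "\<Gamma> = current_support B T"
  shows "\<exists>V E. locally_finite_embedded_graph B \<Gamma> V E \<and>
    (\<forall>K. compact K \<and> K \<subseteq> B \<longrightarrow> finite (V \<inter> K)) \<and>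
    (\<forall>e\<in>E. gradient_flowline B u e)"
proof -
  have "\<exists>\<delta> \<xi>. gradient_cycle B u T \<delta> \<xi>"
    using assms(1,2) unfolding weighted_gradient_cycle_def gradient_cycle_def gradient_cycle_axioms_def hessian_dom_def
    by blast
  then obtain \<delta> \<xi> where "gradient_cycle B u T \<delta> \<xi>" by (elim exE)
  then interpret gradient_cycle B u T \<delta> \<xi> .
  have "\<exists>V E. locally_finite_embedded_graph B \<Gamma> V E \<and> (\<forall>e\<in>E. gradient_flowline B u e)"
    unfolding assms(3) by (rule locally_finite_graph_from_arcs[OF open_B G_closed local_arcs])
  then obtain V E where VE: "locally_finite_embedded_graph B \<Gamma> V E" "\<forall>e\<in>E. gradient_flowline B u e"
    by (elim exE conjE) (rule that; assumption)
  have "\<forall>K. compact K \<and> K \<subseteq> B \<longrightarrow> finite (V \<inter> K)"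
    using VE(1) by (simp add: locally_finite_embedded_graph_def)
  then show ?thesis using VE by (intro exI[of _ V] exI[of _ E] conjI)
qed

end
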